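(* Let $(\psi_j)_{j\ge1}$ be a wavelet basis on $D$, ordered from coarse to fine scale, with the normalization $\|\psi_\lambda\|_{L^\infty(D)}=C2^{-\alpha l}$ for $|\lambda|=l$, for some fixed $C>0$ and $\alpha>0$. Let $0<q<\infty$. If $(\|\psi_j\|_{L^\infty(D)})_{j\ge1}$ belongs to $\ell^q(\mathbb{N})$, then $(\|u_\nu\|_V)_{\nu\in\mathcal{F}}$ belongs to $\ell^p(\mathcal{F})$ for all $0<p<2$ such that $\frac{2p}{2-p}>q$. In particular, the best $n$-term Hermite approximations converge in $L^2(U,V,\gamma)$ with rate $n^{-s}$ for all $s<\frac1q$: for every such $s$ there is a constant $C_s$ such that $\|u-u_{\Lambda_n}\|_{L^2(U,V,\gamma)}\le C_sn^{-s}$ for all $n\ge1$, where $u_{\Lambda_n}:=\sum_{\nu\in\Lambda_n}u_\nu H_\nu$ and $\Lambda_n$ is a set of indices corresponding to the $n$ largest values of $\|u_\nu\|_V$.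
   Context: $D\subset\mathbb{R}^d$ is a bounded Lipschitz domain, $V:=H^1_0(D)$ with norm $\|v\|_V:=\|\nabla v\|_{L^2(D)}$, and $f\in H^{-1}(D)$ is fixed. Wavelet bases on $D$ are indexed as $(\psi_\lambda)$, where $\lambda$ is a scale-space index and $l=|\lambda|\in\{0,1,2,\dots\}$ denotes the scale level. The functions $\psi_\lambda$ lie in $L^\infty(D)$; there are $\mathcal{O}(2^{dl})$ wavelets at level $l$, each with support of diameter $\mathcal{O}(2^{-l})$; and the wavelets at each given scale have finite overlap: there is $M>0$, independent of $l$ and $x$, such that $\#\{\lambda: |\lambda|=l \text{ and } \psi_\lambda(x)\neq0\}\le M$ for all $x\in D$. Ordering the indices $\lambda$ by increasing scale level gives the sequence $(\psi_j)_{j\ge1}$. $U:=\mathbb{R}^{\mathbb{N}}$, $\mathbb{N}=\{1,2,\dots\}$, is equipped with the $\sigma$-algebra generated by the Borel cylinders and with $\gamma$, the countable product of standard Gaussian measures $\mathcal{N}(0,1)$ on $\mathbb{R}$. For $y=(y_j)_{j\ge1}\in U$ set $b(y):=\sum_{j\ge1}y_j\psi_j$ whenever this series converges in $L^\infty(D)$, set $a(y):=\exp(b(y))$, and let $u(y)\in V$ be the unique weak solution of $-\mathrm{div}(a(y)\nabla u(y))=f$ in $D$ with homogeneous Dirichlet boundary conditions, i.e. $\int_D a(y)\nabla u(y)\cdot\nabla v\,dx=\langle f,v\rangle$ for all $v\in V$. The map $y\mapsto u(y)$ need only be defined for $\gamma$-almost every $y$. $\mathcal{F}$ is the countable set of finitely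 supported sequences $\nu=(\nu_j)_{j\ge1}$ of nonnegative integers. $H_k$ are the univariate Hermite polynomials normalized in $L^2(\mathbb{R},g\,dt)$, where $g(t)=(2\pi)^{-1/2}e^{-t^2/2}$, i.e. $H_k=\frac{(-1)^k}{\sqrt{k!}}\frac{g^{(k)}}{g}$; $H_\nu(y):=\prod_{j\ge1}H_{\nu_j}(y_j)$; and $u_\nu:=\int_U u(y)H_\nu(y)\,d\gamma(y)\in V$. *)

theory Defs
  imports "HOL-Probability.Probability"
begin

section \<open>The Hilbert space of square integrable functions on a Euclidean space\<close>

text \<open>
  Almost-everywhere classes of square integrable functions, with the class instances that the
  library's Bochner integral requires of its value space. For \<open>D\<close> measurable, L2(D) is the
  subspace of classes vanishing outside \<open>D\<close> (extension by zero).
\<close>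

definition square_integrable :: "('a::euclidean_space \<Rightarrow> 'b::euclidean_space) set" where
  "square_integrable =
     {f. f \<in> borel_measurable lebesgue \<and> integrable lebesgue (\<lambda>x. (norm (f x))\<^sup>2)}"

lemma sqi_inner:
  assumes "f \<in> square_integrable" "g \<in> square_integrable"
  shows "integrable lebesgue (\<lambda>x. f x \<bullet> g x)"
proof (rule Bochner_Integration.integrable_bound)
  show "integrable lebesgue (\<lambda>x. (norm (f x))\<^sup>2 + (norm (g x))\<^sup>2)"
    using assms by (auto simp: square_integrable_def)
  show "(\<lambda>x. f x \<bullet> g x) \<in> borel_measurable lebesgue"
    using assms by (auto simp: square_integrable_def)
  have "\<bar>f x \<bullet> g x\<bar> \<le> (norm (f x))\<^sup>2 + (norm (g x))\<^sup>2" for x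
  proof -
    have "\<bar>f x \<bullet> g x\<bar> \<le> norm (f x) * norm (g x)" by (rule Cauchy_Schwarz_ineq2)
    also have "\<dots> \<le> (norm (f x))\<^sup>2 + (norm (g x))\<^sup>2"
      using sum_squares_bound[of "norm (f x)" "norm (g x)"]
        mult_nonneg_nonneg[OF norm_ge_zero[of "f x"] norm_ge_zero[of "g x"]] by linarith
    finally show ?thesis .
  qed
  then show "AE x in lebesgue. norm (f x \<bullet> g x) \<le> norm ((norm (f x))\<^sup>2 + (norm (g x))\<^sup>2)"
    by auto
qed

lemma sqi_zero: "(\<lambda>x. 0) \<in> square_integrable"
  by (simp add: square_integrable_def)

lemma sqi_scale: "f \<in> square_integrable \<Longrightarrow> (\<lambda>x. r *\<^sub>R f x) \<in> square_integrable"
  by (auto simp: square_integrable_def power_mult_distrib)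

lemma sqi_add:
  assumes "f \<in> square_integrable" "g \<in> square_integrable"
  shows "(\<lambda>x. f x + g x) \<in> square_integrable"
proof -
  have "integrable lebesgue (\<lambda>x. (norm (f x))\<^sup>2 + 2 * (f x \<bullet> g x) + (norm (g x))\<^sup>2)"
    using assms sqi_inner[OF assms] by (auto simp: square_integrable_def)
  moreover have "(norm (f x + g x))\<^sup>2 = (norm (f x))\<^sup>2 + 2 * (f x \<bullet> g x) + (norm (g x))\<^sup>2" for x
    by (simp add: power2_norm_eq_inner inner_add inner_commute algebra_simps)
  ultimately show ?thesis using assms by (auto simp: square_integrable_def)
qed

lemma sqi_minus: "f \<in> square_integrable \<Longrightarrow> (\<lambda>x. - f x) \<in> square_integrable"
  by (auto simp: square_integrable_def)

lemma sqi_diff: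
  assumes "f \<in> square_integrable" "g \<in> square_integrable"
  shows "(\<lambda>x. f x - g x) \<in> square_integrable"
  using sqi_add[OF assms(1) sqi_minus[OF assms(2)]] by simp

definition L2_rel :: "('a::euclidean_space \<Rightarrow> 'b::euclidean_space) \<Rightarrow> ('a \<Rightarrow> 'b) \<Rightarrow> bool" where
  "L2_rel f g \<longleftrightarrow>
     f \<in> square_integrable \<and> g \<in> square_integrable \<and> (AE x in lebesgue. f x = g x)"

quotient_type (overloaded) ('a, 'b) L2 =
  "'a::euclidean_space \<Rightarrow> 'b::euclidean_space" / partial: L2_rel
proof (rule part_equivpI)
  show "\<exists>x. L2_rel x x" using sqi_zero by (auto simp: L2_rel_def)
  show "symp L2_rel" by (auto simp: L2_rel_def symp_def eq_commute)
  show "transp L2_rel" by (rule transpI) (auto simp: L2_rel_def)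
qed

instantiation L2 :: (euclidean_space, euclidean_space) real_inner
begin

lift_definition zero_L2 :: "('a, 'b) L2" is "\<lambda>x. 0"
  by (simp add: L2_rel_def sqi_zero)
lift_definition plus_L2 :: "('a, 'b) L2 \<Rightarrow> ('a, 'b) L2 \<Rightarrow> ('a, 'b) L2"
  is "\<lambda>f g x. f x + g x"
  by (auto simp: L2_rel_def sqi_add)
lift_definition minus_L2 :: "('a, 'b) L2 \<Rightarrow> ('a, 'b) L2 \<Rightarrow> ('a, 'b) L2"
  is "\<lambda>f g x. f x - g x"
  by (auto simp: L2_rel_def sqi_diff)
lift_definition uminus_L2 :: "('a, 'b) L2 \<Rightarrow> ('a, 'b) L2" is "\<lambda>f x. - f x"
  by (auto simp: L2_rel_def sqi_minus)
lift_definition scaleR_L2 :: "real \<Rightarrow> ('a, 'b) L2 \<Rightarrow> ('a, 'b) L2"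
  is "\<lambda>r f x. r *\<^sub>R f x"
  by (auto simp: L2_rel_def sqi_scale)
lift_definition inner_L2 :: "('a, 'b) L2 \<Rightarrow> ('a, 'b) L2 \<Rightarrow> real"
  is "\<lambda>f g. \<integral>x. f x \<bullet> g x \<partial>lebesgue"
  by (auto simp: L2_rel_def square_integrable_def intro!: integral_cong_AE)

definition norm_L2 :: "('a, 'b) L2 \<Rightarrow> real" where "norm_L2 f = sqrt (f \<bullet> f)"
definition dist_L2 :: "('a, 'b) L2 \<Rightarrow> ('a, 'b) L2 \<Rightarrow> real" where "dist_L2 f g = norm (f - g)"
definition sgn_L2 :: "('a, 'b) L2 \<Rightarrow> ('a, 'b) L2" where "sgn_L2 f = scaleR (inverse (norm f)) f"
definition uniformity_L2 :: "(('a, 'b) L2 \<times> ('a, 'b) L2) filter" where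
  "uniformity_L2 = (INF e\<in>{0<..}. principal {(x, y). dist x y < e})"
definition open_L2 :: "('a, 'b) L2 set \<Rightarrow> bool" where
  "open_L2 U \<longleftrightarrow> (\<forall>x\<in>U. eventually (\<lambda>(x', y). x' = x \<longrightarrow> y \<in> U) uniformity)"

instance
proof
  fix a b c :: "('a, 'b) L2" and r s :: real
  show "a + b + c = a + (b + c)"
    by transfer (auto simp: L2_rel_def sqi_add add.assoc)
  show "a + b = b + a"
    by transfer (auto simp: L2_rel_def sqi_add add.commute)
  show "0 + a = a"
    by transfer (auto simp: L2_rel_def)
  show "- a + a = 0"
    by transfer (auto simp: L2_rel_def sqi_zero)
  show "a - b = a + - b"
    by transfer (auto simp: L2_rel_def sqi_diff)
  show "r *\<^sub>R (a + b) = r *\<^sub>R a + r *\<^sub>R b"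
    by transfer (auto simp: L2_rel_def sqi_add sqi_scale scaleR_add_right)
  show "(r + s) *\<^sub>R a = r *\<^sub>R a + s *\<^sub>R a"
    by transfer (auto simp: L2_rel_def sqi_add sqi_scale scaleR_add_left)
  show "r *\<^sub>R s *\<^sub>R a = (r * s) *\<^sub>R a"
    by transfer (auto simp: L2_rel_def sqi_scale)
  show "1 *\<^sub>R a = a"
    by transfer (auto simp: L2_rel_def)
  show "a \<bullet> b = b \<bullet> a"
    by transfer (simp add: inner_commute)
  show "(a + b) \<bullet> c = a \<bullet> c + b \<bullet> c"
    by transfer (auto simp: L2_rel_def inner_add_left sqi_inner)
  show "(r *\<^sub>R a) \<bullet> b = r * (a \<bullet> b)"
    by transfer (auto simp: L2_rel_def)
  show "0 \<le> a \<bullet> a"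
    by transfer (auto simp: L2_rel_def)
  show "(a \<bullet> a = 0) = (a = 0)"
  proof (transfer)
    fix f :: "'a \<Rightarrow> 'b" assume "L2_rel f f"
    then have f: "f \<in> square_integrable" by (simp add: L2_rel_def)
    show "((\<integral>x. f x \<bullet> f x \<partial>lebesgue) = 0) = L2_rel f (\<lambda>x. 0)"
      by (subst integral_nonneg_eq_0_iff_AE) (auto simp: sqi_inner f L2_rel_def sqi_zero)
  qed
  show "norm a = sqrt (a \<bullet> a)" by (rule norm_L2_def)
  show "dist a b = norm (a - b)" by (rule dist_L2_def)
  show "sgn a = scaleR (inverse (norm a)) a" by (rule sgn_L2_def)
  show "uniformity = (INF e\<in>{0<..}. principal {(x, y). dist x (y :: ('a, 'b) L2) < e})"
    by (rule uniformity_L2_def)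
  show "open U \<longleftrightarrow> (\<forall>x\<in>U. eventually (\<lambda>(x', y). x' = x \<longrightarrow> y \<in> U) uniformity)"
    for U :: "('a, 'b) L2 set"
    by (rule open_L2_def)
qed

end

lemma rep_L2_sqi: "rep_L2 u \<in> square_integrable"
proof -
  have "L2_rel (rep_L2 u) (rep_L2 u)" using Quotient3_rep_reflp[OF Quotient3_L2] by blast
  then show ?thesis by (simp add: L2_rel_def)
qed

lemma abs_rep_L2: "abs_L2 (rep_L2 u) = u"
  using Quotient3_abs_rep[OF Quotient3_L2] by blast

lemma norm_abs_L2:
  assumes "f \<in> square_integrable"
  shows "(norm (abs_L2 f))\<^sup>2 = (\<integral>x. (norm (f x))\<^sup>2 \<partial>lebesgue)"
proof -
  have "L2_rel f f" using assms by (simp add: L2_rel_def)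
  then have "abs_L2 f \<bullet> abs_L2 f = (\<integral>x. f x \<bullet> f x \<partial>lebesgue)" by (simp add: inner_L2.abs_eq)
  then show ?thesis by (simp add: power2_norm_eq_inner)
qed

lemma diff_abs_L2:
  assumes "f \<in> square_integrable" "g \<in> square_integrable"
  shows "abs_L2 f - abs_L2 g = abs_L2 (\<lambda>x. f x - g x)"
  using assms by (simp add: minus_L2.abs_eq L2_rel_def)

lemma add_abs_L2:
  assumes "f \<in> square_integrable" "g \<in> square_integrable"
  shows "abs_L2 f + abs_L2 g = abs_L2 (\<lambda>x. f x + g x)"
  using assms by (simp add: plus_L2.abs_eq L2_rel_def)

lemma nn_norm_L2:
  assumes "f \<in> square_integrable"
  shows "(\<integral>\<^sup>+x. ennreal ((norm (f x))\<^sup>2) \<partial>lebesgue) = ennreal ((norm (abs_L2 f))\<^sup>2)"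
  using assms by (subst nn_integral_eq_integral) (auto simp: square_integrable_def norm_abs_L2)

lemma sqi_nn_integral:
  assumes "f \<in> borel_measurable lebesgue"
    "(\<integral>\<^sup>+x. ennreal ((norm (f x))\<^sup>2) \<partial>lebesgue) < \<infinity>"
  shows "f \<in> square_integrable"
  using assms by (auto simp: square_integrable_def integrable_iff_bounded)

instance L2 :: (euclidean_space, euclidean_space) complete_space
proof
  fix X :: "nat \<Rightarrow> ('a, 'b) L2"
  assume cau: "Cauchy X"
  have "\<exists>r::nat\<Rightarrow>nat. \<forall>k. (\<forall>m\<ge>r k. \<forall>n\<ge>r k. norm (X m - X n) < (1/4)^k)"
  proof (intro choice allI)
    fix k :: nat
    show "\<exists>M. \<forall>m\<ge>M. \<forall>n\<ge>M. norm (X m - X n) < (1/4)^k"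
      using CauchyD[OF cau, of "(1/4)^k"] by auto
  qed
  then obtain r0 :: "nat \<Rightarrow> nat"
    where r0: "\<And>k m n. m \<ge> r0 k \<Longrightarrow> n \<ge> r0 k \<Longrightarrow> norm (X m - X n) < (1/4)^k" by blast
  define r where "r k = (\<Sum>i\<le>k. r0 i)" for k
  have r_ge: "r k \<ge> r0 k" for k unfolding r_def by (rule member_le_sum) auto
  have r_mono: "mono r" by (rule monoI) (auto simp: r_def intro: sum_mono2)
  define F where "F k = rep_L2 (X (r k))" for k
  have F: "F k \<in> square_integrable" for k by (simp add: F_def rep_L2_sqi)
  have absF: "abs_L2 (F k) = X (r k)" for k by (simp add: F_def abs_rep_L2)
  have Fm[measurable]: "F k \<in> borel_measurable lebesgue" for k
    using F by (simp add: square_integrable_def)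
  have nnF: "(\<integral>\<^sup>+x. ennreal ((norm (F k x - F l x))\<^sup>2) \<partial>lebesgue)
      = ennreal ((norm (X (r k) - X (r l)))\<^sup>2)" for k l
    using nn_norm_L2[OF sqi_diff[OF F[of k] F[of l]]] diff_abs_L2[OF F[of k] F[of l]]
    by (simp add: absF)
  have step: "(\<integral>\<^sup>+x. ennreal (4^k * (norm (F (Suc k) x - F k x))\<^sup>2) \<partial>lebesgue) \<le> ennreal ((1/4)^k)" for k
  proof -
    have "(\<integral>\<^sup>+x. ennreal (4^k * (norm (F (Suc k) x - F k x))\<^sup>2) \<partial>lebesgue)
       = ennreal (4^k) * ennreal ((norm (X (r (Suc k)) - X (r k)))\<^sup>2)"
      by (simp add: ennreal_mult nn_integral_cmult nnF)
    also have "\<dots> = ennreal (4^k * (norm (X (r (Suc k)) - X (r k)))\<^sup>2)"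
      by (simp add: ennreal_mult)
    also have "\<dots> \<le> ennreal (4^k * ((1/4)^k)\<^sup>2)"
    proof (intro ennreal_leI mult_left_mono power_mono)
      have "r (Suc k) \<ge> r k" using r_mono by (simp add: mono_def)
      then show "norm (X (r (Suc k)) - X (r k)) \<le> (1/4)^k"
        using r0[of k "r (Suc k)" "r k"] r_ge[of k] by simp
    qed auto
    also have "4^k * ((1/4)^k)\<^sup>2 = ((1/4::real)^k)"
      by (simp add: power2_eq_square power_one_over)
    finally show ?thesis .
  qed
  have "(\<integral>\<^sup>+x. (\<Sum>k. ennreal (4^k * (norm (F (Suc k) x - F k x))\<^sup>2)) \<partial>lebesgue)
      = (\<Sum>k. \<integral>\<^sup>+x. ennreal (4^k * (norm (F (Suc k) x - F k x))\<^sup>2) \<partial>lebesgue)"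
    by (rule nn_integral_suminf) measurable
  also have "\<dots> \<le> (\<Sum>k. ennreal ((1/4)^k))"
    by (intro suminf_le step) auto
  also have "\<dots> = ennreal (\<Sum>k. (1/4)^k)"
    by (intro suminf_ennreal2 summable_geometric) auto
  also have "\<dots> < \<infinity>" by simp
  finally have "AE x in lebesgue. (\<Sum>k. ennreal (4^k * (norm (F (Suc k) x - F k x))\<^sup>2)) \<noteq> \<infinity>"
    by (intro nn_integral_PInf_AE) auto
  then have conv: "AE x in lebesgue. convergent (\<lambda>k. F k x)"
  proof eventually_elim
    fix x assume "(\<Sum>k. ennreal (4^k * (norm (F (Suc k) x - F k x))\<^sup>2)) \<noteq> \<infinity>"
    then have "summable (\<lambda>k. 4^k * (norm (F (Suc k) x - F k x))\<^sup>2)"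
      by (intro summable_suminf_not_top) auto
    then have "Bseq (\<lambda>k. 4^k * (norm (F (Suc k) x - F k x))\<^sup>2)"
      using summable_LIMSEQ_zero convergent_imp_Bseq convergentI by blast
    then obtain K where "K > 0" and K: "\<And>k. 4^k * (norm (F (Suc k) x - F k x))\<^sup>2 \<le> K"
      by (auto simp: Bseq_def)
    have le: "norm (F (Suc k) x - F k x) \<le> sqrt K * (1/2)^k" for k
    proof (rule power2_le_imp_le)
      have "(norm (F (Suc k) x - F k x))\<^sup>2 \<le> K * (1/4)^k"
        using K[of k] by (simp add: field_simps)
      also have "\<dots> = (sqrt K * (1/2)^k)\<^sup>2"
      proof -
        have "((1/2::real)^k)\<^sup>2 = (1/4)^k"
          by (simp add: power2_eq_square flip: power_mult_distrib)
        then show ?thesis using \<open>K > 0\<close> by (simp add: power_mult_distrib)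
      qed
      finally show "(norm (F (Suc k) x - F k x))\<^sup>2 \<le> (sqrt K * (1/2)^k)\<^sup>2" .
      show "0 \<le> sqrt K * (1/2)^k" using \<open>K > 0\<close> by simp
    qed
    have "summable (\<lambda>k. sqrt K * (1/2::real)^k)"
      by (intro summable_mult summable_geometric) auto
    then have "summable (\<lambda>k. F (Suc k) x - F k x)"
      by (rule summable_comparison_test'[where N = 0]) (rule le)
    then have "convergent (\<lambda>n. \<Sum>k<n. F (Suc k) x - F k x)"
      by (simp add: summable_iff_convergent)
    then have "convergent (\<lambda>n. F n x - F 0 x)"
      by (simp only: sum_lessThan_telescope[of "\<lambda>n. F n x"])
    then have "convergent (\<lambda>n. (F n x - F 0 x) + F 0 x)"
      by (intro convergent_add convergent_const)
    then show "convergent (\<lambda>k. F k x)" by simp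
  qed
  define g where "g x = lim (\<lambda>k. F k x)" for x
  have gm[measurable]: "g \<in> borel_measurable lebesgue"
    unfolding g_def by (rule borel_measurable_lim_metric) simp
  have glim: "AE x in lebesgue. (\<lambda>k. F k x) \<longlonglongrightarrow> g x"
    using conv by eventually_elim (simp add: g_def convergent_LIMSEQ_iff)
  have bound: "(\<integral>\<^sup>+x. ennreal ((norm (g x - F k x))\<^sup>2) \<partial>lebesgue) \<le> ennreal (((1/4)^k)\<^sup>2)" for k
  proof -
    have "(\<integral>\<^sup>+x. ennreal ((norm (g x - F k x))\<^sup>2) \<partial>lebesgue)
        = (\<integral>\<^sup>+x. liminf (\<lambda>l. ennreal ((norm (F l x - F k x))\<^sup>2)) \<partial>lebesgue)"
    proof (rule nn_integral_cong_AE)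
      show "AE x in lebesgue. ennreal ((norm (g x - F k x))\<^sup>2)
         = liminf (\<lambda>l. ennreal ((norm (F l x - F k x))\<^sup>2))"
        using glim
      proof eventually_elim
        fix x assume "(\<lambda>k. F k x) \<longlonglongrightarrow> g x"
        then have "(\<lambda>l. ennreal ((norm (F l x - F k x))\<^sup>2)) \<longlonglongrightarrow> ennreal ((norm (g x - F k x))\<^sup>2)"
          by (intro tendsto_ennrealI tendsto_intros)
        then show "ennreal ((norm (g x - F k x))\<^sup>2)
         = liminf (\<lambda>l. ennreal ((norm (F l x - F k x))\<^sup>2))"
          using lim_imp_Liminf[OF sequentially_bot] by metis
      qed
    qed
    also have "\<dots> \<le> liminf (\<lambda>l. \<integral>\<^sup>+x. ennreal ((norm (F l x - F k x))\<^sup>2) \<partial>lebesgue)"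
      by (rule nn_integral_liminf) measurable
    also have "\<dots> \<le> liminf (\<lambda>l. ennreal (((1/4)^k)\<^sup>2))"
    proof (rule Liminf_mono, rule eventually_sequentiallyI[of k])
      fix l assume "l \<ge> k"
      then have "r l \<ge> r k" using r_mono by (simp add: mono_def)
      then have "norm (X (r l) - X (r k)) \<le> (1/4)^k"
        using r0[of k "r l" "r k"] r_ge[of k] by simp
      then show "(\<integral>\<^sup>+x. ennreal ((norm (F l x - F k x))\<^sup>2) \<partial>lebesgue) \<le> ennreal (((1/4)^k)\<^sup>2)"
        unfolding nnF by (intro ennreal_leI power_mono) auto
    qed
    also have "\<dots> = ennreal (((1/4)^k)\<^sup>2)" by (simp add: Liminf_const)
    finally show ?thesis .
  qed
  have dsq: "(\<lambda>x. g x - F k x) \<in> square_integrable" for k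
    using bound[of k] by (intro sqi_nn_integral) (auto intro: le_less_trans)
  have gsq: "g \<in> square_integrable" using sqi_add[OF dsq[of 0] F[of 0]] by simp
  have dk: "norm (abs_L2 g - X (r k)) \<le> (1/4)^k" for k
  proof (rule power2_le_imp_le)
    have "ennreal ((norm (abs_L2 g - X (r k)))\<^sup>2) \<le> ennreal (((1/4)^k)\<^sup>2)"
      using nn_norm_L2[OF dsq[of k]] bound[of k] diff_abs_L2[OF gsq F[of k]] by (simp add: absF)
    then show "(norm (abs_L2 g - X (r k)))\<^sup>2 \<le> ((1/4)^k)\<^sup>2" by (simp add: ennreal_le_iff)
  qed auto
  have "X \<longlonglongrightarrow> abs_L2 g"
  proof (rule LIMSEQ_I)
    fix e :: real assume "e > 0"
    then obtain k where k: "(1/4)^k < e/2" using real_arch_pow_inv[of "e/2" "1/4"] by auto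
    show "\<exists>n0. \<forall>n\<ge>n0. norm (X n - abs_L2 g) < e"
    proof (intro exI allI impI)
      fix n assume n: "n \<ge> r k"
      have "norm (X n - abs_L2 g) \<le> norm (X n - X (r k)) + norm (abs_L2 g - X (r k))"
        using norm_triangle_ineq4[of "X n - X (r k)" "abs_L2 g - X (r k)"] by simp
      also have "\<dots> < e"
        using r0[of k n "r k"] r_ge[of k] n dk[of k] k by simp
      finally show "norm (X n - abs_L2 g) < e" .
    qed
  qed
  then show "convergent X" by (rule convergentI)
qed

instance L2 :: (euclidean_space, euclidean_space) banach ..

lemma sqi_indicator:
  assumes "A \<in> lmeasurable"
  shows "(\<lambda>x. indicator A x *\<^sub>R c) \<in> square_integrable"
proof -
  have "(\<lambda>x. (norm (indicator A x *\<^sub>R c))\<^sup>2) = (\<lambda>x. (norm c)\<^sup>2 * indicator A x)"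
    by (auto simp: indicator_def fun_eq_iff)
  then show ?thesis
    using assms by (auto simp: square_integrable_def fmeasurable_def)
qed

lemma norm_indicator_L2:
  assumes "A \<in> lmeasurable"
  shows "norm (abs_L2 (\<lambda>x. indicator A x *\<^sub>R c)) = sqrt (measure lebesgue A) * norm c"
proof (rule power2_eq_imp_eq)
  have "(\<lambda>x. (norm (indicator A x *\<^sub>R c))\<^sup>2) = (\<lambda>x. (norm c)\<^sup>2 * indicator A x)"
    by (auto simp: indicator_def fun_eq_iff)
  then show "(norm (abs_L2 (\<lambda>x. indicator A x *\<^sub>R c)))\<^sup>2 = (sqrt (measure lebesgue A) * norm c)\<^sup>2"
    by (simp add: norm_abs_L2 sqi_indicator assms power_mult_distrib)
qed auto

lemma approx_open_finite_union:
  fixes A :: "'a::euclidean_space set"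
  assumes A: "A \<in> lmeasurable" and e: "e > 0" and B: "countable B" "topological_basis B"
  shows "\<exists>F. finite F \<and> F \<subseteq> B \<and> \<Union>F \<in> lmeasurable \<and> measure lebesgue ((A - \<Union>F) \<union> (\<Union>F - A)) < e"
proof -
  have "A \<in> sets lebesgue" using A by auto
  then obtain T where T: "open T" "A \<subseteq> T" "T - A \<in> lmeasurable" "emeasure lebesgue (T - A) < ennreal (e/2)"
    using sets_lebesgue_outer_open[of A "e/2"] e by auto
  have TA: "measure lebesgue (T - A) < e/2"
    using T e by (simp add: emeasure_eq_measure2 ennreal_less_iff)
  have Tm: "T \<in> lmeasurable"
    using fmeasurable.Un[OF A T(3)] T(2) by (simp add: Un_absorb1)
  obtain B' where B': "B' \<subseteq> B" "\<Union>B' = T" using B(2) T(1) by (auto simp: topological_basis_def)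
  define b where "b = from_nat_into (insert {} B')"
  have cB': "countable (insert {} B')" using B' B(1) by (auto intro: countable_subset)
  have rb: "range b = insert {} B'" unfolding b_def using cB' by (simp add: range_from_nat_into)
  define W where "W n = (\<Union>i<n. b i)" for n
  have bo: "open (b i)" for i
  proof -
    have "b i \<in> insert {} B'" using rb by blast
    then show ?thesis using B' B(2) topological_basis_open by auto
  qed
  have bT: "b i \<subseteq> T" for i
  proof -
    have "b i \<in> insert {} B'" using rb by blast
    then show ?thesis using B' by auto
  qed
  have Wo: "open (W n)" for n unfolding W_def using bo by auto
  have WT: "W n \<subseteq> T" for n unfolding W_def using bT by auto
  have Wm: "W n \<in> lmeasurable" for n
    by (rule fmeasurableI2[OF Tm WT]) (use Wo in auto)
  have UW: "(\<Union>n. W n) = T"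
  proof -
    have "(\<Union>n. W n) = (\<Union>i. b i)" unfolding W_def by auto
    also have "\<dots> = T" using rb B' by auto
    finally show ?thesis .
  qed
  have "(\<lambda>n. measure lebesgue (W n)) \<longlonglongrightarrow> measure lebesgue (\<Union>n. W n)"
  proof (rule Lim_measure_incseq)
    show "range W \<subseteq> sets lebesgue" using Wm by auto
    show "incseq W" unfolding W_def incseq_def by (auto intro: less_le_trans)
    show "emeasure lebesgue (\<Union>n. W n) \<noteq> \<infinity>" unfolding UW using Tm by (auto simp: fmeasurable_def)
  qed
  then have "(\<lambda>n. measure lebesgue (W n)) \<longlonglongrightarrow> measure lebesgue T" by (simp add: UW)
  then obtain n where "norm (measure lebesgue (W n) - measure lebesgue T) < e/2"
    using e LIMSEQ_D[of _ _ "e/2"] by (meson half_gt_zero order_refl)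
  then have n: "measure lebesgue T - measure lebesgue (W n) < e/2"
    unfolding real_norm_def by linarith
  have TW: "measure lebesgue (T - W n) < e/2"
    using n measurable_measure_Diff[OF Tm, of "W n"] WT[of n] Wm[of n] by auto
  define F where "F = {C \<in> b ` {..<n}. C \<noteq> {}}"
  have UF: "\<Union>F = W n" unfolding F_def W_def by auto
  have "F \<subseteq> B'" unfolding F_def using rb by auto
  have "measure lebesgue ((A - W n) \<union> (W n - A)) \<le> measure lebesgue ((T - W n) \<union> (T - A))"
    by (rule measure_mono_fmeasurable) (use T WT[of n] A Wm[of n] Tm in auto)
  also have "\<dots> \<le> measure lebesgue (T - W n) + measure lebesgue (T - A)"
    by (rule measure_Un_le) (use T Tm Wm[of n] A in auto)
  also have "\<dots> < e" using TW TA by simp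
  finally have "measure lebesgue ((A - \<Union>F) \<union> (\<Union>F - A)) < e" by (simp add: UF)
  moreover have "finite F" by (simp add: F_def)
  ultimately show ?thesis using \<open>F \<subseteq> B'\<close> B' UF Wm by (intro exI[of _ F]) auto
qed

lemma L2_separable:
  "\<exists>S :: ('a::euclidean_space, 'b::euclidean_space) L2 set. countable S \<and> closure S = UNIV"
proof -
  obtain B :: "'a set set" where B: "countable B" "topological_basis B"
    using ex_countable_basis by blast
  obtain Q :: "'b set" where Q: "countable Q" "\<And>X. open X \<Longrightarrow> X \<noteq> {} \<Longrightarrow> \<exists>d\<in>Q. d \<in> X"
    using countable_dense_setE by blast
  define G :: "('a, 'b) L2 set" where
    "G = (\<lambda>(F, c). abs_L2 (\<lambda>x. indicator (\<Union>F) x *\<^sub>R c)) ` ({F. finite F \<and> F \<subseteq> B} \<times> Q)"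
  have cG: "countable G"
    unfolding G_def using B(1) Q(1)
    by (intro countable_image countable_SIGMA countable_Collect_finite_subset) auto
  define S where "S = sum_list ` lists G"
  have cS: "countable S" unfolding S_def using cG by (intro countable_image countable_lists)
  have Sadd: "u + v \<in> S" if "u \<in> S" "v \<in> S" for u v
  proof -
    obtain us vs where "us \<in> lists G" "vs \<in> lists G" "u = sum_list us" "v = sum_list vs"
      using \<open>u \<in> S\<close> \<open>v \<in> S\<close> by (auto simp: S_def)
    then have "us @ vs \<in> lists G" "u + v = sum_list (us @ vs)" by auto
    then show ?thesis unfolding S_def by blast
  qed
  have GS: "G \<subseteq> S"
  proof
    fix u assume "u \<in> G"
    then have "[u] \<in> lists G" "u = sum_list [u]" by auto
    then show "u \<in> S" unfolding S_def by blast
  qed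
  have "sum_list [] \<in> S" unfolding S_def by blast
  then have S0: "0 \<in> closure S" using closure_subset by auto
  have Cadd: "u + v \<in> closure S" if uv: "u \<in> closure S" "v \<in> closure S" for u v
  proof -
    obtain us vs where "\<And>n::nat. us n \<in> S" "us \<longlonglongrightarrow> u" "\<And>n::nat. vs n \<in> S" "vs \<longlonglongrightarrow> v"
      using uv by (auto simp: closure_sequential)
    then show ?thesis
      unfolding closure_sequential by (intro exI[of _ "\<lambda>n. us n + vs n"]) (auto intro: tendsto_add Sadd)
  qed
  have ind: "abs_L2 (\<lambda>x. indicator A x *\<^sub>R c) \<in> closure S" if A: "A \<in> lmeasurable" for A :: "'a set" and c :: 'b
    unfolding closure_approachable
  proof (intro allI impI)
    fix e :: real assume e: "e > 0"
    define e1 where "e1 = (e / (2 * (norm c + 1)))\<^sup>2"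
    have nc: "norm c + 1 > 0" using norm_ge_zero[of c] by linarith
    have e1: "e1 > 0" using e nc by (simp add: e1_def)
    obtain F where F: "finite F" "F \<subseteq> B" "\<Union>F \<in> lmeasurable"
        "measure lebesgue ((A - \<Union>F) \<union> (\<Union>F - A)) < e1"
      using approx_open_finite_union[OF A e1 B] by blast
    define m where "m = sqrt (measure lebesgue (\<Union>F)) + 1"
    have m: "m > 0" by (simp add: m_def add_nonneg_pos)
    have "e / (2 * m) > 0" using e m by simp
    then obtain c' where c': "c' \<in> Q" "c' \<in> ball c (e / (2 * m))"
      using Q(2)[of "ball c (e / (2 * m))"] by (metis centre_in_ball empty_iff open_ball)
    let ?w = "abs_L2 (\<lambda>x. indicator (\<Union>F) x *\<^sub>R c') :: ('a, 'b) L2"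
    have "?w \<in> S" using GS F c' by (auto simp: G_def)
    let ?D = "(A - \<Union>F) \<union> (\<Union>F - A)"
    have Dm: "?D \<in> lmeasurable" using A F by auto
    have i: "abs_L2 (\<lambda>x. indicator A x *\<^sub>R c) - abs_L2 (\<lambda>x. indicator (\<Union>F) x *\<^sub>R c)
      = abs_L2 (\<lambda>x. indicator A x *\<^sub>R c - indicator (\<Union>F) x *\<^sub>R c)"
      by (rule diff_abs_L2) (use A F in \<open>auto intro: sqi_indicator\<close>)
    have "norm (abs_L2 (\<lambda>x. indicator A x *\<^sub>R c) - abs_L2 (\<lambda>x. indicator (\<Union>F) x *\<^sub>R c))
        = norm (abs_L2 (\<lambda>x. indicator ?D x *\<^sub>R c))"
    proof (rule power2_eq_imp_eq)
      have *: "(norm (indicator A x *\<^sub>R c - indicator (\<Union>F) x *\<^sub>R c))\<^sup>2 = (norm (indicator ?D x *\<^sub>R c))\<^sup>2" for x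
        by (auto simp: indicator_def)
      have sq: "(\<lambda>x. indicator A x *\<^sub>R c - indicator (\<Union>F) x *\<^sub>R c) \<in> square_integrable"
        by (rule sqi_diff) (use A F in \<open>auto intro: sqi_indicator\<close>)
      show "(norm (abs_L2 (\<lambda>x. indicator A x *\<^sub>R c) - abs_L2 (\<lambda>x. indicator (\<Union>F) x *\<^sub>R c)))\<^sup>2
        = (norm (abs_L2 (\<lambda>x. indicator ?D x *\<^sub>R c)))\<^sup>2"
        unfolding i norm_abs_L2[OF sq] norm_abs_L2[OF sqi_indicator[OF Dm]] * ..
    qed auto
    also have "\<dots> = sqrt (measure lebesgue ?D) * norm c" by (rule norm_indicator_L2[OF Dm])
    also have "\<dots> \<le> sqrt e1 * norm c"
      using F(4) by (intro mult_right_mono real_sqrt_le_mono) auto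
    also have "\<dots> = e/2 * (norm c / (norm c + 1))"
      using e nc by (simp add: e1_def)
    also have "\<dots> \<le> e/2 * 1"
      using e nc by (intro mult_left_mono) auto
    finally have n1: "norm (abs_L2 (\<lambda>x. indicator A x *\<^sub>R c) - abs_L2 (\<lambda>x. indicator (\<Union>F) x *\<^sub>R c)) \<le> e/2"
      by simp
    have "abs_L2 (\<lambda>x. indicator (\<Union>F) x *\<^sub>R c) - ?w
        = abs_L2 (\<lambda>x. indicator (\<Union>F) x *\<^sub>R c - indicator (\<Union>F) x *\<^sub>R c')"
      by (rule diff_abs_L2) (use F in \<open>auto intro: sqi_indicator\<close>)
    also have "\<dots> = abs_L2 (\<lambda>x. indicator (\<Union>F) x *\<^sub>R (c - c'))"
      by (simp add: scaleR_diff_right)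
    finally have "norm (abs_L2 (\<lambda>x. indicator (\<Union>F) x *\<^sub>R c) - ?w)
        = sqrt (measure lebesgue (\<Union>F)) * norm (c - c')"
      using norm_indicator_L2[OF F(3)] by simp
    also have "\<dots> \<le> m * norm (c - c')"
      by (intro mult_right_mono) (auto simp: m_def)
    also have "\<dots> < m * (e / (2 * m))"
      using c' m by (intro mult_strict_left_mono) (auto simp: dist_norm)
    also have "\<dots> = e/2" using m by simp
    finally have n2: "norm (abs_L2 (\<lambda>x. indicator (\<Union>F) x *\<^sub>R c) - ?w) < e/2" .
    have "dist ?w (abs_L2 (\<lambda>x. indicator A x *\<^sub>R c)) < e"
      using norm_triangle_ineq[of "abs_L2 (\<lambda>x. indicator A x *\<^sub>R c) - abs_L2 (\<lambda>x. indicator (\<Union>F) x *\<^sub>R c)"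
          "abs_L2 (\<lambda>x. indicator (\<Union>F) x *\<^sub>R c) - ?w"] n1 n2
      by (simp add: dist_commute dist_norm)
    then show "\<exists>y\<in>S. dist y (abs_L2 (\<lambda>x. indicator A x *\<^sub>R c)) < e" using \<open>?w \<in> S\<close> by blast
  qed
  have fin: "abs_L2 f \<in> closure S"
    if f: "simple_function lebesgue f" and fs: "f \<in> square_integrable" for f :: "'a \<Rightarrow> 'b"
  proof -
    define R where "R = f ` UNIV - {0}"
    have R: "finite R" using f by (auto simp: R_def simple_function_def)
    have fm: "f -` {c} \<in> lmeasurable" if "c \<in> R" for c
    proof -
      have c: "c \<noteq> 0" using that by (simp add: R_def)
      have s: "f -` {c} \<in> sets lebesgue" using f that by (auto simp: simple_function_def R_def)
      have "integrable lebesgue (\<lambda>x. indicator (f -` {c}) x :: real)"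
      proof (rule Bochner_Integration.integrable_bound)
        show "integrable lebesgue (\<lambda>x. (norm (f x))\<^sup>2 / (norm c)\<^sup>2)"
          using fs by (auto simp: square_integrable_def)
        show "AE x in lebesgue. norm (indicator (f -` {c}) x :: real) \<le> norm ((norm (f x))\<^sup>2 / (norm c)\<^sup>2)"
          using c by (auto simp: indicator_def)
      qed (use s in auto)
      then show ?thesis using s by (auto simp: fmeasurable_def integrable_indicator_iff)
    qed
    have part: "(\<lambda>x. \<Sum>c\<in>R'. indicator (f -` {c}) x *\<^sub>R c) \<in> square_integrable \<and>
        abs_L2 (\<lambda>x. \<Sum>c\<in>R'. indicator (f -` {c}) x *\<^sub>R c) \<in> closure S" if "R' \<subseteq> R" for R'
      using finite_subset[OF that R] that
    proof (induction R' rule: finite_induct)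
      case empty
      then show ?case using S0 sqi_zero by (simp add: zero_L2.abs_eq[symmetric])
    next
      case (insert c R')
      have m: "f -` {c} \<in> lmeasurable" using insert fm by auto
      define h where "h = (\<lambda>x. \<Sum>c\<in>R'. indicator (f -` {c}) x *\<^sub>R c)"
      have h: "h \<in> square_integrable" "abs_L2 h \<in> closure S"
        using insert by (auto simp only: h_def)
      have eq: "(\<lambda>x. \<Sum>c\<in>insert c R'. indicator (f -` {c}) x *\<^sub>R c)
          = (\<lambda>x. indicator (f -` {c}) x *\<^sub>R c + h x)"
        unfolding h_def by (subst sum.insert) (use insert in auto)
      show ?case
        unfolding eq using sqi_add[OF sqi_indicator[OF m, of c] h(1)]
          Cadd[OF ind[OF m, of c] h(2)] add_abs_L2[OF sqi_indicator[OF m, of c] h(1)]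
        by simp
    qed
    have "f = (\<lambda>x. \<Sum>c\<in>R. indicator (f -` {c}) x *\<^sub>R c)"
    proof
      fix x
      have "(\<Sum>c\<in>R. indicator (f -` {c}) x *\<^sub>R c) = (\<Sum>c\<in>R. if c = f x then c else 0)"
        by (intro sum.cong) (auto simp: indicator_def)
      also have "\<dots> = f x" using R by (auto simp: R_def)
      finally show "f x = (\<Sum>c\<in>R. indicator (f -` {c}) x *\<^sub>R c)" by simp
    qed
    then show "abs_L2 f \<in> closure S" using part[of R] by simp
  qed
  have "u \<in> closure S" for u
  proof -
    define f where "f = rep_L2 u"
    have f: "f \<in> square_integrable" "abs_L2 f = u" by (auto simp: f_def rep_L2_sqi abs_rep_L2)
    have fm: "f \<in> borel_measurable lebesgue" using f by (simp add: square_integrable_def)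
    obtain s where s: "\<And>i. simple_function lebesgue (s i)" "\<And>x. (\<lambda>i. s i x) \<longlonglongrightarrow> f x"
        "\<And>i x. dist (s i x) 0 \<le> 2 * dist (f x) 0"
      using borel_measurable_implies_sequence_metric[OF fm, of 0] by auto
    have sm: "s i \<in> borel_measurable lebesgue" for i
      using s(1) by (rule borel_measurable_simple_function)
    have int4: "integrable lebesgue (\<lambda>x. 9 * (norm (f x))\<^sup>2)"
      using f by (auto simp: square_integrable_def)
    have s3: "norm (s i x) \<le> 2 * norm (f x)" for i x using s(3)[of i x] by simp
    have b2: "(norm (s i x))\<^sup>2 \<le> 9 * (norm (f x))\<^sup>2" for i x
    proof -
      have "(norm (s i x))\<^sup>2 \<le> (3 * norm (f x))\<^sup>2"
        using s3[of i x] norm_ge_zero[of "f x"] by (intro power_mono norm_ge_zero) linarith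
      then show ?thesis by (simp add: power_mult_distrib)
    qed
    have b3: "(norm (s i x - f x))\<^sup>2 \<le> 9 * (norm (f x))\<^sup>2" for i x
    proof -
      have "(norm (s i x - f x))\<^sup>2 \<le> (3 * norm (f x))\<^sup>2"
        using s3[of i x] norm_triangle_ineq4[of "s i x" "f x"]
        by (intro power_mono norm_ge_zero) linarith
      then show ?thesis by (simp add: power_mult_distrib)
    qed
    have ssq: "s i \<in> square_integrable" for i
      unfolding square_integrable_def
      using sm[of i] b2[of i] by (auto intro!: Bochner_Integration.integrable_bound[OF int4])
    have "(\<lambda>i. \<integral>x. (norm (s i x - f x))\<^sup>2 \<partial>lebesgue) \<longlonglongrightarrow> integral\<^sup>L (lebesgue :: 'a measure) (\<lambda>x. 0)"
    proof (rule integral_dominated_convergence[where w = "\<lambda>x. 9 * (norm (f x))\<^sup>2"])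
      show "AE x in lebesgue. (\<lambda>i. (norm (s i x - f x))\<^sup>2) \<longlonglongrightarrow> 0"
      proof (rule AE_I2)
        fix x
        have "(\<lambda>i. (norm (s i x - f x))\<^sup>2) \<longlonglongrightarrow> (norm (f x - f x))\<^sup>2"
          by (intro tendsto_intros s)
        then show "(\<lambda>i. (norm (s i x - f x))\<^sup>2) \<longlonglongrightarrow> 0" by simp
      qed
      show "AE x in lebesgue. norm ((norm (s i x - f x))\<^sup>2) \<le> 9 * (norm (f x))\<^sup>2" for i
        using b3 by auto
    qed (use sm fm int4 in auto)
    then have "(\<lambda>i. (norm (abs_L2 (s i) - u))\<^sup>2) \<longlonglongrightarrow> 0"
      using norm_abs_L2[OF sqi_diff[OF ssq f(1)]] diff_abs_L2[OF ssq f(1)] f(2) by simp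
    then have "(\<lambda>i. sqrt ((norm (abs_L2 (s i) - u))\<^sup>2)) \<longlonglongrightarrow> sqrt 0"
      by (intro tendsto_intros)
    then have lim: "(\<lambda>i. abs_L2 (s i)) \<longlonglongrightarrow> u"
      by (simp add: tendsto_norm_zero_iff LIM_zero_iff)
    show ?thesis
      by (rule closed_sequentially[OF closed_closure _ lim]) (rule fin[OF s(1) ssq])
  qed
  then show ?thesis using cS by blast
qed

instance L2 :: (euclidean_space, euclidean_space) second_countable_topology
proof
  obtain S :: "('a, 'b) L2 set" where S: "countable S" "closure S = UNIV"
    using L2_separable by blast
  define B where "B = (\<lambda>(x, n::nat). ball x (1 / real (Suc n))) ` (S \<times> UNIV)"
  have "countable B" unfolding B_def using S(1) by (intro countable_image countable_SIGMA) auto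
  moreover have "topological_basis B"
  proof (rule topological_basisI)
    show "open B'" if "B' \<in> B" for B' using that by (auto simp: B_def)
    show "\<exists>B'\<in>B. x \<in> B' \<and> B' \<subseteq> U" if U: "open U" "x \<in> U" for U x
    proof -
      obtain e where e: "e > 0" "ball x e \<subseteq> U" using U openE by blast
      obtain n where n: "1 / real (Suc n) < e / 2" using e nat_approx_posE[of "e/2"] by auto
      have "x \<in> closure S" using S by simp
      then obtain z where z: "z \<in> S" "dist z x < 1 / real (Suc n)"
        unfolding closure_approachable by (metis of_nat_0_less_iff zero_less_Suc zero_less_divide_1_iff)
      have "ball z (1 / real (Suc n)) \<subseteq> ball x e"
      proof
        fix w assume "w \<in> ball z (1 / real (Suc n))"
        then show "w \<in> ball x e"
          using z(2) n dist_triangle[of x w z] by (simp add: dist_commute)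
      qed
      then show ?thesis
        using z e by (intro bexI[of _ "ball z (1 / real (Suc n))"]) (auto simp: B_def)
    qed
  qed
  ultimately show "\<exists>B :: ('a, 'b) L2 set set. countable B \<and> open = generate_topology B"
    using topological_basis_imp_subbasis by blast
qed

section \<open>Lipschitz domains and the Sobolev space of functions with zero trace\<close>

text \<open>
  Locally, after a rotation taking the last coordinate axis to \<open>\<real>e\<close>, the set is the strict
  epigraph of a Lipschitz function on the hyperplane orthogonal to \<open>e\<close>.
\<close>

definition lipschitz_boundary :: "'a::euclidean_space set \<Rightarrow> bool" where
  "lipschitz_boundary D \<longleftrightarrow>
     (\<forall>z\<in>frontier D. \<exists>e W g L. norm e = 1 \<and> open W \<and> z \<in> W \<and>
        L-lipschitz_on {x. x \<bullet> e = 0} (g :: 'a \<Rightarrow> real) \<and>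
        D \<inter> W = {x \<in> W. x \<bullet> e > g (x - (x \<bullet> e) *\<^sub>R e)})"

definition bounded_lipschitz_domain :: "'a::euclidean_space set \<Rightarrow> bool" where
  "bounded_lipschitz_domain D \<longleftrightarrow>
     open D \<and> connected D \<and> D \<noteq> {} \<and> bounded D \<and> lipschitz_boundary D"

primrec Ck :: "nat \<Rightarrow> ('a::euclidean_space \<Rightarrow> real) \<Rightarrow> bool" where
  "Ck 0 \<phi> \<longleftrightarrow> continuous_on UNIV \<phi>"
| "Ck (Suc k) \<phi> \<longleftrightarrow> (\<forall>x. \<phi> differentiable at x) \<and>
     (\<forall>i\<in>Basis. Ck k (\<lambda>x. frechet_derivative \<phi> (at x) i))"

definition test_functions :: "'a::euclidean_space set \<Rightarrow> ('a \<Rightarrow> real) set" where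
  "test_functions D =
     {\<phi>. (\<forall>k. Ck k \<phi>) \<and> compact (closure {x. \<phi> x \<noteq> 0}) \<and> closure {x. \<phi> x \<noteq> 0} \<subseteq> D}"

definition gradient :: "('a::euclidean_space \<Rightarrow> real) \<Rightarrow> 'a \<Rightarrow> 'a" where
  "gradient \<phi> x = (\<Sum>i\<in>Basis. frechet_derivative \<phi> (at x) i *\<^sub>R i)"

lemma sqi_continuous_compact_support:
  fixes g :: "'a::euclidean_space \<Rightarrow> 'b::euclidean_space"
  assumes g: "continuous_on UNIV g" and K: "compact K" and z: "\<And>x. x \<notin> K \<Longrightarrow> g x = 0"
  shows "g \<in> square_integrable"
proof -
  have gb: "g \<in> borel_measurable borel" using g by (rule borel_measurable_continuous_onI)
  then have gm: "g \<in> borel_measurable lebesgue" by (simp add: measurable_completion)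
  have "compact (g ` K)" using g K by (metis compact_continuous_image continuous_on_subset top_greatest)
  then obtain C where C: "\<And>x. x \<in> K \<Longrightarrow> norm (g x) \<le> C"
    using compact_imp_bounded bounded_iff by (metis imageI)
  have "integrable lebesgue (\<lambda>x. (norm (g x))\<^sup>2)"
  proof (rule Bochner_Integration.integrable_bound)
    show "integrable lebesgue (\<lambda>x. C\<^sup>2 * indicator K x :: real)"
      using lmeasurable_compact[OF K] by (auto simp: fmeasurable_def)
    show "AE x in lebesgue. norm ((norm (g x))\<^sup>2) \<le> norm (C\<^sup>2 * indicator K x :: real)"
      using C z by (intro AE_I2) (auto simp: indicator_def intro: power_mono)
  qed (use gm in auto)
  then show ?thesis using gm by (simp add: square_integrable_def)
qed

lemma test_functions_sqi:
  assumes "\<phi> \<in> test_functions D"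
  shows "\<phi> \<in> square_integrable" "gradient \<phi> \<in> square_integrable"
proof -
  let ?K = "closure {x. \<phi> x \<noteq> 0}"
  have K: "compact ?K" and C0: "Ck 0 \<phi>" and C1: "Ck (Suc 0) \<phi>"
    using assms unfolding test_functions_def by blast+
  have z: "\<phi> x = 0" if "x \<notin> ?K" for x
    using that closure_subset[of "{x. \<phi> x \<noteq> 0}"] by auto
  show "\<phi> \<in> square_integrable"
    by (rule sqi_continuous_compact_support[OF _ K z]) (use C0 in simp)
  show "gradient \<phi> \<in> square_integrable"
  proof (rule sqi_continuous_compact_support[OF _ K])
    show "continuous_on UNIV (gradient \<phi>)"
      unfolding gradient_def using C1 by (intro continuous_intros) auto
    fix x assume x: "x \<notin> ?K"
    have "(\<phi> has_derivative (\<lambda>h. 0)) (at x)"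
    proof (rule has_derivative_transform_within_open)
      show "((\<lambda>x. 0) has_derivative (\<lambda>h. 0)) (at x)" by simp
      show "open (- ?K)" by (rule open_Compl) simp
      show "x \<in> - ?K" using x by blast
      show "0 = \<phi> w" if "w \<in> - ?K" for w using z[of w] that by simp
    qed
    then have "frechet_derivative \<phi> (at x) = (\<lambda>h. 0)" by (rule frechet_derivative_at[symmetric])
    then show "gradient \<phi> x = 0" by (simp add: gradient_def)
  qed
qed

text \<open>
  A Sobolev function \<open>v\<close> is represented by the pair \<open>(v, \<nabla>v)\<close>; the product norm is then the
  usual H1 norm, and \<open>H10 D\<close> is the H1 closure of the smooth functions with compact support
  in \<open>D\<close>, extended by zero. Since the weak gradient is a closed operator, the second component
  of an element is the weak gradient of the first.
\<close>

type_synonym 'a H1 = "('a, real) L2 \<times> ('a, 'a) L2"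

definition H10 :: "'a::euclidean_space set \<Rightarrow> 'a H1 set" where
  "H10 D = closure ((\<lambda>\<phi>. (abs_L2 \<phi>, abs_L2 (gradient \<phi>))) ` test_functions D)"

definition wgrad :: "'a::euclidean_space H1 \<Rightarrow> 'a \<Rightarrow> 'a" where
  "wgrad v = rep_L2 (snd v)"

text \<open>
  On \<open>H10 D\<close> with \<open>D\<close> bounded, \<open>V_norm\<close> is equivalent to the norm of the type by Poincare's
  inequality, so that Bochner integrability and Bochner integrals agree for the two norms.
\<close>

definition V_norm :: "'a::euclidean_space H1 \<Rightarrow> real" where
  "V_norm v = norm (snd v)"

definition H_minus1 :: "'a::euclidean_space set \<Rightarrow> ('a H1 \<Rightarrow> real) set" where
  "H_minus1 D =
     {f. (\<forall>v\<in>H10 D. \<forall>w\<in>H10 D. f (v + w) = f v + f w) \<and>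
         (\<forall>r. \<forall>v\<in>H10 D. f (r *\<^sub>R v) = r * f v) \<and>
         (\<exists>K. \<forall>v\<in>H10 D. \<bar>f v\<bar> \<le> K * V_norm v)}"


section \<open>Bounded functions and wavelet systems\<close>

definition Linf :: "'a::euclidean_space set \<Rightarrow> ('a \<Rightarrow> real) set" where
  "Linf D = {b. b \<in> borel_measurable (lebesgue_on D) \<and>
                esssup (lebesgue_on D) (\<lambda>x. ereal \<bar>b x\<bar>) < \<infinity>}"

definition Linf_norm :: "'a::euclidean_space set \<Rightarrow> ('a \<Rightarrow> real) \<Rightarrow> real" where
  "Linf_norm D b = real_of_ereal (esssup (lebesgue_on D) (\<lambda>x. ereal \<bar>b x\<bar>))"

definition Linf_sums :: "'a::euclidean_space set \<Rightarrow> (nat \<Rightarrow> 'a \<Rightarrow> real) \<Rightarrow> ('a \<Rightarrow> real) \<Rightarrow> bool" where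
  "Linf_sums D h b \<longleftrightarrow>
     b \<in> Linf D \<and> (\<lambda>n. Linf_norm D (\<lambda>x. b x - (\<Sum>j<n. h j x))) \<longlonglongrightarrow> 0"

definition wavelet_system ::
  "'a::euclidean_space set \<Rightarrow> 'i set \<Rightarrow> ('i \<Rightarrow> nat) \<Rightarrow> ('i \<Rightarrow> 'a \<Rightarrow> real) \<Rightarrow> bool" where
  "wavelet_system D I level \<psi> \<longleftrightarrow>
     (\<forall>\<kappa>\<in>I. \<psi> \<kappa> \<in> Linf D) \<and>
     (\<exists>K. \<forall>l. finite {\<kappa>\<in>I. level \<kappa> = l} \<and>
        real (card {\<kappa>\<in>I. level \<kappa> = l}) \<le> K * 2 ^ (DIM('a) * l)) \<and>
     (\<exists>K. \<forall>\<kappa>\<in>I. diameter (closure {x\<in>D. \<psi> \<kappa> x \<noteq> 0}) \<le> K * (1 / 2) ^ level \<kappa>) \<and>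
     (\<exists>M>0. \<forall>l. \<forall>x\<in>D. card {\<kappa>\<in>I. level \<kappa> = l \<and> \<psi> \<kappa> x \<noteq> 0} \<le> M)"


section \<open>The lognormal diffusion problem\<close>

definition weak_solution ::
  "'a::euclidean_space set \<Rightarrow> ('a \<Rightarrow> real) \<Rightarrow> ('a H1 \<Rightarrow> real) \<Rightarrow> 'a H1 \<Rightarrow> bool" where
  "weak_solution D a f w \<longleftrightarrow>
     w \<in> H10 D \<and>
     (\<forall>v\<in>H10 D. (\<integral>x. a x * (wgrad w x \<bullet> wgrad v x) \<partial>lebesgue_on D) = f v)"

definition gaussian :: "(nat \<Rightarrow> real) measure" where
  "gaussian = PiM UNIV (\<lambda>_. std_normal_distribution)"

definition convergence_set ::
  "'a::euclidean_space set \<Rightarrow> (nat \<Rightarrow> 'a \<Rightarrow> real) \<Rightarrow> (nat \<Rightarrow> real) set" where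
  "convergence_set D \<psi> = {y. \<exists>b. Linf_sums D (\<lambda>j x. y j * \<psi> j x) b}"

text \<open>
  The limit \<open>b\<close> is determined up to a null set, on which the weak formulation does not depend.
  The value 0 off the convergence set is an arbitrary but measurable choice.
\<close>

definition diffusion ::
  "'a::euclidean_space set \<Rightarrow> (nat \<Rightarrow> 'a \<Rightarrow> real) \<Rightarrow> (nat \<Rightarrow> real) \<Rightarrow> 'a \<Rightarrow> real" where
  "diffusion D \<psi> y = (\<lambda>x. exp ((SOME b. Linf_sums D (\<lambda>j x. y j * \<psi> j x) b) x))"

definition solution ::
  "'a::euclidean_space set \<Rightarrow> ('a H1 \<Rightarrow> real) \<Rightarrow> (nat \<Rightarrow> 'a \<Rightarrow> real) \<Rightarrow> (nat \<Rightarrow> real) \<Rightarrow> 'a H1" where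
  "solution D f \<psi> y =
     (if y \<in> convergence_set D \<psi> then (THE w. weak_solution D (diffusion D \<psi> y) f w) else 0)"


section \<open>Hermite expansions\<close>

definition hermite :: "nat \<Rightarrow> real \<Rightarrow> real" where
  "hermite k t =
     (-1) ^ k / sqrt (fact k) * ((deriv ^^ k) std_normal_density t / std_normal_density t)"

definition multi_indices :: "(nat \<Rightarrow> nat) set" where
  "multi_indices = {\<nu>. finite {j. \<nu> j \<noteq> 0}}"

text \<open>Since \<open>hermite 0\<close> is constantly 1, only the support of \<open>\<nu>\<close> contributes to the product.\<close>

definition hermite_multi :: "(nat \<Rightarrow> nat) \<Rightarrow> (nat \<Rightarrow> real) \<Rightarrow> real" where
  "hermite_multi \<nu> y = (\<Prod>j\<in>{j. \<nu> j \<noteq> 0}. hermite (\<nu> j) (y j))"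

definition hermite_coeff ::
  "((nat \<Rightarrow> real) \<Rightarrow> 'a::euclidean_space H1) \<Rightarrow> (nat \<Rightarrow> nat) \<Rightarrow> 'a H1" where
  "hermite_coeff u \<nu> = (\<integral>y. hermite_multi \<nu> y *\<^sub>R u y \<partial>gaussian)"

definition hermite_partial ::
  "((nat \<Rightarrow> real) \<Rightarrow> 'a::euclidean_space H1) \<Rightarrow> (nat \<Rightarrow> nat) set \<Rightarrow> (nat \<Rightarrow> real) \<Rightarrow> 'a H1" where
  "hermite_partial u \<Lambda> y = (\<Sum>\<nu>\<in>\<Lambda>. hermite_multi \<nu> y *\<^sub>R hermite_coeff u \<nu>)"

definition L2_UV :: "'a::euclidean_space set \<Rightarrow> ((nat \<Rightarrow> real) \<Rightarrow> 'a H1) set" where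
  "L2_UV D = {w. w \<in> borel_measurable gaussian \<and> (AE y in gaussian. w y \<in> H10 D) \<and>
                 integrable gaussian (\<lambda>y. (V_norm (w y))\<^sup>2)}"

definition L2_UV_norm :: "((nat \<Rightarrow> real) \<Rightarrow> 'a::euclidean_space H1) \<Rightarrow> real" where
  "L2_UV_norm w = sqrt (\<integral>y. (V_norm (w y))\<^sup>2 \<partial>gaussian)"

definition n_largest :: "((nat \<Rightarrow> nat) \<Rightarrow> real) \<Rightarrow> nat \<Rightarrow> (nat \<Rightarrow> nat) set \<Rightarrow> bool" where
  "n_largest c n \<Lambda> \<longleftrightarrow>
     \<Lambda> \<subseteq> multi_indices \<and> finite \<Lambda> \<and> card \<Lambda> = n \<and>
     (\<forall>\<nu>\<in>\<Lambda>. \<forall>\<mu>\<in>multi_indices - \<Lambda>. c \<mu> \<le> c \<nu>)"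

end

theory Submission
  imports Defs
begin

text \<open>
  The coefficients \<open>t\<^sub>\<mu> = \<partial>\<^sup>\<mu>u / \<mu>!\<close> satisfy a recursion obtained by differentiating the weak
  formulation. Testing it with \<open>t\<^sub>\<mu>\<close> in the energy norm bounds \<open>\<Sum>\<^sub>\<mu> \<rho>\<^sup>2\<^sup>\<mu> \<parallel>t\<^sub>\<mu>\<parallel>\<^sup>2\<close> at almost every parameter,
  as soon as \<open>\<Sum>\<^sub>j \<rho>\<^sub>j \<bar>\<psi>\<^sub>j\<bar>\<close> is uniformly small on \<open>D\<close>. Integrating over the parameters, with Gaussian
  integration by parts and Bessel's inequality, turns this into square summability of \<open>\<parallel>u\<^sub>\<nu>\<parallel>\<close> with
  weights that grow like a power of \<open>\<rho>\<close>. The finite overlap of the wavelets at each level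
  makes \<open>\<Sum>\<^sub>j \<rho>\<^sub>j \<bar>\<psi>\<^sub>j\<bar>\<close> a geometric series when \<open>\<rho>\<^sub>j\<close> is a small multiple of the power \<open>-\<theta>\<close> of the
  norm of \<open>\<psi>\<^sub>j\<close>, for any \<open>\<theta> < 1\<close>; this gives the summability, and the convergence rate follows from
  Stechkin's estimate and the completeness of the Hermite polynomials.
\<close>

section \<open>The space of functions with zero trace\<close>

text \<open>The obstacle is that b(y) is unbounded in y, so an ellipticity constant entering at
  every differentiation would compound with the order. In the energy norm of a(y) itself the Taylor
  coefficients are coupled only through the functions \<open>monom_fn \<kappa>\<close>, which do not
  involve y. The smallness condition is therefore deterministic, and y enters once, through the
  energy of order zero, by a factor exponential in \<open>W y\<close> that has finite moments. The
  exponents meet as follows. Put t = p/(2-p) and \<rho>_j = \<kappa> w_j^(-\<theta>), with w_j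
  proportional to the norm of \<psi>_j. Summing the weights to the power -t requires \<rho>_j^(-2t)
  to be summable, which 2 t \<theta> = q ensures; pointwise smallness requires \<theta> < 1. Such a
  \<theta> exists because 2p/(2-p) > q. Derivatives are taken only up to a fixed order r in each
  variable: the combinatorial factor then grows like the r-th power of the index, and r t \<ge> 2
  makes its inverse power summable.\<close>

lemma closure_subspace_real_normed:
  fixes S :: "'a::real_normed_vector set"
  assumes S: "subspace S"
  shows "subspace (closure S)"
  unfolding subspace_def
proof (intro conjI ballI allI)
  show "0 \<in> closure S" using S closure_subset subspace_0 by blast
next
  fix x y assume "x \<in> closure S" "y \<in> closure S"
  then obtain xs ys where "\<And>n::nat. xs n \<in> S" "xs \<longlonglongrightarrow> x" "\<And>n::nat. ys n \<in> S" "ys \<longlonglongrightarrow> y"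
    by (auto simp: closure_sequential)
  then show "x + y \<in> closure S"
    unfolding closure_sequential
    by (intro exI[of _ "\<lambda>n. xs n + ys n"]) (auto intro: tendsto_add subspace_add[OF S])
next
  fix c :: real and x assume "x \<in> closure S"
  then obtain xs where "\<And>n::nat. xs n \<in> S" "xs \<longlonglongrightarrow> x" by (auto simp: closure_sequential)
  then show "c *\<^sub>R x \<in> closure S"
    unfolding closure_sequential
    by (intro exI[of _ "\<lambda>n. c *\<^sub>R xs n"]) (auto intro: tendsto_scaleR subspace_scale[OF S])
qed

text \<open>By symmetry the solution minimises J(v) = B v v - 2 l v over G. Coercivity and the
  parallelogram identity make minimising sequences Cauchy, and the first variation vanishes at the
  limit. Keeping the subspace G explicit allows two uses: the elliptic problem on
  \<open>H10 D\<close>, and orthogonal projection onto a closed span in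
  \<open>poly_dense_std_normal\<close>.\<close>

lemma lax_milgram_symmetric:
  fixes B :: "'h::{real_inner,complete_space} \<Rightarrow> 'h \<Rightarrow> real"
  assumes B: "bounded_bilinear B" and sym: "\<And>v w. B v w = B w v"
    and G: "subspace G" "closed G"
    and c: "c > 0" and coe: "\<And>v. v \<in> G \<Longrightarrow> c * (norm v)\<^sup>2 \<le> B v v"
    and ladd: "\<And>v w. v \<in> G \<Longrightarrow> w \<in> G \<Longrightarrow> l (v + w) = l v + l w"
    and lsc: "\<And>r v. v \<in> G \<Longrightarrow> l (r *\<^sub>R v) = r * l v"
    and lb: "\<And>v. v \<in> G \<Longrightarrow> \<bar>l v\<bar> \<le> K * norm v"
  shows "\<exists>w\<in>G. \<forall>v\<in>G. B w v = l v"
proof -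
  interpret B: bounded_bilinear B by fact
  define J where "J v = B v v - 2 * l v" for v
  have G0: "0 \<in> G" using G(1) by (rule subspace_0)
  \<comment> \<open>Completing the square in c |v|^2 - 2 K |v| gives the lower bound -K^2/c.\<close>
  have Jlow: "J v \<ge> - (K\<^sup>2 / c)" if "v \<in> G" for v
  proof -
    have "l v \<le> K * norm v" using lb[OF that] by linarith
    moreover have "0 \<le> c * (norm v)\<^sup>2 - 2 * (K * norm v) + K\<^sup>2 / c"
    proof -
      have "c * (norm v)\<^sup>2 - 2 * (K * norm v) + K\<^sup>2 / c = (c * norm v - K)\<^sup>2 / c"
        using c by (simp add: field_simps power2_eq_square)
      then show ?thesis using c by simp
    qed
    ultimately show ?thesis using coe[OF that] unfolding J_def by linarith
  qed
  define m where "m = (INF v\<in>G. J v)"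
  have bdd: "bdd_below (J ` G)" using Jlow by (auto intro!: bdd_belowI2)
  have m_le: "m \<le> J v" if "v \<in> G" for v unfolding m_def by (rule cINF_lower[OF bdd that])
  have "\<exists>v\<in>G. J v < m + 1 / real (Suc n)" for n
  proof -
    have "Inf (J ` G) < m + 1 / real (Suc n)" by (simp add: m_def)
    then show ?thesis using cInf_lessD[of "J ` G" "m + 1 / real (Suc n)"] G0 by auto
  qed
  then obtain w where wG: "\<And>n. w n \<in> G" and wJ: "\<And>n. J (w n) < m + 1 / real (Suc n)"
    by metis
  \<comment> \<open>Parallelogram identity: B(w_n - w_k, w_n - w_k) = 2 J(w_n) + 2 J(w_k) - 4 J(z)
    at the midpoint z, and J(z) \<ge> m.\<close>
  have close: "c * (norm (w n - w k))\<^sup>2 \<le> 2 / real (Suc n) + 2 / real (Suc k)" for n k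
  proof -
    define z where "z = (1/2) *\<^sub>R (w n + w k)"
    have z: "z \<in> G" unfolding z_def using wG by (intro subspace_scale subspace_add G)
    have wd: "w n - w k \<in> G" using wG by (intro subspace_diff G)
    have s: "w n + w k \<in> G" using wG by (intro subspace_add G)
    have "J z = (1/4) * (B (w n) (w n) + 2 * B (w n) (w k) + B (w k) (w k)) - (l (w n) + l (w k))"
      using lsc[OF s, of "1/2"] ladd[OF wG wG, of n k] sym[of "w k" "w n"]
      by (simp add: J_def z_def B.add_left B.add_right B.scaleR_left B.scaleR_right field_simps)
    then have "B (w n - w k) (w n - w k) = 2 * J (w n) + 2 * J (w k) - 4 * J z"
      using sym[of "w k" "w n"]
      by (simp add: J_def B.diff_left B.diff_right algebra_simps)
    also have "\<dots> \<le> 2 * (1 / real (Suc n)) + 2 * (1 / real (Suc k))"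
    proof -
      have "2 * x + 2 * y - 4 * j \<le> 2 * a + 2 * b" if "x < m + a" "y < m + b" "m \<le> j"
        for x y j a b :: real
        using that by linarith
      then show ?thesis using wJ[of n] wJ[of k] m_le[OF z] by blast
    qed
    also have "\<dots> = 2 / real (Suc n) + 2 / real (Suc k)" by simp
    finally show ?thesis using coe[OF wd] by linarith
  qed
  have "Cauchy w"
  proof (rule CauchyI)
    fix e :: real assume e: "e > 0"
    then have ce: "c * e\<^sup>2 / 4 > 0" using c by simp
    obtain N where N: "1 / real (Suc N) < c * e\<^sup>2 / 4" using nat_approx_posE[OF ce] by auto
    show "\<exists>M. \<forall>m\<ge>M. \<forall>n\<ge>M. norm (w m - w n) < e"
    proof (intro exI allI impI)
      fix p n assume "p \<ge> N" "n \<ge> N"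
      then have "2 / real (Suc p) \<le> 2 * (1 / real (Suc N))" "2 / real (Suc n) \<le> 2 * (1 / real (Suc N))"
        by (auto simp: field_simps)
      then have "2 / real (Suc p) + 2 / real (Suc n) < c * e\<^sup>2" using N by linarith
      then have "c * (norm (w p - w n))\<^sup>2 < c * e\<^sup>2" using close[of p n] by linarith
      then have "(norm (w p - w n))\<^sup>2 < e\<^sup>2" using c by simp
      then show "norm (w p - w n) < e" using e by (simp add: power_less_imp_less_base)
    qed
  qed
  then obtain x where x: "w \<longlonglongrightarrow> x" using Cauchy_convergent_iff convergent_def by blast
  have xG: "x \<in> G" using closed_sequentially[OF G(2) wG x] .
  have "(\<lambda>n. l (w n)) \<longlonglongrightarrow> l x"
  proof (rule LIM_zero_cancel, rule Lim_null_comparison)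
    have "norm (l (w n) - l x) \<le> \<bar>K\<bar> * norm (w n - x)" for n
    proof -
      have d: "w n - x \<in> G" using wG xG by (intro subspace_diff G)
      have "l (w n) = l (w n - x) + l x" using ladd[OF d xG] by simp
      then have "\<bar>l (w n) - l x\<bar> \<le> K * norm (w n - x)" using lb[OF d] by simp
      also have "\<dots> \<le> \<bar>K\<bar> * norm (w n - x)" by (intro mult_right_mono) auto
      finally show ?thesis by simp
    qed
    then show "\<forall>\<^sub>F n in sequentially. norm (l (w n) - l x) \<le> \<bar>K\<bar> * norm (w n - x)" by simp
    have "(\<lambda>n. \<bar>K\<bar> * norm (w n - x)) \<longlonglongrightarrow> \<bar>K\<bar> * norm (x - x)" by (intro tendsto_intros x)
    then show "(\<lambda>n. \<bar>K\<bar> * norm (w n - x)) \<longlonglongrightarrow> 0" by simp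
  qed
  then have "(\<lambda>n. J (w n)) \<longlonglongrightarrow> J x"
    unfolding J_def by (intro tendsto_intros B.tendsto x)
  moreover have "(\<lambda>n. m + 1 / real (Suc n)) \<longlonglongrightarrow> m + 0"
    by (intro tendsto_intros LIMSEQ_inverse_real_of_nat[unfolded inverse_eq_divide])
  ultimately have Jx: "J x \<le> m"
    using wJ by (intro LIMSEQ_le[of "\<lambda>n. J (w n)"]) (auto intro: less_imp_le)
  have "B x v = l v" if v: "v \<in> G" for v
  proof -
    define a where "a = B x v - l v"
    have q: "0 \<le> 2 * t * a + t\<^sup>2 * B v v" for t
    proof -
      have tv: "t *\<^sub>R v \<in> G" using v by (intro subspace_scale G)
      have "J (x + t *\<^sub>R v) = J x + 2 * t * a + t\<^sup>2 * B v v"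
        using ladd[OF xG tv] lsc[OF v, of t] sym[of v x]
        by (simp add: J_def a_def B.add_left B.add_right B.scaleR_left B.scaleR_right power2_eq_square
            algebra_simps)
      moreover have "m \<le> J (x + t *\<^sub>R v)" using xG tv by (intro m_le subspace_add G)
      ultimately show ?thesis using Jx by linarith
    qed
    have "a = 0"
    proof (rule ccontr)
      assume a: "a \<noteq> 0"
      \<comment> \<open>At t = -a/b the quadratic is at most -a^2/b < 0. The summand 1 keeps b
        positive when B v v = 0.\<close>
      define b where "b = \<bar>B v v\<bar> + 1"
      have b: "b > 0" "B v v < b" by (auto simp: b_def)
      have "0 \<le> 2 * (- a / b) * a + (- a / b)\<^sup>2 * B v v" by (rule q)
      also have "\<dots> \<le> 2 * (- a / b) * a + (- a / b)\<^sup>2 * b"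
        using b by (intro add_left_mono mult_left_mono) auto
      also have "\<dots> = - (a\<^sup>2 / b)" using b by (simp add: field_simps power2_eq_square)
      also have "\<dots> < 0" using a b by simp
      finally show False by simp
    qed
    then show ?thesis by (simp add: a_def)
  qed
  then show ?thesis using xG by blast
qed

section \<open>Test functions and their closure as vector spaces\<close>

lemma compact_subset_closed: "compact K \<Longrightarrow> closed S \<Longrightarrow> S \<subseteq> K \<Longrightarrow> compact S"
  using compact_Int_closed[of K S] by (simp add: inf.absorb2)

lemma Ck_add: "Ck k f \<Longrightarrow> Ck k g \<Longrightarrow> Ck k (\<lambda>x. f x + g x)"
proof (induction k arbitrary: f g)
  case 0
  then show ?case by (auto intro: continuous_on_add)
next
  case (Suc k)
  have fd: "frechet_derivative (\<lambda>x. f x + g x) (at x) = (\<lambda>h. frechet_derivative f (at x) h + frechet_derivative g (at x) h)"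
    for x
    using Suc.prems by (intro frechet_derivative_at[symmetric] has_derivative_add)
      (auto simp: frechet_derivative_works[symmetric])
  show ?case using Suc by (auto simp: fd)
qed

lemma Ck_scale: "Ck k f \<Longrightarrow> Ck k (\<lambda>x. c * f x)"
proof (induction k arbitrary: f)
  case 0
  then show ?case by (auto intro: continuous_on_mult)
next
  case (Suc k)
  have fd: "frechet_derivative (\<lambda>x. c * f x) (at x) = (\<lambda>h. c * frechet_derivative f (at x) h)" for x
    using Suc.prems by (intro frechet_derivative_at[symmetric] has_derivative_mult_right)
      (auto simp: frechet_derivative_works[symmetric])
  show ?case using Suc by (auto simp: fd)
qed

lemma test_functions_differentiable:
  assumes "\<phi> \<in> test_functions D"
  shows "\<phi> differentiable at x" "continuous_on UNIV \<phi>"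
    "i \<in> Basis \<Longrightarrow> continuous_on UNIV (\<lambda>x. frechet_derivative \<phi> (at x) i)"
proof -
  have C0: "Ck 0 \<phi>" and C1: "Ck (Suc 0) \<phi>"
    using assms unfolding test_functions_def by blast+
  show "\<phi> differentiable at x" using C1 by simp
  show "continuous_on UNIV \<phi>" using C0 by simp
  show "i \<in> Basis \<Longrightarrow> continuous_on UNIV (\<lambda>x. frechet_derivative \<phi> (at x) i)" using C1 by simp
qed

lemma test_functions_add:
  assumes f: "f \<in> test_functions D" and g: "g \<in> test_functions D"
  shows "(\<lambda>x. f x + g x) \<in> test_functions D"
    "gradient (\<lambda>x. f x + g x) = (\<lambda>x. gradient f x + gradient g x)"
proof -
  have sub: "closure {x. f x + g x \<noteq> 0} \<subseteq> closure {x. f x \<noteq> 0} \<union> closure {x. g x \<noteq> 0}"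
    unfolding closure_Un[symmetric] by (rule closure_mono) auto
  have "compact (closure {x. f x \<noteq> 0} \<union> closure {x. g x \<noteq> 0})"
    using f g by (auto simp: test_functions_def)
  then have "compact (closure {x. f x + g x \<noteq> 0})"
    by (rule compact_subset_closed[OF _ closed_closure sub])
  then show "(\<lambda>x. f x + g x) \<in> test_functions D"
    using f g sub by (auto simp: test_functions_def intro: Ck_add)
  have "frechet_derivative (\<lambda>x. f x + g x) (at x) = (\<lambda>h. frechet_derivative f (at x) h + frechet_derivative g (at x) h)"
    for x
    using f g by (intro frechet_derivative_at[symmetric] has_derivative_add)
      (auto simp: frechet_derivative_works[symmetric] test_functions_differentiable)
  then show "gradient (\<lambda>x. f x + g x) = (\<lambda>x. gradient f x + gradient g x)"
    by (auto simp: gradient_def sum.distrib scaleR_add_left fun_eq_iff)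
qed

lemma test_functions_scale:
  assumes f: "f \<in> test_functions D"
  shows "(\<lambda>x. c * f x) \<in> test_functions D"
    "gradient (\<lambda>x. c * f x) = (\<lambda>x. c *\<^sub>R gradient f x)"
proof -
  have sub: "closure {x. c * f x \<noteq> 0} \<subseteq> closure {x. f x \<noteq> 0}"
    by (rule closure_mono) auto
  have "compact (closure {x. f x \<noteq> 0})"
    using f by (auto simp: test_functions_def)
  then have "compact (closure {x. c * f x \<noteq> 0})"
    by (rule compact_subset_closed[OF _ closed_closure sub])
  then show "(\<lambda>x. c * f x) \<in> test_functions D"
    using f sub by (auto simp: test_functions_def intro: Ck_scale)
  have "frechet_derivative (\<lambda>x. c * f x) (at x) = (\<lambda>h. c * frechet_derivative f (at x) h)" for x
    using f by (intro frechet_derivative_at[symmetric] has_derivative_mult_right)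
      (auto simp: frechet_derivative_works[symmetric] test_functions_differentiable)
  then show "gradient (\<lambda>x. c * f x) = (\<lambda>x. c *\<^sub>R gradient f x)"
    by (auto simp: gradient_def scaleR_sum_right fun_eq_iff)
qed

lemma scaleR_abs_L2:
  assumes "f \<in> square_integrable"
  shows "r *\<^sub>R abs_L2 f = abs_L2 (\<lambda>x. r *\<^sub>R f x)"
  using assms by (simp add: scaleR_L2.abs_eq L2_rel_def)

lemma zero_in_test_functions: "(\<lambda>x. 0) \<in> test_functions D"
proof -
  have fd: "frechet_derivative (\<lambda>x. 0) (at x) = (\<lambda>h. 0)" for x :: 'a
    by (rule frechet_derivative_at[symmetric]) simp
  have "Ck k (\<lambda>x::'a. 0::real)" for k
    by (induction k) (auto simp: fd)
  then show ?thesis by (simp add: test_functions_def)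
qed

lemma H10_subspace: "subspace (H10 D)"
proof -
  let ?F = "\<lambda>\<phi>. (abs_L2 \<phi>, abs_L2 (gradient \<phi>)) :: 'a H1"
  have "subspace (?F ` test_functions D)"
    unfolding subspace_def
  proof (intro conjI ballI allI)
    have "gradient (\<lambda>x::'a. 0) = (\<lambda>x. 0 *\<^sub>R gradient (\<lambda>x. 0) x)"
      using test_functions_scale(2)[OF zero_in_test_functions[of D], of 0] by simp
    then have "gradient (\<lambda>x::'a. 0) = (\<lambda>x. 0)" by simp
    then have "?F (\<lambda>x. 0) = 0" by (simp add: zero_L2.abs_eq[symmetric] zero_prod_def)
    then show "0 \<in> ?F ` test_functions D"
      by (intro image_eqI[where x = "\<lambda>x. 0"] zero_in_test_functions) (rule sym)
  next
    fix v w assume "v \<in> ?F ` test_functions D" "w \<in> ?F ` test_functions D"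
    then obtain f g where fg: "f \<in> test_functions D" "g \<in> test_functions D" and v: "v = ?F f" "w = ?F g"
      by auto
    have "v + w = ?F (\<lambda>x. f x + g x)"
      using fg by (simp add: v test_functions_add test_functions_sqi add_abs_L2)
    then show "v + w \<in> ?F ` test_functions D" using test_functions_add(1)[OF fg] by blast
  next
    fix c :: real and v assume "v \<in> ?F ` test_functions D"
    then obtain f where f: "f \<in> test_functions D" and v: "v = ?F f" by auto
    have "c *\<^sub>R v = ?F (\<lambda>x. c * f x)"
      using f by (simp add: v test_functions_scale test_functions_sqi scaleR_abs_L2)
    then show "c *\<^sub>R v \<in> ?F ` test_functions D" using test_functions_scale(1)[OF f] by blast
  qed
  then show ?thesis unfolding H10_def by (rule closure_subspace_real_normed)
qed

section \<open>Poincare's inequality\<close>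

lemma integral_lborel_translate:
  fixes F :: "'a::euclidean_space \<Rightarrow> real"
  assumes [measurable]: "F \<in> borel_measurable borel"
  shows "(\<integral>x. F (a + x) \<partial>lborel) = (\<integral>x. F x \<partial>lborel)"
proof -
  have "(\<integral>x. F x \<partial>lborel) = (\<integral>x. F x \<partial>distr lborel borel ((+) a))"
    by (simp add: lborel_distr_plus)
  also have "\<dots> = (\<integral>x. F (a + x) \<partial>lborel)" by (rule integral_distr) auto
  finally show ?thesis by simp
qed

text \<open>The difference quotients have integral 0 by translation invariance.\<close>

lemma integral_partial_derivative_eq_0:
  fixes F :: "'a::euclidean_space \<Rightarrow> real"
  assumes dF: "\<And>x. (F has_derivative F' x) (at x)"
    and cont: "continuous_on UNIV (\<lambda>x. F' x e)"
    and e: "norm e = 1"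
    and K: "compact K" "\<And>x. x \<notin> K \<Longrightarrow> F x = 0"
  shows "(\<integral>x. F' x e \<partial>lborel) = 0"
proof -
  \<comment> \<open>K1 sweeps K backwards along e by lengths up to 1, so it contains the support of
    every difference quotient with step at most 1. Its indicator carries the dominating
    function.\<close>
  define K1 where "K1 = (\<lambda>(x, t). x - t *\<^sub>R e) ` (K \<times> {0..1::real})"
  have K1: "compact K1"
    unfolding K1_def
    by (intro compact_continuous_image compact_Times K) (auto simp: case_prod_beta intro!: continuous_intros)
  have K1I: "x \<in> K1" if "x + t *\<^sub>R e \<in> K" "0 \<le> t" "t \<le> 1" for x t
    unfolding K1_def by (rule image_eqI[of _ _ "(x + t *\<^sub>R e, t)"]) (use that in auto)
  have KK1: "K \<subseteq> K1" using K1I[of _ 0] by auto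
  have Fc: "continuous_on UNIV F"
    using dF has_derivative_continuous by (metis continuous_at_imp_continuous_on)
  have [measurable]: "F \<in> borel_measurable borel" using Fc by (rule borel_measurable_continuous_onI)
  have [measurable]: "(\<lambda>x. F' x e) \<in> borel_measurable borel" using cont by (rule borel_measurable_continuous_onI)
  have Fint: "integrable lborel F"
  proof -
    have "integrable lborel (\<lambda>x. indicator K x *\<^sub>R F x)"
      by (rule borel_integrable_compact[OF K(1)]) (rule continuous_on_subset[OF Fc], simp)
    moreover have "(\<lambda>x. indicator K x *\<^sub>R F x) = F" using K(2) by (auto simp: indicator_def fun_eq_iff)
    ultimately show ?thesis by simp
  qed
  have "compact ((\<lambda>x. F' x e) ` K1)" by (intro compact_continuous_image K1 continuous_on_subset[OF cont]) simp
  then obtain C0 where C0: "\<And>x. x \<in> K1 \<Longrightarrow> \<bar>F' x e\<bar> \<le> C0"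
    using compact_imp_bounded bounded_iff by (metis imageI real_norm_def)
  define C where "C = \<bar>C0\<bar>"
  have F'0: "F' x e = 0" if "x \<notin> K" for x
  proof -
    have "(F has_derivative (\<lambda>h. 0)) (at x)"
    proof (rule has_derivative_transform_within_open)
      show "((\<lambda>x. 0) has_derivative (\<lambda>h. 0)) (at x)" by simp
      show "open (- K)" using K(1) by (simp add: compact_imp_closed open_Compl)
      show "x \<in> - K" using that by simp
      show "0 = F w" if "w \<in> - K" for w using K(2) that by simp
    qed
    then show ?thesis using has_derivative_unique[OF dF] by metis
  qed
  have C: "\<bar>F' x e\<bar> \<le> C" for x
    proof (cases "x \<in> K1")
    case True
    then show ?thesis using C0[of x] by (simp add: C_def)
  next
    case False
    then have "x \<notin> K" using KK1 by blast
    then show ?thesis using F'0[of x] by (simp add: C_def)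
  qed
  define h where "h n = 1 / real (Suc n)" for n
  have h: "0 < h n" "h n \<le> 1" for n by (auto simp: h_def)
  define Q where "Q n x = (F (h n *\<^sub>R e + x) - F x) / h n" for n x
  have [measurable]: "Q n \<in> borel_measurable borel" for n unfolding Q_def by measurable
  have line: "((\<lambda>t. F (x + t *\<^sub>R e)) has_real_derivative F' (x + t *\<^sub>R e) e) (at t)" for x t
  proof -
    have "((\<lambda>t. F (x + t *\<^sub>R e)) has_derivative (\<lambda>s. F' (x + t *\<^sub>R e) (s *\<^sub>R e))) (at t)"
      by (rule has_derivative_compose[OF _ dF]) (auto intro!: derivative_eq_intros)
    moreover have "F' (x + t *\<^sub>R e) (s *\<^sub>R e) = F' (x + t *\<^sub>R e) e * s" for s
      using linear_scale[OF has_derivative_linear[OF dF]] by simp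
    ultimately show ?thesis by (simp only: has_field_derivative_def)
  qed
  \<comment> \<open>By the mean value theorem each quotient is a value of the directional derivative
    on a segment, hence bounded by C; outside K1 it vanishes.\<close>
  have lim: "(\<lambda>n. \<integral>x. Q n x \<partial>lborel) \<longlonglongrightarrow> (\<integral>x. F' x e \<partial>lborel)"
  proof (rule integral_dominated_convergence[where w = "\<lambda>x. C * indicator K1 x"])
    show "integrable lborel (\<lambda>x. C * indicator K1 x :: real)"
      using K1 emeasure_compact_finite[OF K1]
      by (intro integrable_mult_right integrable_real_indicator) (auto simp: borel_compact)
    show "AE x in lborel. (\<lambda>n. Q n x) \<longlonglongrightarrow> F' x e"
    proof (rule AE_I2)
      fix x
      have "((\<lambda>t. (F (x + (0 + t) *\<^sub>R e) - F (x + 0 *\<^sub>R e)) / t) \<longlongrightarrow> F' x e) (at 0)"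
        using line[of x 0] by (simp add: DERIV_def)
      moreover have "filterlim h (at 0) sequentially"
        unfolding filterlim_at h_def using LIMSEQ_inverse_real_of_nat by (auto simp: inverse_eq_divide)
      ultimately have "((\<lambda>n. (F (x + (0 + h n) *\<^sub>R e) - F (x + 0 *\<^sub>R e)) / h n) \<longlongrightarrow> F' x e) sequentially"
        by (rule filterlim_compose)
      then show "(\<lambda>n. Q n x) \<longlonglongrightarrow> F' x e" by (simp add: Q_def add.commute)
    qed
    show "AE x in lborel. norm (Q n x) \<le> C * indicator K1 x" for n
    proof (rule AE_I2)
      fix x
      show "norm (Q n x) \<le> C * indicator K1 x"
      proof (cases "x \<in> K1")
        case True
        obtain z where "0 < z" "z < h n" "F (x + h n *\<^sub>R e) - F (x + 0 *\<^sub>R e) = (h n - 0) * F' (x + z *\<^sub>R e) e"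
          using MVT2[OF h(1)[of n] line[of x]] by auto
        then have "Q n x = F' (x + z *\<^sub>R e) e" using h[of n] by (simp add: Q_def add.commute)
        then show ?thesis using C True by simp
      next
        case False
        have "x \<notin> K" using False KK1 by auto
        moreover have "h n *\<^sub>R e + x \<notin> K"
        proof
          assume "h n *\<^sub>R e + x \<in> K"
          then have "x \<in> K1" using K1I[of x "h n"] h[of n] by (simp add: add.commute)
          then show False using False by simp
        qed
        ultimately show ?thesis using False K(2) by (simp add: Q_def)
      qed
    qed
  qed auto
  have "(\<integral>x. Q n x \<partial>lborel) = 0" for n
  proof -
    have "integrable (distr lborel borel ((+) (h n *\<^sub>R e))) F"
      using Fint by (simp add: lborel_distr_plus)
    then have "integrable lborel (\<lambda>x. F (h n *\<^sub>R e + x))"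
      by (subst (asm) integrable_distr_eq) auto
    then have "(\<integral>x. Q n x \<partial>lborel) = ((\<integral>x. F (h n *\<^sub>R e + x) \<partial>lborel) - (\<integral>x. F x \<partial>lborel)) / h n"
      unfolding Q_def using Fint by simp
    then show ?thesis by (simp add: integral_lborel_translate)
  qed
  then have "(\<lambda>n. 0) \<longlonglongrightarrow> (\<integral>x. F' x e \<partial>lborel)" using lim by simp
  then show ?thesis using LIMSEQ_const_iff by metis
qed

text \<open>Integrate \<open>\<phi>\<^sup>2 = \<phi>\<^sup>2 \<partial>\<^sub>i(x\<^sub>i)\<close> by parts.\<close>

lemma poincare_test_functions:
  fixes \<phi> :: "'a::euclidean_space \<Rightarrow> real"
  assumes \<phi>: "\<phi> \<in> test_functions D" and R: "\<And>x. x \<in> D \<Longrightarrow> norm x \<le> R" and "R \<ge> 0"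
  shows "norm (abs_L2 \<phi>) \<le> 2 * R * norm (abs_L2 (gradient \<phi>))"
proof -
  obtain i :: 'a where i: "i \<in> Basis" using nonempty_Basis by blast
  let ?K = "closure {x. \<phi> x \<noteq> 0}"
  have K: "compact ?K" "?K \<subseteq> D" using \<phi> by (auto simp: test_functions_def)
  have z: "\<phi> x = 0" if "x \<notin> ?K" for x
    using that closure_subset[of "{x. \<phi> x \<noteq> 0}"] by auto
  define d where "d x = frechet_derivative \<phi> (at x) i" for x
  have dd: "gradient \<phi> x \<bullet> i = d x" for x
    using i by (simp add: gradient_def d_def inner_sum_left inner_Basis if_distrib cong: if_cong)
  have dc: "continuous_on UNIV d" unfolding d_def using test_functions_differentiable(3)[OF \<phi> i] .
  have \<phi>c: "continuous_on UNIV \<phi>" using test_functions_differentiable(2)[OF \<phi>] .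
  define F where "F x = (\<phi> x)\<^sup>2 * (x \<bullet> i)" for x
  define F' where "F' x h = 2 * \<phi> x * frechet_derivative \<phi> (at x) h * (x \<bullet> i) + (\<phi> x)\<^sup>2 * (h \<bullet> i)" for x h
  have "(F has_derivative F' x) (at x)" for x
  proof -
    have "(\<phi> has_derivative frechet_derivative \<phi> (at x)) (at x)"
      using test_functions_differentiable(1)[OF \<phi>] by (simp add: frechet_derivative_works[symmetric])
    then show ?thesis
      unfolding F_def F'_def by (auto intro!: derivative_eq_intros simp: algebra_simps)
  qed
  moreover have F'i: "F' x i = 2 * \<phi> x * d x * (x \<bullet> i) + (\<phi> x)\<^sup>2" for x
    using i by (simp add: F'_def d_def inner_Basis)
  moreover have "continuous_on UNIV (\<lambda>x. F' x i)"
    unfolding F'i by (intro continuous_intros \<phi>c dc)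
  moreover have "F x = 0" if "x \<notin> ?K" for x using z[OF that] by (simp add: F_def)
  ultimately have "(\<integral>x. F' x i \<partial>lborel) = 0"
    using K i by (intro integral_partial_derivative_eq_0[of F F' i ?K]) auto
  have gs: "gradient \<phi> \<in> square_integrable" "\<phi> \<in> square_integrable" using test_functions_sqi[OF \<phi>] by auto
  have F'm: "(\<lambda>x. F' x i) \<in> borel_measurable lborel"
    using \<open>continuous_on UNIV (\<lambda>x. F' x i)\<close> borel_measurable_continuous_onI by auto
  have F'0: "(\<integral>x. F' x i \<partial>lebesgue) = 0"
    using \<open>(\<integral>x. F' x i \<partial>lborel) = 0\<close> integral_completion[OF F'm] by simp
  have i1: "integrable lebesgue (\<lambda>x. (norm (\<phi> x))\<^sup>2)" and i2: "integrable lebesgue (\<lambda>x. (norm (gradient \<phi> x))\<^sup>2)"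
    using gs by (auto simp: square_integrable_def)
  have dle: "\<bar>d x\<bar> \<le> norm (gradient \<phi> x)" for x
    using Basis_le_norm[OF i, of "gradient \<phi> x"] dd by simp
  \<comment> \<open>Young's inequality, weighted so that the square of \<phi> has coefficient 1/2
    and can be absorbed on the left. What remains is the factor 4 R^2, whose root is the constant 2
    R.\<close>
  have bd: "\<bar>2 * \<phi> x * d x * (x \<bullet> i)\<bar> \<le> (1/2) * (norm (\<phi> x))\<^sup>2 + 2 * R\<^sup>2 * (norm (gradient \<phi> x))\<^sup>2" for x
  proof (cases "x \<in> D")
    case True
    have "\<bar>x \<bullet> i\<bar> \<le> R" using R[OF True] Basis_le_norm[OF i, of x] by linarith
    then have "\<bar>2 * \<phi> x * d x * (x \<bullet> i)\<bar> \<le> 2 * \<bar>\<phi> x\<bar> * norm (gradient \<phi> x) * R"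
      using dle[of x] by (simp add: abs_mult mult_mono mult_nonneg_nonneg)
    also have "\<dots> \<le> (1/2) * (\<bar>\<phi> x\<bar>)\<^sup>2 + 2 * R\<^sup>2 * (norm (gradient \<phi> x))\<^sup>2"
    proof -
      have "0 \<le> (\<bar>\<phi> x\<bar> - 2 * R * norm (gradient \<phi> x))\<^sup>2" by simp
      then show ?thesis by (simp add: power2_eq_square algebra_simps)
    qed
    finally show ?thesis by simp
  next
    case False
    then have "\<phi> x = 0" using K by (intro z) blast
    then show ?thesis by simp
  qed
  have i3: "integrable lebesgue (\<lambda>x. 2 * \<phi> x * d x * (x \<bullet> i))"
  proof (rule Bochner_Integration.integrable_bound)
    show "integrable lebesgue (\<lambda>x. (1/2) * (norm (\<phi> x))\<^sup>2 + 2 * R\<^sup>2 * (norm (gradient \<phi> x))\<^sup>2)"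
      using i1 i2 by (intro Bochner_Integration.integrable_add integrable_mult_right)
    show "(\<lambda>x. 2 * \<phi> x * d x * (x \<bullet> i)) \<in> borel_measurable lebesgue"
    proof -
      have "(\<lambda>x. 2 * \<phi> x * d x * (x \<bullet> i)) \<in> borel_measurable borel"
        by (intro borel_measurable_continuous_onI continuous_intros \<phi>c dc)
      then show ?thesis by (simp add: measurable_completion)
    qed
    show "AE x in lebesgue. norm (2 * \<phi> x * d x * (x \<bullet> i))
        \<le> norm ((1/2) * (norm (\<phi> x))\<^sup>2 + 2 * R\<^sup>2 * (norm (gradient \<phi> x))\<^sup>2)"
      using order_trans[OF bd abs_ge_self] by (intro AE_I2) (simp only: real_norm_def)
  qed
  have "(\<integral>x. (norm (\<phi> x))\<^sup>2 \<partial>lebesgue) = - (\<integral>x. 2 * \<phi> x * d x * (x \<bullet> i) \<partial>lebesgue)"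
  proof -
    have "(\<integral>x. F' x i \<partial>lebesgue) = (\<integral>x. 2 * \<phi> x * d x * (x \<bullet> i) \<partial>lebesgue) + (\<integral>x. (norm (\<phi> x))\<^sup>2 \<partial>lebesgue)"
      unfolding F'i using i1 i3 by (simp add: Bochner_Integration.integral_add)
    then show ?thesis using F'0 by simp
  qed
  also have "\<dots> = (\<integral>x. - (2 * \<phi> x * d x * (x \<bullet> i)) \<partial>lebesgue)" by simp
  also have "\<dots> \<le> (\<integral>x. (1/2) * (norm (\<phi> x))\<^sup>2 + 2 * R\<^sup>2 * (norm (gradient \<phi> x))\<^sup>2 \<partial>lebesgue)"
  proof (rule integral_mono)
    show "- (2 * \<phi> x * d x * (x \<bullet> i)) \<le> (1/2) * (norm (\<phi> x))\<^sup>2 + 2 * R\<^sup>2 * (norm (gradient \<phi> x))\<^sup>2" for x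
      using bd[of x] by linarith
  qed (use i1 i2 i3 in \<open>auto intro!: Bochner_Integration.integrable_add integrable_mult_right\<close>)
  also have "\<dots> = (1/2) * (\<integral>x. (norm (\<phi> x))\<^sup>2 \<partial>lebesgue) + 2 * R\<^sup>2 * (\<integral>x. (norm (gradient \<phi> x))\<^sup>2 \<partial>lebesgue)"
    using i1 i2 by (simp add: Bochner_Integration.integral_add)
  finally have "(\<integral>x. (norm (\<phi> x))\<^sup>2 \<partial>lebesgue) \<le> 4 * R\<^sup>2 * (\<integral>x. (norm (gradient \<phi> x))\<^sup>2 \<partial>lebesgue)" by simp
  then have "(norm (abs_L2 \<phi>))\<^sup>2 \<le> (2 * R * norm (abs_L2 (gradient \<phi>)))\<^sup>2"
    using norm_abs_L2[OF gs(1)] norm_abs_L2[OF gs(2)] by (simp add: power_mult_distrib)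
  then show ?thesis using \<open>R \<ge> 0\<close> by (simp add: power2_le_iff_abs_le)
qed

text \<open>Being an inequality between continuous functions of the pair, the bound defines a closed
  set, so it passes from test functions to their closure.\<close>

lemma poincare_H10:
  fixes D :: "'a::euclidean_space set"
  assumes "bounded D"
  shows "\<exists>K\<ge>0. \<forall>v\<in>H10 D. norm (fst v) \<le> K * V_norm v"
proof -
  obtain R where R: "\<And>x. x \<in> D \<Longrightarrow> norm x \<le> R" "R > 0"
    using assms bounded_pos by metis
  have cl: "closed {v :: 'a H1. norm (fst v) \<le> 2 * R * norm (snd v)}"
    by (intro closed_Collect_le continuous_intros)
  have "H10 D \<subseteq> {v. norm (fst v) \<le> 2 * R * norm (snd v)}"
    unfolding H10_def
    by (rule closure_minimal[OF _ cl]) (use poincare_test_functions[OF _ R(1)] R(2) in auto)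
  then show ?thesis using R(2) unfolding V_norm_def
    by (intro exI[of _ "2 * R"]) auto
qed

section \<open>Multi-indices\<close>

lemma finite_lower:
  assumes "finite {j. \<mu> j \<noteq> 0}"
  shows "finite {\<kappa>. \<kappa> \<le> (\<mu> :: nat \<Rightarrow> nat)}"
proof (rule finite_subset)
  let ?S = "{j. \<mu> j \<noteq> 0}"
  show "{\<kappa>. \<kappa> \<le> \<mu>} \<subseteq> {\<kappa>. \<forall>j. (j \<in> ?S \<longrightarrow> \<kappa> j \<in> {..Max (\<mu> ` ?S)}) \<and> (j \<notin> ?S \<longrightarrow> \<kappa> j = 0)}"
  proof (intro subsetI CollectI allI conjI impI)
    fix \<kappa> j assume le: "\<kappa> \<in> {\<kappa>. \<kappa> \<le> \<mu>}" and j: "j \<in> ?S"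
    have "\<mu> j \<le> Max (\<mu> ` ?S)" using assms j by (intro Max_ge) auto
    moreover have "\<kappa> j \<le> \<mu> j" using le by (auto simp: le_fun_def)
    ultimately show "\<kappa> j \<in> {..Max (\<mu> ` ?S)}" by simp
  next
    fix \<kappa> j assume le: "\<kappa> \<in> {\<kappa>. \<kappa> \<le> \<mu>}" and j: "j \<notin> ?S"
    have "\<kappa> j \<le> \<mu> j" using le by (auto simp: le_fun_def)
    then show "\<kappa> j = 0" using j by simp
  qed
  show "finite {\<kappa>. \<forall>j. (j \<in> ?S \<longrightarrow> \<kappa> j \<in> {..Max (\<mu> ` ?S)}) \<and> (j \<notin> ?S \<longrightarrow> \<kappa> j = 0)}"
    by (intro finite_set_of_finite_funs assms) auto
qed

lemma finite_support_mono: "finite {j. \<mu> j \<noteq> 0} \<Longrightarrow> \<kappa> \<le> (\<mu> :: nat \<Rightarrow> nat) \<Longrightarrow> finite {j. \<kappa> j \<noteq> 0}"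
  by (rule finite_subset[rotated]) (auto simp: le_fun_def intro: less_le_trans)

lemma zero_multi_index[simp]: "(\<lambda>_. 0) \<in> multi_indices" by (simp add: multi_indices_def)

lemma multi_indices_upd: "\<mu> \<in> multi_indices \<Longrightarrow> \<mu>(j := n) \<in> multi_indices"
  unfolding multi_indices_def by (auto intro: finite_subset[of _ "insert j {j. \<mu> j \<noteq> 0}"])

lemma multi_indices_diff: "\<mu> \<in> multi_indices \<Longrightarrow> \<mu> - \<kappa> \<in> multi_indices"
  unfolding multi_indices_def by (auto elim: finite_subset[rotated])

definition degree_of :: "(nat \<Rightarrow> nat) \<Rightarrow> nat" where
  "degree_of \<mu> = (\<Sum>j | \<mu> j \<noteq> 0. \<mu> j)"

text \<open>Gives the termination of the recursion for \<open>taylor\<close> and the inductions on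
  total degree.\<close>

lemma degree_of_diff_less:
  assumes f: "finite {j. \<mu> j \<noteq> 0}" and "\<kappa> \<le> \<mu>" "\<kappa> \<noteq> (\<lambda>_. 0)"
  shows "degree_of (\<mu> - \<kappa>) < degree_of \<mu>"
proof -
  obtain i where i: "\<kappa> i \<noteq> 0" using assms(3) by blast
  have le: "\<kappa> j \<le> \<mu> j" for j using assms(2) by (auto simp: le_fun_def)
  have "degree_of (\<mu> - \<kappa>) = (\<Sum>j | \<mu> j \<noteq> 0. (\<mu> - \<kappa>) j)"
    unfolding degree_of_def by (rule sum.mono_neutral_left) (use f in auto)
  also have "\<dots> < degree_of \<mu>"
    unfolding degree_of_def
    by (rule sum_strict_mono_ex1[OF f]) (use i le[of i] in \<open>auto intro!: exI[of _ i]\<close>)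
  finally show ?thesis .
qed

section \<open>Finite boxes of multi-indices\<close>

definition index_box :: "nat \<Rightarrow> nat \<Rightarrow> (nat \<Rightarrow> nat) set" where
  "index_box N r = {\<kappa>. (\<forall>j<N. \<kappa> j \<le> r) \<and> (\<forall>j\<ge>N. \<kappa> j = 0)}"

lemma index_box_Suc:
  "index_box (Suc N) r = (\<lambda>(\<kappa>, n). \<kappa>(N := n)) ` (index_box N r \<times> {..r})"
proof (intro equalityI subsetI)
  fix \<kappa> assume k: "\<kappa> \<in> index_box (Suc N) r"
  have "\<kappa>(N := 0) \<in> index_box N r" "\<kappa> N \<le> r"
    using k by (auto simp: index_box_def less_Suc_eq)
  then show "\<kappa> \<in> (\<lambda>(\<kappa>, n). \<kappa>(N := n)) ` (index_box N r \<times> {..r})"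
    by (intro image_eqI[of _ _ "(\<kappa>(N := 0), \<kappa> N)"]) auto
qed (auto simp: index_box_def less_Suc_eq)

text \<open>Distributivity over coordinates. Boxes are preferred to general finite sets because sums
  of products factorise on them, they are closed under passing to smaller indices, and every finite
  set of multi-indices lies in one.\<close>

lemma sum_index_box:
  fixes \<phi> :: "nat \<Rightarrow> nat \<Rightarrow> 'b::comm_semiring_1"
  shows "(\<Sum>\<kappa>\<in>index_box N r. \<Prod>j<N. \<phi> j (\<kappa> j)) = (\<Prod>j<N. \<Sum>n\<le>r. \<phi> j n)"
proof (induction N)
  case 0
  have "index_box 0 r = {\<lambda>_. 0}" by (auto simp: index_box_def)
  then show ?case by simp
next
  case (Suc N)
  have z: "\<kappa> N = 0" if "\<kappa> \<in> index_box N r" for \<kappa> using that by (auto simp: index_box_def)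
  have inj: "inj_on (\<lambda>(\<kappa>, n). \<kappa>(N := n)) (index_box N r \<times> {..r})"
  proof (rule inj_onI, safe)
    fix \<kappa> \<kappa>' :: "nat \<Rightarrow> nat" and n n' assume k: "\<kappa> \<in> index_box N r" "\<kappa>' \<in> index_box N r" and eq: "\<kappa>(N := n) = \<kappa>'(N := n')"
    show "\<kappa> = \<kappa>'"
    proof
      fix j show "\<kappa> j = \<kappa>' j" using z[OF k(1)] z[OF k(2)] fun_cong[OF eq, of j] by (cases "j = N") auto
    qed
    show "n = n'" using fun_cong[OF eq, of N] by simp
  qed
  have "(\<Sum>\<kappa>\<in>index_box (Suc N) r. \<Prod>j<Suc N. \<phi> j (\<kappa> j))
    = (\<Sum>(\<kappa>, n)\<in>index_box N r \<times> {..r}. \<Prod>j<Suc N. \<phi> j ((\<kappa>(N := n)) j))"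
    unfolding index_box_Suc sum.reindex[OF inj] by (simp add: case_prod_beta)
  also have "\<dots> = (\<Sum>(\<kappa>, n)\<in>index_box N r \<times> {..r}. (\<Prod>j<N. \<phi> j (\<kappa> j)) * \<phi> N n)"
    by (intro sum.cong) auto
  also have "\<dots> = (\<Sum>\<kappa>\<in>index_box N r. \<Prod>j<N. \<phi> j (\<kappa> j)) * (\<Sum>n\<le>r. \<phi> N n)"
    by (simp add: sum_product sum.cartesian_product)
  finally show ?case using Suc.IH by simp
qed

lemma finite_index_box: "finite (index_box N r)"
proof (induction N)
  case 0
  have "index_box 0 r = {\<lambda>_. 0}" by (auto simp: index_box_def)
  then show ?case by simp
next
  case (Suc N)
  then show ?case unfolding index_box_Suc by (intro finite_imageI finite_cartesian_product) auto
qed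

lemma index_box_support:
  assumes "\<kappa> \<in> index_box N r"
  shows "{j. \<kappa> j \<noteq> 0} \<subseteq> {..<N}"
proof
  fix j assume "j \<in> {j. \<kappa> j \<noteq> 0}"
  then have "\<kappa> j \<noteq> 0" by simp
  moreover have "N \<le> j \<longrightarrow> \<kappa> j = 0" using assms by (simp add: index_box_def)
  ultimately have "\<not> N \<le> j" by auto
  then show "j \<in> {..<N}" by simp
qed

lemma index_box_multi_indices: "index_box N r \<subseteq> multi_indices"
proof
  fix \<kappa> assume "\<kappa> \<in> index_box N r"
  then show "\<kappa> \<in> multi_indices"
    using finite_subset[OF index_box_support[of \<kappa> N r]] by (simp add: multi_indices_def)
qed

lemma index_box_lower:
  assumes "\<mu> \<in> index_box N r" "\<kappa> \<le> \<mu>"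
  shows "\<kappa> \<in> index_box N r"
proof -
  have le: "\<kappa> j \<le> \<mu> j" for j using assms(2) by (rule le_funD)
  have m: "j < N \<Longrightarrow> \<mu> j \<le> r" "N \<le> j \<Longrightarrow> \<mu> j = 0" for j using assms(1) by (auto simp: index_box_def)
  have "j < N \<Longrightarrow> \<kappa> j \<le> r" "N \<le> j \<Longrightarrow> \<kappa> j = 0" for j using le[of j] m[of j] by auto
  then show ?thesis by (simp add: index_box_def)
qed

lemma finite_multi_indices_box:
  assumes "finite \<Lambda>" "\<Lambda> \<subseteq> multi_indices"
  shows "\<exists>N r. \<Lambda> \<subseteq> index_box N r"
proof -
  define S where "S = (\<Union>\<nu>\<in>\<Lambda>. {j. \<nu> j \<noteq> 0})"
  have S: "finite S" using assms by (auto simp: S_def multi_indices_def)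
  define N where "N = Suc (Max (insert 0 S))"
  define r where "r = Max (insert 0 ((\<lambda>(\<nu>, j). \<nu> j) ` (\<Lambda> \<times> S)))"
  have "\<nu> \<in> index_box N r" if \<nu>: "\<nu> \<in> \<Lambda>" for \<nu>
  proof -
    have "j < N \<and> \<nu> j \<le> r" if "\<nu> j \<noteq> 0" for j
    proof -
      have j: "j \<in> S" using \<nu> that by (auto simp: S_def)
      have "j \<le> Max (insert 0 S)" using S j by (intro Max_ge) auto
      then have "j < N" by (simp add: N_def)
      moreover have "\<nu> j \<le> r" unfolding r_def using S assms(1) \<nu> j by (intro Max_ge) auto
      ultimately show ?thesis by simp
    qed
    then show ?thesis by (force simp: index_box_def)
  qed
  then show ?thesis by blast
qed

section \<open>Powers and factorials of multi-indices\<close>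

definition index_pow :: "(nat \<Rightarrow> real) \<Rightarrow> (nat \<Rightarrow> nat) \<Rightarrow> real" where
  "index_pow \<rho> \<mu> = (\<Prod>j | \<mu> j \<noteq> 0. \<rho> j ^ \<mu> j)"

definition index_fact :: "(nat \<Rightarrow> nat) \<Rightarrow> real" where
  "index_fact \<mu> = (\<Prod>j | \<mu> j \<noteq> 0. fact (\<mu> j))"

lemma index_pow_superset:
  assumes "finite S" "{j. \<mu> j \<noteq> 0} \<subseteq> S"
  shows "index_pow \<rho> \<mu> = (\<Prod>j\<in>S. \<rho> j ^ \<mu> j)"
  unfolding index_pow_def by (rule prod.mono_neutral_left) (use assms in auto)

lemma index_fact_superset:
  assumes "finite S" "{j. \<mu> j \<noteq> 0} \<subseteq> S"
  shows "index_fact \<mu> = (\<Prod>j\<in>S. fact (\<mu> j))"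
  unfolding index_fact_def by (rule prod.mono_neutral_left) (use assms in auto)

lemma index_pow_zero[simp]: "index_pow \<rho> (\<lambda>_. 0) = 1" by (simp add: index_pow_def)
lemma index_fact_zero[simp]: "index_fact (\<lambda>_. 0) = 1" by (simp add: index_fact_def)

lemma index_fact_pos: "index_fact \<mu> > 0" by (auto simp: index_fact_def intro: prod_pos)

lemma index_pow_split:
  assumes f: "finite {j. \<mu> j \<noteq> 0}" and le: "\<kappa> \<le> \<mu>"
  shows "index_pow \<rho> \<mu> = index_pow \<rho> \<kappa> * index_pow \<rho> (\<mu> - \<kappa>)"
proof -
  have l: "\<kappa> j \<le> \<mu> j" for j using le by (auto simp: le_fun_def)
  have "{j. \<kappa> j \<noteq> 0} \<subseteq> {j. \<mu> j \<noteq> 0}" using l by (auto) (metis le_zero_eq not_gr0)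
  moreover have "{j. (\<mu> - \<kappa>) j \<noteq> 0} \<subseteq> {j. \<mu> j \<noteq> 0}" by auto
  ultimately have "index_pow \<rho> \<kappa> * index_pow \<rho> (\<mu> - \<kappa>) = (\<Prod>j | \<mu> j \<noteq> 0. \<rho> j ^ \<kappa> j * \<rho> j ^ (\<mu> - \<kappa>) j)"
    by (simp add: index_pow_superset[OF f] prod.distrib)
  also have "\<dots> = index_pow \<rho> \<mu>" unfolding index_pow_def
    by (intro prod.cong refl) (use l in \<open>simp flip: power_add\<close>)
  finally show ?thesis by simp
qed

lemma index_pow_nonneg: "(\<And>j. 0 \<le> \<rho> j) \<Longrightarrow> 0 \<le> index_pow \<rho> \<mu>"
  by (auto simp: index_pow_def intro: prod_nonneg)

text \<open>A product of truncated exponential series, from which the term of index 0 is removed.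
  With z_j = \<rho>_j |\<psi>_j(x)| the left side is the total size of the perturbations in the
  energy estimate.\<close>

lemma sum_index_box_exp:
  assumes z: "\<And>j. 0 \<le> (z j :: real)"
  shows "(\<Sum>\<kappa>\<in>index_box N r - {\<lambda>_. 0}. index_pow z \<kappa> / index_fact \<kappa>) \<le> exp (\<Sum>j<N. z j) - 1"
proof -
  have z0: "(\<lambda>_. 0) \<in> index_box N r" by (simp add: index_box_def)
  have "(\<Sum>\<kappa>\<in>index_box N r. index_pow z \<kappa> / index_fact \<kappa>) = (\<Sum>\<kappa>\<in>index_box N r. \<Prod>j<N. z j ^ \<kappa> j / fact (\<kappa> j))"
    using index_pow_superset[OF finite_lessThan index_box_support] index_fact_superset[OF finite_lessThan index_box_support]
    by (intro sum.cong) (auto simp: prod_dividef)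
  also have "\<dots> = (\<Prod>j<N. \<Sum>n\<le>r. z j ^ n / fact n)" by (rule sum_index_box)
  also have "\<dots> \<le> (\<Prod>j<N. exp (z j))"
  proof (rule prod_mono, safe)
    fix j
    show "0 \<le> (\<Sum>n\<le>r. z j ^ n / fact n)" using z by (auto intro: sum_nonneg)
    have "(\<Sum>n\<le>r. z j ^ n /\<^sub>R fact n) \<le> exp (z j)"
      unfolding exp_def using z by (intro sum_le_suminf summable_exp_generic) auto
    then show "(\<Sum>n\<le>r. z j ^ n / fact n) \<le> exp (z j)" by (simp add: field_simps)
  qed
  also have "\<dots> = exp (\<Sum>j<N. z j)" by (simp add: exp_sum)
  finally show ?thesis using sum_diff1[OF finite_index_box, of "\<lambda>\<kappa>. index_pow z \<kappa> / index_fact \<kappa>" N r "\<lambda>_. 0"] z0 by simp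
qed

section \<open>Hermite polynomials\<close>

text \<open>The probabilists' Hermite polynomials He_k: since g' = -x g, the derivative of He_k g is
  (He_k' - x He_k) g, which is -He_(k+1) g.\<close>

primrec hermite_poly :: "nat \<Rightarrow> real poly" where
  "hermite_poly 0 = 1"
| "hermite_poly (Suc k) = [:0, 1:] * hermite_poly k - pderiv (hermite_poly k)"

text \<open>Differentiating the recursion and inserting the hypothesis for both derivatives leaves k
  times the recursion one step lower.\<close>

lemma pderiv_hermite_poly: "pderiv (hermite_poly k) = smult (of_nat k) (hermite_poly (k - 1))"
proof (induction k)
  case (Suc k)
  show ?case
  proof (cases k)
    case 0
    then show ?thesis by (simp add: pderiv_mult pderiv_pCons)
  next
    case (Suc m)
    have "pderiv (hermite_poly (Suc k)) = hermite_poly k + ([:0, 1:] * pderiv (hermite_poly k) - pderiv (pderiv (hermite_poly k)))"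
      by (simp add: pderiv_mult pderiv_diff pderiv_pCons)
    also have "[:0, 1:] * pderiv (hermite_poly k) - pderiv (pderiv (hermite_poly k)) = smult (of_nat k) (hermite_poly k)"
      unfolding Suc.IH by (simp add: Suc pderiv_smult smult_diff_right)
    finally show ?thesis by (simp add: smult_add_left)
  qed
qed (simp add: pderiv_1)

lemma std_normal_density_DERIV:
  "(std_normal_density has_real_derivative - x * std_normal_density x) (at x)"
proof -
  have "((\<lambda>x. c * exp (- x\<^sup>2 / 2)) has_real_derivative - x * (c * exp (- x\<^sup>2 / 2))) (at x)" for c :: real
    by (auto intro!: derivative_eq_intros)
  then show ?thesis unfolding std_normal_density_def[abs_def] .
qed

lemma deriv_std_normal_density:
  "(deriv ^^ k) std_normal_density = (\<lambda>x. (-1) ^ k * poly (hermite_poly k) x * std_normal_density x)"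
proof (induction k)
  case (Suc k)
  have "deriv (\<lambda>x. (-1) ^ k * poly (hermite_poly k) x * std_normal_density x) x
     = (-1) ^ Suc k * poly (hermite_poly (Suc k)) x * std_normal_density x" for x
    by (rule DERIV_imp_deriv)
      (auto intro!: derivative_eq_intros std_normal_density_DERIV poly_DERIV simp: algebra_simps)
  then show ?case using Suc by simp
qed simp

lemma hermite_eq: "hermite k t = poly (hermite_poly k) t / sqrt (fact k)"
proof -
  have "std_normal_density t > 0" by (rule normal_density_pos) simp
  then show ?thesis unfolding hermite_def deriv_std_normal_density
    by (simp add: field_simps flip: power_mult_distrib)
qed

lemma hermite_0[simp]: "hermite 0 t = 1" by (simp add: hermite_eq)

lemma hermite_DERIV: "(hermite k has_real_derivative sqrt k * hermite (k - 1) t) (at t)"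
proof -
  have "(hermite k has_real_derivative poly (pderiv (hermite_poly k)) t / sqrt (fact k)) (at t)"
    unfolding hermite_eq[abs_def] by (intro DERIV_cdivide poly_DERIV)
  moreover have "poly (pderiv (hermite_poly k)) t / sqrt (fact k) = sqrt k * hermite (k - 1) t"
  proof (cases k)
    case (Suc m)
    have "real k / sqrt (fact k) = sqrt k / sqrt (fact m)"
      using real_sqrt_mult_self[of "real k"]
      by (simp add: Suc real_sqrt_mult field_simps del: of_nat_Suc real_sqrt_mult_self)
    then show ?thesis by (simp add: pderiv_hermite_poly hermite_eq Suc mult.commute del: of_nat_Suc hermite_poly.simps)
        (simp add: field_simps del: of_nat_Suc)
  qed (simp add: pderiv_hermite_poly)
  ultimately show ?thesis by simp
qed

text \<open>The three-term recurrence, with the normalisation by sqrt(k!) moved into the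
  coefficients. For k = 0 the index k - 1 is 0 by truncation, and the factor sqrt k removes the
  term.\<close>

lemma hermite_Suc: "sqrt (Suc k) * hermite (Suc k) t = t * hermite k t - sqrt k * hermite (k - 1) t"
proof -
  have "sqrt (Suc k) * hermite (Suc k) t = poly (hermite_poly (Suc k)) t / sqrt (fact k)"
    by (simp add: hermite_eq[of "Suc k"] real_sqrt_mult field_simps del: of_nat_Suc hermite_poly.simps)
  also have "\<dots> = t * hermite k t - poly (pderiv (hermite_poly k)) t / sqrt (fact k)"
    by (simp add: hermite_eq diff_divide_distrib)
  also have "poly (pderiv (hermite_poly k)) t / sqrt (fact k) = sqrt k * hermite (k - 1) t"
  proof -
    have "(hermite k has_real_derivative poly (pderiv (hermite_poly k)) t / sqrt (fact k)) (at t)"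
      unfolding hermite_eq[abs_def] by (intro DERIV_cdivide poly_DERIV)
    then show ?thesis using hermite_DERIV DERIV_unique by blast
  qed
  finally show ?thesis .
qed

lemma hermite_measurable[measurable]: "hermite k \<in> borel_measurable borel"
  unfolding hermite_eq[abs_def] by (intro borel_measurable_continuous_onI continuous_intros) auto

section \<open>Gaussian integration by parts and orthonormality in one variable\<close>

lemma integrable_poly_std_normal: "integrable std_normal_distribution (poly p)"
proof -
  have "poly p = (\<lambda>x. \<Sum>i\<le>degree p. coeff p i * x ^ i)" by (rule ext) (rule poly_altdef)
  then show ?thesis
    using integrable_std_normal_distribution_moment by (simp add: Bochner_Integration.integrable_sum)
qed

lemma integrable_hermite_mult: "integrable std_normal_distribution (\<lambda>t. hermite m t * hermite n t)"
proof -
  have "integrable std_normal_distribution (\<lambda>t. poly (hermite_poly m * hermite_poly n) t / (sqrt (fact m) * sqrt (fact n)))"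
    by (intro integrable_divide integrable_poly_std_normal)
  then show ?thesis by (simp add: hermite_eq)
qed

lemma integrable_hermite: "integrable std_normal_distribution (hermite n)"
  using integrable_hermite_mult[of 0 n] by simp

text \<open>No limits of G at infinity are assumed. If the integral L were nonzero, |G(t) - G(-t)|
  would exceed |L|/2 for all large t, and integrability of G would give a half-line finite
  measure.\<close>

lemma integral_derivative_eq_0:
  fixes G G' :: "real \<Rightarrow> real"
  assumes d: "\<And>x. (G has_real_derivative G' x) (at x)" and c: "continuous_on UNIV G'"
    and G: "integrable lborel G" and G': "integrable lborel G'"
  shows "(\<integral>x. G' x \<partial>lborel) = 0"
proof (rule ccontr)
  let ?L = "\<integral>x. G' x \<partial>lborel"
  assume "?L \<noteq> 0"
  have "((\<lambda>t. \<integral>x. indicator {-t..t} x *\<^sub>R G' x \<partial>lborel) \<longlongrightarrow> ?L) at_top"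
  proof (rule integral_dominated_convergence_at_top[where w = "\<lambda>x. \<bar>G' x\<bar>"])
    show "AE x in lborel. ((\<lambda>t. indicator {-t..t} x *\<^sub>R G' x) \<longlongrightarrow> G' x) at_top"
    proof (rule AE_I2)
      fix x
      have "\<forall>\<^sub>F t in at_top. indicator {-t..t} x *\<^sub>R G' x = G' x"
        using eventually_ge_at_top[of "\<bar>x\<bar>"] by eventually_elim (auto simp: indicator_def)
      then show "((\<lambda>t. indicator {-t..t} x *\<^sub>R G' x) \<longlongrightarrow> G' x) at_top" by (rule tendsto_eventually)
    qed
    show "\<forall>\<^sub>F t in at_top. AE x in lborel. norm (indicator {-t..t} x *\<^sub>R G' x) \<le> \<bar>G' x\<bar>"
      by (intro always_eventually allI AE_I2) (auto simp: indicator_def)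
  qed (use G' in auto)
  moreover have "\<forall>\<^sub>F t in at_top. (\<integral>x. indicator {-t..t} x *\<^sub>R G' x \<partial>lborel) = G t - G (-t)"
    using eventually_ge_at_top[of 0]
  proof eventually_elim
    fix t :: real assume "0 \<le> t"
    then show "(\<integral>x. indicator {-t..t} x *\<^sub>R G' x \<partial>lborel) = G t - G (-t)"
      using d by (intro integral_FTC_atLeastAtMost continuous_on_subset[OF c])
        (auto simp: has_real_derivative_iff_has_vector_derivative[symmetric] intro: DERIV_subset)
  qed
  ultimately have "((\<lambda>t. G t - G (-t)) \<longlongrightarrow> ?L) at_top" by (rule Lim_transform_eventually)
  then have "((\<lambda>t. \<bar>G t - G (-t)\<bar>) \<longlongrightarrow> \<bar>?L\<bar>) at_top" by (rule tendsto_rabs)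
  then have "\<forall>\<^sub>F t in at_top. \<bar>?L\<bar> / 2 < \<bar>G t - G (-t)\<bar>"
    by (rule order_tendstoD) (use \<open>?L \<noteq> 0\<close> in simp)
  then obtain N where N: "\<And>t. t \<ge> N \<Longrightarrow> \<bar>?L\<bar> / 2 < \<bar>G t - G (-t)\<bar>"
    unfolding eventually_at_top_linorder by blast
  have "integrable lborel (\<lambda>x. (2 / \<bar>?L\<bar>) * (\<bar>G x\<bar> + \<bar>G (0 + (-1) * x)\<bar>))"
    using G lborel_integrable_real_affine[OF G, of "-1" 0]
    by (intro integrable_mult_right Bochner_Integration.integrable_add integrable_abs) auto
  then have "integrable lborel (\<lambda>x. indicator {N..} x :: real)"
  proof (rule Bochner_Integration.integrable_bound)
    show "AE x in lborel. norm (indicator {N..} x :: real) \<le> norm ((2 / \<bar>?L\<bar>) * (\<bar>G x\<bar> + \<bar>G (0 + (-1) * x)\<bar>))"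
    proof (rule AE_I2)
      fix x
      show "norm (indicator {N..} x :: real) \<le> norm ((2 / \<bar>?L\<bar>) * (\<bar>G x\<bar> + \<bar>G (0 + (-1) * x)\<bar>))"
      proof (cases "x \<ge> N")
        case True
        have "\<bar>?L\<bar> / 2 \<le> \<bar>G x\<bar> + \<bar>G (- x)\<bar>" using N[OF True] by linarith
        then show ?thesis using True \<open>?L \<noteq> 0\<close> by (simp add: field_simps)
      qed simp
    qed
  qed simp
  then have fin: "emeasure lborel {N..} < \<infinity>" by (simp add: integrable_indicator_iff)
  have "ennreal (real k) \<le> emeasure lborel {N..}" for k :: nat
  proof -
    have "emeasure lborel {N..N + real k} \<le> emeasure lborel {N..}" by (rule emeasure_mono) auto
    then show ?thesis by simp
  qed
  moreover obtain k :: nat where "emeasure lborel {N..} < of_nat k"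
    using fin ennreal_Ex_less_of_nat by auto
  ultimately show False by (metis ennreal_of_nat_eq_real_of_nat not_le)
qed

text \<open>By the three-term recurrence g H_n F has derivative g H_n F' - sqrt(n+1) g H_(n+1) F,
  and the integral of this derivative is 0. Integrability of the three products takes the place of
  growth conditions.\<close>

lemma hermite_ibp_real:
  fixes F F' :: "real \<Rightarrow> real"
  assumes d: "\<And>s. (F has_real_derivative F' s) (at s)" and c: "continuous_on UNIV F'"
    and i1: "integrable std_normal_distribution (\<lambda>s. hermite n s * F s)"
    and i2: "integrable std_normal_distribution (\<lambda>s. hermite n s * F' s)"
    and i3: "integrable std_normal_distribution (\<lambda>s. hermite (Suc n) s * F s)"
  shows "(\<integral>s. hermite n s * F' s \<partial>std_normal_distribution)
    = sqrt (Suc n) * (\<integral>s. hermite (Suc n) s * F s \<partial>std_normal_distribution)"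
proof -
  let ?g = "std_normal_density"
  have Fc: "continuous_on UNIV F" using d DERIV_isCont continuous_at_imp_continuous_on by blast
  have [measurable]: "F \<in> borel_measurable borel" "F' \<in> borel_measurable borel"
    using Fc c by (auto intro: borel_measurable_continuous_onI)
  have dens: "integrable std_normal_distribution f \<longleftrightarrow> integrable lborel (\<lambda>s. ?g s * f s)"
    "(\<integral>s. f s \<partial>std_normal_distribution) = (\<integral>s. ?g s * f s \<partial>lborel)"
    if [measurable]: "f \<in> borel_measurable borel" for f :: "real \<Rightarrow> real"
    by (simp_all add: integrable_density integral_density)
  define G where "G s = ?g s * (hermite n s * F s)" for s
  define G' where "G' s = ?g s * (hermite n s * F' s) - sqrt (Suc n) * (?g s * (hermite (Suc n) s * F s))" for s
  have "(G has_real_derivative G' s) (at s)" for s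
  proof -
    have "(G has_real_derivative (- s * ?g s) * (hermite n s * F s) + ?g s * ((sqrt n * hermite (n - 1) s) * F s + hermite n s * F' s)) (at s)"
      unfolding G_def by (auto intro!: derivative_eq_intros std_normal_density_DERIV hermite_DERIV d)
    moreover have "(- s * ?g s) * (hermite n s * F s) + ?g s * ((sqrt n * hermite (n - 1) s) * F s + hermite n s * F' s)
      = ?g s * (hermite n s * F' s) - (?g s * F s) * (s * hermite n s - sqrt n * hermite (n - 1) s)"
      by (simp add: algebra_simps)
    moreover have "G' s = ?g s * (hermite n s * F' s) - (?g s * F s) * (sqrt (Suc n) * hermite (Suc n) s)"
      by (simp add: G'_def mult_ac del: of_nat_Suc)
    ultimately show ?thesis by (simp only: hermite_Suc)
  qed
  moreover have hc: "continuous_on UNIV (hermite k)" for k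
    unfolding hermite_eq[abs_def] by (intro continuous_intros) auto
  have "continuous_on UNIV G'"
    unfolding G'_def std_normal_density_def by (intro continuous_intros c Fc hc) auto
  moreover have "integrable lborel G" unfolding G_def using i1 by (subst dens(1)[symmetric]) auto
  moreover have i2': "integrable lborel (\<lambda>s. ?g s * (hermite n s * F' s))"
    using i2 by (subst dens(1)[symmetric]) auto
  have i3': "integrable lborel (\<lambda>s. ?g s * (hermite (Suc n) s * F s))"
    using i3 by (subst dens(1)[symmetric]) auto
  have "integrable lborel G'" unfolding G'_def using i2' i3' by simp
  ultimately have "(\<integral>s. G' s \<partial>lborel) = 0" by (intro integral_derivative_eq_0)
  then show ?thesis unfolding G'_def using i2' i3' by (simp add: dens(2))
qed

text \<open>Pairing both sides with an arbitrary vector reduces the claim to real functions.\<close>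

lemma hermite_ibp:
  fixes F F' :: "real \<Rightarrow> 'h::{real_inner, banach, second_countable_topology}"
  assumes d: "\<And>s. (F has_vector_derivative F' s) (at s)" and c: "continuous_on UNIV F'"
    and i1: "integrable std_normal_distribution (\<lambda>s. hermite n s *\<^sub>R F s)"
    and i2: "integrable std_normal_distribution (\<lambda>s. hermite n s *\<^sub>R F' s)"
    and i3: "integrable std_normal_distribution (\<lambda>s. hermite (Suc n) s *\<^sub>R F s)"
  shows "(\<integral>s. hermite n s *\<^sub>R F' s \<partial>std_normal_distribution)
    = sqrt (Suc n) *\<^sub>R (\<integral>s. hermite (Suc n) s *\<^sub>R F s \<partial>std_normal_distribution)"
proof (rule vector_eq_rdot[THEN iffD1], rule allI)
  fix v :: 'h
  have "(\<integral>s. hermite n s * (F' s \<bullet> v) \<partial>std_normal_distribution)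
    = sqrt (Suc n) * (\<integral>s. hermite (Suc n) s * (F s \<bullet> v) \<partial>std_normal_distribution)"
  proof (rule hermite_ibp_real)
    show "((\<lambda>s. F s \<bullet> v) has_real_derivative F' s \<bullet> v) (at s)" for s
      using bounded_linear.has_vector_derivative[OF bounded_linear_inner_left d]
      by (simp add: has_real_derivative_iff_has_vector_derivative)
    show "continuous_on UNIV (\<lambda>s. F' s \<bullet> v)" by (intro continuous_intros c)
  qed (use i1 i2 i3 in \<open>auto simp flip: inner_scaleR_left intro: integrable_inner_left\<close>)
  then show "(\<integral>s. hermite n s *\<^sub>R F' s \<partial>std_normal_distribution) \<bullet> v
    = (sqrt (Suc n) *\<^sub>R (\<integral>s. hermite (Suc n) s *\<^sub>R F s \<partial>std_normal_distribution)) \<bullet> v"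
    using i2 i3 by (simp flip: integral_inner_left)
qed

lemma prob_space_std_normal: "prob_space std_normal_distribution"
  by (rule prob_space_normal_density) simp

text \<open>Integration by parts with F = H_m lowers both degrees by one, at the price of the
  factors sqrt(m) and sqrt(n+1). The base case integrates the constant 1 by parts.\<close>

lemma hermite_orthonormal:
  "(\<integral>t. hermite m t * hermite n t \<partial>std_normal_distribution) = (if m = n then 1 else 0)"
proof (induction n arbitrary: m)
  case 0
  interpret prob_space std_normal_distribution by (rule prob_space_std_normal)
  show ?case
  proof (cases m)
    case (Suc k)
    have "(\<integral>t. hermite 0 t * 0 \<partial>std_normal_distribution) = sqrt 1 * (\<integral>t. hermite (Suc 0) t * 1 \<partial>std_normal_distribution)"
      using hermite_ibp_real[of "\<lambda>_. 1" "\<lambda>_. 0" 0] integrable_hermite by simp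
    have "(\<integral>t. hermite k t * 0 \<partial>std_normal_distribution) = sqrt (Suc k) * (\<integral>t. hermite (Suc k) t * 1 \<partial>std_normal_distribution)"
      by (rule hermite_ibp_real) (use integrable_hermite in \<open>auto intro!: derivative_eq_intros\<close>)
    then show ?thesis using Suc by simp
  qed (use prob_space in simp)
next
  case (Suc n)
  have "(\<integral>t. hermite n t * (sqrt m * hermite (m - 1) t) \<partial>std_normal_distribution)
    = sqrt (Suc n) * (\<integral>t. hermite (Suc n) t * hermite m t \<partial>std_normal_distribution)"
  proof (rule hermite_ibp_real)
    show "(hermite m has_real_derivative sqrt m * hermite (m - 1) s) (at s)" for s by (rule hermite_DERIV)
    show "continuous_on UNIV (\<lambda>s. sqrt m * hermite (m - 1) s)"
      unfolding hermite_eq by (intro continuous_intros) auto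
    have "integrable std_normal_distribution (\<lambda>s. sqrt m * (hermite n s * hermite (m - 1) s))"
      by (intro integrable_mult_right integrable_hermite_mult)
    then show "integrable std_normal_distribution (\<lambda>s. hermite n s * (sqrt m * hermite (m - 1) s))"
      by (simp add: mult_ac)
  qed (rule integrable_hermite_mult)+
  moreover have "(\<integral>t. hermite n t * (sqrt m * hermite (m - 1) t) \<partial>std_normal_distribution)
    = sqrt m * (\<integral>t. hermite (m - 1) t * hermite n t \<partial>std_normal_distribution)"
    by (simp add: mult_ac flip: integral_mult_right_zero)
  ultimately have "sqrt (Suc n) * (\<integral>t. hermite m t * hermite (Suc n) t \<partial>std_normal_distribution)
     = sqrt m * (if m - 1 = n then 1 else 0)"
    using Suc.IH[of "m - 1"] by (simp add: mult.commute)
  then show ?case by (cases "m = 0") (auto split: if_splits)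
qed

section \<open>The Gaussian product measure\<close>

lemma prob_space_gaussian: "prob_space gaussian"
  unfolding gaussian_def by (intro prob_space_PiM prob_space_std_normal)

lemma space_gaussian[simp]: "space gaussian = UNIV"
  by (simp add: gaussian_def space_PiM)

lemma sets_gaussian: "sets gaussian = sets (PiM UNIV (\<lambda>_. borel))"
  unfolding gaussian_def by (intro sets_PiM_cong) auto

text \<open>Allows closed sets and continuous functions for the product topology to be used as
  measurable ones.\<close>

lemma sets_gaussian_borel: "sets gaussian = sets borel"
  unfolding sets_gaussian by (rule sets_PiM_equal_borel)

lemma measurable_gaussian_component: "(\<lambda>y. y j) \<in> borel_measurable gaussian"
  unfolding measurable_cong_sets[OF sets_gaussian refl] by measurable

lemma measurable_gaussian_upd:
  "(\<lambda>(s, y). y(j := s)) \<in> measurable (std_normal_distribution \<Otimes>\<^sub>M gaussian) gaussian"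
proof -
  have "(\<lambda>(s, y). y(j := s)) \<in> measurable (borel \<Otimes>\<^sub>M PiM UNIV (\<lambda>_. borel)) (PiM UNIV (\<lambda>_. borel))"
    unfolding case_prod_beta
    by (rule measurable_PiM_single') (auto simp: space_pair_measure space_PiM)
  moreover have "sets (std_normal_distribution \<Otimes>\<^sub>M gaussian) = sets (borel \<Otimes>\<^sub>M PiM UNIV (\<lambda>_. borel))"
    using sets_gaussian by (intro sets_pair_measure_cong) auto
  ultimately show ?thesis using measurable_cong_sets[OF _ sets_gaussian] by blast
qed

text \<open>The form in which Fubini in one variable is used: the j-th coordinate is resampled
  independently, so the parameter space never has to be split into a product.\<close>

lemma distr_gaussian_upd:
  "distr (std_normal_distribution \<Otimes>\<^sub>M gaussian) gaussian (\<lambda>(s, y). y(j := s)) = gaussian"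
  using distr_pair_PiM_eq_PiM[of UNIV "\<lambda>_. std_normal_distribution" j] prob_space_std_normal
  by (simp add: gaussian_def)

lemma pair_sigma_finite_gaussian: "pair_sigma_finite std_normal_distribution gaussian"
proof -
  interpret N: prob_space std_normal_distribution by (rule prob_space_std_normal)
  interpret G: prob_space gaussian by (rule prob_space_gaussian)
  show ?thesis by unfold_locales
qed

lemma nn_integral_gaussian_upd:
  assumes [measurable]: "\<Phi> \<in> borel_measurable gaussian"
  shows "(\<integral>\<^sup>+y. \<Phi> y \<partial>gaussian) = (\<integral>\<^sup>+y. (\<integral>\<^sup>+s. \<Phi> (y(j := s)) \<partial>std_normal_distribution) \<partial>gaussian)"
proof -
  interpret pair_sigma_finite std_normal_distribution gaussian by (rule pair_sigma_finite_gaussian)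
  note [measurable] = measurable_gaussian_upd
  have m: "(\<lambda>(s, y). \<Phi> (y(j := s))) \<in> borel_measurable (std_normal_distribution \<Otimes>\<^sub>M gaussian)"
    using measurable_compose[OF measurable_gaussian_upd assms] by (simp add: case_prod_beta)
  have "(\<integral>\<^sup>+y. \<Phi> y \<partial>gaussian) = (\<integral>\<^sup>+z. \<Phi> ((\<lambda>(s, y). y(j := s)) z) \<partial>(std_normal_distribution \<Otimes>\<^sub>M gaussian))"
    by (subst distr_gaussian_upd[of j, symmetric], subst nn_integral_distr) simp_all
  also have "\<dots> = (\<integral>\<^sup>+y. (\<integral>\<^sup>+s. \<Phi> (y(j := s)) \<partial>std_normal_distribution) \<partial>gaussian)"
    using nn_integral_snd[OF m] by (simp add: split_beta')
  finally show ?thesis .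
qed

lemma integral_gaussian_upd:
  fixes \<Phi> :: "(nat \<Rightarrow> real) \<Rightarrow> 'h::{banach, second_countable_topology}"
  assumes i: "integrable gaussian \<Phi>"
  shows "(\<integral>y. \<Phi> y \<partial>gaussian) = (\<integral>y. (\<integral>s. \<Phi> (y(j := s)) \<partial>std_normal_distribution) \<partial>gaussian)"
    "AE y in gaussian. integrable std_normal_distribution (\<lambda>s. \<Phi> (y(j := s)))"
    "integrable gaussian (\<lambda>y. \<integral>s. \<Phi> (y(j := s)) \<partial>std_normal_distribution)"
proof -
  interpret pair_sigma_finite std_normal_distribution gaussian by (rule pair_sigma_finite_gaussian)
  have m: "\<Phi> \<in> borel_measurable gaussian" using i by simp
  have "integrable (distr (std_normal_distribution \<Otimes>\<^sub>M gaussian) gaussian (\<lambda>(s, y). y(j := s))) \<Phi>"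
    using i by (simp only: distr_gaussian_upd)
  then have i': "integrable (std_normal_distribution \<Otimes>\<^sub>M gaussian) (\<lambda>(s, y). \<Phi> (y(j := s)))"
    by (subst (asm) integrable_distr_eq[OF measurable_gaussian_upd m]) (simp add: split_beta')
  have "(\<integral>y. \<Phi> y \<partial>gaussian) = (\<integral>z. \<Phi> ((\<lambda>(s, y). y(j := s)) z) \<partial>(std_normal_distribution \<Otimes>\<^sub>M gaussian))"
    by (subst distr_gaussian_upd[of j, symmetric], rule integral_distr[OF measurable_gaussian_upd m])
  also have "\<dots> = (\<integral>y. (\<integral>s. \<Phi> (y(j := s)) \<partial>std_normal_distribution) \<partial>gaussian)"
    using integral_snd[OF i'] by (simp add: split_beta')
  finally show "(\<integral>y. \<Phi> y \<partial>gaussian) = (\<integral>y. (\<integral>s. \<Phi> (y(j := s)) \<partial>std_normal_distribution) \<partial>gaussian)" .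
  show "AE y in gaussian. integrable std_normal_distribution (\<lambda>s. \<Phi> (y(j := s)))" by (rule AE_integrable_snd[OF i'])
  show "integrable gaussian (\<lambda>y. \<integral>s. \<Phi> (y(j := s)) \<partial>std_normal_distribution)" by (rule integrable_snd[OF i'])
qed

lemma nn_integral_gaussian_prod:
  assumes "finite J" and m[measurable]: "\<And>j. f j \<in> borel_measurable borel"
  shows "(\<integral>\<^sup>+y. (\<Prod>j\<in>J. f j (y j)) \<partial>gaussian) = (\<Prod>j\<in>J. \<integral>\<^sup>+s. f j s \<partial>std_normal_distribution)"
  using assms(1)
proof (induction J rule: finite_induct)
  case empty
  interpret G: prob_space gaussian by (rule prob_space_gaussian)
  show ?case by (simp add: G.emeasure_space_1[simplified])
next
  case (insert j J)
  have "(\<integral>\<^sup>+y. (\<Prod>i\<in>insert j J. f i (y i)) \<partial>gaussian) = (\<integral>\<^sup>+y. (\<integral>\<^sup>+s. (\<Prod>i\<in>insert j J. f i ((y(j := s)) i)) \<partial>std_normal_distribution) \<partial>gaussian)"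
    by (rule nn_integral_gaussian_upd, intro borel_measurable_prod_ennreal measurable_compose[OF measurable_gaussian_component m])
  also have "\<dots> = (\<integral>\<^sup>+y. (\<integral>\<^sup>+s. f j s * (\<Prod>i\<in>J. f i (y i)) \<partial>std_normal_distribution) \<partial>gaussian)"
  proof (intro nn_integral_cong)
    fix y and s :: real
    have "(\<Prod>i\<in>J. f i ((y(j := s)) i)) = (\<Prod>i\<in>J. f i (y i))" using insert by (intro prod.cong) auto
    then show "(\<Prod>i\<in>insert j J. f i ((y(j := s)) i)) = f j s * (\<Prod>i\<in>J. f i (y i))" using insert by simp
  qed
  also have "\<dots> = (\<integral>\<^sup>+s. f j s \<partial>std_normal_distribution) * (\<integral>\<^sup>+y. (\<Prod>i\<in>J. f i (y i)) \<partial>gaussian)"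
  proof -
    have [measurable]: "(\<lambda>y. \<Prod>i\<in>J. f i (y i)) \<in> borel_measurable gaussian"
      by (intro borel_measurable_prod_ennreal measurable_compose[OF measurable_gaussian_component m])
    show ?thesis by (simp add: nn_integral_multc nn_integral_cmult)
  qed
  finally show ?case using insert by simp
qed

text \<open>Only finitely many coordinates enter, so the integral is pushed forward by restriction
  to J onto a finite product measure.\<close>

lemma
  fixes f :: "nat \<Rightarrow> real \<Rightarrow> real"
  assumes "finite J" and i: "\<And>j. j \<in> J \<Longrightarrow> integrable std_normal_distribution (f j)"
  shows integral_gaussian_prod: "(\<integral>y. (\<Prod>j\<in>J. f j (y j)) \<partial>gaussian) = (\<Prod>j\<in>J. \<integral>s. f j s \<partial>std_normal_distribution)"
    and integrable_gaussian_prod: "integrable gaussian (\<lambda>y. \<Prod>j\<in>J. f j (y j))"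
proof -
  interpret product_prob_space "\<lambda>_. std_normal_distribution" "UNIV :: nat set"
    by (intro product_prob_spaceI prob_space_std_normal)
  have r: "distr gaussian (PiM J (\<lambda>_. std_normal_distribution)) (\<lambda>x. restrict x J) = PiM J (\<lambda>_. std_normal_distribution)"
    unfolding gaussian_def using assms(1) by (intro distr_PiM_restrict_finite) auto
  have rm: "(\<lambda>x. restrict x J) \<in> measurable gaussian (PiM J (\<lambda>_. std_normal_distribution))"
    unfolding gaussian_def by (rule measurable_restrict_subset) simp
  have ip: "integrable (PiM J (\<lambda>_. std_normal_distribution)) (\<lambda>x. \<Prod>j\<in>J. f j (x j))"
    by (rule product_integrable_prod[OF assms])
  have eq: "(\<Prod>j\<in>J. f j (restrict y J j)) = (\<Prod>j\<in>J. f j (y j))" for y by (intro prod.cong) auto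
  have ip': "integrable (distr gaussian (PiM J (\<lambda>_. std_normal_distribution)) (\<lambda>x. restrict x J)) (\<lambda>x. \<Prod>j\<in>J. f j (x j))"
    unfolding r by (rule ip)
  show "integrable gaussian (\<lambda>y. \<Prod>j\<in>J. f j (y j))"
    using integrable_distr[OF rm ip'] by (simp only: eq)
  have "(\<Prod>j\<in>J. \<integral>s. f j s \<partial>std_normal_distribution) = (\<integral>x. (\<Prod>j\<in>J. f j (x j)) \<partial>PiM J (\<lambda>_. std_normal_distribution))"
    by (rule product_integral_prod[OF assms, symmetric])
  also have "\<dots> = (\<integral>y. (\<Prod>j\<in>J. f j (restrict y J j)) \<partial>gaussian)"
    by (subst r[symmetric], rule integral_distr[OF rm]) (use ip in simp)
  finally show "(\<integral>y. (\<Prod>j\<in>J. f j (y j)) \<partial>gaussian) = (\<Prod>j\<in>J. \<integral>s. f j s \<partial>std_normal_distribution)"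
    by (simp only: eq)
qed

section \<open>Multivariate Hermite polynomials\<close>

lemma hermite_multi_superset:
  assumes "finite S" "{j. \<nu> j \<noteq> 0} \<subseteq> S"
  shows "hermite_multi \<nu> y = (\<Prod>j\<in>S. hermite (\<nu> j) (y j))"
  unfolding hermite_multi_def by (rule prod.mono_neutral_left) (use assms in auto)

lemma hermite_multi_measurable[measurable]: "hermite_multi \<nu> \<in> borel_measurable gaussian"
  unfolding hermite_multi_def[abs_def]
  by (intro borel_measurable_prod measurable_compose[OF measurable_gaussian_component hermite_measurable])

lemma
  assumes "\<mu> \<in> multi_indices" "\<nu> \<in> multi_indices"
  shows hermite_multi_orthonormal: "(\<integral>y. hermite_multi \<mu> y * hermite_multi \<nu> y \<partial>gaussian) = (if \<mu> = \<nu> then 1 else 0)"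
    and integrable_hermite_multi_mult: "integrable gaussian (\<lambda>y. hermite_multi \<mu> y * hermite_multi \<nu> y)"
proof -
  let ?S = "{j. \<mu> j \<noteq> 0} \<union> {j. \<nu> j \<noteq> 0}"
  have S: "finite ?S" "{j. \<mu> j \<noteq> 0} \<subseteq> ?S" "{j. \<nu> j \<noteq> 0} \<subseteq> ?S" using assms by (auto simp: multi_indices_def)
  have eq: "hermite_multi \<mu> y * hermite_multi \<nu> y = (\<Prod>j\<in>?S. hermite (\<mu> j) (y j) * hermite (\<nu> j) (y j))" for y
    by (simp only: hermite_multi_superset[OF S(1,2)] hermite_multi_superset[OF S(1,3)] prod.distrib)
  show "integrable gaussian (\<lambda>y. hermite_multi \<mu> y * hermite_multi \<nu> y)"
    unfolding eq by (rule integrable_gaussian_prod[OF S(1)]) (rule integrable_hermite_mult)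
  have "(\<integral>y. hermite_multi \<mu> y * hermite_multi \<nu> y \<partial>gaussian) = (\<Prod>j\<in>?S. if \<mu> j = \<nu> j then 1 else 0)"
    unfolding eq by (subst integral_gaussian_prod[OF S(1)]) (simp_all add: integrable_hermite_mult hermite_orthonormal)
  also have "\<dots> = (if \<mu> = \<nu> then 1 else 0)"
  proof (cases "\<mu> = \<nu>")
    case False
    then obtain i where i: "\<mu> i \<noteq> \<nu> i" by blast
    then have "i \<in> ?S" by auto
    then have "(\<Prod>j\<in>?S. if \<mu> j = \<nu> j then 1 else 0 :: real) = 0"
      using S(1) i by (intro prod_zero) auto
    then show ?thesis using False by simp
  qed simp
  finally show "(\<integral>y. hermite_multi \<mu> y * hermite_multi \<nu> y \<partial>gaussian) = (if \<mu> = \<nu> then 1 else 0)" .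
qed

lemma hermite_multi_upd:
  assumes "\<nu> \<in> multi_indices"
  shows "hermite_multi \<nu> (y(j := s)) = hermite (\<nu> j) s * hermite_multi (\<nu>(j := 0)) y"
proof -
  let ?S = "insert j {j. \<nu> j \<noteq> 0}"
  have S: "finite ?S" "{j. \<nu> j \<noteq> 0} \<subseteq> ?S" "{i. (\<nu>(j := 0)) i \<noteq> 0} \<subseteq> ?S"
    using assms by (auto simp: multi_indices_def)
  show ?thesis
    unfolding hermite_multi_superset[OF S(1,2)] hermite_multi_superset[OF S(1,3)]
    using S(1) by (subst (1 2) prod.remove[of _ j]) (auto intro!: prod.cong)
qed

section \<open>Square integrable functions of the parameter and Bessel's inequality\<close>

definition sq_integrable :: "((nat \<Rightarrow> real) \<Rightarrow> 'h::{real_inner, banach, second_countable_topology}) \<Rightarrow> bool" where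
  "sq_integrable F \<longleftrightarrow> F \<in> borel_measurable gaussian \<and> integrable gaussian (\<lambda>y. (norm (F y))\<^sup>2)"

lemma sq_integrableD: "sq_integrable F \<Longrightarrow> F \<in> borel_measurable gaussian" "sq_integrable F \<Longrightarrow> integrable gaussian (\<lambda>y. (norm (F y))\<^sup>2)"
  by (auto simp: sq_integrable_def)

lemma sq_integrable_add:
  assumes "sq_integrable F" "sq_integrable G"
  shows "sq_integrable (\<lambda>y. F y + G y)"
proof -
  note [measurable] = sq_integrableD(1)[OF assms(1)] sq_integrableD(1)[OF assms(2)]
  have "integrable gaussian (\<lambda>y. (norm (F y + G y))\<^sup>2)"
  proof (rule Bochner_Integration.integrable_bound)
    show "integrable gaussian (\<lambda>y. 2 * (norm (F y))\<^sup>2 + 2 * (norm (G y))\<^sup>2)"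
      using assms by (auto simp: sq_integrable_def)
    show "AE y in gaussian. norm ((norm (F y + G y))\<^sup>2) \<le> norm (2 * (norm (F y))\<^sup>2 + 2 * (norm (G y))\<^sup>2)"
    proof (rule AE_I2)
      fix y
      have "(norm (F y + G y))\<^sup>2 + (norm (F y - G y))\<^sup>2 = 2 * (norm (F y))\<^sup>2 + 2 * (norm (G y))\<^sup>2"
        by (simp add: power2_norm_eq_inner inner_add inner_diff inner_commute)
      then have "(norm (F y + G y))\<^sup>2 \<le> 2 * (norm (F y))\<^sup>2 + 2 * (norm (G y))\<^sup>2"
        using zero_le_power2[of "norm (F y - G y)"] by linarith
      then show "norm ((norm (F y + G y))\<^sup>2) \<le> norm (2 * (norm (F y))\<^sup>2 + 2 * (norm (G y))\<^sup>2)" by simp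
    qed
  qed measurable
  then show ?thesis by (simp add: sq_integrable_def)
qed

lemma sq_integrable_scaleR: "sq_integrable F \<Longrightarrow> sq_integrable (\<lambda>y. c *\<^sub>R F y)"
  by (auto simp: sq_integrable_def power_mult_distrib)

lemma sq_integrable_diff: "sq_integrable F \<Longrightarrow> sq_integrable G \<Longrightarrow> sq_integrable (\<lambda>y. F y - G y)"
  using sq_integrable_add[OF _ sq_integrable_scaleR[of G "-1"]] by simp

lemma sq_integrable_0: "sq_integrable (\<lambda>y. 0)" by (simp add: sq_integrable_def)

lemma sq_integrable_sum: "(\<And>i. i \<in> S \<Longrightarrow> sq_integrable (F i)) \<Longrightarrow> sq_integrable (\<lambda>y. \<Sum>i\<in>S. F i y)"
  by (induction S rule: infinite_finite_induct) (auto intro: sq_integrable_add sq_integrable_0)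

lemma sq_integrable_hermite: "\<nu> \<in> multi_indices \<Longrightarrow> sq_integrable (hermite_multi \<nu>)"
  using integrable_hermite_multi_mult[of \<nu> \<nu>] by (simp add: sq_integrable_def power2_eq_square)

lemma sq_integrable_mult:
  fixes F :: "(nat \<Rightarrow> real) \<Rightarrow> 'h::{real_inner, banach, second_countable_topology}"
  assumes g: "sq_integrable g" and F: "sq_integrable F"
  shows "integrable gaussian (\<lambda>y. g y *\<^sub>R F y)"
proof (rule Bochner_Integration.integrable_bound)
  note [measurable] = sq_integrableD(1)[OF g] sq_integrableD(1)[OF F]
  show "integrable gaussian (\<lambda>y. (norm (g y))\<^sup>2 + (norm (F y))\<^sup>2)"
    using g F by (auto simp: sq_integrable_def)
  show "(\<lambda>y. g y *\<^sub>R F y) \<in> borel_measurable gaussian" by measurable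
  show "AE y in gaussian. norm (g y *\<^sub>R F y) \<le> norm ((norm (g y))\<^sup>2 + (norm (F y))\<^sup>2)"
  proof (rule AE_I2)
    fix y
    have "2 * (\<bar>g y\<bar> * norm (F y)) \<le> \<bar>g y\<bar>\<^sup>2 + (norm (F y))\<^sup>2"
      using sum_squares_bound[of "\<bar>g y\<bar>" "norm (F y)"] by simp
    moreover have "0 \<le> \<bar>g y\<bar> * norm (F y)" by simp
    ultimately have "\<bar>g y\<bar> * norm (F y) \<le> \<bar>g y\<bar>\<^sup>2 + (norm (F y))\<^sup>2" by linarith
    then show "norm (g y *\<^sub>R F y) \<le> norm ((norm (g y))\<^sup>2 + (norm (F y))\<^sup>2)" by simp
  qed
qed

text \<open>The integral of \<open>hermite_coeff\<close> for values in a general Hilbert space. It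
  is applied to the gradient component, for which the norm of the type is the V-norm.\<close>

definition hcoeff :: "((nat \<Rightarrow> real) \<Rightarrow> 'h::{real_inner, banach, second_countable_topology}) \<Rightarrow> (nat \<Rightarrow> nat) \<Rightarrow> 'h" where
  "hcoeff F \<nu> = (\<integral>y. hermite_multi \<nu> y *\<^sub>R F y \<partial>gaussian)"

text \<open>Expand the square and use orthonormality. The coefficients c are arbitrary because c =
  \<open>hcoeff F\<close> gives Bessel's identity and the comparison with other c gives best
  approximation.\<close>

lemma hermite_expansion_error:
  assumes F: "sq_integrable F" and \<Lambda>: "finite \<Lambda>" "\<Lambda> \<subseteq> multi_indices"
  shows "(\<integral>y. (norm (F y - (\<Sum>\<nu>\<in>\<Lambda>. hermite_multi \<nu> y *\<^sub>R c \<nu>)))\<^sup>2 \<partial>gaussian)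
    = (\<integral>y. (norm (F y))\<^sup>2 \<partial>gaussian) - 2 * (\<Sum>\<nu>\<in>\<Lambda>. c \<nu> \<bullet> hcoeff F \<nu>) + (\<Sum>\<nu>\<in>\<Lambda>. (norm (c \<nu>))\<^sup>2)"
    "sq_integrable (\<lambda>y. F y - (\<Sum>\<nu>\<in>\<Lambda>. hermite_multi \<nu> y *\<^sub>R c \<nu>))"
proof -
  have mi: "\<nu> \<in> multi_indices" if "\<nu> \<in> \<Lambda>" for \<nu> using that \<Lambda> by auto
  have sqH: "sq_integrable (\<lambda>y. hermite_multi \<nu> y *\<^sub>R v)" if "\<nu> \<in> \<Lambda>" for \<nu> and v :: 'a
    using sq_integrable_hermite[OF mi[OF that]] by (auto simp: sq_integrable_def power_mult_distrib)
  show "sq_integrable (\<lambda>y. F y - (\<Sum>\<nu>\<in>\<Lambda>. hermite_multi \<nu> y *\<^sub>R c \<nu>))"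
    by (intro sq_integrable_diff F sq_integrable_sum sqH)
  have pt: "(norm (F y - (\<Sum>\<nu>\<in>\<Lambda>. hermite_multi \<nu> y *\<^sub>R c \<nu>)))\<^sup>2
    = (norm (F y))\<^sup>2 - 2 * (\<Sum>\<nu>\<in>\<Lambda>. (hermite_multi \<nu> y *\<^sub>R F y) \<bullet> c \<nu>)
      + (\<Sum>\<mu>\<in>\<Lambda>. \<Sum>\<nu>\<in>\<Lambda>. (hermite_multi \<mu> y * hermite_multi \<nu> y) * (c \<mu> \<bullet> c \<nu>))" for y
  proof -
    define S where "S = (\<Sum>\<nu>\<in>\<Lambda>. hermite_multi \<nu> y *\<^sub>R c \<nu>)"
    have "(norm (F y - S))\<^sup>2 = (norm (F y))\<^sup>2 - 2 * (F y \<bullet> S) + S \<bullet> S"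
      by (simp add: power2_norm_eq_inner inner_diff_left inner_diff_right inner_commute[of S "F y"])
    moreover have "F y \<bullet> S = (\<Sum>\<nu>\<in>\<Lambda>. (hermite_multi \<nu> y *\<^sub>R F y) \<bullet> c \<nu>)"
      by (simp add: S_def inner_sum_right)
    moreover have "S \<bullet> S = (\<Sum>\<mu>\<in>\<Lambda>. \<Sum>\<nu>\<in>\<Lambda>. (hermite_multi \<mu> y * hermite_multi \<nu> y) * (c \<mu> \<bullet> c \<nu>))"
      unfolding S_def inner_sum_left unfolding inner_sum_right by (simp add: mult_ac)
    ultimately show ?thesis by (simp only: S_def)
  qed
  have i1: "integrable gaussian (\<lambda>y. (norm (F y))\<^sup>2)" using F by (simp add: sq_integrable_def)
  have i2: "integrable gaussian (\<lambda>y. (hermite_multi \<nu> y *\<^sub>R F y) \<bullet> c \<nu>)" if "\<nu> \<in> \<Lambda>" for \<nu>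
    by (intro integrable_inner_left impI sq_integrable_mult sq_integrable_hermite mi that F)
  have e2: "(\<integral>y. (hermite_multi \<nu> y *\<^sub>R F y) \<bullet> c \<nu> \<partial>gaussian) = c \<nu> \<bullet> hcoeff F \<nu>" if "\<nu> \<in> \<Lambda>" for \<nu>
    unfolding hcoeff_def
    by (subst integral_inner_left) (use sq_integrable_mult[OF sq_integrable_hermite[OF mi[OF that]] F] in \<open>simp_all only: inner_commute\<close>)
  have i3: "integrable gaussian (\<lambda>y. (hermite_multi \<mu> y * hermite_multi \<nu> y) * (c \<mu> \<bullet> c \<nu>))" if "\<mu> \<in> \<Lambda>" "\<nu> \<in> \<Lambda>" for \<mu> \<nu>
    by (intro integrable_mult_left integrable_hermite_multi_mult mi that)
  have "(\<integral>y. (norm (F y - (\<Sum>\<nu>\<in>\<Lambda>. hermite_multi \<nu> y *\<^sub>R c \<nu>)))\<^sup>2 \<partial>gaussian)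
    = (\<integral>y. (norm (F y))\<^sup>2 \<partial>gaussian) - 2 * (\<Sum>\<nu>\<in>\<Lambda>. (\<integral>y. (hermite_multi \<nu> y *\<^sub>R F y) \<bullet> c \<nu> \<partial>gaussian))
      + (\<Sum>\<mu>\<in>\<Lambda>. \<Sum>\<nu>\<in>\<Lambda>. (\<integral>y. (hermite_multi \<mu> y * hermite_multi \<nu> y) * (c \<mu> \<bullet> c \<nu>) \<partial>gaussian))"
    unfolding pt using i1 i2 i3
    by (simp add: Bochner_Integration.integrable_sum Bochner_Integration.integral_add Bochner_Integration.integral_diff
        Bochner_Integration.integral_sum)
  also have "(\<Sum>\<mu>\<in>\<Lambda>. \<Sum>\<nu>\<in>\<Lambda>. (\<integral>y. (hermite_multi \<mu> y * hermite_multi \<nu> y) * (c \<mu> \<bullet> c \<nu>) \<partial>gaussian))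
     = (\<Sum>\<mu>\<in>\<Lambda>. \<Sum>\<nu>\<in>\<Lambda>. if \<mu> = \<nu> then (norm (c \<mu>))\<^sup>2 else 0)"
    by (intro sum.cong refl) (simp add: hermite_multi_orthonormal mi power2_norm_eq_inner)
  also have "\<dots> = (\<Sum>\<nu>\<in>\<Lambda>. (norm (c \<nu>))\<^sup>2)" using \<Lambda>(1) by (intro sum.cong refl) simp
  finally have fin: "(\<integral>y. (norm (F y - (\<Sum>\<nu>\<in>\<Lambda>. hermite_multi \<nu> y *\<^sub>R c \<nu>)))\<^sup>2 \<partial>gaussian)
    = (\<integral>y. (norm (F y))\<^sup>2 \<partial>gaussian) - 2 * (\<Sum>\<nu>\<in>\<Lambda>. \<integral>y. (hermite_multi \<nu> y *\<^sub>R F y) \<bullet> c \<nu> \<partial>gaussian) + (\<Sum>\<nu>\<in>\<Lambda>. (norm (c \<nu>))\<^sup>2)"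
  .
  show "(\<integral>y. (norm (F y - (\<Sum>\<nu>\<in>\<Lambda>. hermite_multi \<nu> y *\<^sub>R c \<nu>)))\<^sup>2 \<partial>gaussian)
    = (\<integral>y. (norm (F y))\<^sup>2 \<partial>gaussian) - 2 * (\<Sum>\<nu>\<in>\<Lambda>. c \<nu> \<bullet> hcoeff F \<nu>) + (\<Sum>\<nu>\<in>\<Lambda>. (norm (c \<nu>))\<^sup>2)"
  proof -
    have "(\<Sum>\<nu>\<in>\<Lambda>. \<integral>y. (hermite_multi \<nu> y *\<^sub>R F y) \<bullet> c \<nu> \<partial>gaussian) = (\<Sum>\<nu>\<in>\<Lambda>. c \<nu> \<bullet> hcoeff F \<nu>)"
      by (intro sum.cong refl e2)
    then show ?thesis using fin by (simp only:)
  qed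
qed

lemma hermite_bessel_error:
  assumes F: "sq_integrable F" and \<Lambda>: "finite \<Lambda>" "\<Lambda> \<subseteq> multi_indices"
  shows "(\<integral>y. (norm (F y - (\<Sum>\<nu>\<in>\<Lambda>. hermite_multi \<nu> y *\<^sub>R hcoeff F \<nu>)))\<^sup>2 \<partial>gaussian)
    = (\<integral>y. (norm (F y))\<^sup>2 \<partial>gaussian) - (\<Sum>\<nu>\<in>\<Lambda>. (norm (hcoeff F \<nu>))\<^sup>2)"
  using hermite_expansion_error(1)[OF assms, of "hcoeff F"] by (simp add: power2_norm_eq_inner)

lemma hermite_bessel:
  assumes F: "sq_integrable F" and \<Lambda>: "finite \<Lambda>" "\<Lambda> \<subseteq> multi_indices"
  shows "(\<Sum>\<nu>\<in>\<Lambda>. (norm (hcoeff F \<nu>))\<^sup>2) \<le> (\<integral>y. (norm (F y))\<^sup>2 \<partial>gaussian)"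
proof -
  have "0 \<le> (\<integral>y. (norm (F y - (\<Sum>\<nu>\<in>\<Lambda>. hermite_multi \<nu> y *\<^sub>R hcoeff F \<nu>)))\<^sup>2 \<partial>gaussian)" by simp
  then show ?thesis unfolding hermite_bessel_error[OF assms] by simp
qed

lemma hermite_best_approximation:
  assumes F: "sq_integrable F" and \<Lambda>: "finite \<Lambda>" "\<Lambda> \<subseteq> multi_indices"
  shows "(\<integral>y. (norm (F y))\<^sup>2 \<partial>gaussian) - (\<Sum>\<nu>\<in>\<Lambda>. (norm (hcoeff F \<nu>))\<^sup>2)
    \<le> (\<integral>y. (norm (F y - (\<Sum>\<nu>\<in>\<Lambda>. hermite_multi \<nu> y *\<^sub>R c \<nu>)))\<^sup>2 \<partial>gaussian)"
proof -
  have "0 \<le> (\<Sum>\<nu>\<in>\<Lambda>. (norm (c \<nu> - hcoeff F \<nu>))\<^sup>2)" by (simp add: sum_nonneg)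
  also have "\<dots> = (\<Sum>\<nu>\<in>\<Lambda>. (norm (c \<nu>))\<^sup>2) - 2 * (\<Sum>\<nu>\<in>\<Lambda>. c \<nu> \<bullet> hcoeff F \<nu>) + (\<Sum>\<nu>\<in>\<Lambda>. (norm (hcoeff F \<nu>))\<^sup>2)"
    by (simp add: power2_norm_eq_inner inner_diff inner_commute sum.distrib sum_subtractf sum_distrib_left algebra_simps)
  finally show ?thesis unfolding hermite_expansion_error(1)[OF assms] by linarith
qed

text \<open>On a line in direction j the Hermite product splits into a univariate factor and a
  constant, so the univariate formula applies on almost every line and Fubini assembles the lines.
  Differentiability enters only along coordinate lines.\<close>

lemma gaussian_ibp:
  fixes F F' :: "(nat \<Rightarrow> real) \<Rightarrow> 'h::{real_inner, banach, second_countable_topology}"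
  assumes \<nu>: "\<nu> \<in> multi_indices" and F: "sq_integrable F" and F': "sq_integrable F'"
    and d: "AE y in gaussian. (\<forall>s. ((\<lambda>s. F (y(j := s))) has_vector_derivative F' (y(j := s))) (at s))
      \<and> continuous_on UNIV (\<lambda>s. F' (y(j := s)))"
  shows "hcoeff F' \<nu> = sqrt (Suc (\<nu> j)) *\<^sub>R hcoeff F (\<nu>(j := Suc (\<nu> j)))"
proof -
  let ?n = "\<nu> j" and ?\<nu>' = "\<nu>(j := Suc (\<nu> j))"
  have \<nu>': "?\<nu>' \<in> multi_indices" using \<nu> by (auto simp: multi_indices_def intro: finite_subset[of _ "insert j {j. \<nu> j \<noteq> 0}"])
  define w where "w = hermite_multi (\<nu>(j := 0))"
  have H: "hermite_multi \<nu> (y(j := s)) = hermite ?n s * w y" "hermite_multi ?\<nu>' (y(j := s)) = hermite (Suc ?n) s * w y" for y s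
    using hermite_multi_upd[OF \<nu>, of y j s] hermite_multi_upd[OF \<nu>', of y j s] by (auto simp: w_def)
  have i1: "integrable gaussian (\<lambda>y. hermite_multi \<nu> y *\<^sub>R F y)"
    and i2: "integrable gaussian (\<lambda>y. hermite_multi \<nu> y *\<^sub>R F' y)"
    and i3: "integrable gaussian (\<lambda>y. hermite_multi ?\<nu>' y *\<^sub>R F y)"
    by (intro sq_integrable_mult sq_integrable_hermite \<nu> \<nu>' F F')+
  have "hcoeff F' \<nu> = (\<integral>y. (\<integral>s. hermite_multi \<nu> (y(j := s)) *\<^sub>R F' (y(j := s)) \<partial>std_normal_distribution) \<partial>gaussian)"
    unfolding hcoeff_def by (rule integral_gaussian_upd(1)[OF i2])
  also have "\<dots> = (\<integral>y. sqrt (Suc ?n) *\<^sub>R (\<integral>s. hermite_multi ?\<nu>' (y(j := s)) *\<^sub>R F (y(j := s)) \<partial>std_normal_distribution) \<partial>gaussian)"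
  proof (rule integral_cong_AE)
    show "AE y in gaussian. (\<integral>s. hermite_multi \<nu> (y(j := s)) *\<^sub>R F' (y(j := s)) \<partial>std_normal_distribution)
      = sqrt (Suc ?n) *\<^sub>R (\<integral>s. hermite_multi ?\<nu>' (y(j := s)) *\<^sub>R F (y(j := s)) \<partial>std_normal_distribution)"
      using d integral_gaussian_upd(2)[OF i1, of j] integral_gaussian_upd(2)[OF i2, of j] integral_gaussian_upd(2)[OF i3, of j]
    proof eventually_elim
      case (elim y)
      have "(\<integral>s. hermite ?n s *\<^sub>R (w y *\<^sub>R F' (y(j := s))) \<partial>std_normal_distribution)
        = sqrt (Suc ?n) *\<^sub>R (\<integral>s. hermite (Suc ?n) s *\<^sub>R (w y *\<^sub>R F (y(j := s))) \<partial>std_normal_distribution)"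
      proof (rule hermite_ibp)
        show "((\<lambda>s. w y *\<^sub>R F (y(j := s))) has_vector_derivative w y *\<^sub>R F' (y(j := s))) (at s)" for s
          using elim(1) bounded_linear.has_vector_derivative[OF bounded_linear_scaleR_right] by blast
        show "continuous_on UNIV (\<lambda>s. w y *\<^sub>R F' (y(j := s)))" using elim(1) by (intro continuous_intros) auto
      qed (use elim in \<open>simp_all add: H\<close>)
      then show ?case by (simp add: H)
    qed
    show "(\<lambda>y. \<integral>s. hermite_multi \<nu> (y(j := s)) *\<^sub>R F' (y(j := s)) \<partial>std_normal_distribution) \<in> borel_measurable gaussian"
      using integral_gaussian_upd(3)[OF i2, of j] by (rule borel_measurable_integrable)
    show "(\<lambda>y. sqrt (Suc ?n) *\<^sub>R (\<integral>s. hermite_multi ?\<nu>' (y(j := s)) *\<^sub>R F (y(j := s)) \<partial>std_normal_distribution)) \<in> borel_measurable gaussian"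
      by (intro borel_measurable_scaleR borel_measurable_const borel_measurable_integrable integral_gaussian_upd(3)[OF i3])
  qed
  also have "\<dots> = sqrt (Suc ?n) *\<^sub>R hcoeff F ?\<nu>'"
    unfolding hcoeff_def integral_gaussian_upd(1)[OF i3, of j]
    using integral_gaussian_upd(3)[OF i3, of j] by (intro integral_scaleR_right)
  finally show ?thesis .
qed

section \<open>Completeness of the Hermite polynomials\<close>

lemma integrable_std_normal_iff:
  fixes f :: "real \<Rightarrow> 'b::{banach, second_countable_topology}"
  assumes "f \<in> borel_measurable borel"
  shows "integrable std_normal_distribution f \<longleftrightarrow> integrable lborel (\<lambda>x. std_normal_density x *\<^sub>R f x)"
  using assms by (simp add: integrable_density)

lemma integrable_exp_std_normal: "integrable std_normal_distribution (\<lambda>x. exp (c * x))"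
proof -
  \<comment> \<open>Completing the square: the product of density and exponential is exp(c^2/2)
    times the normal density with mean c.\<close>
  have e: "c * x - x\<^sup>2 / 2 = c\<^sup>2 / 2 - (x - c)\<^sup>2 / 2" for x
    by (simp add: power2_eq_square field_simps)
  have "std_normal_density x * exp (c * x) = exp (c\<^sup>2 / 2) * normal_density c 1 x" for x
  proof -
    have "exp (- x\<^sup>2 / 2) * exp (c * x) = exp (c * x - x\<^sup>2 / 2)" by (simp add: mult_exp_exp)
    also have "\<dots> = exp (c\<^sup>2 / 2) * exp (- (x - c)\<^sup>2 / 2)" unfolding e by (simp add: mult_exp_exp)
    finally have "exp (- x\<^sup>2 / 2) * exp (c * x) = exp (c\<^sup>2 / 2) * exp (- (x - c)\<^sup>2 / 2)" .
    then show ?thesis unfolding std_normal_density_def normal_density_def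
      by (simp add: mult.assoc)
  qed
  moreover have "integrable lborel (\<lambda>x. exp (c\<^sup>2 / 2) * normal_density c 1 x)"
    by (intro integrable_mult_right integrable_normal_density) simp
  ultimately show ?thesis by (subst integrable_std_normal_iff) auto
qed

lemma integrable_exp_abs_std_normal: "integrable std_normal_distribution (\<lambda>x. exp (c * \<bar>x\<bar>))"
proof (rule Bochner_Integration.integrable_bound)
  show "integrable std_normal_distribution (\<lambda>x. exp (c * x) + exp ((- c) * x))"
    by (intro Bochner_Integration.integrable_add integrable_exp_std_normal)
  show "AE x in std_normal_distribution. norm (exp (c * \<bar>x\<bar>)) \<le> norm (exp (c * x) + exp ((- c) * x))"
  proof (rule AE_I2)
    fix x :: real
    have "0 < exp (c * x)" "0 < exp ((- c) * x)" by simp_all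
    moreover have "exp (c * \<bar>x\<bar>) = exp (c * x) \<or> exp (c * \<bar>x\<bar>) = exp ((- c) * x)" by (cases "x \<ge> 0") auto
    ultimately show "norm (exp (c * \<bar>x\<bar>)) \<le> norm (exp (c * x) + exp ((- c) * x))"
      unfolding real_norm_def by linarith
  qed
qed simp

text \<open>A density is determined by its characteristic function, which the moments determine here.\<close>

lemma moments_zero_imp_zero:
  fixes \<rho> :: "real \<Rightarrow> real"
  assumes [measurable]: "\<rho> \<in> borel_measurable borel"
    and int: "\<And>t. integrable lborel (\<lambda>x. exp (t * \<bar>x\<bar>) * \<bar>\<rho> x\<bar>)"
    and mom: "\<And>n. (\<integral>x. \<rho> x * x ^ n \<partial>lborel) = 0"
  shows "AE x in lborel. \<rho> x = 0"
proof -
  \<comment> \<open>A single term of the exponential series gives |x|^n \<le> n! exp |x|.\<close>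
  have powint: "integrable lborel (\<lambda>x. \<rho> x * x ^ n)" for n
  proof (rule Bochner_Integration.integrable_bound)
    show "integrable lborel (\<lambda>x. fact n * (exp (1 * \<bar>x\<bar>) * \<bar>\<rho> x\<bar>))" by (intro integrable_mult_right int)
    show "AE x in lborel. norm (\<rho> x * x ^ n) \<le> norm (fact n * (exp (1 * \<bar>x\<bar>) * \<bar>\<rho> x\<bar>))"
    proof (rule AE_I2)
      fix x :: real
      have "\<bar>x\<bar> ^ n /\<^sub>R fact n \<le> (\<Sum>k<Suc n. \<bar>x\<bar> ^ k /\<^sub>R fact k)" by (rule member_le_sum) auto
      also have "\<dots> \<le> exp \<bar>x\<bar>" unfolding exp_def by (intro sum_le_suminf summable_exp_generic) auto
      finally have "\<bar>x\<bar> ^ n / fact n \<le> exp \<bar>x\<bar>" by (simp add: divide_inverse mult.commute)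
      then have "\<bar>x\<bar> ^ n \<le> fact n * exp \<bar>x\<bar>" by (simp add: field_simps)
      then have "\<bar>x\<bar> ^ n * \<bar>\<rho> x\<bar> \<le> (fact n * exp \<bar>x\<bar>) * \<bar>\<rho> x\<bar>" by (rule mult_right_mono) simp
      then show "norm (\<rho> x * x ^ n) \<le> norm (fact n * (exp (1 * \<bar>x\<bar>) * \<bar>\<rho> x\<bar>))"
        by (simp add: abs_mult power_abs mult_ac)
    qed
  qed simp
  have char0: "(\<integral>x. \<rho> x *\<^sub>R iexp (t * x) \<partial>lborel) = 0" for t
  proof -
    \<comment> \<open>Partial sums of the Taylor series of the character. They are dominated by
      exp(|t| |x|), and each integrates against \<rho> to a combination of moments, hence to
      0.\<close>
    define S where "S k x = (\<Sum>n<k. (\<i> * complex_of_real (t * x)) ^ n /\<^sub>R fact n)" for k x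
    have "(\<lambda>k. \<integral>x. \<rho> x *\<^sub>R S k x \<partial>lborel) \<longlonglongrightarrow> (\<integral>x. \<rho> x *\<^sub>R iexp (t * x) \<partial>lborel)"
    proof (rule integral_dominated_convergence[where w = "\<lambda>x. exp (\<bar>t\<bar> * \<bar>x\<bar>) * \<bar>\<rho> x\<bar>"])
      show "(\<lambda>x. \<rho> x *\<^sub>R S k x) \<in> borel_measurable lborel" for k
        unfolding S_def by (intro borel_measurable_scaleR borel_measurable_sum)
          (auto intro!: borel_measurable_continuous_onI continuous_intros)
      show "AE x in lborel. (\<lambda>k. \<rho> x *\<^sub>R S k x) \<longlonglongrightarrow> \<rho> x *\<^sub>R iexp (t * x)"
        unfolding S_def by (intro AE_I2 tendsto_intros exp_converges[unfolded sums_def])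
      show "AE x in lborel. norm (\<rho> x *\<^sub>R S k x) \<le> exp (\<bar>t\<bar> * \<bar>x\<bar>) * \<bar>\<rho> x\<bar>" for k
      proof (rule AE_I2)
        fix x
        have "norm (S k x) \<le> (\<Sum>n<k. norm ((\<i> * complex_of_real (t * x)) ^ n /\<^sub>R fact n))" unfolding S_def by (rule norm_sum)
        also have "\<dots> = (\<Sum>n<k. (\<bar>t\<bar> * \<bar>x\<bar>) ^ n /\<^sub>R fact n)"
          by (intro sum.cong refl) (simp add: norm_mult norm_power abs_mult)
        also have "\<dots> \<le> exp (\<bar>t\<bar> * \<bar>x\<bar>)"
          unfolding exp_def by (intro sum_le_suminf summable_exp_generic) auto
        finally show "norm (\<rho> x *\<^sub>R S k x) \<le> exp (\<bar>t\<bar> * \<bar>x\<bar>) * \<bar>\<rho> x\<bar>"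
          by (simp add: mult.commute mult_left_mono)
      qed
    qed (use int in \<open>auto intro!: borel_measurable_continuous_onI continuous_intros\<close>)
    moreover have "(\<integral>x. \<rho> x *\<^sub>R S k x \<partial>lborel) = 0" for k
    proof -
      have e: "\<rho> x *\<^sub>R S k x = (\<Sum>n<k. (\<rho> x * x ^ n) *\<^sub>R ((\<i> * complex_of_real t) ^ n /\<^sub>R fact n))" for x
        unfolding S_def scaleR_sum_right
        by (intro sum.cong refl) (simp add: power_mult_distrib scaleR_conv_of_real field_simps)
      show ?thesis unfolding e using powint by (simp add: mom)
    qed
    ultimately show ?thesis using LIMSEQ_unique[OF tendsto_const] by force
  qed
  \<comment> \<open>The positive and the negative part of \<rho> have equal mass m and equal Fourier
    transforms. Divided by m they are probability densities, so Levy's uniqueness theorem applies; m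
    = 0 is treated separately.\<close>
  define p where "p x = max 0 (\<rho> x)" for x
  define n where "n x = max 0 (- \<rho> x)" for x
  have [measurable]: "p \<in> borel_measurable borel" "n \<in> borel_measurable borel" unfolding p_def n_def by measurable
  have nn: "0 \<le> p x" "0 \<le> n x" and pn: "\<rho> x = p x - n x" for x by (auto simp: p_def n_def)
  have i\<rho>: "integrable lborel \<rho>" using powint[of 0] by simp
  have ip: "integrable lborel p" "integrable lborel n" unfolding p_def n_def using i\<rho> by auto
  define m where "m = (\<integral>x. p x \<partial>lborel)"
  have mn: "(\<integral>x. n x \<partial>lborel) = m"
    using mom[of 0] ip by (simp add: pn m_def)
  have chpn: "(\<integral>x. p x *\<^sub>R iexp (t * x) \<partial>lborel) = (\<integral>x. n x *\<^sub>R iexp (t * x) \<partial>lborel)" for t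
  proof -
    have "integrable lborel (\<lambda>x. p x *\<^sub>R iexp (t * x))"
    proof (rule Bochner_Integration.integrable_bound[OF ip(1)])
      show "(\<lambda>x. p x *\<^sub>R iexp (t * x)) \<in> borel_measurable lborel" by measurable
      show "AE x in lborel. norm (p x *\<^sub>R iexp (t * x)) \<le> norm (p x)" by (intro AE_I2) (simp del: of_real_mult)
    qed
    moreover have "integrable lborel (\<lambda>x. n x *\<^sub>R iexp (t * x))"
    proof (rule Bochner_Integration.integrable_bound[OF ip(2)])
      show "(\<lambda>x. n x *\<^sub>R iexp (t * x)) \<in> borel_measurable lborel" by measurable
      show "AE x in lborel. norm (n x *\<^sub>R iexp (t * x)) \<le> norm (n x)" by (intro AE_I2) (simp del: of_real_mult)
    qed
    ultimately show ?thesis using char0[of t] by (simp add: pn scaleR_diff_left)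
  qed
  have m0: "m \<ge> 0" unfolding m_def using nn by simp
  have "AE x in lborel. p x = n x"
  proof (cases "m = 0")
    case True
    have "AE x in lborel. p x = 0"
      using integral_nonneg_eq_0_iff_AE[OF ip(1)] nn True m_def by auto
    moreover have "AE x in lborel. n x = 0"
      using integral_nonneg_eq_0_iff_AE[OF ip(2)] nn True mn by auto
    ultimately show ?thesis by eventually_elim simp
  next
    case False
    then have mp: "m > 0" using m0 by simp
    define M where "M h = density lborel (\<lambda>x. ennreal (h x / m))" for h :: "real \<Rightarrow> real"
    have rd: "real_distribution (M h)" if [measurable]: "h \<in> borel_measurable borel" and h: "integrable lborel h" "\<And>x. 0 \<le> h x" "(\<integral>x. h x \<partial>lborel) = m" for h
    proof -
      have "emeasure (M h) (space (M h)) = (\<integral>\<^sup>+x. ennreal (h x / m) \<partial>lborel)"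
        unfolding M_def by (subst emeasure_density) auto
      also have "\<dots> = ennreal (\<integral>x. h x / m \<partial>lborel)"
        using h mp by (intro nn_integral_eq_integral) auto
      also have "\<dots> = 1" using h(3) mp by simp
      finally have "prob_space (M h)" by (rule prob_spaceI)
      then show ?thesis by (simp add: real_distribution_def real_distribution_axioms_def M_def)
    qed
    have ch: "char (M h) t = (\<integral>x. h x *\<^sub>R iexp (t * x) \<partial>lborel) /\<^sub>R m"
      if [measurable]: "h \<in> borel_measurable borel" and h: "\<And>x. 0 \<le> h x" for h t
    proof -
      have "char (M h) t = (\<integral>x. (h x / m) *\<^sub>R iexp (t * x) \<partial>lborel)"
        unfolding char_def M_def using h mp by (subst integral_density) auto
      also have "\<dots> = (\<integral>x. (1 / m) *\<^sub>R (h x *\<^sub>R iexp (t * x)) \<partial>lborel)" by simp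
      also have "\<dots> = (1 / m) *\<^sub>R (\<integral>x. h x *\<^sub>R iexp (t * x) \<partial>lborel)" by (rule integral_scaleR_right)
      finally show ?thesis by (simp add: inverse_eq_divide)
    qed
    have "M p = M n"
    proof (rule Levy_uniqueness)
      show "real_distribution (M p)" "real_distribution (M n)" using ip nn mn m_def by (auto intro!: rd)
      show "char (M p) = char (M n)"
      proof
        fix t
        have "char (M p) t = (\<integral>x. p x *\<^sub>R iexp (t * x) \<partial>lborel) /\<^sub>R m" using nn by (intro ch) auto
        also have "\<dots> = (\<integral>x. n x *\<^sub>R iexp (t * x) \<partial>lborel) /\<^sub>R m" by (simp only: chpn)
        also have "\<dots> = char (M n) t" using nn by (intro ch[symmetric]) auto
        finally show "char (M p) t = char (M n) t" .
      qed
    qed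
    then have "AE x in lborel. ennreal (p x / m) = ennreal (n x / m)"
      unfolding M_def using ip nn mp
      by (intro sigma_finite_measure.density_unique[OF sigma_finite_lborel]) auto
    then show ?thesis by eventually_elim (use nn mp in auto)
  qed
  then show ?thesis by eventually_elim (simp add: pn)
qed

text \<open>Multiplication by the square root of the Gaussian density embeds the weighted space
  isometrically into the Lebesgue L2 type, which is complete. The residual of projecting the
  indicator onto the closed span of the polynomials is orthogonal to all monomials, so its product
  with that root has vanishing moments and the residual is 0.\<close>

lemma poly_dense_std_normal:
  assumes E: "E \<in> sets borel" and \<epsilon>: "0 < \<epsilon>"
  shows "\<exists>p. (\<integral>x. (indicator E x - poly p x)\<^sup>2 \<partial>std_normal_distribution) < \<epsilon>"
proof -
  define sg where "sg x = sqrt (std_normal_density x)" for x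
  have [measurable]: "sg \<in> borel_measurable borel" unfolding sg_def by measurable
  have sg2: "sg x * sg x = std_normal_density x" "(sg x)\<^sup>2 = std_normal_density x" for x by (simp_all add: sg_def)
  have sgp: "sg x > 0" for x by (simp add: sg_def normal_density_pos)
  define J where "J f = abs_L2 (\<lambda>x. f x * sg x)" for f :: "real \<Rightarrow> real"
  define good where "good f \<longleftrightarrow> f \<in> borel_measurable borel \<and> integrable std_normal_distribution (\<lambda>x. (f x)\<^sup>2)" for f :: "real \<Rightarrow> real"
  have goodD: "f \<in> borel_measurable borel" "integrable lborel (\<lambda>x. (f x * sg x)\<^sup>2)" if "good f" for f
  proof -
    show [measurable]: "f \<in> borel_measurable borel" using that by (simp add: good_def)
    have "integrable std_normal_distribution (\<lambda>x. (f x)\<^sup>2)" using that by (simp add: good_def)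
    then show "integrable lborel (\<lambda>x. (f x * sg x)\<^sup>2)"
      by (subst (asm) integrable_std_normal_iff) (simp_all add: power_mult_distrib sg2 mult.commute)
  qed
  have sqJ: "(\<lambda>x. f x * sg x) \<in> square_integrable" if f: "good f" for f
  proof -
    have [measurable]: "f \<in> borel_measurable borel" by (rule goodD[OF f])
    have "(\<lambda>x. f x * sg x) \<in> borel_measurable lborel" by measurable
    moreover have "integrable lebesgue (\<lambda>x. (f x * sg x)\<^sup>2)" using goodD(2)[OF f] by (subst integrable_completion) auto
    ultimately show ?thesis by (simp add: square_integrable_def measurable_completion)
  qed
  have good_poly: "good (poly p)" for p
  proof -
    have "integrable std_normal_distribution (poly (p * p))" by (rule integrable_poly_std_normal)
    moreover have "poly p \<in> borel_measurable borel" by (intro borel_measurable_continuous_onI continuous_intros)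
    moreover have "poly (p * p) = (\<lambda>x. (poly p x)\<^sup>2)" by (simp add: fun_eq_iff power2_eq_square)
    ultimately show ?thesis by (simp only: good_def)
  qed
  have good_ind: "good (indicator E)"
  proof -
    interpret prob_space std_normal_distribution by (rule prob_space_std_normal)
    have "integrable std_normal_distribution (\<lambda>x. (indicator E x :: real)\<^sup>2)"
      by (rule integrable_const_bound[where B = 1]) (use E in \<open>auto simp: indicator_def\<close>)
    then show ?thesis using E by (simp add: good_def)
  qed
  have dist: "(norm (J f - J h))\<^sup>2 = (\<integral>x. (f x - h x)\<^sup>2 \<partial>std_normal_distribution)" if f: "good f" and h: "good h" for f h
  proof -
    have [measurable]: "f \<in> borel_measurable borel" "h \<in> borel_measurable borel" using goodD f h by auto
    have "J f - J h = abs_L2 (\<lambda>x. f x * sg x - h x * sg x)" unfolding J_def by (rule diff_abs_L2[OF sqJ[OF f] sqJ[OF h]])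
    then have "(norm (J f - J h))\<^sup>2 = (\<integral>x. (norm (f x * sg x - h x * sg x))\<^sup>2 \<partial>lebesgue)"
      using norm_abs_L2[OF sqi_diff[OF sqJ[OF f] sqJ[OF h]]] by simp
    also have "\<dots> = (\<integral>x. (norm (f x * sg x - h x * sg x))\<^sup>2 \<partial>lborel)" by (rule integral_completion) measurable
    also have "\<dots> = (\<integral>x. std_normal_density x * (f x - h x)\<^sup>2 \<partial>lborel)"
      by (intro Bochner_Integration.integral_cong refl)
        (simp add: sg2 power_mult_distrib left_diff_distrib[symmetric] mult.commute)
    also have "\<dots> = (\<integral>x. (f x - h x)\<^sup>2 \<partial>std_normal_distribution)" by (simp add: integral_density)
    finally show ?thesis .
  qed
  define Q where "Q = range (\<lambda>p. J (poly p))"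
  have "subspace Q"
    unfolding subspace_def Q_def
  proof (safe)
    have "J (poly 0) = 0" by (simp add: J_def zero_L2.abs_eq)
    then show "0 \<in> range (\<lambda>p. J (poly p))" by (metis rangeI)
  next
    fix p q
    have "J (poly p) + J (poly q) = J (poly (p + q))"
      unfolding J_def using add_abs_L2[OF sqJ[OF good_poly[of p]] sqJ[OF good_poly[of q]]] by (simp add: algebra_simps)
    then show "J (poly p) + J (poly q) \<in> range (\<lambda>p. J (poly p))" by simp
  next
    fix c p
    have "c *\<^sub>R J (poly p) = J (poly (smult c p))"
      unfolding J_def using scaleR_L2.abs_eq[of "\<lambda>x. poly p x * sg x" c] sqJ[OF good_poly[of p]]
      by (simp add: L2_rel_def mult.assoc)
    then show "c *\<^sub>R J (poly p) \<in> range (\<lambda>p. J (poly p))" by simp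
  qed
  then have sub: "subspace (closure Q)" by (rule closure_subspace_real_normed)
  define f0 where "f0 = J (indicator E)"
  \<comment> \<open>Orthogonal projection of f0 onto the closure of Q: the minimisation lemma with
    the inner product itself as bilinear form.\<close>
  obtain w where w: "w \<in> closure Q" "\<And>v. v \<in> closure Q \<Longrightarrow> w \<bullet> v = f0 \<bullet> v"
  proof -
    have "\<exists>w\<in>closure Q. \<forall>v\<in>closure Q. w \<bullet> v = f0 \<bullet> v"
      by (rule lax_milgram_symmetric[OF bounded_bilinear_inner inner_commute sub closed_closure, of 1 _ "norm f0"])
        (auto simp: power2_norm_eq_inner inner_add_right Cauchy_Schwarz_ineq2)
    then show ?thesis using that by blast
  qed
  define r where "r = f0 - w"
  have orth: "r \<bullet> J (poly p) = 0" for p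
  proof -
    have "J (poly p) \<in> closure Q" using closure_subset[of Q] unfolding Q_def by blast
    from w(2)[OF this] show ?thesis by (simp add: r_def inner_diff_left)
  qed
  \<comment> \<open>\<open>moments_zero_imp_zero\<close> is stated for Borel functions, so the
    Lebesgue measurable representative is exchanged for a Borel one.\<close>
  have "rep_L2 r \<in> borel_measurable (completion lborel)" using rep_L2_sqi[of r] by (simp add: square_integrable_def)
  from completion_ex_borel_measurable_real[OF this]
  obtain r' where r'[measurable]: "r' \<in> borel_measurable borel" and rr': "AE x in lborel. rep_L2 r x = r' x" by auto
  have rr'': "AE x in lebesgue. rep_L2 r x = r' x" using rr' by (rule AE_completion)
  have ir': "integrable lborel (\<lambda>x. (r' x)\<^sup>2)"
  proof -
    have "integrable lebesgue (\<lambda>x. (norm (rep_L2 r x))\<^sup>2)" using rep_L2_sqi[of r] by (simp add: square_integrable_def)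
    then have "integrable lebesgue (\<lambda>x. (r' x)\<^sup>2)"
      by (subst (asm) integrable_cong_AE[where g = "\<lambda>x. (r' x)\<^sup>2"])
        (use rep_L2_sqi[of r] rr'' in \<open>auto simp: square_integrable_def measurable_completion\<close>)
    then show ?thesis by (subst (asm) integrable_completion) auto
  qed
  define \<rho> where "\<rho> x = r' x * sg x" for x
  have "AE x in lborel. \<rho> x = 0"
  proof (rule moments_zero_imp_zero)
    show [measurable]: "\<rho> \<in> borel_measurable borel" unfolding \<rho>_def by measurable
    show "integrable lborel (\<lambda>x. exp (t * \<bar>x\<bar>) * \<bar>\<rho> x\<bar>)" for t
    proof (rule Bochner_Integration.integrable_bound)
      have "integrable lborel (\<lambda>x. std_normal_density x *\<^sub>R exp (2 * t * \<bar>x\<bar>))"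
        using integrable_exp_abs_std_normal[of "2 * t"] by (subst integrable_std_normal_iff[symmetric]) auto
      then show "integrable lborel (\<lambda>x. (r' x)\<^sup>2 + std_normal_density x * exp (2 * t * \<bar>x\<bar>))"
        using ir' by simp
      show "AE x in lborel. norm (exp (t * \<bar>x\<bar>) * \<bar>\<rho> x\<bar>) \<le> norm ((r' x)\<^sup>2 + std_normal_density x * exp (2 * t * \<bar>x\<bar>))"
      proof (rule AE_I2)
        fix x
        \<comment> \<open>Young's inequality: the square of r' is integrable, and the square of the
          other factor is the density times exp(2 t |x|).\<close>
        have "2 * (\<bar>r' x\<bar> * (sg x * exp (t * \<bar>x\<bar>))) \<le> \<bar>r' x\<bar>\<^sup>2 + (sg x * exp (t * \<bar>x\<bar>))\<^sup>2"
          using sum_squares_bound[of "\<bar>r' x\<bar>" "sg x * exp (t * \<bar>x\<bar>)"] by (simp add: mult.assoc)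
        also have "(sg x * exp (t * \<bar>x\<bar>))\<^sup>2 = std_normal_density x * exp (2 * t * \<bar>x\<bar>)"
          by (simp add: power_mult_distrib sg2 power2_eq_square[of "exp _"] flip: exp_add)
        finally have "2 * (\<bar>r' x\<bar> * (sg x * exp (t * \<bar>x\<bar>))) \<le> (r' x)\<^sup>2 + std_normal_density x * exp (2 * t * \<bar>x\<bar>)" by simp
        moreover have "0 \<le> \<bar>r' x\<bar> * (sg x * exp (t * \<bar>x\<bar>))" using sgp[of x] by simp
        moreover have "norm (exp (t * \<bar>x\<bar>) * \<bar>\<rho> x\<bar>) = \<bar>r' x\<bar> * (sg x * exp (t * \<bar>x\<bar>))"
          using sgp[of x] by (simp add: \<rho>_def abs_mult)
        ultimately show "norm (exp (t * \<bar>x\<bar>) * \<bar>\<rho> x\<bar>) \<le> norm ((r' x)\<^sup>2 + std_normal_density x * exp (2 * t * \<bar>x\<bar>))"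
          unfolding real_norm_def[of "(r' x)\<^sup>2 + std_normal_density x * exp (2 * t * \<bar>x\<bar>)"] by linarith
      qed
    qed measurable
    show "(\<integral>x. \<rho> x * x ^ n \<partial>lborel) = 0" for n
    proof -
      have pm: "poly (monom 1 n) x = x ^ n" for x :: real by (simp add: poly_monom)
      have "r \<bullet> J (poly (monom 1 n)) = abs_L2 (rep_L2 r) \<bullet> abs_L2 (\<lambda>x. poly (monom 1 n) x * sg x)"
        by (simp add: abs_rep_L2 J_def)
      also have "\<dots> = (\<integral>x. rep_L2 r x \<bullet> (poly (monom 1 n) x * sg x) \<partial>lebesgue)"
        by (rule inner_L2.abs_eq) (use sqJ[OF good_poly] rep_L2_sqi in \<open>auto simp: L2_rel_def\<close>)
      also have "\<dots> = (\<integral>x. \<rho> x * x ^ n \<partial>lebesgue)"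
      proof (rule integral_cong_AE)
        show "AE x in lebesgue. rep_L2 r x \<bullet> (poly (monom 1 n) x * sg x) = \<rho> x * x ^ n"
          using rr'' by eventually_elim (simp add: \<rho>_def pm)
        show "(\<lambda>x. rep_L2 r x \<bullet> (poly (monom 1 n) x * sg x)) \<in> borel_measurable lebesgue"
          using rep_L2_sqi[of r] sqJ[OF good_poly[of "monom 1 n"]] unfolding square_integrable_def
          by (intro borel_measurable_inner) auto
        show "(\<lambda>x. \<rho> x * x ^ n) \<in> borel_measurable lebesgue" by (rule measurable_completion) measurable
      qed
      also have "\<dots> = (\<integral>x. \<rho> x * x ^ n \<partial>lborel)" by (rule integral_completion) measurable
      finally show ?thesis using orth by simp
    qed
  qed
  then have "AE x in lborel. rep_L2 r x = 0" using rr'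
  proof eventually_elim
    fix x assume "rep_L2 r x = r' x" "\<rho> x = 0"
    then show "rep_L2 r x = 0" using sgp[of x] by (auto simp: \<rho>_def)
  qed
  then have "AE x in lebesgue. rep_L2 r x = 0" by (rule AE_completion)
  then have "L2_rel (rep_L2 r) (\<lambda>x. 0)" by (simp add: L2_rel_def rep_L2_sqi sqi_zero)
  then have "r = 0" using Quotient3_rel_abs[OF Quotient3_L2, of "rep_L2 r" "\<lambda>x. 0"] by (simp add: abs_rep_L2 zero_L2.abs_eq)
  then have "f0 \<in> closure Q" using w(1) by (simp add: r_def)
  moreover have "sqrt \<epsilon> > 0" using \<epsilon> by simp
  ultimately obtain p where "dist (J (poly p)) f0 < sqrt \<epsilon>"
    unfolding closure_approachable Q_def by blast
  then have "norm (f0 - J (poly p)) < sqrt \<epsilon>" by (simp add: dist_norm norm_minus_commute)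
  then have "(norm (f0 - J (poly p)))\<^sup>2 < (sqrt \<epsilon>)\<^sup>2" by (intro power_strict_mono) auto
  then show ?thesis using \<epsilon> dist[OF good_ind good_poly[of p]] by (auto simp: f0_def)
qed

section \<open>Hermite polynomials with vector coefficients\<close>

definition hermite_span :: "nat set \<Rightarrow> ((nat \<Rightarrow> real) \<Rightarrow> 'h::{real_inner, banach, second_countable_topology}) set" where
  "hermite_span J = {P. \<exists>\<Lambda> c. finite \<Lambda> \<and> \<Lambda> \<subseteq> {\<nu>\<in>multi_indices. {j. \<nu> j \<noteq> 0} \<subseteq> J} \<and>
     P = (\<lambda>y. \<Sum>\<nu>\<in>\<Lambda>. hermite_multi \<nu> y *\<^sub>R c \<nu>)}"

lemma hermite_span_single:
  "\<nu> \<in> multi_indices \<Longrightarrow> {j. \<nu> j \<noteq> 0} \<subseteq> J \<Longrightarrow> (\<lambda>y. hermite_multi \<nu> y *\<^sub>R v) \<in> hermite_span J"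
  unfolding hermite_span_def by (intro CollectI exI[of _ "{\<nu>}"] exI[of _ "\<lambda>_. v"]) auto

lemma hermite_span_0: "(\<lambda>y. 0) \<in> hermite_span J"
  unfolding hermite_span_def by (intro CollectI exI[of _ "{}"]) auto

lemma hermite_span_add:
  assumes "P \<in> hermite_span J" "Q \<in> hermite_span J"
  shows "(\<lambda>y. P y + Q y) \<in> hermite_span J"
proof -
  obtain \<Lambda> c \<Lambda>' c' where P: "finite \<Lambda>" "\<Lambda> \<subseteq> {\<nu>\<in>multi_indices. {j. \<nu> j \<noteq> 0} \<subseteq> J}" "P = (\<lambda>y. \<Sum>\<nu>\<in>\<Lambda>. hermite_multi \<nu> y *\<^sub>R c \<nu>)"
    and Q: "finite \<Lambda>'" "\<Lambda>' \<subseteq> {\<nu>\<in>multi_indices. {j. \<nu> j \<noteq> 0} \<subseteq> J}" "Q = (\<lambda>y. \<Sum>\<nu>\<in>\<Lambda>'. hermite_multi \<nu> y *\<^sub>R c' \<nu>)"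
    using assms unfolding hermite_span_def by blast
  define d where "d \<nu> = (if \<nu> \<in> \<Lambda> then c \<nu> else 0) + (if \<nu> \<in> \<Lambda>' then c' \<nu> else 0)" for \<nu>
  have "P y + Q y = (\<Sum>\<nu>\<in>\<Lambda> \<union> \<Lambda>'. hermite_multi \<nu> y *\<^sub>R d \<nu>)" for y
  proof -
    have "P y = (\<Sum>\<nu>\<in>\<Lambda> \<union> \<Lambda>'. hermite_multi \<nu> y *\<^sub>R (if \<nu> \<in> \<Lambda> then c \<nu> else 0))"
      unfolding P(3) using P(1) Q(1) by (intro sum.mono_neutral_cong_left) auto
    moreover have "Q y = (\<Sum>\<nu>\<in>\<Lambda> \<union> \<Lambda>'. hermite_multi \<nu> y *\<^sub>R (if \<nu> \<in> \<Lambda>' then c' \<nu> else 0))"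
      unfolding Q(3) using P(1) Q(1) by (intro sum.mono_neutral_cong_left) auto
    ultimately show ?thesis by (simp only: d_def scaleR_add_right sum.distrib)
  qed
  then show ?thesis unfolding hermite_span_def using P(1,2) Q(1,2)
    by (intro CollectI exI[of _ "\<Lambda> \<union> \<Lambda>'"] exI[of _ d]) auto
qed

lemma hermite_span_sum: "(\<And>i. i \<in> S \<Longrightarrow> P i \<in> hermite_span J) \<Longrightarrow> (\<lambda>y. \<Sum>i\<in>S. P i y) \<in> hermite_span J"
  by (induction S rule: infinite_finite_induct) (auto intro: hermite_span_add hermite_span_0)

text \<open>Linearity in the value carries T through the finite sum, so single terms suffice. T may
  depend on y, as for multiplication by \<open>y j\<close>.\<close>

lemma hermite_span_induct:
  assumes P: "P \<in> hermite_span J"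
    and s: "\<And>\<nu> v. \<nu> \<in> multi_indices \<Longrightarrow> {j. \<nu> j \<noteq> 0} \<subseteq> J \<Longrightarrow> (\<lambda>y. T y (hermite_multi \<nu> y *\<^sub>R v)) \<in> hermite_span K"
    and T: "\<And>y. linear (T y)"
  shows "(\<lambda>y. T y (P y)) \<in> hermite_span K"
proof -
  obtain \<Lambda> c where L: "finite \<Lambda>" "\<Lambda> \<subseteq> {\<nu>\<in>multi_indices. {j. \<nu> j \<noteq> 0} \<subseteq> J}" "P = (\<lambda>y. \<Sum>\<nu>\<in>\<Lambda>. hermite_multi \<nu> y *\<^sub>R c \<nu>)"
    using P unfolding hermite_span_def by blast
  have "(\<lambda>y. T y (P y)) = (\<lambda>y. \<Sum>\<nu>\<in>\<Lambda>. T y (hermite_multi \<nu> y *\<^sub>R c \<nu>))"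
    unfolding L(3) by (intro ext linear_sum[OF T])
  also have "\<dots> \<in> hermite_span K" by (rule hermite_span_sum) (use L(2) in \<open>auto intro!: s\<close>)
  finally show ?thesis .
qed

lemma hermite_span_mono: "J \<subseteq> K \<Longrightarrow> P \<in> hermite_span J \<Longrightarrow> P \<in> hermite_span K"
  using hermite_span_induct[of P J "\<lambda>_ x. x" K] hermite_span_single[of _ K] linear_ident by blast

lemma hermite_span_scaleR: "P \<in> hermite_span J \<Longrightarrow> (\<lambda>y. r *\<^sub>R P y) \<in> hermite_span J"
proof (rule hermite_span_induct[where T = "\<lambda>_ x. r *\<^sub>R x"])
  show "(\<lambda>y. r *\<^sub>R (hermite_multi \<nu> y *\<^sub>R v)) \<in> hermite_span J" if "\<nu> \<in> multi_indices" "{j. \<nu> j \<noteq> 0} \<subseteq> J" for \<nu> and v :: 'a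
    using hermite_span_single[OF that, of "r *\<^sub>R v"] by (simp add: mult.commute)
qed (auto intro: linearI simp: scaleR_add_right)

lemma hermite_span_tensor:
  assumes "P \<in> hermite_span J"
  shows "(\<lambda>y. P y *\<^sub>R v) \<in> hermite_span J"
proof -
  obtain \<Lambda> c where L: "finite \<Lambda>" "\<Lambda> \<subseteq> {\<nu>\<in>multi_indices. {j. \<nu> j \<noteq> 0} \<subseteq> J}" "P = (\<lambda>y. \<Sum>\<nu>\<in>\<Lambda>. hermite_multi \<nu> y *\<^sub>R c \<nu>)"
    using assms unfolding hermite_span_def by blast
  have "(\<lambda>y. P y *\<^sub>R v) = (\<lambda>y. \<Sum>\<nu>\<in>\<Lambda>. hermite_multi \<nu> y *\<^sub>R (c \<nu> *\<^sub>R v))"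
    unfolding L(3) by (simp add: scaleR_sum_left)
  then show ?thesis unfolding hermite_span_def using L(1,2)
    by (intro CollectI exI[of _ \<Lambda>] exI[of _ "\<lambda>\<nu>. c \<nu> *\<^sub>R v"]) auto
qed

lemma hermite_span_sq_integrable: "P \<in> hermite_span J \<Longrightarrow> sq_integrable P"
proof -
  assume "P \<in> hermite_span J"
  then obtain \<Lambda> c where L: "\<Lambda> \<subseteq> multi_indices" "P = (\<lambda>y. \<Sum>\<nu>\<in>\<Lambda>. hermite_multi \<nu> y *\<^sub>R c \<nu>)"
    unfolding hermite_span_def by blast
  have "sq_integrable (\<lambda>y. hermite_multi \<nu> y *\<^sub>R c \<nu>)" if "\<nu> \<in> \<Lambda>" for \<nu>
    using sq_integrable_hermite[of \<nu>] that L(1) by (auto simp: sq_integrable_def power_mult_distrib)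
  then show ?thesis unfolding L(2) by (rule sq_integrable_sum)
qed

text \<open>The reason for recording the coordinates J in the span: a polynomial in these is
  constant in every other coordinate, which makes an error factorise in
  \<open>happrox_cylinder\<close>.\<close>

lemma hermite_span_upd:
  assumes "P \<in> hermite_span J" "j \<notin> J"
  shows "P (y(j := s)) = P y"
proof -
  obtain \<Lambda> c where L: "\<Lambda> \<subseteq> {\<nu>\<in>multi_indices. {j. \<nu> j \<noteq> 0} \<subseteq> J}" "P = (\<lambda>y. \<Sum>\<nu>\<in>\<Lambda>. hermite_multi \<nu> y *\<^sub>R c \<nu>)"
    using assms unfolding hermite_span_def by blast
  have "hermite_multi \<nu> (y(j := s)) = hermite_multi \<nu> y" if "\<nu> \<in> \<Lambda>" for \<nu>
    unfolding hermite_multi_def using that L(1) assms(2) by (intro prod.cong) auto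
  then show ?thesis unfolding L(2) by simp
qed

text \<open>The recurrence t H_n = sqrt(n+1) H_(n+1) + sqrt(n) H_(n-1) in coordinate j changes the
  index only at j, so its support stays in J.\<close>

lemma hermite_span_mult_var:
  fixes P :: "(nat \<Rightarrow> real) \<Rightarrow> real"
  assumes "P \<in> hermite_span J" "j \<in> J"
  shows "(\<lambda>y. y j * P y) \<in> hermite_span J"
proof (rule hermite_span_induct[OF assms(1), where T = "\<lambda>y x. y j * x"])
  fix \<nu> :: "nat \<Rightarrow> nat" and v :: real assume \<nu>: "\<nu> \<in> multi_indices" "{j. \<nu> j \<noteq> 0} \<subseteq> J"
  let ?n = "\<nu> j"
  have upd: "\<nu>(j := m) \<in> multi_indices" "{i. (\<nu>(j := m)) i \<noteq> 0} \<subseteq> J" for m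
    using \<nu> assms(2) by (auto simp: multi_indices_def intro: finite_subset[of _ "insert j {j. \<nu> j \<noteq> 0}"])
  have H: "hermite_multi (\<nu>(j := m)) y = hermite m (y j) * hermite_multi (\<nu>(j := 0)) y" for m y
    using hermite_multi_upd[OF upd(1)[of m], of y j "y j"] by simp
  have e: "y j * hermite_multi \<nu> y = sqrt (Suc ?n) * hermite_multi (\<nu>(j := Suc ?n)) y + sqrt ?n * hermite_multi (\<nu>(j := ?n - 1)) y" for y
  proof -
    have "y j * hermite_multi \<nu> y = (y j * hermite ?n (y j)) * hermite_multi (\<nu>(j := 0)) y"
      using H[of ?n y] by simp
    also have "y j * hermite ?n (y j) = sqrt (Suc ?n) * hermite (Suc ?n) (y j) + sqrt ?n * hermite (?n - 1) (y j)"
      using hermite_Suc[of ?n "y j"] by simp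
    finally show ?thesis unfolding H[of "Suc ?n"] H[of "?n - 1"] by (simp only: distrib_right mult.assoc)
  qed
  have "(\<lambda>y. hermite_multi (\<nu>(j := Suc ?n)) y *\<^sub>R (sqrt (Suc ?n) * v) + hermite_multi (\<nu>(j := ?n - 1)) y *\<^sub>R (sqrt ?n * v)) \<in> hermite_span J"
    by (intro hermite_span_add hermite_span_single upd)
  moreover have "y j * (hermite_multi \<nu> y *\<^sub>R v)
     = hermite_multi (\<nu>(j := Suc ?n)) y *\<^sub>R (sqrt (Suc ?n) * v) + hermite_multi (\<nu>(j := ?n - 1)) y *\<^sub>R (sqrt ?n * v)" for y
    using e[of y] by (simp add: algebra_simps flip: mult.assoc del: of_nat_Suc)
  ultimately show "(\<lambda>y. y j * (hermite_multi \<nu> y *\<^sub>R v)) \<in> hermite_span J" by (simp only:)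
qed (auto intro: linearI simp: algebra_simps)

lemma hermite_span_mult_poly:
  fixes P :: "(nat \<Rightarrow> real) \<Rightarrow> real"
  assumes "P \<in> hermite_span J" "j \<in> J"
  shows "(\<lambda>y. poly p (y j) * P y) \<in> hermite_span J"
proof (induction p rule: pCons_induct)
  case 0
  then show ?case by (simp add: hermite_span_0)
next
  case (pCons a p)
  have "(\<lambda>y. a *\<^sub>R P y + y j * (poly p (y j) * P y)) \<in> hermite_span J"
    by (intro hermite_span_add hermite_span_scaleR hermite_span_mult_var assms pCons)
  then show ?case by (simp add: algebra_simps)
qed

section \<open>Density of the Hermite polynomials\<close>

definition happrox :: "nat set \<Rightarrow> ((nat \<Rightarrow> real) \<Rightarrow> 'h::{real_inner, banach, second_countable_topology}) \<Rightarrow> bool" where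
  "happrox J F \<longleftrightarrow> sq_integrable F \<and> (\<forall>\<epsilon>>0. \<exists>P\<in>hermite_span J. (\<integral>y. (norm (F y - P y))\<^sup>2 \<partial>gaussian) < \<epsilon>)"

lemma integral_norm_add_sq_le:
  assumes F: "sq_integrable F" and G: "sq_integrable G"
  shows "(\<integral>y. (norm (F y + G y))\<^sup>2 \<partial>gaussian)
    \<le> 2 * (\<integral>y. (norm (F y))\<^sup>2 \<partial>gaussian) + 2 * (\<integral>y. (norm (G y))\<^sup>2 \<partial>gaussian)"
proof -
  have i: "integrable gaussian (\<lambda>y. (norm (F y))\<^sup>2)" "integrable gaussian (\<lambda>y. (norm (G y))\<^sup>2)" "integrable gaussian (\<lambda>y. (norm (F y + G y))\<^sup>2)"
    using F G sq_integrable_add[OF F G] by (auto simp: sq_integrable_def)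
  have "(\<integral>y. (norm (F y + G y))\<^sup>2 \<partial>gaussian) \<le> (\<integral>y. 2 * (norm (F y))\<^sup>2 + 2 * (norm (G y))\<^sup>2 \<partial>gaussian)"
  proof (rule integral_mono)
    fix y
    have "(norm (F y + G y))\<^sup>2 + (norm (F y - G y))\<^sup>2 = 2 * (norm (F y))\<^sup>2 + 2 * (norm (G y))\<^sup>2"
      by (simp add: power2_norm_eq_inner inner_add inner_diff inner_commute)
    then show "(norm (F y + G y))\<^sup>2 \<le> 2 * (norm (F y))\<^sup>2 + 2 * (norm (G y))\<^sup>2"
      using zero_le_power2[of "norm (F y - G y)"] by linarith
  qed (use i in auto)
  then show ?thesis using i by simp
qed

text \<open>The tolerance is split into quarters because |a + b|^2 \<le> 2 |a|^2 + 2 |b|^2. Density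
  is then built in stages: cylinders, measurable sets, simple functions, all square integrable
  functions.\<close>

lemma happrox_limit:
  assumes F: "sq_integrable F"
    and G: "\<And>\<epsilon>. \<epsilon> > 0 \<Longrightarrow> \<exists>G. happrox J G \<and> (\<integral>y. (norm (F y - G y))\<^sup>2 \<partial>gaussian) < \<epsilon>"
  shows "happrox J F"
  unfolding happrox_def
proof (intro conjI allI impI F)
  fix \<epsilon> :: real assume \<epsilon>: "\<epsilon> > 0"
  then obtain G where G1: "happrox J G" and G2: "(\<integral>y. (norm (F y - G y))\<^sup>2 \<partial>gaussian) < \<epsilon> / 4"
    using G[of "\<epsilon> / 4"] by auto
  have "\<forall>\<epsilon>>0. \<exists>P\<in>hermite_span J. (\<integral>y. (norm (G y - P y))\<^sup>2 \<partial>gaussian) < \<epsilon>" and sG: "sq_integrable G"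
    using G1 unfolding happrox_def by auto
  then obtain P where P: "P \<in> hermite_span J" "(\<integral>y. (norm (G y - P y))\<^sup>2 \<partial>gaussian) < \<epsilon> / 4"
    using \<epsilon> by (metis divide_pos_pos zero_less_numeral)
  have "(\<integral>y. (norm ((F y - G y) + (G y - P y)))\<^sup>2 \<partial>gaussian)
    \<le> 2 * (\<integral>y. (norm (F y - G y))\<^sup>2 \<partial>gaussian) + 2 * (\<integral>y. (norm (G y - P y))\<^sup>2 \<partial>gaussian)"
    by (intro integral_norm_add_sq_le sq_integrable_diff F sG hermite_span_sq_integrable[OF P(1)])
  then have "(\<integral>y. (norm (F y - P y))\<^sup>2 \<partial>gaussian) < \<epsilon>" using P(2) G2 by simp
  then show "\<exists>P\<in>hermite_span J. (\<integral>y. (norm (F y - P y))\<^sup>2 \<partial>gaussian) < \<epsilon>" using P(1) by blast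
qed

lemma happrox_add:
  assumes F: "happrox J F" and G: "happrox J G"
  shows "happrox J (\<lambda>y. F y + G y)"
  unfolding happrox_def
proof (intro conjI allI impI)
  have sF: "sq_integrable F" and sG: "sq_integrable G" using F G by (auto simp: happrox_def)
  then show "sq_integrable (\<lambda>y. F y + G y)" by (rule sq_integrable_add)
  fix \<epsilon> :: real assume "\<epsilon> > 0"
  then have \<epsilon>: "\<epsilon> / 4 > 0" by simp
  obtain P where P: "P \<in> hermite_span J" "(\<integral>y. (norm (F y - P y))\<^sup>2 \<partial>gaussian) < \<epsilon> / 4"
    using F \<epsilon> unfolding happrox_def by blast
  obtain Q where Q: "Q \<in> hermite_span J" "(\<integral>y. (norm (G y - Q y))\<^sup>2 \<partial>gaussian) < \<epsilon> / 4"
    using G \<epsilon> unfolding happrox_def by blast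
  have "(\<integral>y. (norm ((F y - P y) + (G y - Q y)))\<^sup>2 \<partial>gaussian)
    \<le> 2 * (\<integral>y. (norm (F y - P y))\<^sup>2 \<partial>gaussian) + 2 * (\<integral>y. (norm (G y - Q y))\<^sup>2 \<partial>gaussian)"
    by (intro integral_norm_add_sq_le sq_integrable_diff sF sG hermite_span_sq_integrable[OF P(1)] hermite_span_sq_integrable[OF Q(1)])
  then have "(\<integral>y. (norm (F y + G y - (P y + Q y)))\<^sup>2 \<partial>gaussian) < \<epsilon>" using P(2) Q(2) by (simp add: algebra_simps)
  then show "\<exists>P\<in>hermite_span J. (\<integral>y. (norm (F y + G y - P y))\<^sup>2 \<partial>gaussian) < \<epsilon>"
    by (rule bexI[OF _ hermite_span_add[OF P(1) Q(1)]])
qed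

lemma happrox_span: "P \<in> hermite_span J \<Longrightarrow> happrox J P"
  unfolding happrox_def using hermite_span_sq_integrable by (auto intro!: bexI[of _ P])

lemma happrox_sum: "(\<And>i. i \<in> S \<Longrightarrow> happrox J (F i)) \<Longrightarrow> happrox J (\<lambda>y. \<Sum>i\<in>S. F i y)"
  by (induction S rule: infinite_finite_induct) (auto intro: happrox_add happrox_span hermite_span_0)

lemma happrox_tensor:
  assumes F: "happrox J (F :: (nat \<Rightarrow> real) \<Rightarrow> real)"
  shows "happrox J (\<lambda>y. F y *\<^sub>R v)"
  unfolding happrox_def
proof (intro conjI allI impI)
  have "sq_integrable F" using F by (auto simp: happrox_def)
  then show "sq_integrable (\<lambda>y. F y *\<^sub>R v)" by (auto simp: sq_integrable_def power_mult_distrib)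
  fix \<epsilon> :: real assume \<epsilon>: "\<epsilon> > 0"
  define d where "d = \<epsilon> / ((norm v)\<^sup>2 + 1)"
  have vp: "(norm v)\<^sup>2 + 1 > 0" by (simp add: add_nonneg_pos)
  have d: "d > 0" using \<epsilon> vp by (simp add: d_def)
  then obtain P where P: "P \<in> hermite_span J" "(\<integral>y. (norm (F y - P y))\<^sup>2 \<partial>gaussian) < d"
    using F unfolding happrox_def by blast
  have "(\<integral>y. (norm (F y *\<^sub>R v - P y *\<^sub>R v))\<^sup>2 \<partial>gaussian) = (\<integral>y. (norm (F y - P y))\<^sup>2 * (norm v)\<^sup>2 \<partial>gaussian)"
    by (simp add: power_mult_distrib flip: scaleR_diff_left)
  also have "\<dots> = (\<integral>y. (norm (F y - P y))\<^sup>2 \<partial>gaussian) * (norm v)\<^sup>2" by simp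
  also have "\<dots> \<le> d * (norm v)\<^sup>2" using P(2) by (intro mult_right_mono) auto
  also have "\<dots> < d * ((norm v)\<^sup>2 + 1)" using d by simp
  also have "\<dots> = \<epsilon>" using vp by (simp add: d_def)
  finally show "\<exists>P\<in>hermite_span J. (\<integral>y. (norm (F y *\<^sub>R v - P y))\<^sup>2 \<partial>gaussian) < \<epsilon>"
    by (rule bexI[OF _ hermite_span_tensor[OF P(1)]])
qed

lemma sq_integrable_bounded:
  fixes F :: "(nat \<Rightarrow> real) \<Rightarrow> real"
  assumes [measurable]: "F \<in> borel_measurable gaussian" and "\<And>y. \<bar>F y\<bar> \<le> B"
  shows "sq_integrable F"
proof -
  interpret prob_space gaussian by (rule prob_space_gaussian)
  have "integrable gaussian (\<lambda>y. (norm (F y))\<^sup>2)"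
  proof (rule integrable_const_bound[where B = "B\<^sup>2"])
    show "AE y in gaussian. norm ((norm (F y))\<^sup>2) \<le> B\<^sup>2"
      using power_mono[OF assms(2) abs_ge_zero, where n = 2] by (intro AE_I2) simp
  qed measurable
  then show ?thesis by (simp add: sq_integrable_def)
qed

text \<open>Coordinates are added one at a time. A polynomial P for the earlier factors is fixed
  first; its squared norm K then sets the accuracy \<epsilon>/(4(K+1)) with which the new indicator
  is replaced by a univariate polynomial. As P is constant in the new coordinate, that error is an
  integral in one variable times K.\<close>

lemma happrox_cylinder:
  assumes "finite J" and E: "\<And>j. E j \<in> sets borel"
  shows "happrox J (\<lambda>y. \<Prod>j\<in>J. indicator (E j) (y j) :: real)"
  using assms(1)
proof (induction J rule: finite_induct)
  case empty
  have "(\<lambda>y. hermite_multi (\<lambda>_. 0) y *\<^sub>R (1::real)) \<in> hermite_span {}"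
    by (rule hermite_span_single) (auto simp: multi_indices_def)
  then show ?case by (intro happrox_span) (simp add: hermite_multi_def)
next
  case (insert j J)
  define F where "F y = (\<Prod>j\<in>J. indicator (E j) (y j) :: real)" for y
  have m1: "(\<lambda>y. indicator (E i) (y i) :: real) \<in> borel_measurable gaussian" for i
    using E by (intro measurable_compose[OF measurable_gaussian_component]) auto
  have Fm[measurable]: "F \<in> borel_measurable gaussian" unfolding F_def by (intro borel_measurable_prod m1)
  have F1: "\<bar>F y\<bar> \<le> 1" for y
    unfolding F_def by (simp add: abs_prod) (intro prod_le_1, auto simp: indicator_def)
  have eq: "(\<Prod>i\<in>insert j J. indicator (E i) (y i) :: real) = indicator (E j) (y j) * F y" for y
    using insert by (simp add: F_def)
  show ?case
    unfolding happrox_def eq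
  proof (intro conjI allI impI)
    show "sq_integrable (\<lambda>y. indicator (E j) (y j) * F y)"
      by (rule sq_integrable_bounded[where B = 1], intro borel_measurable_times m1 Fm)
        (use F1 in \<open>auto simp: indicator_def abs_mult\<close>)
    fix \<epsilon> :: real assume "\<epsilon> > 0"
    then obtain P where P: "P \<in> hermite_span J" "(\<integral>y. (norm (F y - P y))\<^sup>2 \<partial>gaussian) < \<epsilon> / 4"
      using insert.IH unfolding happrox_def F_def[symmetric] by (metis divide_pos_pos zero_less_numeral)
    have sP: "sq_integrable P" by (rule hermite_span_sq_integrable[OF P(1)])
    note [measurable] = sq_integrableD(1)[OF sP]
    define K where "K = (\<integral>y. (norm (P y))\<^sup>2 \<partial>gaussian)"
    have K: "K \<ge> 0" by (simp add: K_def)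
    have "\<epsilon> / (4 * (K + 1)) > 0" using K \<open>\<epsilon> > 0\<close> by simp
    then obtain p where p: "(\<integral>x. (indicator (E j) x - poly p x)\<^sup>2 \<partial>std_normal_distribution) < \<epsilon> / (4 * (K + 1))"
      using poly_dense_std_normal[OF E] by blast
    define Q where "Q y = poly p (y j) * P y" for y
    have "P \<in> hermite_span (insert j J)" by (rule hermite_span_mono[OF _ P(1)]) auto
    then have Q: "Q \<in> hermite_span (insert j J)"
      unfolding Q_def by (intro hermite_span_mult_poly) auto
    have sQ: "sq_integrable Q" by (rule hermite_span_sq_integrable[OF Q])
    have s1: "sq_integrable (\<lambda>y. indicator (E j) (y j) * P y)"
    proof -
      have "integrable gaussian (\<lambda>y. (norm (indicator (E j) (y j) * P y))\<^sup>2)"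
      proof (rule Bochner_Integration.integrable_bound[OF sq_integrableD(2)[OF sP]])
        show "(\<lambda>y. (norm (indicator (E j) (y j) * P y))\<^sup>2) \<in> borel_measurable gaussian"
          using m1[of j] by measurable
      qed (auto simp: indicator_def)
      moreover have "(\<lambda>y. indicator (E j) (y j) * P y) \<in> borel_measurable gaussian" using m1[of j] by measurable
      ultimately show ?thesis by (simp add: sq_integrable_def)
    qed
    have s2: "sq_integrable (\<lambda>y. indicator (E j) (y j) * (F y - P y))"
    proof -
      have sFP: "sq_integrable (\<lambda>y. F y - P y)"
        by (intro sq_integrable_diff sP sq_integrable_bounded[OF Fm F1])
      have "integrable gaussian (\<lambda>y. (norm (indicator (E j) (y j) * (F y - P y)))\<^sup>2)"
      proof (rule Bochner_Integration.integrable_bound[OF sq_integrableD(2)[OF sFP]])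
        show "(\<lambda>y. (norm (indicator (E j) (y j) * (F y - P y)))\<^sup>2) \<in> borel_measurable gaussian"
          using m1[of j] by measurable
      qed (auto simp: indicator_def)
      moreover have "(\<lambda>y. indicator (E j) (y j) * (F y - P y)) \<in> borel_measurable gaussian" using m1[of j] by measurable
      ultimately show ?thesis by (simp add: sq_integrable_def)
    qed
    have b2: "(\<integral>y. (norm (indicator (E j) (y j) * (F y - P y)))\<^sup>2 \<partial>gaussian) \<le> (\<integral>y. (norm (F y - P y))\<^sup>2 \<partial>gaussian)"
      by (rule integral_mono)
        (use s2 sq_integrable_diff[OF sq_integrable_bounded[OF Fm F1] sP] in \<open>auto simp: sq_integrable_def indicator_def\<close>)
    have b1: "(\<integral>y. (norm (indicator (E j) (y j) * P y - Q y))\<^sup>2 \<partial>gaussian)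
      = (\<integral>x. (indicator (E j) x - poly p x)\<^sup>2 \<partial>std_normal_distribution) * K"
    proof -
      have i: "integrable gaussian (\<lambda>y. (norm (indicator (E j) (y j) * P y - Q y))\<^sup>2)"
        using sq_integrable_diff[OF s1 sQ] by (simp add: sq_integrable_def)
      have e: "(norm (indicator (E j) ((y(j := s)) j) * P (y(j := s)) - Q (y(j := s))))\<^sup>2
        = (indicator (E j) s - poly p s)\<^sup>2 * (norm (P y))\<^sup>2" for y s
        unfolding Q_def hermite_span_upd[OF P(1) insert(2)]
        by (simp add: left_diff_distrib[symmetric] power_mult_distrib)
      show ?thesis unfolding integral_gaussian_upd(1)[OF i, of j] e by (simp add: K_def)
    qed
    have "(\<integral>y. (norm (indicator (E j) (y j) * (F y - P y) + (indicator (E j) (y j) * P y - Q y)))\<^sup>2 \<partial>gaussian)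
      \<le> 2 * (\<integral>y. (norm (indicator (E j) (y j) * (F y - P y)))\<^sup>2 \<partial>gaussian) + 2 * (\<integral>y. (norm (indicator (E j) (y j) * P y - Q y))\<^sup>2 \<partial>gaussian)"
      by (intro integral_norm_add_sq_le s2 sq_integrable_diff s1 sQ)
    also have "\<dots> < \<epsilon>"
    proof -
      have "(\<integral>x. (indicator (E j) x - poly p x)\<^sup>2 \<partial>std_normal_distribution) * K \<le> \<epsilon> / (4 * (K + 1)) * K"
        using p K by (intro mult_right_mono) auto
      also have "\<dots> \<le> \<epsilon> / (4 * (K + 1)) * (K + 1)" using \<open>\<epsilon> / (4 * (K + 1)) > 0\<close> by (intro mult_left_mono) auto
      also have "\<dots> = \<epsilon> / 4"
      proof -
        have "\<epsilon> / (4 * L) * L = \<epsilon> / 4" if "L > 0" for L using that by simp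
        then show ?thesis using K by (meson add_nonneg_pos zero_less_one)
      qed
      finally show ?thesis using b1 b2 P(2) by linarith
    qed
    finally have "(\<integral>y. (norm (indicator (E j) (y j) * F y - Q y))\<^sup>2 \<partial>gaussian) < \<epsilon>" by (simp add: algebra_simps)
    then show "\<exists>P\<in>hermite_span (insert j J). (\<integral>y. (norm (indicator (E j) (y j) * F y - P y))\<^sup>2 \<partial>gaussian) < \<epsilon>"
      using Q by blast
  qed
qed

lemma happrox_mono: "J \<subseteq> K \<Longrightarrow> happrox J F \<Longrightarrow> happrox K F"
  unfolding happrox_def using hermite_span_mono by blast

text \<open>Dynkin's argument: cylinders form an intersection-stable generator, and approximability
  passes to complements and to countable disjoint unions, the latter by dominated convergence of the
  finite unions.\<close>

lemma happrox_indicator: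
  assumes "A \<in> sets gaussian"
  shows "happrox UNIV (indicator A :: (nat \<Rightarrow> real) \<Rightarrow> real)"
proof -
  let ?G = "prod_algebra UNIV (\<lambda>_. borel :: real measure)"
  interpret prob_space gaussian by (rule prob_space_gaussian)
  have sG: "sets gaussian = sigma_sets UNIV ?G"
    unfolding sets_gaussian sets_PiM by (simp add: PiE_UNIV_domain)
  have sqi: "sq_integrable (indicator B :: (nat \<Rightarrow> real) \<Rightarrow> real)" if "B \<in> sets gaussian" for B
    by (rule sq_integrable_bounded[where B = 1]) (use that in \<open>auto simp: indicator_def\<close>)
  have "A \<in> sigma_sets UNIV ?G" using assms sG by simp
  have IS: "Int_stable ?G" by (rule Int_stable_prod_algebra)
  have sub: "?G \<subseteq> Pow UNIV" by simp
  from IS sub \<open>A \<in> sigma_sets UNIV ?G\<close>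
  show ?thesis
  proof (induction rule: sigma_sets_induct_disjoint)
    case (basic A)
    then obtain J E where J: "A = prod_emb UNIV (\<lambda>_. borel :: real measure) J (Pi\<^sub>E J E)" "finite J" "\<And>i. i \<in> J \<Longrightarrow> E i \<in> sets borel"
      by (elim prod_algebraE) auto
    define E' where "E' j = (if j \<in> J then E j else UNIV)" for j
    have "indicator A = (\<lambda>y. \<Prod>j\<in>J. indicator (E' j) (y j) :: real)"
    proof
      fix y :: "nat \<Rightarrow> real"
      have yA: "y \<in> A \<longleftrightarrow> (\<forall>j\<in>J. y j \<in> E j)" unfolding J(1) by (auto simp: prod_emb_def PiE_iff)
      show "indicator A y = (\<Prod>j\<in>J. indicator (E' j) (y j) :: real)"
      proof (cases "y \<in> A")
        case True
        then show ?thesis using yA by (simp add: E'_def)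
      next
        case False
        then obtain j where "j \<in> J" "y j \<notin> E j" using yA by blast
        then have "(\<Prod>j\<in>J. indicator (E' j) (y j) :: real) = 0"
          using J(2) by (intro prod_zero) (auto simp: E'_def intro!: bexI[of _ j])
        then show ?thesis using False by simp
      qed
    qed
    moreover have "happrox J (\<lambda>y. \<Prod>j\<in>J. indicator (E' j) (y j) :: real)"
      by (rule happrox_cylinder[OF J(2)]) (use J(3) in \<open>auto simp: E'_def\<close>)
    ultimately show ?case using happrox_mono[of J UNIV] by simp
  next
    case empty
    show ?case using happrox_span[OF hermite_span_0] by (simp add: indicator_def[abs_def])
  next
    case (compl A)
    have "(\<lambda>y. hermite_multi (\<lambda>_. 0) y *\<^sub>R (1::real)) \<in> hermite_span UNIV"
      by (rule hermite_span_single) (auto simp: multi_indices_def)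
    then have "happrox UNIV (\<lambda>y. 1 + indicator A y *\<^sub>R (- 1 :: real))"
      by (intro happrox_add happrox_tensor compl happrox_span) (simp add: hermite_multi_def)
    moreover have "(\<lambda>y. 1 + indicator A y *\<^sub>R (- 1 :: real)) = indicator (UNIV - A)" by (auto simp: indicator_def)
    ultimately show ?case by simp
  next
    case (union A)
    have As: "A i \<in> sets gaussian" for i using union(2) sG by auto
    let ?U = "\<Union>i. A i"
    have Us: "?U \<in> sets gaussian" using As by auto
    define S where "S n y = (\<Sum>i<n. indicator (A i) y :: real)" for n :: nat and y
    have S_eq: "S n y = indicator (\<Union>i<n. A i) y" for n y
      unfolding S_def using union(1)
      by (subst indicator_UN_disjoint) (auto intro: disjoint_family_on_mono)
    have S1: "norm ((norm (indicator ?U y - S n y))\<^sup>2) \<le> 1" for n y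
      unfolding S_eq by (auto simp: indicator_def)
    have [measurable]: "S n \<in> borel_measurable gaussian" for n unfolding S_def using As by measurable
    have "(\<lambda>n. \<integral>y. (norm (indicator ?U y - S n y))\<^sup>2 \<partial>gaussian) \<longlonglongrightarrow> (\<integral>y. 0 \<partial>gaussian)"
    proof (rule integral_dominated_convergence[where w = "\<lambda>_. 1"])
      show "(\<lambda>y. (norm (indicator ?U y - S n y))\<^sup>2) \<in> borel_measurable gaussian" for n using Us by measurable
      show "AE y in gaussian. (\<lambda>n. (norm (indicator ?U y - S n y))\<^sup>2) \<longlonglongrightarrow> 0"
      proof (rule AE_I2)
        fix y
        have "\<forall>\<^sub>F n in sequentially. (norm (indicator ?U y - S n y))\<^sup>2 = 0"
        proof (cases "y \<in> ?U")
          case True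
          then obtain i where i: "y \<in> A i" by blast
          show ?thesis
            using eventually_gt_at_top[of i]
          proof eventually_elim
            fix n assume "i < n"
            then have "y \<in> (\<Union>i<n. A i)" using i by auto
            then show "(norm (indicator ?U y - S n y))\<^sup>2 = 0" using True unfolding S_eq by simp
          qed
        next
          case False
          then show ?thesis unfolding S_eq by (intro always_eventually allI) auto
        qed
        then show "(\<lambda>n. (norm (indicator ?U y - S n y))\<^sup>2) \<longlonglongrightarrow> 0" by (rule tendsto_eventually)
      qed
    qed (use S1 in auto)
    then have lim: "(\<lambda>n. \<integral>y. (norm (indicator ?U y - S n y))\<^sup>2 \<partial>gaussian) \<longlonglongrightarrow> 0" by simp
    show ?case
    proof (rule happrox_limit[OF sqi[OF Us]])
      fix \<epsilon> :: real assume "\<epsilon> > 0"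
      then have "\<forall>\<^sub>F n in sequentially. (\<integral>y. (norm (indicator ?U y - S n y))\<^sup>2 \<partial>gaussian) < \<epsilon>"
        using lim order_tendstoD(2) by blast
      then obtain n where n: "(\<integral>y. (norm (indicator ?U y - S n y))\<^sup>2 \<partial>gaussian) < \<epsilon>"
        using eventually_happens'[OF sequentially_bot] by blast
      have "happrox UNIV (S n)" unfolding S_def[abs_def] by (intro happrox_sum union)
      then show "\<exists>G. happrox UNIV G \<and> (\<integral>y. (norm (indicator ?U y - G y :: real))\<^sup>2 \<partial>gaussian) < \<epsilon>"
        using n by (intro exI[of _ "S n"] conjI)
    qed
  qed
qed

lemma happrox_sq_integrable:
  fixes F :: "(nat \<Rightarrow> real) \<Rightarrow> 'h::{real_inner, banach, second_countable_topology}"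
  assumes F: "sq_integrable F"
  shows "happrox UNIV F"
proof -
  have Fm[measurable]: "F \<in> borel_measurable gaussian" using F by (simp add: sq_integrable_def)
  obtain s where s: "\<And>i. simple_function gaussian (s i)" "\<And>y. y \<in> space gaussian \<Longrightarrow> (\<lambda>i. s i y) \<longlonglongrightarrow> F y"
      "\<And>i y. y \<in> space gaussian \<Longrightarrow> dist (s i y) 0 \<le> 2 * dist (F y) 0"
    using borel_measurable_implies_sequence_metric[OF Fm, of 0] by auto
  have [measurable]: "s i \<in> borel_measurable gaussian" for i using s(1) by (rule borel_measurable_simple_function)
  have simp: "happrox UNIV (s i)" for i
  proof -
    have fin: "finite (range (s i))" using s(1)[of i] by (simp add: simple_function_def)
    have "happrox UNIV (\<lambda>y. \<Sum>v\<in>range (s i). indicator (s i -` {v}) y *\<^sub>R v)"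
    proof (intro happrox_sum happrox_tensor happrox_indicator)
      fix v assume "v \<in> range (s i)"
      then show "s i -` {v} \<in> sets gaussian" using s(1)[of i] by (auto simp: simple_function_def)
    qed
    moreover have "(\<Sum>v\<in>range (s i). indicator (s i -` {v}) y *\<^sub>R v) = s i y" for y
    proof -
      have "(\<Sum>v\<in>range (s i). indicator (s i -` {v}) y *\<^sub>R v) = (\<Sum>v\<in>range (s i). if v = s i y then v else 0)"
        by (intro sum.cong) (auto simp: indicator_def)
      then show ?thesis using fin by simp
    qed
    ultimately show ?thesis by simp
  qed
  \<comment> \<open>From |s_i| \<le> 2 |F|; this dominates the squared error.\<close>
  have b: "(norm (F y - s i y))\<^sup>2 \<le> 9 * (norm (F y))\<^sup>2" for i y
  proof -
    have "norm (s i y) \<le> 2 * norm (F y)" using s(3)[of y i] by simp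
    then have "norm (F y - s i y) \<le> 3 * norm (F y)" using norm_triangle_ineq4[of "F y" "s i y"] by linarith
    then have "(norm (F y - s i y))\<^sup>2 \<le> (3 * norm (F y))\<^sup>2" by (intro power_mono) auto
    then show ?thesis by (simp add: power_mult_distrib)
  qed
  have "(\<lambda>i. \<integral>y. (norm (F y - s i y))\<^sup>2 \<partial>gaussian) \<longlonglongrightarrow> (\<integral>y. 0 \<partial>gaussian)"
  proof (rule integral_dominated_convergence[where w = "\<lambda>y. 9 * (norm (F y))\<^sup>2"])
    show "AE y in gaussian. (\<lambda>i. (norm (F y - s i y))\<^sup>2) \<longlonglongrightarrow> 0"
    proof (rule AE_I2)
      fix y
      have "(\<lambda>i. (norm (F y - s i y))\<^sup>2) \<longlonglongrightarrow> (norm (F y - F y))\<^sup>2" by (intro tendsto_intros s) simp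
      then show "(\<lambda>i. (norm (F y - s i y))\<^sup>2) \<longlonglongrightarrow> 0" by simp
    qed
    show "integrable gaussian (\<lambda>y. 9 * (norm (F y))\<^sup>2)" using F by (simp add: sq_integrable_def)
  qed (use b in auto)
  then have lim: "(\<lambda>i. \<integral>y. (norm (F y - s i y))\<^sup>2 \<partial>gaussian) \<longlonglongrightarrow> 0" by simp
  show ?thesis
  proof (rule happrox_limit[OF F])
    fix \<epsilon> :: real assume "\<epsilon> > 0"
    then have "\<forall>\<^sub>F n in sequentially. (\<integral>y. (norm (F y - s n y))\<^sup>2 \<partial>gaussian) < \<epsilon>"
      using lim order_tendstoD(2) by blast
    then obtain n where "(\<integral>y. (norm (F y - s n y))\<^sup>2 \<partial>gaussian) < \<epsilon>"
      using eventually_happens'[OF sequentially_bot] by blast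
    then show "\<exists>G. happrox UNIV G \<and> (\<integral>y. (norm (F y - G y))\<^sup>2 \<partial>gaussian) < \<epsilon>" using simp by blast
  qed
qed

text \<open>Completeness in the form in which it is applied: the Hermite sum over \<Lambda> is at
  least as close to F as any polynomial with the same indices, in particular the approximating
  P.\<close>

lemma hermite_parseval:
  assumes F: "sq_integrable F" and \<epsilon>: "\<epsilon> > 0"
  shows "\<exists>\<Lambda>. finite \<Lambda> \<and> \<Lambda> \<subseteq> multi_indices \<and>
    (\<integral>y. (norm (F y))\<^sup>2 \<partial>gaussian) - (\<Sum>\<nu>\<in>\<Lambda>. (norm (hcoeff F \<nu>))\<^sup>2) < \<epsilon>"
proof -
  obtain P where P: "P \<in> hermite_span UNIV" "(\<integral>y. (norm (F y - P y))\<^sup>2 \<partial>gaussian) < \<epsilon>"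
    using happrox_sq_integrable[OF F] \<epsilon> unfolding happrox_def by blast
  obtain \<Lambda> c where L: "finite \<Lambda>" "\<Lambda> \<subseteq> multi_indices" "P = (\<lambda>y. \<Sum>\<nu>\<in>\<Lambda>. hermite_multi \<nu> y *\<^sub>R c \<nu>)"
    using P(1) unfolding hermite_span_def by blast
  show ?thesis using hermite_best_approximation[OF F L(1,2), of c] P(2) L by (intro exI[of _ \<Lambda>]) auto
qed

section \<open>Best approximation by finitely many terms\<close>

lemma infinite_multi_indices: "infinite multi_indices"
proof -
  have "inj (\<lambda>n. (\<lambda>_. 0)(0 := n) :: nat \<Rightarrow> nat)" by (rule injI) (metis fun_upd_same)
  moreover have "range (\<lambda>n. (\<lambda>_. 0)(0 := n)) \<subseteq> multi_indices"
    by (auto simp: multi_indices_def intro: finite_subset[of _ "{0}"])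
  ultimately show ?thesis using finite_subset infinite_UNIV_nat range_inj_infinite by blast
qed

text \<open>By counting: each member of a finite subset contributes at least d to the sum.\<close>

lemma summable_powr_finite_level:
  fixes c :: "(nat \<Rightarrow> nat) \<Rightarrow> real"
  assumes s: "(\<lambda>\<nu>. c \<nu> powr p) summable_on multi_indices" and d: "d > 0"
  shows "finite {\<nu>\<in>multi_indices. d \<le> c \<nu> powr p}"
proof -
  let ?S = "infsum (\<lambda>\<nu>. c \<nu> powr p) multi_indices"
  have "finite {\<nu>\<in>multi_indices. d \<le> c \<nu> powr p} \<and> card {\<nu>\<in>multi_indices. d \<le> c \<nu> powr p} \<le> nat \<lceil>?S / d\<rceil>"
  proof (rule finite_if_finite_subsets_card_bdd)
    fix G assume G: "G \<subseteq> {\<nu>\<in>multi_indices. d \<le> c \<nu> powr p}" "finite G"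
    have "real (card G) * d = (\<Sum>\<nu>\<in>G. d)" by simp
    also have "\<dots> \<le> (\<Sum>\<nu>\<in>G. c \<nu> powr p)" using G by (intro sum_mono) auto
    also have "\<dots> \<le> ?S" using G by (intro finite_sum_le_infsum s) auto
    finally have "real (card G) \<le> ?S / d" using d by (simp add: field_simps)
    then show "card G \<le> nat \<lceil>?S / d\<rceil>" by linarith
  qed
  then show ?thesis by blast
qed

text \<open>Greedy choice. A largest remaining coefficient exists because only finitely many reach a
  given positive level; if all the remaining ones vanish, any of the infinitely many indices left
  serves.\<close>

lemma n_largest_exists:
  fixes c :: "(nat \<Rightarrow> nat) \<Rightarrow> real"
  assumes s: "(\<lambda>\<nu>. c \<nu> powr p) summable_on multi_indices" and p: "p > 0" and c: "\<And>\<nu>. 0 \<le> c \<nu>"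
  shows "\<exists>\<Lambda>. n_largest c n \<Lambda>"
proof (induction n)
  case 0
  show ?case by (intro exI[of _ "{}"]) (simp add: n_largest_def)
next
  case (Suc n)
  then obtain \<Lambda> where L: "n_largest c n \<Lambda>" by blast
  let ?R = "multi_indices - \<Lambda>"
  have "finite \<Lambda>" using L by (simp add: n_largest_def)
  then have "infinite ?R" using infinite_multi_indices by (rule Diff_infinite_finite)
  then obtain \<nu>2 where \<nu>2: "\<nu>2 \<in> ?R" using infinite_imp_nonempty by blast
  have "\<exists>\<nu>0\<in>?R. \<forall>\<mu>\<in>?R. c \<mu> \<le> c \<nu>0"
  proof (cases "\<forall>\<nu>\<in>?R. c \<nu> = 0")
    case True
    then show ?thesis using \<nu>2 by (intro bexI[of _ \<nu>2]) auto
  next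
    case False
    then obtain \<nu>1 where \<nu>1: "\<nu>1 \<in> ?R" "c \<nu>1 > 0" using c by (metis less_eq_real_def)
    define M where "M = {\<nu>\<in>?R. c \<nu>1 \<le> c \<nu>}"
    have "M \<subseteq> {\<nu>\<in>multi_indices. c \<nu>1 powr p \<le> c \<nu> powr p}"
      using p \<nu>1(2) by (auto simp: M_def intro: powr_mono2)
    then have fM: "finite M" using summable_powr_finite_level[OF s, of "c \<nu>1 powr p"] \<nu>1(2) finite_subset by auto
    have "\<nu>1 \<in> M" using \<nu>1 by (simp add: M_def)
    then have "Max (c ` M) \<in> c ` M" using fM by (intro Max_in) auto
    then obtain \<nu>0 where \<nu>0: "\<nu>0 \<in> M" "c \<nu>0 = Max (c ` M)" by auto
    have "c \<mu> \<le> c \<nu>0" if "\<mu> \<in> ?R" for \<mu>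
    proof (cases "\<mu> \<in> M")
      case True
      then show ?thesis using fM \<nu>0(2) by simp
    next
      case False
      then have "c \<mu> \<le> c \<nu>1" using that by (simp add: M_def)
      also have "\<dots> \<le> c \<nu>0" using \<nu>0(1) by (simp add: M_def)
      finally show ?thesis .
    qed
    then show ?thesis using \<nu>0(1) by (intro bexI[of _ \<nu>0]) (auto simp: M_def)
  qed
  then obtain \<nu>0 where \<nu>0: "\<nu>0 \<in> ?R" "\<And>\<mu>. \<mu> \<in> ?R \<Longrightarrow> c \<mu> \<le> c \<nu>0" by blast
  have "n_largest c (Suc n) (insert \<nu>0 \<Lambda>)"
    using L \<nu>0 unfolding n_largest_def by auto
  then show ?case by blast
qed

text \<open>Stechkin's estimate: a coefficient outside \<Lambda> is dominated by n others, so its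
  p-th power is at most S/n, and c^2 = c^(2-p) c^p gains the factor (S/n)^((2-p)/p). Parseval, up to
  \<epsilon>, identifies the error with the sum over the tail.\<close>

lemma best_n_term_error:
  fixes F :: "(nat \<Rightarrow> real) \<Rightarrow> 'h::{real_inner, banach, second_countable_topology}"
  assumes F: "sq_integrable F" and p: "0 < p" "p < 2"
    and s: "(\<lambda>\<nu>. norm (hcoeff F \<nu>) powr p) summable_on multi_indices"
    and n: "n \<ge> 1" and L: "n_largest (\<lambda>\<nu>. norm (hcoeff F \<nu>)) n \<Lambda>"
  defines "S \<equiv> infsum (\<lambda>\<nu>. norm (hcoeff F \<nu>) powr p) multi_indices"
  shows "(\<integral>y. (norm (F y - (\<Sum>\<nu>\<in>\<Lambda>. hermite_multi \<nu> y *\<^sub>R hcoeff F \<nu>)))\<^sup>2 \<partial>gaussian)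
    \<le> (S / real n) powr ((2 - p) / p) * S"
proof -
  define c where "c \<nu> = norm (hcoeff F \<nu>)" for \<nu>
  have S_ge: "(\<Sum>\<nu>\<in>G. c \<nu> powr p) \<le> S" if "finite G" "G \<subseteq> multi_indices" for G
    unfolding S_def c_def using that by (intro finite_sum_le_infsum s) auto
  have \<Lambda>: "finite \<Lambda>" "\<Lambda> \<subseteq> multi_indices" "card \<Lambda> = n" and big: "\<And>\<nu> \<mu>. \<nu> \<in> \<Lambda> \<Longrightarrow> \<mu> \<in> multi_indices - \<Lambda> \<Longrightarrow> c \<mu> \<le> c \<nu>"
    using L unfolding n_largest_def c_def by auto
  define a where "a = (2 - p) / p"
  have a: "a > 0" using p by (simp add: a_def)
  have small: "(c \<mu>)\<^sup>2 \<le> (S / real n) powr a * c \<mu> powr p" if \<mu>: "\<mu> \<in> multi_indices - \<Lambda>" for \<mu>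
  proof (cases "c \<mu> = 0")
    case False
    then have pos: "c \<mu> > 0" by (simp add: c_def)
    have "real n * c \<mu> powr p = (\<Sum>\<nu>\<in>\<Lambda>. c \<mu> powr p)" using \<Lambda>(3) by simp
    also have "\<dots> \<le> (\<Sum>\<nu>\<in>\<Lambda>. c \<nu> powr p)" using big[OF _ \<mu>] pos p by (intro sum_mono powr_mono2) auto
    also have "\<dots> \<le> S" by (rule S_ge[OF \<Lambda>(1,2)])
    finally have "c \<mu> powr p \<le> S / real n" using n by (simp add: field_simps)
    then have "(c \<mu> powr p) powr a \<le> (S / real n) powr a" using a by (intro powr_mono2) auto
    then have "c \<mu> powr (2 - p) \<le> (S / real n) powr a" using p by (simp add: powr_powr a_def)
    then have "c \<mu> powr (2 - p) * c \<mu> powr p \<le> (S / real n) powr a * c \<mu> powr p" by (rule mult_right_mono) simp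
    also have "c \<mu> powr (2 - p) * c \<mu> powr p = (c \<mu>)\<^sup>2" using pos by (simp add: powr_numeral flip: powr_add)
    finally show ?thesis .
  qed simp
  let ?err = "\<integral>y. (norm (F y - (\<Sum>\<nu>\<in>\<Lambda>. hermite_multi \<nu> y *\<^sub>R hcoeff F \<nu>)))\<^sup>2 \<partial>gaussian"
  let ?N = "\<integral>y. (norm (F y))\<^sup>2 \<partial>gaussian"
  have err: "?err = ?N - (\<Sum>\<nu>\<in>\<Lambda>. (c \<nu>)\<^sup>2)" unfolding c_def by (rule hermite_bessel_error[OF F \<Lambda>(1,2)])
  have "?err \<le> (S / real n) powr a * S"
  proof (rule field_le_epsilon)
    fix \<epsilon> :: real assume "\<epsilon> > 0"
    from hermite_parseval[OF F this] obtain \<Lambda>0 where \<Lambda>0: "finite \<Lambda>0" "\<Lambda>0 \<subseteq> multi_indices" "?N - (\<Sum>\<nu>\<in>\<Lambda>0. (c \<nu>)\<^sup>2) < \<epsilon>"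
      unfolding c_def by blast
    have "(\<Sum>\<nu>\<in>\<Lambda>0. (c \<nu>)\<^sup>2) \<le> (\<Sum>\<nu>\<in>\<Lambda> \<union> (\<Lambda>0 - \<Lambda>). (c \<nu>)\<^sup>2)"
      by (rule sum_mono2) (use \<Lambda> \<Lambda>0 in auto)
    also have "\<dots> = (\<Sum>\<nu>\<in>\<Lambda>. (c \<nu>)\<^sup>2) + (\<Sum>\<nu>\<in>\<Lambda>0 - \<Lambda>. (c \<nu>)\<^sup>2)"
      by (rule sum.union_disjoint) (use \<Lambda> \<Lambda>0 in auto)
    also have "(\<Sum>\<nu>\<in>\<Lambda>0 - \<Lambda>. (c \<nu>)\<^sup>2) \<le> (\<Sum>\<nu>\<in>\<Lambda>0 - \<Lambda>. (S / real n) powr a * c \<nu> powr p)"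
      by (intro sum_mono small) (use \<Lambda>0 in auto)
    also have "\<dots> = (S / real n) powr a * (\<Sum>\<nu>\<in>\<Lambda>0 - \<Lambda>. c \<nu> powr p)" by (simp add: sum_distrib_left)
    also have "\<dots> \<le> (S / real n) powr a * S" by (intro mult_left_mono S_ge) (use \<Lambda>0 in auto)
    finally show "?err \<le> (S / real n) powr a * S + \<epsilon>" using \<Lambda>0(3) err by linarith
  qed
  then show ?thesis by (simp add: a_def)
qed

section \<open>Summability from weighted square summability\<close>

text \<open>Young's inequality \<open>c\<^sup>p \<le> b c\<^sup>2 + b\<^sup>-\<^sup>t\<close> takes the place of Hoelder's.\<close>

lemma summable_powr_from_weights:
  fixes c b :: "'i \<Rightarrow> real"
  assumes p: "0 < p" "p < 2" and c: "\<And>\<nu>. 0 \<le> c \<nu>" and b: "\<And>\<nu>. \<nu> \<in> I \<Longrightarrow> 0 < b \<nu>"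
    and A: "\<And>\<Lambda>. finite \<Lambda> \<Longrightarrow> \<Lambda> \<subseteq> I \<Longrightarrow> (\<Sum>\<nu>\<in>\<Lambda>. b \<nu> * (c \<nu>)\<^sup>2) \<le> A"
    and B: "\<And>\<Lambda>. finite \<Lambda> \<Longrightarrow> \<Lambda> \<subseteq> I \<Longrightarrow> (\<Sum>\<nu>\<in>\<Lambda>. b \<nu> powr (- (p / (2 - p)))) \<le> B"
  shows "(\<lambda>\<nu>. c \<nu> powr p) summable_on I"
proof (rule nonneg_bdd_above_summable_on)
  show "bdd_above (sum (\<lambda>\<nu>. c \<nu> powr p) ` {F. F \<subseteq> I \<and> finite F})"
  proof (rule bdd_aboveI2)
    fix \<Lambda> assume L: "\<Lambda> \<in> {F. F \<subseteq> I \<and> finite F}"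
    \<comment> \<open>Chosen so that -t (1 - p/2) = -p/2: in the geometric mean of b c^2 and b^(-t)
      with weights p/2 and 1 - p/2 the powers of b cancel.\<close>
    define t where "t = p / (2 - p)"
    have pt: "c \<nu> powr p \<le> b \<nu> * (c \<nu>)\<^sup>2 + b \<nu> powr (- t)" if "\<nu> \<in> \<Lambda>" for \<nu>
    proof (cases "c \<nu> = 0")
      case False
      have cp: "c \<nu> > 0" using False c[of \<nu>] by simp
      have bp: "b \<nu> > 0" using b L that by auto
      have "- t * (1 - p / 2) = - (p / 2)" using p by (simp add: t_def field_simps)
      then have "(b \<nu> powr (- t)) powr (1 - p / 2) = b \<nu> powr (- (p / 2))" by (simp only: powr_powr)
      moreover have "(b \<nu> * (c \<nu>)\<^sup>2) powr (p / 2) = b \<nu> powr (p / 2) * c \<nu> powr p"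
      proof -
        have "(b \<nu> * (c \<nu>)\<^sup>2) powr (p / 2) = b \<nu> powr (p / 2) * ((c \<nu>)\<^sup>2) powr (p / 2)"
          using bp cp by (simp add: powr_mult)
        also have "((c \<nu>)\<^sup>2) powr (p / 2) = (c \<nu> powr 2) powr (p / 2)" using cp by (simp add: powr_numeral)
        finally show ?thesis by (simp add: powr_powr)
      qed
      ultimately have "(b \<nu> * (c \<nu>)\<^sup>2) powr (p / 2) * (b \<nu> powr (- t)) powr (1 - p / 2) = c \<nu> powr p"
        using bp by (simp add: powr_minus field_simps)
      moreover have "(b \<nu> * (c \<nu>)\<^sup>2) powr (p / 2) * (b \<nu> powr (- t)) powr (1 - p / 2)
        \<le> p / 2 * (b \<nu> * (c \<nu>)\<^sup>2) + (1 - p / 2) * b \<nu> powr (- t)"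
        by (rule Youngs_inequality_0) (use p bp cp in auto)
      moreover have "p / 2 * (b \<nu> * (c \<nu>)\<^sup>2) \<le> 1 * (b \<nu> * (c \<nu>)\<^sup>2)" using p bp by (intro mult_right_mono) auto
      moreover have "(1 - p / 2) * b \<nu> powr (- t) \<le> 1 * b \<nu> powr (- t)" using p by (intro mult_right_mono) auto
      ultimately show ?thesis by linarith
    qed (use p in \<open>simp add: order_less_imp_le\<close>)
    have "(\<Sum>\<nu>\<in>\<Lambda>. c \<nu> powr p) \<le> (\<Sum>\<nu>\<in>\<Lambda>. b \<nu> * (c \<nu>)\<^sup>2 + b \<nu> powr (- t))" by (intro sum_mono pt)
    also have "\<dots> \<le> A + B" unfolding sum.distrib t_def using L by (intro add_mono A B) auto
    finally show "(\<Sum>\<nu>\<in>\<Lambda>. c \<nu> powr p) \<le> A + B" .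
  qed
qed simp

text \<open>Equals binom(l+m, m)/m!. The m-th derivative divided by m! has at index l the
  coefficient of index l + m times sqrt((l+1)...(l+m))/m!, and \<open>gfac l m\<close> is the square
  of this factor.\<close>

definition gfac :: "nat \<Rightarrow> nat \<Rightarrow> real" where
  "gfac l m = fact (l + m) / (fact l * (fact m)\<^sup>2)"

lemma gfac_0[simp]: "gfac l 0 = 1" by (simp add: gfac_def)

lemma gfac_pos: "gfac l m > 0" by (simp add: gfac_def)

lemma gfac_Suc: "gfac l (Suc m) = real (Suc l) / (real (Suc m))\<^sup>2 * gfac (Suc l) m"
proof -
  have "F / (a * (y * b)\<^sup>2) = x / y\<^sup>2 * (F / ((x * a) * b\<^sup>2))" if "x \<noteq> 0" for F a b x y :: real
    using that by (simp add: power_mult_distrib)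
  from this[of "real (Suc l)" "fact (Suc (l + m))" "fact l" "real (Suc m)" "fact m"]
  show ?thesis by (simp add: gfac_def del: of_nat_Suc)
qed

definition mfac :: "(nat \<Rightarrow> nat) \<Rightarrow> (nat \<Rightarrow> nat) \<Rightarrow> real" where
  "mfac \<kappa> \<mu> = (\<Prod>j | \<mu> j \<noteq> 0. gfac (\<kappa> j) (\<mu> j))"

lemma mfac_superset:
  assumes "finite S" "{j. \<mu> j \<noteq> 0} \<subseteq> S"
  shows "mfac \<kappa> \<mu> = (\<Prod>j\<in>S. gfac (\<kappa> j) (\<mu> j))"
  unfolding mfac_def by (rule prod.mono_neutral_left) (use assms in auto)

lemma mfac_pos: "mfac \<kappa> \<mu> > 0" unfolding mfac_def by (intro prod_pos) (auto simp: gfac_pos)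

text \<open>The factor of one integration by parts in coordinate j, squared: sqrt(\<kappa>_j + 1)
  from the Hermite polynomial, 1/(\<mu>_j + 1) from the division by \<mu>!.\<close>

lemma mfac_Suc:
  assumes "\<mu> \<in> multi_indices"
  shows "mfac \<kappa> (\<mu>(j := Suc (\<mu> j))) = real (Suc (\<kappa> j)) / (real (Suc (\<mu> j)))\<^sup>2 * mfac (\<kappa>(j := Suc (\<kappa> j))) \<mu>"
proof -
  let ?S = "insert j {i. \<mu> i \<noteq> 0}"
  have S: "finite ?S" "{i. \<mu> i \<noteq> 0} \<subseteq> ?S" "{i. (\<mu>(j := Suc (\<mu> j))) i \<noteq> 0} \<subseteq> ?S"
    using assms by (auto simp: multi_indices_def)
  have "(\<Prod>i\<in>?S - {j}. gfac (\<kappa> i) ((\<mu>(j := Suc (\<mu> j))) i)) = (\<Prod>i\<in>?S - {j}. gfac ((\<kappa>(j := Suc (\<kappa> j))) i) (\<mu> i))"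
    by (intro prod.cong) auto
  then show ?thesis
    unfolding mfac_superset[OF S(1,2)] mfac_superset[OF S(1,3)]
    using S(1) by (subst (1 2) prod.remove[of _ j]) (simp_all add: gfac_Suc)
qed

text \<open>\<open>trunc r \<nu>\<close> selects, for each coefficient, one derivative that controls it.\<close>

definition trunc :: "nat \<Rightarrow> (nat \<Rightarrow> nat) \<Rightarrow> nat \<Rightarrow> nat" where
  "trunc r \<nu> = (\<lambda>j. min (\<nu> j) r)"

text \<open>The weight of the squared coefficient of index \<nu> in Bessel's inequality for the
  derivative of order \<open>trunc r \<nu>\<close>. Cutting the order at r assigns to each
  coefficient one derivative and gives algebraic growth in \<nu>.\<close>

definition bweight :: "(nat \<Rightarrow> real) \<Rightarrow> nat \<Rightarrow> (nat \<Rightarrow> nat) \<Rightarrow> real" where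
  "bweight \<rho> r \<nu> = mfac (\<nu> - trunc r \<nu>) (trunc r \<nu>) * (index_pow \<rho> (trunc r \<nu>))\<^sup>2"

lemma trunc_multi_indices: "\<nu> \<in> multi_indices \<Longrightarrow> trunc r \<nu> \<in> multi_indices"
  unfolding multi_indices_def trunc_def by (auto elim: finite_subset[rotated])

lemma index_pow_pos: "(\<And>j. 0 < \<rho> j) \<Longrightarrow> 0 < index_pow \<rho> \<mu>"
  by (auto simp: index_pow_def intro: prod_pos)

lemma bweight_pos: "(\<And>j. 0 < \<rho> j) \<Longrightarrow> bweight \<rho> r \<nu> > 0"
  unfolding bweight_def using index_pow_pos[of \<rho> "trunc r \<nu>"] mfac_pos by (simp add: zero_less_mult_iff)

text \<open>The weights are products over coordinates, so the sum over a box factorises. In one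
  coordinate the weight of n \<ge> 1 is at least a multiple of n^r \<rho>^(2 min(n,r)). To the power
  -t this is summable in n, because r t \<ge> 2 gives 1/n^2, and the product of the factors 1 + 2 C
  s_j is bounded because s is summable.\<close>

lemma sum_bweight_bounded:
  assumes \<rho>: "\<And>j. 0 < \<rho> j" and t: "0 < t" and r: "1 \<le> r" "2 \<le> real r * t"
    and sm: "summable (\<lambda>j. \<rho> j powr (- 2 * t) + \<rho> j powr (- 2 * t * r))"
  shows "\<exists>B. \<forall>\<Lambda>. finite \<Lambda> \<longrightarrow> \<Lambda> \<subseteq> multi_indices \<longrightarrow> (\<Sum>\<nu>\<in>\<Lambda>. bweight \<rho> r \<nu> powr (- t)) \<le> B"
proof -
  define \<beta> where "\<beta> j n = gfac (n - min n r) (min n r) * (\<rho> j ^ min n r)\<^sup>2" for j n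
  \<comment> \<open>The exponent min(n,r) lies between 1 and r, so its power of \<rho> is at most
    the sum of the powers at both ends, whether \<rho> is above or below 1.\<close>
  define s where "s j = \<rho> j powr (- 2 * t) + \<rho> j powr (- 2 * t * r)" for j
  define C where "C = (fact r * real r ^ r) powr t"
  have C0: "C \<ge> 0" by (simp add: C_def)
  \<comment> \<open>For n \<le> r use n^r \<le> r^r and n! \<le> r!; for n > r use binom(n,r) \<ge>
    (n/r)^r.\<close>
  have \<beta>ge: "real n ^ r / (fact r * real r ^ r) * (\<rho> j ^ min n r)\<^sup>2 \<le> \<beta> j n" if n: "n \<ge> 1" for j n
  proof -
    have "real n ^ r / (fact r * real r ^ r) \<le> gfac (n - min n r) (min n r)"
    proof (cases "n \<le> r")
      case True
      have "real n ^ r / (fact r * real r ^ r) \<le> 1 / fact r"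
        using True r(1) power_mono[of "real n" "real r" r] by (simp add: field_simps)
      also have "\<dots> \<le> 1 / fact n" using True by (intro divide_left_mono fact_mono) auto
      also have "\<dots> = gfac (n - min n r) (min n r)" using True by (simp add: gfac_def min_def power2_eq_square)
      finally show ?thesis .
    next
      case False
      then have "(real n / real r) ^ r \<le> real (n choose r)" using binomial_ge_n_over_k_pow_k[of r n] by simp
      also have "real (n choose r) = fact n / (fact r * fact (n - r))" using False by (simp add: binomial_fact)
      finally have "(real n / real r) ^ r / fact r \<le> fact n / (fact r * fact (n - r)) / fact r"
        by (rule divide_right_mono) simp
      also have "\<dots> = gfac (n - min n r) (min n r)" using False by (simp add: gfac_def min_def power2_eq_square mult_ac)
      finally show ?thesis by (simp add: power_divide mult.commute)
    qed
    then show ?thesis unfolding \<beta>_def by (rule mult_right_mono) simp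
  qed
  have trm: "\<beta> j n powr (- t) \<le> C * s j * (1 / real n ^ 2)" if n: "n \<ge> 1" for j n
  proof -
    let ?m = "min n r"
    have m: "1 \<le> ?m" "?m \<le> r" using n r(1) by auto
    have np: "real n > 0" using n by simp
    have rp: "real r > 0" using r(1) by simp
    have low: "0 < real n ^ r / (fact r * real r ^ r) * (\<rho> j ^ ?m)\<^sup>2" using np rp \<rho>[of j] by simp
    have "\<beta> j n powr (- t) \<le> (real n ^ r / (fact r * real r ^ r) * (\<rho> j ^ ?m)\<^sup>2) powr (- t)"
      using \<beta>ge[OF n] low t by (intro powr_mono2') auto
    also have "\<dots> = (real n ^ r) powr (- t) * C * ((\<rho> j ^ ?m)\<^sup>2) powr (- t)"
      using np rp \<rho>[of j] by (simp add: powr_mult powr_divide powr_minus C_def field_simps)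
    also have "\<dots> \<le> (1 / real n ^ 2) * C * s j"
    proof (intro mult_mono mult_nonneg_nonneg)
      have "(real n ^ r) powr (- t) = real n powr (- (real r * t))" using np by (simp add: powr_powr flip: powr_realpow)
      also have "\<dots> \<le> real n powr (- 2)" using n r(2) by (intro powr_mono) auto
      also have "\<dots> = 1 / real n ^ 2" using np by (simp add: powr_minus powr_numeral divide_inverse)
      finally show "(real n ^ r) powr (- t) \<le> 1 / real n ^ 2" .
      have e: "((\<rho> j ^ ?m)\<^sup>2) powr (- t) = \<rho> j powr (- 2 * t * ?m)"
      proof -
        have "((\<rho> j ^ ?m)\<^sup>2) = \<rho> j powr (real (?m * 2))" using \<rho>[of j] by (simp only: powr_realpow power_mult)
        then show ?thesis by (simp add: powr_powr mult_ac)
      qed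
      show "((\<rho> j ^ ?m)\<^sup>2) powr (- t) \<le> s j"
      proof (cases "\<rho> j \<ge> 1")
        case True
        have "- 2 * t * ?m \<le> - 2 * t" using t m(1) by simp
        then have "\<rho> j powr (- 2 * t * ?m) \<le> \<rho> j powr (- 2 * t)" using True by (intro powr_mono) auto
        then show ?thesis unfolding e s_def by (simp add: add_increasing2)
      next
        case False
        have "- 2 * t * r \<le> - 2 * t * ?m" using t m(2) by simp
        then have "\<rho> j powr (- 2 * t * ?m) \<le> \<rho> j powr (- 2 * t * r)"
          using False \<rho>[of j] by (intro powr_mono') auto
        then show ?thesis unfolding e s_def by (simp add: add_increasing)
      qed
    qed (use C0 in auto)
    finally show ?thesis by (simp add: mult_ac)
  qed
  have s0: "s j \<ge> 0" for j by (simp add: s_def)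
  have sumn: "(\<Sum>n\<le>R. \<beta> j n powr (- t)) \<le> exp (2 * C * s j)" for j R
  proof -
    \<comment> \<open>Telescoping, by 1/(x+1)^2 \<le> 1/x - 1/(x+1).\<close>
    have bas1: "(\<Sum>n\<in>{1..Suc R}. 1 / real n ^ 2) \<le> 2 - 1 / real (Suc R)" for R
    proof (induction R)
      case (Suc R)
      have "1 / (x + 1) ^ 2 \<le> 1 / x - 1 / (x + 1)" if "x > 0" for x :: real
      proof -
        have "1 / (x + 1) ^ 2 \<le> 1 / (x * (x + 1))"
          using that by (intro divide_left_mono) (auto simp: power2_eq_square)
        also have "\<dots> = 1 / x - 1 / (x + 1)" using that by (simp add: field_simps)
        finally show ?thesis .
      qed
      from this[of "real (Suc R)"] have "1 / real (Suc (Suc R)) ^ 2 \<le> 1 / real (Suc R) - 1 / real (Suc (Suc R))"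
        by (simp add: add.commute)
      moreover have "(\<Sum>n\<in>{1..Suc (Suc R)}. 1 / real n ^ 2) = (\<Sum>n\<in>{1..Suc R}. 1 / real n ^ 2) + 1 / real (Suc (Suc R)) ^ 2"
        by (subst sum.nat_ivl_Suc') auto
      ultimately show ?case using Suc by linarith
    qed simp
    have bas: "(\<Sum>n\<in>{1..R}. 1 / real n ^ 2) \<le> 2" for R
    proof (cases R)
      case (Suc k)
      have "0 \<le> 1 / real (Suc k)" by simp
      then show ?thesis using bas1[of k] unfolding Suc by linarith
    qed simp
    have "(\<Sum>n\<le>R. \<beta> j n powr (- t)) = \<beta> j 0 powr (- t) + (\<Sum>n\<in>{1..R}. \<beta> j n powr (- t))"
      by (simp add: sum.atLeast_Suc_atMost atMost_atLeast0)
    also have "\<dots> \<le> 1 + (\<Sum>n\<in>{1..R}. C * s j * (1 / real n ^ 2))"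
      by (intro add_mono sum_mono trm) (auto simp: \<beta>_def)
    also have "(\<Sum>n\<in>{1..R}. C * s j * (1 / real n ^ 2)) = C * s j * (\<Sum>n\<in>{1..R}. 1 / real n ^ 2)"
      by (simp only: sum_distrib_left)
    also have "\<dots> \<le> C * s j * 2"
      using bas[of R] C0 s0[of j] by (intro mult_left_mono) (auto intro: order_trans)
    finally have "(\<Sum>n\<le>R. \<beta> j n powr (- t)) \<le> 1 + 2 * C * s j" by (simp add: mult_ac)
    also have "\<dots> \<le> exp (2 * C * s j)" by (rule exp_ge_add_one_self)
    finally show ?thesis .
  qed
  have bw: "bweight \<rho> r \<nu> powr (- t) = (\<Prod>j<N. \<beta> j (\<nu> j) powr (- t))" if \<nu>: "\<nu> \<in> index_box N R" for \<nu> N R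
  proof -
    have "{j. trunc r \<nu> j \<noteq> 0} \<subseteq> {..<N}" using index_box_support[OF \<nu>] by (auto simp: trunc_def)
    then have "bweight \<rho> r \<nu> = (\<Prod>j<N. \<beta> j (\<nu> j))"
      unfolding bweight_def
      by (simp add: mfac_superset[OF finite_lessThan] index_pow_superset[OF finite_lessThan] \<beta>_def trunc_def
          prod.distrib prod_power_distrib)
    also have "(\<Prod>j<N. \<beta> j (\<nu> j)) powr (- t) = (\<Prod>j<N. \<beta> j (\<nu> j) powr (- t))"
      by (rule prod_powr_distrib)
    finally show ?thesis .
  qed
  show ?thesis
  proof (intro exI allI impI)
    fix \<Lambda> :: "(nat \<Rightarrow> nat) set" assume "finite \<Lambda>" "\<Lambda> \<subseteq> multi_indices"
    then obtain N R where NR: "\<Lambda> \<subseteq> index_box N R" using finite_multi_indices_box by blast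
    have "(\<Sum>\<nu>\<in>\<Lambda>. bweight \<rho> r \<nu> powr (- t)) \<le> (\<Sum>\<nu>\<in>index_box N R. bweight \<rho> r \<nu> powr (- t))"
      by (rule sum_mono2[OF finite_index_box NR]) simp
    also have "\<dots> = (\<Sum>\<nu>\<in>index_box N R. \<Prod>j<N. \<beta> j (\<nu> j) powr (- t))" by (intro sum.cong refl bw)
    also have "\<dots> = (\<Prod>j<N. \<Sum>n\<le>R. \<beta> j n powr (- t))" by (rule sum_index_box)
    also have "\<dots> \<le> (\<Prod>j<N. exp (2 * C * s j))" by (intro prod_mono conjI sumn sum_nonneg) auto
    also have "\<dots> = exp (2 * C * (\<Sum>j<N. s j))" by (simp add: exp_sum sum_distrib_left)
    also have "\<dots> \<le> exp (2 * C * suminf s)"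
      using C0 sm s0 by (auto intro!: mult_left_mono sum_le_suminf simp: s_def[abs_def])
    finally show "(\<Sum>\<nu>\<in>\<Lambda>. bweight \<rho> r \<nu> powr (- t)) \<le> exp (2 * C * suminf s)" .
  qed
qed

text \<open>Integration by parts turns the Hermite coefficients of the derivatives \<open>\<partial>\<^sup>\<mu>u / \<mu>!\<close> into
  those of \<open>u\<close>; Bessel's inequality for each derivative then bounds the weighted sum.\<close>

lemma weighted_hermite_bound:
  fixes T :: "(nat \<Rightarrow> nat) \<Rightarrow> (nat \<Rightarrow> real) \<Rightarrow> 'h::{real_inner, banach, second_countable_topology}"
  assumes Tm: "\<And>\<mu>. \<mu> \<in> multi_indices \<Longrightarrow> T \<mu> \<in> borel_measurable gaussian"
    and Td: "AE y in gaussian. \<forall>\<mu>\<in>multi_indices. \<forall>j s. ((\<lambda>s. T \<mu> (y(j := s))) has_vector_derivative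
        real (Suc (\<mu> j)) *\<^sub>R T (\<mu>(j := Suc (\<mu> j))) (y(j := s))) (at s)"
    and \<rho>: "\<And>j. 0 < \<rho> j"
    and \<Phi>: "integrable gaussian \<Phi>"
    and Tb: "AE y in gaussian. \<forall>N R. (\<Sum>\<mu>\<in>index_box N R. (index_pow \<rho> \<mu>)\<^sup>2 * (norm (T \<mu> y))\<^sup>2) \<le> \<Phi> y"
  shows "\<mu> \<in> multi_indices \<Longrightarrow> sq_integrable (T \<mu>)"
    and "1 \<le> r \<Longrightarrow> finite \<Lambda> \<Longrightarrow> \<Lambda> \<subseteq> multi_indices \<Longrightarrow>
      (\<Sum>\<nu>\<in>\<Lambda>. bweight \<rho> r \<nu> * (norm (hcoeff (T (\<lambda>_. 0)) \<nu>))\<^sup>2) \<le> (\<integral>y. \<Phi> y \<partial>gaussian)"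
proof -
  have sq: "sq_integrable (T \<mu>)" if \<mu>: "\<mu> \<in> multi_indices" for \<mu>
  proof -
    obtain N R where NR: "\<mu> \<in> index_box N R" using finite_multi_indices_box[of "{\<mu>}"] \<mu> by auto
    have ip: "index_pow \<rho> \<mu> > 0" by (rule index_pow_pos[OF \<rho>])
    note [measurable] = Tm[OF \<mu>]
    have "integrable gaussian (\<lambda>y. (norm (T \<mu> y))\<^sup>2)"
    proof (rule Bochner_Integration.integrable_bound)
      show "integrable gaussian (\<lambda>y. \<Phi> y / (index_pow \<rho> \<mu>)\<^sup>2)" using \<Phi> by simp
      show "AE y in gaussian. norm ((norm (T \<mu> y))\<^sup>2) \<le> norm (\<Phi> y / (index_pow \<rho> \<mu>)\<^sup>2)"
        using Tb
      proof eventually_elim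
        fix y assume b: "\<forall>N R. (\<Sum>\<mu>\<in>index_box N R. (index_pow \<rho> \<mu>)\<^sup>2 * (norm (T \<mu> y))\<^sup>2) \<le> \<Phi> y"
        have "(index_pow \<rho> \<mu>)\<^sup>2 * (norm (T \<mu> y))\<^sup>2 \<le> (\<Sum>\<mu>\<in>index_box N R. (index_pow \<rho> \<mu>)\<^sup>2 * (norm (T \<mu> y))\<^sup>2)"
          by (rule member_le_sum[OF NR]) (auto simp: finite_index_box)
        also have "\<dots> \<le> \<Phi> y" using b by blast
        finally have "(norm (T \<mu> y))\<^sup>2 \<le> \<Phi> y / (index_pow \<rho> \<mu>)\<^sup>2" using ip by (simp add: field_simps)
        from order_trans[OF this abs_ge_self]
        show "norm ((norm (T \<mu> y))\<^sup>2) \<le> norm (\<Phi> y / (index_pow \<rho> \<mu>)\<^sup>2)" by simp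
      qed
    qed measurable
    then show ?thesis by (simp add: sq_integrable_def)
  qed
  then show "\<mu> \<in> multi_indices \<Longrightarrow> sq_integrable (T \<mu>)" .
  \<comment> \<open>One integration by parts moves a unit from \<mu>_j to \<kappa>_j; induction on
    the degree of \<mu> ends at the undifferentiated function.\<close>
  have rel: "hcoeff (T \<mu>) \<kappa> = sqrt (mfac \<kappa> \<mu>) *\<^sub>R hcoeff (T (\<lambda>_. 0)) (\<lambda>j. \<kappa> j + \<mu> j)"
    if "\<mu> \<in> multi_indices" "\<kappa> \<in> multi_indices" for \<mu> \<kappa>
    using that
  proof (induction "degree_of \<mu>" arbitrary: \<mu> \<kappa> rule: less_induct)
    case less
    note \<mu> = less.prems(1) and \<kappa> = less.prems(2)
    show ?case
    proof (cases "\<mu> = (\<lambda>_. 0)")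
      case True
      then show ?thesis by (simp add: mfac_def)
    next
      case False
      then obtain j where j: "\<mu> j \<noteq> 0" by blast
      define \<mu>' where "\<mu>' = \<mu>(j := \<mu> j - 1)"
      have \<mu>_eq: "\<mu> = \<mu>'(j := Suc (\<mu>' j))" using j by (auto simp: \<mu>'_def)
      have \<mu>': "\<mu>' \<in> multi_indices" unfolding \<mu>'_def by (rule multi_indices_upd[OF \<mu>])
      define \<kappa>' where "\<kappa>' = \<kappa>(j := Suc (\<kappa> j))"
      have \<kappa>': "\<kappa>' \<in> multi_indices" unfolding \<kappa>'_def by (rule multi_indices_upd[OF \<kappa>])
      have "\<mu>' = \<mu> - (\<lambda>_. 0)(j := 1)" by (auto simp: \<mu>'_def fun_eq_iff)
      moreover have "degree_of (\<mu> - (\<lambda>_. 0)(j := 1)) < degree_of \<mu>"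
        using \<mu> j by (intro degree_of_diff_less) (auto simp: multi_indices_def le_fun_def fun_eq_iff)
      ultimately have deg: "degree_of \<mu>' < degree_of \<mu>" by simp
      have "hcoeff (\<lambda>y. real (Suc (\<mu>' j)) *\<^sub>R T \<mu> y) \<kappa> = sqrt (Suc (\<kappa> j)) *\<^sub>R hcoeff (T \<mu>') (\<kappa>(j := Suc (\<kappa> j)))"
      proof (rule gaussian_ibp[OF \<kappa> sq[OF \<mu>'] sq_integrable_scaleR[OF sq[OF \<mu>]]])
        show "AE y in gaussian. (\<forall>s. ((\<lambda>s. T \<mu>' (y(j := s))) has_vector_derivative real (Suc (\<mu>' j)) *\<^sub>R T \<mu> (y(j := s))) (at s))
          \<and> continuous_on UNIV (\<lambda>s. real (Suc (\<mu>' j)) *\<^sub>R T \<mu> (y(j := s)))"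
          using Td
        proof eventually_elim
          fix y assume d: "\<forall>\<mu>\<in>multi_indices. \<forall>j s. ((\<lambda>s. T \<mu> (y(j := s))) has_vector_derivative
            real (Suc (\<mu> j)) *\<^sub>R T (\<mu>(j := Suc (\<mu> j))) (y(j := s))) (at s)"
          have "((\<lambda>s. T \<mu>' (y(j := s))) has_vector_derivative real (Suc (\<mu>' j)) *\<^sub>R T \<mu> (y(j := s))) (at s)" for s
            using d \<mu>' \<mu>_eq by metis
          moreover have "continuous_on UNIV (\<lambda>s. T \<mu> (y(j := s)))"
            using d \<mu> by (intro continuous_at_imp_continuous_on ballI) (blast dest: has_vector_derivative_continuous)
          ultimately show "(\<forall>s. ((\<lambda>s. T \<mu>' (y(j := s))) has_vector_derivative real (Suc (\<mu>' j)) *\<^sub>R T \<mu> (y(j := s))) (at s))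
            \<and> continuous_on UNIV (\<lambda>s. real (Suc (\<mu>' j)) *\<^sub>R T \<mu> (y(j := s)))"
            by (auto intro!: continuous_intros)
        qed
      qed
      moreover have "hcoeff (\<lambda>y. real (Suc (\<mu>' j)) *\<^sub>R T \<mu> y) \<kappa> = real (Suc (\<mu>' j)) *\<^sub>R hcoeff (T \<mu>) \<kappa>"
      proof -
        have "hcoeff (\<lambda>y. real (Suc (\<mu>' j)) *\<^sub>R T \<mu> y) \<kappa> = (\<integral>y. real (Suc (\<mu>' j)) *\<^sub>R (hermite_multi \<kappa> y *\<^sub>R T \<mu> y) \<partial>gaussian)"
          unfolding hcoeff_def by (simp only: scaleR_scaleR mult.commute)
        then show ?thesis unfolding hcoeff_def by (simp only: integral_scaleR_right)
      qed
      moreover have "hcoeff (T \<mu>') \<kappa>' = sqrt (mfac \<kappa>' \<mu>') *\<^sub>R hcoeff (T (\<lambda>_. 0)) (\<lambda>i. \<kappa>' i + \<mu>' i)"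
        by (rule less.hyps[OF deg \<mu>' \<kappa>'])
      moreover have "(\<lambda>i. \<kappa>' i + \<mu>' i) = (\<lambda>i. \<kappa> i + \<mu> i)" using j by (auto simp: \<kappa>'_def \<mu>'_def fun_eq_iff)
      ultimately have "real (Suc (\<mu>' j)) *\<^sub>R hcoeff (T \<mu>) \<kappa>
        = (sqrt (Suc (\<kappa> j)) * sqrt (mfac \<kappa>' \<mu>')) *\<^sub>R hcoeff (T (\<lambda>_. 0)) (\<lambda>i. \<kappa> i + \<mu> i)"
        by (simp add: \<kappa>'_def del: of_nat_Suc)
      moreover have "sqrt (Suc (\<kappa> j)) * sqrt (mfac \<kappa>' \<mu>') = real (Suc (\<mu>' j)) * sqrt (mfac \<kappa> \<mu>)"
      proof -
        have "mfac \<kappa> \<mu> = real (Suc (\<kappa> j)) / (real (Suc (\<mu>' j)))\<^sup>2 * mfac \<kappa>' \<mu>'"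
          using mfac_Suc[OF \<mu>', of \<kappa> j] unfolding \<mu>_eq[symmetric] \<kappa>'_def .
        then show ?thesis by (simp add: real_sqrt_mult real_sqrt_divide del: of_nat_Suc)
      qed
      ultimately have "real (Suc (\<mu>' j)) *\<^sub>R hcoeff (T \<mu>) \<kappa>
        = real (Suc (\<mu>' j)) *\<^sub>R (sqrt (mfac \<kappa> \<mu>) *\<^sub>R hcoeff (T (\<lambda>_. 0)) (\<lambda>i. \<kappa> i + \<mu> i))" by simp
      then show ?thesis by (rule scaleR_left_imp_eq[rotated]) simp
    qed
  qed
  show "(\<Sum>\<nu>\<in>\<Lambda>. bweight \<rho> r \<nu> * (norm (hcoeff (T (\<lambda>_. 0)) \<nu>))\<^sup>2) \<le> (\<integral>y. \<Phi> y \<partial>gaussian)"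
    if r: "1 \<le> r" and \<Lambda>: "finite \<Lambda>" "\<Lambda> \<subseteq> multi_indices"
  proof -
    \<comment> \<open>The indices are grouped by the derivative that controls them, so that Bessel's
      inequality is applied once per derivative.\<close>
    let ?M = "trunc r ` \<Lambda>"
    have M: "?M \<subseteq> multi_indices" "finite ?M" using \<Lambda> trunc_multi_indices by auto
    have "bweight \<rho> r \<nu> * (norm (hcoeff (T (\<lambda>_. 0)) \<nu>))\<^sup>2
      = (index_pow \<rho> (trunc r \<nu>))\<^sup>2 * (norm (hcoeff (T (trunc r \<nu>)) (\<nu> - trunc r \<nu>)))\<^sup>2" if "\<nu> \<in> \<Lambda>" for \<nu>
    proof -
      have \<nu>: "\<nu> \<in> multi_indices" using that \<Lambda> by auto
      have "(\<lambda>j. (\<nu> - trunc r \<nu>) j + trunc r \<nu> j) = \<nu>" by (auto simp: trunc_def fun_eq_iff)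
      then have "hcoeff (T (trunc r \<nu>)) (\<nu> - trunc r \<nu>) = sqrt (mfac (\<nu> - trunc r \<nu>) (trunc r \<nu>)) *\<^sub>R hcoeff (T (\<lambda>_. 0)) \<nu>"
        using rel[OF trunc_multi_indices[OF \<nu>] multi_indices_diff[OF \<nu>], of r "trunc r \<nu>"] by (simp only:)
      then show ?thesis using mfac_pos[of "\<nu> - trunc r \<nu>" "trunc r \<nu>"]
        by (simp add: bweight_def power_mult_distrib mult_ac)
    qed
    then have "(\<Sum>\<nu>\<in>\<Lambda>. bweight \<rho> r \<nu> * (norm (hcoeff (T (\<lambda>_. 0)) \<nu>))\<^sup>2)
      = (\<Sum>\<nu>\<in>\<Lambda>. (index_pow \<rho> (trunc r \<nu>))\<^sup>2 * (norm (hcoeff (T (trunc r \<nu>)) (\<nu> - trunc r \<nu>)))\<^sup>2)"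
      by (intro sum.cong refl)
    also have "\<dots> = (\<Sum>\<mu>\<in>?M. \<Sum>\<nu>\<in>{\<nu>\<in>\<Lambda>. trunc r \<nu> = \<mu>}. (index_pow \<rho> (trunc r \<nu>))\<^sup>2 * (norm (hcoeff (T (trunc r \<nu>)) (\<nu> - trunc r \<nu>)))\<^sup>2)"
      by (rule sum.image_gen[OF \<Lambda>(1)])
    also have "\<dots> \<le> (\<Sum>\<mu>\<in>?M. (index_pow \<rho> \<mu>)\<^sup>2 * (\<integral>y. (norm (T \<mu> y))\<^sup>2 \<partial>gaussian))"
    proof (rule sum_mono)
      fix \<mu> assume "\<mu> \<in> ?M"
      then have \<mu>: "\<mu> \<in> multi_indices" using M by auto
      let ?L = "{\<nu>\<in>\<Lambda>. trunc r \<nu> = \<mu>}"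
      \<comment> \<open>Within a group \<nu> can be recovered from \<nu> - \<mu>, because \<mu>
        \<le> \<nu> in every coordinate.\<close>
      have inj: "inj_on (\<lambda>\<nu>. \<nu> - \<mu>) ?L"
      proof (rule inj_onI)
        fix \<nu> \<nu>' assume n: "\<nu> \<in> ?L" "\<nu>' \<in> ?L" "\<nu> - \<mu> = \<nu>' - \<mu>"
        show "\<nu> = \<nu>'"
        proof
          fix j
          have "trunc r \<nu> = \<mu>" "trunc r \<nu>' = \<mu>" using n(1,2) by auto
          then have "\<mu> j = min (\<nu> j) r" "\<mu> j = min (\<nu>' j) r" unfolding trunc_def by metis+
          then show "\<nu> j = \<nu>' j" using fun_cong[OF n(3), of j] by (auto simp: min_def split: if_splits)
        qed
      qed
      have A: "(\<Sum>\<nu>\<in>?L. (index_pow \<rho> (trunc r \<nu>))\<^sup>2 * (norm (hcoeff (T (trunc r \<nu>)) (\<nu> - trunc r \<nu>)))\<^sup>2)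
        = (index_pow \<rho> \<mu>)\<^sup>2 * (\<Sum>\<nu>\<in>?L. (norm (hcoeff (T \<mu>) (\<nu> - \<mu>)))\<^sup>2)"
        by (simp add: sum_distrib_left)
      have "(\<Sum>\<nu>\<in>?L. (norm (hcoeff (T \<mu>) (\<nu> - \<mu>)))\<^sup>2) = (\<Sum>\<kappa>\<in>(\<lambda>\<nu>. \<nu> - \<mu>) ` ?L. (norm (hcoeff (T \<mu>) \<kappa>))\<^sup>2)"
        by (simp add: sum.reindex[OF inj])
      also have "\<dots> \<le> (\<integral>y. (norm (T \<mu> y))\<^sup>2 \<partial>gaussian)"
        by (rule hermite_bessel[OF sq[OF \<mu>]]) (use \<Lambda> in \<open>auto intro!: multi_indices_diff\<close>)
      finally have B: "(\<Sum>\<nu>\<in>?L. (norm (hcoeff (T \<mu>) (\<nu> - \<mu>)))\<^sup>2) \<le> (\<integral>y. (norm (T \<mu> y))\<^sup>2 \<partial>gaussian)" .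
      show "(\<Sum>\<nu>\<in>?L. (index_pow \<rho> (trunc r \<nu>))\<^sup>2 * (norm (hcoeff (T (trunc r \<nu>)) (\<nu> - trunc r \<nu>)))\<^sup>2)
        \<le> (index_pow \<rho> \<mu>)\<^sup>2 * (\<integral>y. (norm (T \<mu> y))\<^sup>2 \<partial>gaussian)"
        unfolding A by (intro mult_left_mono B) simp
    qed
    also have "\<dots> = (\<integral>y. (\<Sum>\<mu>\<in>?M. (index_pow \<rho> \<mu>)\<^sup>2 * (norm (T \<mu> y))\<^sup>2) \<partial>gaussian)"
      using sq M by (subst Bochner_Integration.integral_sum) (auto simp: sq_integrable_def)
    also have "\<dots> \<le> (\<integral>y. \<Phi> y \<partial>gaussian)"
    proof (rule integral_mono_AE)
      show "integrable gaussian (\<lambda>y. \<Sum>\<mu>\<in>?M. (index_pow \<rho> \<mu>)\<^sup>2 * (norm (T \<mu> y))\<^sup>2)"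
        using sq M by (intro Bochner_Integration.integrable_sum integrable_mult_right) (auto simp: sq_integrable_def)
      obtain N R where NR: "?M \<subseteq> index_box N R" using finite_multi_indices_box[OF M(2,1)] by blast
      show "AE y in gaussian. (\<Sum>\<mu>\<in>?M. (index_pow \<rho> \<mu>)\<^sup>2 * (norm (T \<mu> y))\<^sup>2) \<le> \<Phi> y"
        using Tb
      proof eventually_elim
        fix y assume b: "\<forall>N R. (\<Sum>\<mu>\<in>index_box N R. (index_pow \<rho> \<mu>)\<^sup>2 * (norm (T \<mu> y))\<^sup>2) \<le> \<Phi> y"
        have "(\<Sum>\<mu>\<in>?M. (index_pow \<rho> \<mu>)\<^sup>2 * (norm (T \<mu> y))\<^sup>2) \<le> (\<Sum>\<mu>\<in>index_box N R. (index_pow \<rho> \<mu>)\<^sup>2 * (norm (T \<mu> y))\<^sup>2)"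
          by (rule sum_mono2[OF finite_index_box NR]) simp
        then show "(\<Sum>\<mu>\<in>?M. (index_pow \<rho> \<mu>)\<^sup>2 * (norm (T \<mu> y))\<^sup>2) \<le> \<Phi> y" using b by (meson order_trans)
      qed
    qed (rule \<Phi>)
    finally show ?thesis .
  qed
qed

section \<open>Multiplication operators and the solution operator\<close>

lemma rep_abs_L2: "f \<in> square_integrable \<Longrightarrow> AE x in lebesgue. rep_L2 (abs_L2 f) x = f x"
  using Quotient3_rep_abs[OF Quotient3_L2, of f] by (simp add: L2_rel_def)

lemma L2_eqI:
  assumes "AE x in lebesgue. rep_L2 f x = rep_L2 g x"
  shows "f = g"
proof -
  have "L2_rel (rep_L2 f) (rep_L2 g)" using assms by (simp add: L2_rel_def rep_L2_sqi)
  then show ?thesis using Quotient3_rel_abs[OF Quotient3_L2] by (metis abs_rep_L2)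
qed

lemma rep_L2_add: "AE x in lebesgue. rep_L2 (f + g) x = rep_L2 f x + rep_L2 g x"
  using rep_abs_L2[OF sqi_add[OF rep_L2_sqi[of f] rep_L2_sqi[of g]]]
  by (simp add: add_abs_L2[symmetric] rep_L2_sqi abs_rep_L2)

lemma rep_L2_scaleR: "AE x in lebesgue. rep_L2 (r *\<^sub>R f) x = r *\<^sub>R rep_L2 f x"
  using rep_abs_L2[OF sqi_scale[OF rep_L2_sqi[of f]], of r]
  by (simp add: scaleR_abs_L2[symmetric] rep_L2_sqi abs_rep_L2)

text \<open>Bounds with a free constant pass through sums, products and exp without computing an
  essential supremum; \<open>Linf_bdd_on\<close> and \<open>bdd_on_Linf\<close> translate in both
  directions.\<close>

definition bdd_on :: "'a::euclidean_space set \<Rightarrow> ('a \<Rightarrow> real) \<Rightarrow> real \<Rightarrow> bool" where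
  "bdd_on D \<phi> c \<longleftrightarrow> \<phi> \<in> borel_measurable (lebesgue_on D) \<and> (AE x in lebesgue_on D. \<bar>\<phi> x\<bar> \<le> c)"

lemma Linf_bdd_on:
  assumes "\<phi> \<in> Linf D"
  shows "bdd_on D \<phi> (Linf_norm D \<phi>)"
proof -
  let ?e = "esssup (lebesgue_on D) (\<lambda>x. ereal \<bar>\<phi> x\<bar>)"
  have m: "\<phi> \<in> borel_measurable (lebesgue_on D)" and fin: "?e < \<infinity>" using assms by (auto simp: Linf_def)
  have "(\<lambda>x. ereal \<bar>\<phi> x\<bar>) \<in> borel_measurable (lebesgue_on D)" using m by measurable
  then have "AE x in lebesgue_on D. ereal \<bar>\<phi> x\<bar> \<le> ?e" by (intro esssup_AE)
  then have "AE x in lebesgue_on D. \<bar>\<phi> x\<bar> \<le> Linf_norm D \<phi>"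
  proof eventually_elim
    fix x assume "ereal \<bar>\<phi> x\<bar> \<le> ?e"
    then show "\<bar>\<phi> x\<bar> \<le> Linf_norm D \<phi>"
      unfolding Linf_norm_def using fin by (cases ?e) auto
  qed
  then show ?thesis using m by (simp add: bdd_on_def)
qed

lemma bdd_on_Linf:
  assumes "bdd_on D \<phi> c"
  shows "\<phi> \<in> Linf D" "0 \<le> c \<Longrightarrow> Linf_norm D \<phi> \<le> c"
proof -
  let ?e = "esssup (lebesgue_on D) (\<lambda>x. ereal \<bar>\<phi> x\<bar>)"
  have m: "\<phi> \<in> borel_measurable (lebesgue_on D)" using assms by (simp add: bdd_on_def)
  have "?e \<le> ereal c"
  proof (rule esssup_I)
    show "(\<lambda>x. ereal \<bar>\<phi> x\<bar>) \<in> borel_measurable (lebesgue_on D)" using m by measurable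
    show "AE x in lebesgue_on D. ereal \<bar>\<phi> x\<bar> \<le> ereal c" using assms by (simp add: bdd_on_def)
  qed
  then show "\<phi> \<in> Linf D" using m by (auto simp: Linf_def intro: le_less_trans)
  \<comment> \<open>On a null set the essential supremum is -infinity and its real value is 0, hence
    the condition on c.\<close>
  show "Linf_norm D \<phi> \<le> c" if "0 \<le> c"
    using \<open>?e \<le> ereal c\<close> that unfolding Linf_norm_def by (cases ?e) auto
qed

lemma Linf_iff: "\<phi> \<in> Linf D \<longleftrightarrow> (\<exists>c. bdd_on D \<phi> c)"
  using Linf_bdd_on bdd_on_Linf by blast

lemma bdd_on_mono: "bdd_on D \<phi> c \<Longrightarrow> c \<le> c' \<Longrightarrow> bdd_on D \<phi> c'"
  unfolding bdd_on_def by (auto elim!: eventually_mono)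

lemma bdd_on_add: "bdd_on D \<phi> c \<Longrightarrow> bdd_on D \<theta> d \<Longrightarrow> bdd_on D (\<lambda>x. \<phi> x + \<theta> x) (c + d)"
proof -
  assume *: "bdd_on D \<phi> c" "bdd_on D \<theta> d"
  then have "AE x in lebesgue_on D. \<bar>\<phi> x\<bar> \<le> c" "AE x in lebesgue_on D. \<bar>\<theta> x\<bar> \<le> d" by (auto simp: bdd_on_def)
  then have "AE x in lebesgue_on D. \<bar>\<phi> x + \<theta> x\<bar> \<le> c + d" by eventually_elim linarith
  then show ?thesis using * by (auto simp: bdd_on_def)
qed

lemma bdd_on_mult: "bdd_on D \<phi> c \<Longrightarrow> bdd_on D \<theta> d \<Longrightarrow> bdd_on D (\<lambda>x. \<phi> x * \<theta> x) (c * d)"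
proof -
  assume *: "bdd_on D \<phi> c" "bdd_on D \<theta> d"
  then have "AE x in lebesgue_on D. \<bar>\<phi> x\<bar> \<le> c" "AE x in lebesgue_on D. \<bar>\<theta> x\<bar> \<le> d" by (auto simp: bdd_on_def)
  then have "AE x in lebesgue_on D. \<bar>\<phi> x * \<theta> x\<bar> \<le> c * d"
    by eventually_elim (simp add: abs_mult mult_mono')
  then show ?thesis using * by (auto simp: bdd_on_def)
qed

lemma bdd_on_const: "bdd_on D (\<lambda>x. c) \<bar>c\<bar>"
  by (auto simp: bdd_on_def)

lemma bdd_on_exp: "bdd_on D \<phi> c \<Longrightarrow> bdd_on D (\<lambda>x. exp (\<phi> x)) (exp c)"
  unfolding bdd_on_def by (auto elim!: eventually_mono)

lemma bdd_on_abs: "bdd_on D \<phi> c \<Longrightarrow> bdd_on D (\<lambda>x. \<bar>\<phi> x\<bar>) c"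
  unfolding bdd_on_def by (auto elim!: eventually_mono)

lemma Linf_const[simp, intro]: "(\<lambda>x. c) \<in> Linf D"
  using bdd_on_const Linf_iff by blast

lemma Linf_add[intro]: "\<phi> \<in> Linf D \<Longrightarrow> \<theta> \<in> Linf D \<Longrightarrow> (\<lambda>x. \<phi> x + \<theta> x) \<in> Linf D"
  using bdd_on_add Linf_iff by metis

lemma Linf_mult[intro]: "\<phi> \<in> Linf D \<Longrightarrow> \<theta> \<in> Linf D \<Longrightarrow> (\<lambda>x. \<phi> x * \<theta> x) \<in> Linf D"
  using bdd_on_mult Linf_iff by metis

lemma Linf_minus[intro]: "\<phi> \<in> Linf D \<Longrightarrow> (\<lambda>x. - \<phi> x) \<in> Linf D"
  using Linf_mult[OF Linf_const[of "-1"]] by simp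

lemma Linf_diff[intro]: "\<phi> \<in> Linf D \<Longrightarrow> \<theta> \<in> Linf D \<Longrightarrow> (\<lambda>x. \<phi> x - \<theta> x) \<in> Linf D"
  using Linf_add[OF _ Linf_minus] by simp

lemma Linf_exp[intro]: "\<phi> \<in> Linf D \<Longrightarrow> (\<lambda>x. exp (\<phi> x)) \<in> Linf D"
  using bdd_on_exp Linf_iff by metis

lemma Linf_abs[intro]: "\<phi> \<in> Linf D \<Longrightarrow> (\<lambda>x. \<bar>\<phi> x\<bar>) \<in> Linf D"
  using bdd_on_abs Linf_iff by metis

lemma Linf_power[intro]: "\<phi> \<in> Linf D \<Longrightarrow> (\<lambda>x. \<phi> x ^ n) \<in> Linf D"
  by (induction n) auto

lemma Linf_divide[intro]: "\<phi> \<in> Linf D \<Longrightarrow> (\<lambda>x. \<phi> x / c) \<in> Linf D"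
  using Linf_mult[OF _ Linf_const[of "1/c"]] by simp

lemma Linf_sum[intro]: "(\<And>i. i \<in> J \<Longrightarrow> \<phi> i \<in> Linf D) \<Longrightarrow> (\<lambda>x. \<Sum>i\<in>J. \<phi> i x) \<in> Linf D"
  by (induction J rule: infinite_finite_induct) auto

lemma Linf_prod[intro]: "(\<And>i. i \<in> J \<Longrightarrow> \<phi> i \<in> Linf D) \<Longrightarrow> (\<lambda>x. \<Prod>i\<in>J. \<phi> i x) \<in> Linf D"
  by (induction J rule: infinite_finite_induct) auto

text \<open>The indicator of D builds in the extension by zero. Multiplication is an element of the
  space of bounded operators so that coefficients can be composed and differentiated in operator
  norm.\<close>

definition Mul :: "'a::euclidean_space set \<Rightarrow> ('a \<Rightarrow> real) \<Rightarrow> ('a, 'b::euclidean_space) L2 \<Rightarrow>\<^sub>L ('a, 'b) L2" where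
  "Mul D \<phi> = Blinfun (\<lambda>g. abs_L2 (\<lambda>x. (indicator D x * \<phi> x) *\<^sub>R rep_L2 g x))"

section \<open>Algebra and order of the multiplication operators\<close>

locale pde_domain =
  fixes D :: "'a::euclidean_space set"
  assumes open_D: "open D" and bounded_D: "bounded D"
begin

lemma D_sets[simp, measurable]: "D \<in> sets lebesgue"
  using open_D by (simp add: borel_open)

lemma AE_lebesgue_on: "(AE x in lebesgue_on D. P x) \<longleftrightarrow> (AE x in lebesgue. x \<in> D \<longrightarrow> P x)"
  by (rule AE_restrict_space_iff) simp

lemma Linf_measurable[measurable (raw)]: "\<phi> \<in> Linf D \<Longrightarrow> (\<lambda>x. indicator D x * \<phi> x) \<in> borel_measurable lebesgue"
  using borel_measurable_restrict_space_iff[of D lebesgue \<phi>] by (simp add: Linf_def)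

lemma AE_bdd_on: "bdd_on D \<phi> c \<Longrightarrow> AE x in lebesgue. x \<in> D \<longrightarrow> \<bar>\<phi> x\<bar> \<le> c"
  by (simp add: bdd_on_def AE_lebesgue_on)

lemma sqi_Mul:
  assumes \<phi>: "\<phi> \<in> Linf D" and g: "g \<in> square_integrable"
  shows "(\<lambda>x. (indicator D x * \<phi> x) *\<^sub>R g x) \<in> square_integrable"
proof -
  have [measurable]: "g \<in> borel_measurable lebesgue" using g by (simp add: square_integrable_def)
  note [measurable] = Linf_measurable[OF \<phi>]
  obtain c where c: "bdd_on D \<phi> c" using \<phi> Linf_iff by blast
  have "integrable lebesgue (\<lambda>x. (norm ((indicator D x * \<phi> x) *\<^sub>R g x))\<^sup>2)"
  proof (rule Bochner_Integration.integrable_bound)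
    show "integrable lebesgue (\<lambda>x. c\<^sup>2 * (norm (g x))\<^sup>2)" using g by (simp add: square_integrable_def)
    show "AE x in lebesgue. norm ((norm ((indicator D x * \<phi> x) *\<^sub>R g x))\<^sup>2) \<le> norm (c\<^sup>2 * (norm (g x))\<^sup>2)"
      using AE_bdd_on[OF c]
    proof eventually_elim
      fix x assume "x \<in> D \<longrightarrow> \<bar>\<phi> x\<bar> \<le> c"
      then have "\<bar>indicator D x * \<phi> x\<bar> \<le> \<bar>c\<bar>" by (auto simp: indicator_def)
      then have "(indicator D x * \<phi> x)\<^sup>2 \<le> c\<^sup>2" by (simp add: abs_le_square_iff)
      then show "norm ((norm ((indicator D x * \<phi> x) *\<^sub>R g x))\<^sup>2) \<le> norm (c\<^sup>2 * (norm (g x))\<^sup>2)"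
        by (simp add: power_mult_distrib mult_right_mono)
    qed
  qed measurable
  then show ?thesis by (simp add: square_integrable_def)
qed

lemma
  assumes \<phi>: "\<phi> \<in> Linf D"
  shows bounded_linear_Mul: "bounded_linear (\<lambda>g :: ('a, 'b::euclidean_space) L2. abs_L2 (\<lambda>x. (indicator D x * \<phi> x) *\<^sub>R rep_L2 g x))"
    and norm_Mul_fun: "bdd_on D \<phi> c \<Longrightarrow> 0 \<le> c \<Longrightarrow>
      norm (abs_L2 (\<lambda>x. (indicator D x * \<phi> x) *\<^sub>R rep_L2 (g :: ('a, 'b) L2) x)) \<le> c * norm g"
proof -
  let ?M = "\<lambda>g :: ('a, 'b) L2. abs_L2 (\<lambda>x. (indicator D x * \<phi> x) *\<^sub>R rep_L2 g x)"
  note sq = sqi_Mul[OF \<phi> rep_L2_sqi]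
  have rep: "AE x in lebesgue. rep_L2 (?M g) x = (indicator D x * \<phi> x) *\<^sub>R rep_L2 g x" for g :: "('a, 'b) L2"
    by (rule rep_abs_L2[OF sq])
  have nb: "norm (?M g) \<le> c * norm g" if c: "bdd_on D \<phi> c" "0 \<le> c" for c and g :: "('a, 'b) L2"
  proof (rule power2_le_imp_le)
    have i: "integrable lebesgue (\<lambda>x. (norm (rep_L2 g x))\<^sup>2)" using rep_L2_sqi[of g] by (simp add: square_integrable_def)
    have "(norm (?M g))\<^sup>2 = (\<integral>x. (norm ((indicator D x * \<phi> x) *\<^sub>R rep_L2 g x))\<^sup>2 \<partial>lebesgue)"
      by (rule norm_abs_L2[OF sq])
    also have "\<dots> \<le> (\<integral>x. c\<^sup>2 * (norm (rep_L2 g x))\<^sup>2 \<partial>lebesgue)"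
    proof (rule integral_mono_AE)
      show "integrable lebesgue (\<lambda>x. (norm ((indicator D x * \<phi> x) *\<^sub>R rep_L2 g x))\<^sup>2)"
        using sq[of g] by (simp add: square_integrable_def)
      show "AE x in lebesgue. (norm ((indicator D x * \<phi> x) *\<^sub>R rep_L2 g x))\<^sup>2 \<le> c\<^sup>2 * (norm (rep_L2 g x))\<^sup>2"
        using AE_bdd_on[OF c(1)]
      proof eventually_elim
        fix x assume "x \<in> D \<longrightarrow> \<bar>\<phi> x\<bar> \<le> c"
        then have "\<bar>indicator D x * \<phi> x\<bar> \<le> c" using c(2) by (auto simp: indicator_def)
        then have "norm ((indicator D x * \<phi> x) *\<^sub>R rep_L2 g x) \<le> c * norm (rep_L2 g x)"
          by (simp add: mult_right_mono)
        then have "(norm ((indicator D x * \<phi> x) *\<^sub>R rep_L2 g x))\<^sup>2 \<le> (c * norm (rep_L2 g x))\<^sup>2"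
          by (intro power_mono) auto
        then show "(norm ((indicator D x * \<phi> x) *\<^sub>R rep_L2 g x))\<^sup>2 \<le> c\<^sup>2 * (norm (rep_L2 g x))\<^sup>2"
          by (simp only: power_mult_distrib)
      qed
    qed (use i in simp)
    also have "\<dots> = (c * norm g)\<^sup>2"
      using norm_abs_L2[OF rep_L2_sqi[of g]] by (simp add: abs_rep_L2 power_mult_distrib)
    finally show "(norm (?M g))\<^sup>2 \<le> (c * norm g)\<^sup>2" .
    show "0 \<le> c * norm g" using c by simp
  qed
  then show "bdd_on D \<phi> c \<Longrightarrow> 0 \<le> c \<Longrightarrow> norm (?M g) \<le> c * norm g" .
  obtain c where c: "bdd_on D \<phi> c" using \<phi> Linf_iff by blast
  have c': "bdd_on D \<phi> \<bar>c\<bar>" by (rule bdd_on_mono[OF c]) simp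
  show "bounded_linear ?M"
  proof (rule bounded_linear_intro)
    fix f g :: "('a, 'b) L2" and r :: real
    show "?M (f + g) = ?M f + ?M g"
      by (rule L2_eqI) (use rep[of f] rep[of g] rep[of "f + g"] rep_L2_add[of f g] rep_L2_add[of "?M f" "?M g"] in
        \<open>eventually_elim, simp add: scaleR_add_right\<close>)
    show "?M (r *\<^sub>R f) = r *\<^sub>R ?M f"
      by (rule L2_eqI) (use rep[of f] rep[of "r *\<^sub>R f"] rep_L2_scaleR[of r f] rep_L2_scaleR[of r "?M f"] in
        \<open>eventually_elim, simp\<close>)
    show "norm (?M f) \<le> norm f * \<bar>c\<bar>" using nb[OF c'] by (simp add: mult.commute)
  qed
qed

lemma Mul_apply: "\<phi> \<in> Linf D \<Longrightarrow> Mul D \<phi> g = abs_L2 (\<lambda>x. (indicator D x * \<phi> x) *\<^sub>R rep_L2 g x)"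
  unfolding Mul_def by (subst bounded_linear_Blinfun_apply) (auto intro: bounded_linear_Mul)

lemma rep_Mul: "\<phi> \<in> Linf D \<Longrightarrow> AE x in lebesgue. rep_L2 (Mul D \<phi> g) x = (indicator D x * \<phi> x) *\<^sub>R rep_L2 g x"
  unfolding Mul_apply by (rule rep_abs_L2[OF sqi_Mul[OF _ rep_L2_sqi]])

lemma norm_Mul: "bdd_on D \<phi> c \<Longrightarrow> 0 \<le> c \<Longrightarrow> norm (Mul D \<phi> :: ('a, 'b::euclidean_space) L2 \<Rightarrow>\<^sub>L ('a, 'b) L2) \<le> c"
proof (rule norm_blinfun_bound)
  assume c: "bdd_on D \<phi> c" "0 \<le> c"
  then have "\<phi> \<in> Linf D" using Linf_iff by blast
  then show "norm (Mul D \<phi> g) \<le> c * norm g" for g :: "('a, 'b) L2" using c by (simp add: Mul_apply norm_Mul_fun)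
qed

lemma Mul_cong:
  assumes "\<phi> \<in> Linf D" "\<theta> \<in> Linf D" "AE x in lebesgue_on D. \<phi> x = \<theta> x"
  shows "Mul D \<phi> = Mul D \<theta>"
proof (rule blinfun_eqI, rule L2_eqI)
  fix g
  show "AE x in lebesgue. rep_L2 (Mul D \<phi> g) x = rep_L2 (Mul D \<theta> g) x"
    using rep_Mul[OF assms(1), of g] rep_Mul[OF assms(2), of g] assms(3)[unfolded AE_lebesgue_on]
    by eventually_elim (auto simp: indicator_def)
qed

lemma Mul_add:
  assumes "\<phi> \<in> Linf D" "\<theta> \<in> Linf D"
  shows "Mul D (\<lambda>x. \<phi> x + \<theta> x) = Mul D \<phi> + Mul D \<theta>"
proof (rule blinfun_eqI, rule L2_eqI)
  fix g
  show "AE x in lebesgue. rep_L2 (Mul D (\<lambda>x. \<phi> x + \<theta> x) g) x = rep_L2 ((Mul D \<phi> + Mul D \<theta>) g) x"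
    using rep_Mul[OF assms(1), of g] rep_Mul[OF assms(2), of g] rep_Mul[OF Linf_add[OF assms], of g]
      rep_L2_add[of "Mul D \<phi> g" "Mul D \<theta> g"]
    by eventually_elim (auto simp: blinfun.add_left algebra_simps)
qed

lemma Mul_scale:
  assumes "\<phi> \<in> Linf D"
  shows "Mul D (\<lambda>x. c * \<phi> x) = c *\<^sub>R Mul D \<phi>"
proof (rule blinfun_eqI, rule L2_eqI)
  fix g
  show "AE x in lebesgue. rep_L2 (Mul D (\<lambda>x. c * \<phi> x) g) x = rep_L2 ((c *\<^sub>R Mul D \<phi>) g) x"
    using rep_Mul[OF assms(1), of g] rep_Mul[OF Linf_mult[OF Linf_const[of c] assms], of g]
      rep_L2_scaleR[of c "Mul D \<phi> g"]
    by eventually_elim (auto simp: blinfun.scaleR_left algebra_simps)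
qed

lemma Mul_diff:
  assumes "\<phi> \<in> Linf D" "\<theta> \<in> Linf D"
  shows "Mul D (\<lambda>x. \<phi> x - \<theta> x) = Mul D \<phi> - (Mul D \<theta> :: ('a, 'b::euclidean_space) L2 \<Rightarrow>\<^sub>L ('a, 'b) L2)"
proof -
  have "Mul D (\<lambda>x. \<phi> x + (-1) * \<theta> x) = Mul D \<phi> + (Mul D (\<lambda>x. (-1) * \<theta> x) :: ('a, 'b) L2 \<Rightarrow>\<^sub>L ('a, 'b) L2)"
    by (rule Mul_add) (use assms in auto)
  also have "Mul D (\<lambda>x. (-1) * \<theta> x) = (-1) *\<^sub>R (Mul D \<theta> :: ('a, 'b) L2 \<Rightarrow>\<^sub>L ('a, 'b) L2)"
    by (rule Mul_scale[OF assms(2)])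
  finally show ?thesis by simp
qed

lemma Mul_zero: "Mul D (\<lambda>x. 0) = 0"
  using Mul_scale[OF Linf_const[of 0], of 0] by simp

lemma Mul_sum:
  assumes "finite J" "\<And>i. i \<in> J \<Longrightarrow> \<phi> i \<in> Linf D"
  shows "Mul D (\<lambda>x. \<Sum>i\<in>J. \<phi> i x) = (\<Sum>i\<in>J. Mul D (\<phi> i))"
  using assms by (induction J rule: finite_induct) (auto simp: Mul_add Mul_zero Linf_sum)

lemma Mul_mult:
  assumes "\<phi> \<in> Linf D" "\<theta> \<in> Linf D"
  shows "Mul D (\<lambda>x. \<phi> x * \<theta> x) = Mul D \<phi> o\<^sub>L Mul D \<theta>"
proof (rule blinfun_eqI, rule L2_eqI)
  fix g
  show "AE x in lebesgue. rep_L2 (Mul D (\<lambda>x. \<phi> x * \<theta> x) g) x = rep_L2 ((Mul D \<phi> o\<^sub>L Mul D \<theta>) g) x"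
    using rep_Mul[OF assms(1), of "Mul D \<theta> g"] rep_Mul[OF assms(2), of g] rep_Mul[OF Linf_mult[OF assms], of g]
    by eventually_elim (auto simp: indicator_def)
qed

lemma Mul_dist:
  assumes "\<phi> \<in> Linf D" "\<theta> \<in> Linf D" "bdd_on D (\<lambda>x. \<phi> x - \<theta> x) c" "0 \<le> c"
  shows "norm (Mul D \<phi> - (Mul D \<theta> :: ('a, 'b::euclidean_space) L2 \<Rightarrow>\<^sub>L ('a, 'b) L2)) \<le> c"
  unfolding Mul_diff[OF assms(1,2), symmetric] by (rule norm_Mul[OF assms(3,4)])

lemma inner_Mul_lebesgue:
  assumes "\<phi> \<in> Linf D"
  shows "Mul D \<phi> g \<bullet> h = (\<integral>x. indicator D x * \<phi> x * (rep_L2 g x \<bullet> rep_L2 h x) \<partial>lebesgue)"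
    and "integrable lebesgue (\<lambda>x. indicator D x * \<phi> x * (rep_L2 g x \<bullet> rep_L2 h x))"
proof -
  have "Mul D \<phi> g \<bullet> h = abs_L2 (\<lambda>x. (indicator D x * \<phi> x) *\<^sub>R rep_L2 g x) \<bullet> abs_L2 (rep_L2 h)"
    by (simp add: Mul_apply[OF assms] abs_rep_L2)
  also have "\<dots> = (\<integral>x. ((indicator D x * \<phi> x) *\<^sub>R rep_L2 g x) \<bullet> rep_L2 h x \<partial>lebesgue)"
    by (rule inner_L2.abs_eq) (simp_all add: L2_rel_def rep_L2_sqi sqi_Mul[OF assms])
  finally show "Mul D \<phi> g \<bullet> h = (\<integral>x. indicator D x * \<phi> x * (rep_L2 g x \<bullet> rep_L2 h x) \<partial>lebesgue)" by simp
  show "integrable lebesgue (\<lambda>x. indicator D x * \<phi> x * (rep_L2 g x \<bullet> rep_L2 h x))"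
    using sqi_inner[OF sqi_Mul[OF assms rep_L2_sqi[of g]] rep_L2_sqi[of h]] by simp
qed

lemma inner_Mul:
  assumes "\<phi> \<in> Linf D"
  shows "Mul D \<phi> g \<bullet> h = (\<integral>x. \<phi> x * (rep_L2 g x \<bullet> rep_L2 h x) \<partial>lebesgue_on D)"
  unfolding inner_Mul_lebesgue[OF assms]
  by (subst integral_restrict_space) (auto simp: mult.assoc)

lemma Mul_sym: "\<phi> \<in> Linf D \<Longrightarrow> Mul D \<phi> g \<bullet> h = Mul D \<phi> h \<bullet> g"
  unfolding inner_Mul by (simp add: inner_commute)

lemma Mul_mono:
  assumes "\<phi> \<in> Linf D" "\<theta> \<in> Linf D" "AE x in lebesgue_on D. \<phi> x \<le> \<theta> x"
  shows "Mul D \<phi> g \<bullet> g \<le> Mul D \<theta> g \<bullet> g"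
  unfolding inner_Mul_lebesgue[OF assms(1)] inner_Mul_lebesgue[OF assms(2)]
proof (rule integral_mono_AE)
  show "AE x in lebesgue. indicator D x * \<phi> x * (rep_L2 g x \<bullet> rep_L2 g x)
      \<le> indicator D x * \<theta> x * (rep_L2 g x \<bullet> rep_L2 g x)"
    using assms(3)[unfolded AE_lebesgue_on]
    by eventually_elim (auto simp: indicator_def intro: mult_right_mono)
qed (rule inner_Mul_lebesgue(2)[OF assms(1)] inner_Mul_lebesgue(2)[OF assms(2)])+

lemma Mul_nonneg:
  assumes "\<phi> \<in> Linf D" "AE x in lebesgue_on D. 0 \<le> \<phi> x"
  shows "0 \<le> Mul D \<phi> g \<bullet> g"
  using Mul_mono[of "\<lambda>x. 0" \<phi> g] assms by (simp add: Mul_zero)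

text \<open>Young's inequality is applied under the integral, with the weight kept as a function of
  x. \<open>taylor_bound\<close> can therefore add the weights of all \<kappa> at a fixed x before
  bounding them, which is where finite overlap counts.\<close>

lemma Mul_abs_le:
  assumes "\<phi> \<in> Linf D" "\<theta> \<in> Linf D" "AE x in lebesgue_on D. \<bar>\<phi> x\<bar> \<le> \<theta> x"
  shows "\<bar>Mul D \<phi> g \<bullet> h\<bar> \<le> (Mul D \<theta> g \<bullet> g + Mul D \<theta> h \<bullet> h) / 2"
proof -
  note [simp] = inner_Mul_lebesgue(2)[OF assms(1)] inner_Mul_lebesgue(2)[OF assms(2)]
  have pt: "\<bar>a * (v \<bullet> w)\<bar> \<le> (b * (v \<bullet> v) + b * (w \<bullet> w)) / 2" if "\<bar>a\<bar> \<le> b" for a b :: real and v w :: 'b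
  proof -
    have "0 \<le> (v - w) \<bullet> (v - w)" "0 \<le> (v + w) \<bullet> (v + w)" by (rule inner_ge_zero)+
    then have "\<bar>v \<bullet> w\<bar> \<le> (v \<bullet> v + w \<bullet> w) / 2"
      by (simp add: inner_add inner_diff inner_commute abs_le_iff)
    then have "\<bar>a\<bar> * \<bar>v \<bullet> w\<bar> \<le> b * ((v \<bullet> v + w \<bullet> w) / 2)" using that by (intro mult_mono) auto
    then show ?thesis by (simp add: abs_mult algebra_simps add_divide_distrib)
  qed
  have "\<bar>Mul D \<phi> g \<bullet> h\<bar> \<le> (\<integral>x. \<bar>indicator D x * \<phi> x * (rep_L2 g x \<bullet> rep_L2 h x)\<bar> \<partial>lebesgue)"
    unfolding inner_Mul_lebesgue[OF assms(1)] by (rule integral_abs_bound)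
  also have "\<dots> \<le> (\<integral>x. (indicator D x * \<theta> x * (rep_L2 g x \<bullet> rep_L2 g x) + indicator D x * \<theta> x * (rep_L2 h x \<bullet> rep_L2 h x)) / 2 \<partial>lebesgue)"
  proof (rule integral_mono_AE)
    show "AE x in lebesgue. \<bar>indicator D x * \<phi> x * (rep_L2 g x \<bullet> rep_L2 h x)\<bar>
      \<le> (indicator D x * \<theta> x * (rep_L2 g x \<bullet> rep_L2 g x) + indicator D x * \<theta> x * (rep_L2 h x \<bullet> rep_L2 h x)) / 2"
      using assms(3)[unfolded AE_lebesgue_on]
      by eventually_elim (intro pt, auto simp: indicator_def)
  qed auto
  also have "\<dots> = (Mul D \<theta> g \<bullet> g + Mul D \<theta> h \<bullet> h) / 2"
    unfolding inner_Mul_lebesgue[OF assms(2)] by simp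
  finally show ?thesis .
qed

text \<open>Gradients of test functions vanish off D, and the condition is closed. Through it a
  quadratic form over D controls the norm, which integrates over the whole space.\<close>

lemma gradient_eq_0_outside:
  assumes "v \<in> H10 D"
  shows "Mul D (\<lambda>x. 1) (snd v) = snd v"
proof -
  have cl: "closed {v :: 'a H1. Mul D (\<lambda>x. 1) (snd v) = snd v}"
    by (intro closed_Collect_eq continuous_intros)
  have "H10 D \<subseteq> {v. Mul D (\<lambda>x. 1) (snd v) = snd v}"
    unfolding H10_def
  proof (rule closure_minimal[OF _ cl], safe)
    fix \<phi> assume \<phi>: "\<phi> \<in> test_functions D"
    let ?K = "closure {x. \<phi> x \<noteq> 0}"
    have z: "gradient \<phi> x = 0" if x: "x \<notin> D" for x
    proof -
      have x: "x \<in> - ?K" using \<phi> x by (auto simp: test_functions_def)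
      have "(\<phi> has_derivative (\<lambda>h. 0)) (at x)"
      proof (rule has_derivative_transform_within_open)
        show "((\<lambda>x. 0) has_derivative (\<lambda>h. 0)) (at x)" by simp
        show "open (- ?K)" by (rule open_Compl) simp
        show "x \<in> - ?K" using x by blast
        show "0 = \<phi> w" if "w \<in> - ?K" for w using that closure_subset[of "{x. \<phi> x \<noteq> 0}"] by auto
      qed
      then have "frechet_derivative \<phi> (at x) = (\<lambda>h. 0)" by (rule frechet_derivative_at[symmetric])
      then show "gradient \<phi> x = 0" by (simp add: gradient_def)
    qed
    have "AE x in lebesgue. rep_L2 (Mul D (\<lambda>x. 1) (abs_L2 (gradient \<phi>))) x = rep_L2 (abs_L2 (gradient \<phi>)) x"
      using rep_Mul[OF Linf_const[of 1], of "abs_L2 (gradient \<phi>)"] rep_abs_L2[OF test_functions_sqi(2)[OF \<phi>]]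
      by eventually_elim (auto simp: z indicator_def)
    then show "Mul D (\<lambda>x. 1) (snd (abs_L2 \<phi>, abs_L2 (gradient \<phi>))) = snd (abs_L2 \<phi>, abs_L2 (gradient \<phi>))"
      by (simp add: L2_eqI)
  qed
  then show ?thesis using assms by blast
qed

lemma Mul_coercive:
  assumes "v \<in> H10 D" "a \<in> Linf D" "AE x in lebesgue_on D. c \<le> a x"
  shows "c * (V_norm v)\<^sup>2 \<le> Mul D a (snd v) \<bullet> snd v"
proof -
  have "Mul D (\<lambda>x. c) (snd v) \<bullet> snd v = c * (V_norm v)\<^sup>2"
  proof -
    have "Mul D (\<lambda>x. c * 1) = c *\<^sub>R (Mul D (\<lambda>x. 1) :: ('a, 'a) L2 \<Rightarrow>\<^sub>L ('a, 'a) L2)"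
      by (rule Mul_scale) simp
    then show ?thesis using gradient_eq_0_outside[OF assms(1)]
      by (simp add: blinfun.scaleR_left V_norm_def power2_norm_eq_inner)
  qed
  then show ?thesis using Mul_mono[OF Linf_const assms(2,3), of "snd v"] by simp
qed

section \<open>The elliptic problem and its solution operator\<close>

definition poincare_const :: real where
  "poincare_const = (SOME K. K \<ge> 0 \<and> (\<forall>v\<in>H10 D. norm (fst v) \<le> K * V_norm v))"

lemma poincare_const: "poincare_const \<ge> 0" "v \<in> H10 D \<Longrightarrow> norm (fst v) \<le> poincare_const * V_norm v"
  using someI_ex[of "\<lambda>K. K \<ge> 0 \<and> (\<forall>v\<in>H10 D. norm (fst v) \<le> K * V_norm v)"] poincare_H10[OF bounded_D]
  unfolding poincare_const_def by auto

lemma norm_H10_le: "v \<in> H10 D \<Longrightarrow> norm v \<le> (poincare_const + 1) * V_norm v"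
  using norm_Pair_le[of "fst v" "snd v"] poincare_const(2)[of v] by (simp add: V_norm_def algebra_simps)

lemma V_norm_le: "V_norm v \<le> norm v"
  unfolding V_norm_def using norm_snd_le[of "snd v" "fst v"] by simp

lemma H10_add: "v \<in> H10 D \<Longrightarrow> w \<in> H10 D \<Longrightarrow> v + w \<in> H10 D"
  by (rule subspace_add[OF H10_subspace])

lemma H10_diff: "v \<in> H10 D \<Longrightarrow> w \<in> H10 D \<Longrightarrow> v - w \<in> H10 D"
  by (rule subspace_diff[OF H10_subspace])

lemma H10_scale: "v \<in> H10 D \<Longrightarrow> r *\<^sub>R v \<in> H10 D"
  by (rule subspace_scale[OF H10_subspace])

lemma H10_closed: "closed (H10 D)"
  by (simp add: H10_def)

text \<open>The right-hand side is a vector field h acting on v by its inner product with the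
  gradient; \<open>riesz_H_minus1\<close> represents every functional of \<open>H_minus1 D\<close>
  in this way. With data in a Hilbert space the solution operator is a bounded linear map.\<close>

definition solves :: "('a \<Rightarrow> real) \<Rightarrow> ('a, 'a) L2 \<Rightarrow> 'a H1 \<Rightarrow> bool" where
  "solves a h w \<longleftrightarrow> w \<in> H10 D \<and> (\<forall>v\<in>H10 D. Mul D a (snd w) \<bullet> snd v = h \<bullet> snd v)"

definition elliptic :: "('a \<Rightarrow> real) \<Rightarrow> real \<Rightarrow> bool" where
  "elliptic a c \<longleftrightarrow> a \<in> Linf D \<and> 0 < c \<and> (AE x in lebesgue_on D. c \<le> a x)"

lemma elliptic_form_exists:
  assumes a: "elliptic a c"
    and ladd: "\<And>v w. v \<in> H10 D \<Longrightarrow> w \<in> H10 D \<Longrightarrow> l (v + w) = l v + l w"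
    and lsc: "\<And>r v. v \<in> H10 D \<Longrightarrow> l (r *\<^sub>R v) = r * l v"
    and lb: "\<And>v. v \<in> H10 D \<Longrightarrow> \<bar>l v\<bar> \<le> K * V_norm v"
  shows "\<exists>w\<in>H10 D. \<forall>v\<in>H10 D. Mul D a (snd w) \<bullet> snd v = l v"
proof (rule lax_milgram_symmetric[OF _ _ H10_subspace H10_closed _ _ ladd lsc])
  have aL: "a \<in> Linf D" using a by (simp add: elliptic_def)
  show "bounded_bilinear (\<lambda>w v :: 'a H1. Mul D a (snd w) \<bullet> snd v)"
    by (rule bounded_bilinear.comp[OF bounded_bilinear_inner])
      (auto intro!: bounded_linear_intros)
  show "Mul D a (snd v) \<bullet> snd w = Mul D a (snd w) \<bullet> snd v" for v w :: "'a H1" by (rule Mul_sym[OF aL])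
  \<comment> \<open>Converts coercivity in \<open>V_norm\<close> into coercivity in the norm of the
    pair, by Poincare's inequality.\<close>
  define p where "p = (poincare_const + 1)\<^sup>2"
  have p: "p > 0" using poincare_const(1) by (simp add: p_def add_nonneg_eq_0_iff zero_less_power2)
  show "0 < c / p" using a p by (simp add: elliptic_def)
  show "c / p * (norm v)\<^sup>2 \<le> Mul D a (snd v) \<bullet> snd v" if v: "v \<in> H10 D" for v
  proof -
    have "(norm v)\<^sup>2 \<le> p * (V_norm v)\<^sup>2"
      using power_mono[OF norm_H10_le[OF v] norm_ge_zero, of 2] by (simp add: p_def power_mult_distrib)
    then have "c / p * (norm v)\<^sup>2 \<le> c / p * (p * (V_norm v)\<^sup>2)"
      using \<open>0 < c / p\<close> by (intro mult_left_mono) auto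
    also have "\<dots> = c * (V_norm v)\<^sup>2" using p by simp
    also have "\<dots> \<le> Mul D a (snd v) \<bullet> snd v" using a v by (intro Mul_coercive) (auto simp: elliptic_def)
    finally show ?thesis .
  qed
  show "\<bar>l v\<bar> \<le> \<bar>K\<bar> * norm v" if "v \<in> H10 D" for v
    using lb[OF that] by (rule order_trans) (intro mult_mono V_norm_le, auto simp: V_norm_def)
qed

lemma solves_diff: "solves a h w \<Longrightarrow> solves a h' w' \<Longrightarrow> solves a (h - h') (w - w')"
  unfolding solves_def using H10_diff
  by (simp add: blinfun.diff_right inner_diff_left)

text \<open>Test with w itself; one factor \<open>V_norm w\<close> cancels unless it is 0.\<close>

lemma solves_bound:
  assumes a: "elliptic a c" and w: "solves a h w"
  shows "V_norm w \<le> norm h / c"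
proof -
  have wH: "w \<in> H10 D" using w by (simp add: solves_def)
  have c: "c > 0" using a by (simp add: elliptic_def)
  have "c * (V_norm w)\<^sup>2 \<le> Mul D a (snd w) \<bullet> snd w" using a wH by (intro Mul_coercive) (auto simp: elliptic_def)
  also have "\<dots> = h \<bullet> snd w" using w wH by (simp add: solves_def)
  also have "\<dots> \<le> norm h * V_norm w" unfolding V_norm_def by (rule norm_cauchy_schwarz)
  finally have "(c * V_norm w) * V_norm w \<le> norm h * V_norm w" by (simp add: power2_eq_square mult.assoc)
  then have "c * V_norm w \<le> norm h \<or> V_norm w = 0"
    using mult_right_le_imp_le[of "c * V_norm w" "V_norm w" "norm h"] by (force simp: V_norm_def)
  then show ?thesis using c by (auto simp: field_simps)
qed

lemma solves_unique:
  assumes a: "elliptic a c" and w: "solves a h w" and w': "solves a h w'"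
  shows "w = w'"
proof -
  have s: "solves a 0 (w - w')" using solves_diff[OF w w'] by simp
  then have "V_norm (w - w') \<le> 0" using solves_bound[OF a] by fastforce
  moreover have "V_norm (w - w') \<ge> 0" by (simp add: V_norm_def)
  ultimately have "norm (w - w') \<le> 0" using norm_H10_le[of "w - w'"] s by (simp add: solves_def)
  then show ?thesis by simp
qed

definition Sol :: "('a \<Rightarrow> real) \<Rightarrow> ('a, 'a) L2 \<Rightarrow>\<^sub>L 'a H1" where
  "Sol a = Blinfun (\<lambda>h. THE w. solves a h w)"

lemma Sol_apply:
  assumes a: "elliptic a c"
  shows "solves a h (Sol a h)" "norm (Sol a) \<le> (poincare_const + 1) / c"
proof -
  have c: "c > 0" using a by (simp add: elliptic_def)
  have ex: "\<exists>!w. solves a h w" for h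
  proof -
    have "\<exists>w\<in>H10 D. \<forall>v\<in>H10 D. Mul D a (snd w) \<bullet> snd v = h \<bullet> snd v"
      by (rule elliptic_form_exists[OF a, where K = "norm h"])
        (auto simp: inner_add_right V_norm_def Cauchy_Schwarz_ineq2)
    then show ?thesis using solves_unique[OF a] unfolding solves_def by blast
  qed
  define s where "s h = (THE w. solves a h w)" for h
  have s: "solves a h (s h)" for h unfolding s_def by (rule theI'[OF ex])
  have sb: "norm (s h) \<le> (poincare_const + 1) / c * norm h" for h
  proof -
    have "norm (s h) \<le> (poincare_const + 1) * V_norm (s h)"
      using s[of h] by (intro norm_H10_le) (simp add: solves_def)
    also have "\<dots> \<le> (poincare_const + 1) * (norm h / c)"
      using solves_bound[OF a s] poincare_const(1) by (intro mult_left_mono) auto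
    finally show ?thesis by simp
  qed
  have bl: "bounded_linear s"
  proof (rule bounded_linear_intro)
    fix h h' :: "('a, 'a) L2" and r :: real
    have "solves a (h + h') (s h + s h')"
      using s[of h] s[of h'] H10_add by (simp add: solves_def blinfun.add_right inner_add_left)
    then show "s (h + h') = s h + s h'" using solves_unique[OF a s] by blast
    have "solves a (r *\<^sub>R h) (r *\<^sub>R s h)"
      using s[of h] H10_scale by (simp add: solves_def blinfun.scaleR_right)
    then show "s (r *\<^sub>R h) = r *\<^sub>R s h" using solves_unique[OF a s] by blast
    show "norm (s h) \<le> norm h * ((poincare_const + 1) / c)" using sb[of h] by (simp add: mult.commute)
  qed
  have eq: "Sol a h = s h" for h unfolding Sol_def s_def[abs_def, symmetric]
    by (simp add: bounded_linear_Blinfun_apply[OF bl])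
  show "solves a h (Sol a h)" unfolding eq by (rule s)
  show "norm (Sol a) \<le> (poincare_const + 1) / c"
    using c poincare_const(1) sb by (intro norm_blinfun_bound) (auto simp: eq)
qed

lemma Sol_H10: "elliptic a c \<Longrightarrow> Sol a h \<in> H10 D"
  using Sol_apply(1) by (auto simp: solves_def)

lemma Sol_eqI: "elliptic a c \<Longrightarrow> solves a h w \<Longrightarrow> Sol a h = w"
  using Sol_apply(1) solves_unique by blast

text \<open>The second resolvent identity: the solution w for a' also solves the problem for a, with
  the datum changed by the difference of the multiplication operators applied to its gradient. Both
  continuity and differentiability in the coefficient come from it.\<close>

lemma Sol_diff:
  assumes a: "elliptic a c" and a': "elliptic a' c'"
  shows "Sol a - Sol a' = - (Sol a o\<^sub>L ((Mul D a - Mul D a') o\<^sub>L (Blinfun snd o\<^sub>L Sol a')))"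
proof (rule blinfun_eqI)
  fix h
  define w where "w = Sol a' h"
  have w: "solves a' h w" unfolding w_def by (rule Sol_apply(1)[OF a'])
  have "solves a (h + (Mul D a - Mul D a') (snd w)) w"
    using w by (auto simp: solves_def blinfun.diff_left inner_diff_left inner_add_left)
  then have "Sol a (h + (Mul D a - Mul D a') (snd w)) = w" by (rule Sol_eqI[OF a])
  then have "Sol a h - w = - Sol a ((Mul D a - Mul D a') (snd w))"
    by (simp add: blinfun.add_right algebra_simps)
  then show "(Sol a - Sol a') h = (- (Sol a o\<^sub>L ((Mul D a - Mul D a') o\<^sub>L (Blinfun snd o\<^sub>L Sol a')))) h"
    by (simp add: w_def blinfun.diff_left blinfun.minus_left bounded_linear_Blinfun_apply[OF bounded_linear_snd])
qed

end

text \<open>Expansions of exp and of resolvents provide quadratic remainders, and such remainders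
  combine by plain multiplication of operator norms.\<close>

lemma has_vector_derivative_quadratic:
  fixes f :: "real \<Rightarrow> 'b::real_normed_vector"
  assumes "\<And>t. \<bar>t - s\<bar> \<le> 1 \<Longrightarrow> norm (f t - f s - (t - s) *\<^sub>R d) \<le> C * (t - s)\<^sup>2"
  shows "(f has_vector_derivative d) (at s)"
  unfolding has_vector_derivative_def has_derivative_at_within
proof (intro conjI)
  show "bounded_linear (\<lambda>x. x *\<^sub>R d)" by (rule bounded_linear_scaleR_left)
  show "((\<lambda>y. (f y - f s - (y - s) *\<^sub>R d) /\<^sub>R norm (y - s)) \<longlongrightarrow> 0) (at s)"
  proof (rule Lim_null_comparison)
    show "\<forall>\<^sub>F y in at s. norm ((f y - f s - (y - s) *\<^sub>R d) /\<^sub>R norm (y - s)) \<le> \<bar>C\<bar> * \<bar>y - s\<bar>"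
      unfolding eventually_at
    proof (intro exI[of _ 1] conjI ballI impI)
      fix y assume y: "y \<noteq> s \<and> dist y s < 1"
      have "norm (f y - f s - (y - s) *\<^sub>R d) \<le> C * (y - s)\<^sup>2" using y by (intro assms) (simp add: dist_real_def)
      also have "\<dots> \<le> \<bar>C\<bar> * (y - s)\<^sup>2" by (intro mult_right_mono) auto
      also have "\<dots> = (\<bar>C\<bar> * \<bar>y - s\<bar>) * \<bar>y - s\<bar>" by (simp add: power2_eq_square)
      finally show "norm ((f y - f s - (y - s) *\<^sub>R d) /\<^sub>R norm (y - s)) \<le> \<bar>C\<bar> * \<bar>y - s\<bar>"
        using y by (simp add: divide_inverse_commute[symmetric] pos_divide_le_eq)
    qed auto
    have "((\<lambda>y. \<bar>C\<bar> * \<bar>y - s\<bar>) \<longlongrightarrow> \<bar>C\<bar> * \<bar>s - s\<bar>) (at s)" by (intro tendsto_intros)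
    then show "((\<lambda>y. \<bar>C\<bar> * \<bar>y - s\<bar>) \<longlongrightarrow> 0) (at s)" by simp
  qed
qed

section \<open>Taylor coefficients of the solution\<close>

lemma exp_taylor_quadratic: "\<bar>exp z - 1 - z\<bar> \<le> z\<^sup>2 * exp \<bar>z\<bar>" for z :: real
proof -
  obtain t where t: "\<bar>t\<bar> \<le> \<bar>z\<bar>" "exp z = (\<Sum>m<2. z ^ m / fact m) + exp t / fact 2 * z ^ 2"
    using Maclaurin_exp_le[of z 2] by blast
  have "exp z - 1 - z = exp t / 2 * z\<^sup>2" using t(2) by (simp add: numeral_2_eq_2)
  then have "\<bar>exp z - 1 - z\<bar> = \<bar>exp t / 2 * z\<^sup>2\<bar>" by (rule arg_cong)
  also have "\<dots> = exp t / 2 * z\<^sup>2" by simp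
  also have "\<dots> \<le> exp \<bar>z\<bar> * z\<^sup>2"
  proof (intro mult_right_mono)
    have "exp t \<le> exp \<bar>z\<bar>" using t(1) by simp
    then show "exp t / 2 \<le> exp \<bar>z\<bar>" using exp_gt_zero[of t] by linarith
  qed simp
  finally show ?thesis by (simp add: mult.commute)
qed

locale pde_family = pde_domain +
  fixes \<psi> :: "nat \<Rightarrow> 'a \<Rightarrow> real"
  assumes \<psi>: "\<And>j. \<psi> j \<in> Linf D"
begin

text \<open>The Taylor coefficient at s = 0 of exp of the sum of s_j \<psi>_j: the diffusion
  coefficient a has the Taylor coefficients \<open>monom_fn \<kappa>\<close> times a.\<close>

definition monom_fn :: "(nat \<Rightarrow> nat) \<Rightarrow> 'a \<Rightarrow> real" where
  "monom_fn \<kappa> x = index_pow (\<lambda>j. \<psi> j x) \<kappa> / index_fact \<kappa>"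

definition Pop :: "(nat \<Rightarrow> nat) \<Rightarrow> ('a, 'a) L2 \<Rightarrow>\<^sub>L ('a, 'a) L2" where
  "Pop \<kappa> = Mul D (monom_fn \<kappa>)"

definition Aop :: "('a \<Rightarrow> real) \<Rightarrow> ('a, 'a) L2 \<Rightarrow>\<^sub>L ('a, 'a) L2" where
  "Aop b = Mul D (\<lambda>x. exp (b x))"

text \<open>The solution operator followed by the gradient. With gradients the whole recursion stays
  in one space, on which the multiplication operators act.\<close>

definition Rop :: "('a \<Rightarrow> real) \<Rightarrow> ('a, 'a) L2 \<Rightarrow>\<^sub>L ('a, 'a) L2" where
  "Rop b = Blinfun snd o\<^sub>L Sol (\<lambda>x. exp (b x))"

text \<open>\<open>taylor b h \<mu>\<close> is the coefficient \<open>\<partial>\<^sup>\<mu>u / \<mu>!\<close> at \<open>b\<close>, obtained by differentiating the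
  weak formulation with the Leibniz rule.\<close>

function (domintros) taylor :: "('a \<Rightarrow> real) \<Rightarrow> ('a, 'a) L2 \<Rightarrow> (nat \<Rightarrow> nat) \<Rightarrow> ('a, 'a) L2" where
  "taylor b h \<mu> = (if \<mu> \<in> multi_indices then
     Rop b ((if \<mu> = (\<lambda>_. 0) then h else 0)
       - (\<Sum>\<kappa>\<in>{\<kappa>. \<kappa> \<le> \<mu> \<and> \<kappa> \<noteq> (\<lambda>_. 0)}. Pop \<kappa> (Aop b (taylor b h (\<mu> - \<kappa>))))) else 0)"
  by auto
termination
\<comment> \<open>Subtracting \<kappa> \<noteq> 0 lowers the total degree. The guard \<mu> \<in>
  \<open>multi_indices\<close> in the recursion supplies the finite support that makes the degree
  meaningful.\<close>
proof (relation "Wellfounded.measure (\<lambda>(b, h, \<mu>). degree_of \<mu>)")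
  show "((b, h, \<mu> - \<kappa>), b, h, \<mu>) \<in> Wellfounded.measure (\<lambda>(b, h, \<mu>). degree_of \<mu>)"
    if "\<mu> \<in> multi_indices" "\<kappa> \<in> {\<kappa>. \<kappa> \<le> \<mu> \<and> \<kappa> \<noteq> (\<lambda>_. 0)}" for b :: "'a \<Rightarrow> real" and h :: "('a, 'a) L2" and \<mu> \<kappa>
    using that degree_of_diff_less by (auto simp: multi_indices_def)
qed auto

declare taylor.simps[simp del]

lemma monom_fn_Linf: "monom_fn \<kappa> \<in> Linf D"
  unfolding monom_fn_def index_pow_def using \<psi> by (intro Linf_divide Linf_prod Linf_power)

lemma elliptic_exp:
  assumes "bdd_on D b B"
  shows "elliptic (\<lambda>x. exp (b x)) (exp (- B))"
proof -
  have "AE x in lebesgue_on D. exp (- B) \<le> exp (b x)"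
    using assms unfolding bdd_on_def by (auto elim!: eventually_mono)
  moreover have "b \<in> Linf D" using assms Linf_iff by blast
  ultimately show ?thesis by (auto simp: elliptic_def)
qed

lemma norm_Aop: "bdd_on D b B \<Longrightarrow> norm (Aop b) \<le> exp B"
  unfolding Aop_def by (intro norm_Mul bdd_on_exp) auto

lemma norm_Blinfun_snd: "norm (Blinfun snd :: ('b::real_normed_vector \<times> 'c::real_normed_vector) \<Rightarrow>\<^sub>L 'c) \<le> 1"
  by (rule norm_blinfun_bound)
    (auto simp: bounded_linear_Blinfun_apply[OF bounded_linear_snd] norm_snd_le split: prod.split)

lemma norm_Rop:
  assumes "bdd_on D b B"
  shows "norm (Rop b) \<le> (poincare_const + 1) * exp B"
proof -
  have "norm (Rop b) \<le> norm (Blinfun snd :: 'a H1 \<Rightarrow>\<^sub>L ('a, 'a) L2) * norm (Sol (\<lambda>x. exp (b x)))"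
    unfolding Rop_def by (rule norm_blinfun_compose)
  also have "\<dots> \<le> 1 * ((poincare_const + 1) / exp (- B))"
    by (intro mult_mono norm_Blinfun_snd Sol_apply(2)[OF elliptic_exp[OF assms]]) auto
  finally show ?thesis by (simp add: exp_minus field_simps)
qed

lemma Rop_diff:
  assumes "b \<in> Linf D" "b' \<in> Linf D"
  shows "Rop b - Rop b' = - (Rop b o\<^sub>L ((Aop b - Aop b') o\<^sub>L Rop b'))"
proof -
  obtain B B' where B: "bdd_on D b B" "bdd_on D b' B'" using assms Linf_iff by metis
  note d = Sol_diff[OF elliptic_exp[OF B(1)] elliptic_exp[OF B(2)]]
  show ?thesis
  proof (rule blinfun_eqI)
    fix h
    show "(Rop b - Rop b') h = (- (Rop b o\<^sub>L ((Aop b - Aop b') o\<^sub>L Rop b'))) h"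
      using arg_cong[OF d, of "\<lambda>T. Blinfun snd (T h)"]
      by (simp add: Rop_def Aop_def blinfun.diff_left blinfun.diff_right blinfun.minus_left blinfun.minus_right)
  qed
qed

section \<open>Differentiation along one coordinate\<close>

definition unit_index :: "nat \<Rightarrow> nat \<Rightarrow> nat" where "unit_index j = (\<lambda>_. 0)(j := 1)"

lemma monom_e: "monom_fn (unit_index j) = \<psi> j"
proof -
  have "{i. unit_index j i \<noteq> 0} = {j}" by (auto simp: unit_index_def)
  then show ?thesis by (auto simp: fun_eq_iff monom_fn_def index_pow_def index_fact_def unit_index_def)
qed

text \<open>Raising \<kappa>_j multiplies \<kappa>! by \<kappa>_j + 1. These integers are the ones
  that \<open>sum_lower_Suc\<close> collects.\<close>

lemma monom_mult_psi:
  assumes "finite {i. \<kappa> i \<noteq> 0}"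
  shows "monom_fn \<kappa> x * \<psi> j x = real (Suc (\<kappa> j)) * monom_fn (\<kappa>(j := Suc (\<kappa> j))) x"
proof -
  let ?S = "insert j {i. \<kappa> i \<noteq> 0}"
  have S: "finite ?S" "{i. \<kappa> i \<noteq> 0} \<subseteq> ?S" "{i. (\<kappa>(j := Suc (\<kappa> j))) i \<noteq> 0} \<subseteq> ?S" using assms by auto
  have p: "index_pow (\<lambda>j. \<psi> j x) (\<kappa>(j := Suc (\<kappa> j))) = \<psi> j x * index_pow (\<lambda>j. \<psi> j x) \<kappa>"
    unfolding index_pow_superset[OF S(1,2)] index_pow_superset[OF S(1,3)]
    using S(1) by (subst (1 2) prod.remove[of _ j]) (auto intro!: prod.cong)
  have f: "index_fact (\<kappa>(j := Suc (\<kappa> j))) = real (Suc (\<kappa> j)) * index_fact \<kappa>"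
    unfolding index_fact_superset[OF S(1,2)] index_fact_superset[OF S(1,3)]
    using S(1) by (subst (1 2) prod.remove[of _ j]) (auto intro!: prod.cong simp: algebra_simps)
  have "real (Suc (\<kappa> j)) > 0" by simp
  then show ?thesis unfolding monom_fn_def p f using index_fact_pos[of \<kappa>] by (simp add: field_simps del: of_nat_Suc)
qed

lemma Pop_psi:
  assumes "finite {i. \<kappa> i \<noteq> 0}"
  shows "Pop \<kappa> o\<^sub>L Mul D (\<psi> j) = real (Suc (\<kappa> j)) *\<^sub>R Pop (\<kappa>(j := Suc (\<kappa> j)))"
proof -
  have "Pop \<kappa> o\<^sub>L Mul D (\<psi> j) = Mul D (\<lambda>x. monom_fn \<kappa> x * \<psi> j x)"
    unfolding Pop_def by (rule Mul_mult[symmetric, OF monom_fn_Linf \<psi>])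
  also have "\<dots> = Mul D (\<lambda>x. real (Suc (\<kappa> j)) * monom_fn (\<kappa>(j := Suc (\<kappa> j))) x)"
    by (simp only: monom_mult_psi[OF assms])
  also have "\<dots> = real (Suc (\<kappa> j)) *\<^sub>R Pop (\<kappa>(j := Suc (\<kappa> j)))"
    unfolding Pop_def by (rule Mul_scale[OF monom_fn_Linf])
  finally show ?thesis .
qed

abbreviation shift :: "('a \<Rightarrow> real) \<Rightarrow> nat \<Rightarrow> real \<Rightarrow> 'a \<Rightarrow> real" where
  "shift b j s \<equiv> (\<lambda>x. b x + s * \<psi> j x)"

lemma shift_Linf: "b \<in> Linf D \<Longrightarrow> shift b j s \<in> Linf D"
  using \<psi> by (intro Linf_add Linf_mult) auto

text \<open>Pointwise expansion of exp((t - s) \<psi>_j), uniform in x because b and \<psi>_j are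
  essentially bounded. The explicit remainder is recorded as well because
  \<open>Rop_derivative\<close> starts from it.\<close>

lemma Aop_derivative:
  assumes b: "b \<in> Linf D"
  shows "((\<lambda>s. Aop (shift b j s)) has_vector_derivative (Mul D (\<psi> j) o\<^sub>L Aop (shift b j s))) (at s)"
    and "\<exists>C. \<forall>t. \<bar>t - s\<bar> \<le> 1 \<longrightarrow>
      norm (Aop (shift b j t) - Aop (shift b j s) - (t - s) *\<^sub>R (Mul D (\<psi> j) o\<^sub>L Aop (shift b j s))) \<le> C * (t - s)\<^sup>2"
proof -
  obtain B where B: "bdd_on D (shift b j s) B" using shift_Linf[OF b] Linf_iff by blast
  obtain c where "bdd_on D (\<psi> j) c" using \<psi> Linf_iff by blast
  then have c: "bdd_on D (\<psi> j) \<bar>c\<bar>" by (rule bdd_on_mono) simp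
  note bs = shift_Linf[OF b]
  have bound: "norm (Aop (shift b j t) - Aop (shift b j s) - (t - s) *\<^sub>R (Mul D (\<psi> j) o\<^sub>L Aop (shift b j s)))
      \<le> exp B * c\<^sup>2 * exp \<bar>c\<bar> * (t - s)\<^sup>2" if t: "\<bar>t - s\<bar> \<le> 1" for t
  proof -
    let ?f = "\<lambda>x. exp (shift b j t x) - exp (shift b j s x) - (t - s) * (\<psi> j x * exp (shift b j s x))"
    have m1: "(\<lambda>x. \<psi> j x * exp (shift b j s x)) \<in> Linf D" using bs \<psi> by (intro Linf_mult Linf_exp)
    have m2: "(\<lambda>x. (t - s) * (\<psi> j x * exp (shift b j s x))) \<in> Linf D" by (rule Linf_mult[OF Linf_const m1])
    have m3: "(\<lambda>x. exp (shift b j t x) - exp (shift b j s x)) \<in> Linf D" using bs by (intro Linf_diff Linf_exp)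
    have e: "Aop (shift b j t) - Aop (shift b j s) - (t - s) *\<^sub>R (Mul D (\<psi> j) o\<^sub>L Aop (shift b j s)) = Mul D ?f"
      unfolding Aop_def Mul_mult[symmetric, OF \<psi> Linf_exp[OF bs]] Mul_scale[symmetric, OF m1]
        Mul_diff[symmetric, OF Linf_exp[OF bs] Linf_exp[OF bs]] Mul_diff[symmetric, OF m3 m2] ..
    have "bdd_on D ?f (exp B * c\<^sup>2 * exp \<bar>c\<bar> * (t - s)\<^sup>2)"
      unfolding bdd_on_def
    proof (intro conjI)
      show "?f \<in> borel_measurable (lebesgue_on D)" using Linf_diff[OF m3 m2] by (simp add: Linf_def)
      have "AE x in lebesgue_on D. \<bar>shift b j s x\<bar> \<le> B" "AE x in lebesgue_on D. \<bar>\<psi> j x\<bar> \<le> \<bar>c\<bar>"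
        using B c by (auto simp: bdd_on_def)
      then show "AE x in lebesgue_on D. \<bar>?f x\<bar> \<le> exp B * c\<^sup>2 * exp \<bar>c\<bar> * (t - s)\<^sup>2"
      proof eventually_elim
        fix x assume x: "\<bar>shift b j s x\<bar> \<le> B" "\<bar>\<psi> j x\<bar> \<le> \<bar>c\<bar>"
        define z where "z = (t - s) * \<psi> j x"
        define p where "p = exp (shift b j s x)"
        have "shift b j t x = shift b j s x + z" by (simp add: z_def algebra_simps)
        then have "exp (shift b j t x) = p * exp z" by (simp only: exp_add p_def)
        then have "?f x = p * exp z - p - (t - s) * (\<psi> j x * p)" by (simp only: p_def)
        also have "\<dots> = p * (exp z - 1 - z)" by (simp add: z_def algebra_simps)
        finally have "?f x = exp (shift b j s x) * (exp z - 1 - z)" by (simp only: p_def)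
        then have "\<bar>?f x\<bar> = exp (shift b j s x) * \<bar>exp z - 1 - z\<bar>" by (simp add: abs_mult)
        also have "\<dots> \<le> exp B * (z\<^sup>2 * exp \<bar>z\<bar>)"
          using x(1) exp_taylor_quadratic[of z] by (intro mult_mono) auto
        also have "\<dots> \<le> exp B * (((t - s)\<^sup>2 * c\<^sup>2) * exp \<bar>c\<bar>)"
        proof (intro mult_left_mono mult_mono)
          show "z\<^sup>2 \<le> (t - s)\<^sup>2 * c\<^sup>2"
            unfolding z_def power_mult_distrib using x(2) by (intro mult_left_mono) (auto simp: abs_le_square_iff)
          have "\<bar>t - s\<bar> * \<bar>\<psi> j x\<bar> \<le> 1 * \<bar>c\<bar>" using t x(2) by (intro mult_mono) auto
          then show "exp \<bar>z\<bar> \<le> exp \<bar>c\<bar>" by (simp add: z_def abs_mult)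
        qed auto
        finally show "\<bar>?f x\<bar> \<le> exp B * c\<^sup>2 * exp \<bar>c\<bar> * (t - s)\<^sup>2" by (simp add: mult_ac)
      qed
    qed
    then show ?thesis unfolding e by (rule norm_Mul) auto
  qed
  show "((\<lambda>s. Aop (shift b j s)) has_vector_derivative (Mul D (\<psi> j) o\<^sub>L Aop (shift b j s))) (at s)"
    by (rule has_vector_derivative_quadratic[OF bound])
  show "\<exists>C. \<forall>t. \<bar>t - s\<bar> \<le> 1 \<longrightarrow>
      norm (Aop (shift b j t) - Aop (shift b j s) - (t - s) *\<^sub>R (Mul D (\<psi> j) o\<^sub>L Aop (shift b j s))) \<le> C * (t - s)\<^sup>2"
    using bound by blast
qed

text \<open>The derivative of an inverse. By the resolvent identity the remainder splits into R_t
  (A_t - A_s - (t-s) A') R_s, quadratic by the expansion of A, and (R_t - R_s) (t-s) A' R_s,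
  quadratic because R is Lipschitz near s.\<close>

lemma Rop_derivative:
  assumes b: "b \<in> Linf D"
  shows "((\<lambda>s. Rop (shift b j s)) has_vector_derivative
     - (Rop (shift b j s) o\<^sub>L (Mul D (\<psi> j) o\<^sub>L Aop (shift b j s)) o\<^sub>L Rop (shift b j s))) (at s)"
proof -
  define A R A' where "A t = Aop (shift b j t)" and "R t = Rop (shift b j t)" and "A' = Mul D (\<psi> j) o\<^sub>L A s" for t
  obtain C0 where C0: "\<And>t. \<bar>t - s\<bar> \<le> 1 \<Longrightarrow> norm (A t - A s - (t - s) *\<^sub>R A') \<le> C0 * (t - s)\<^sup>2"
    using Aop_derivative(2)[OF b, of s j] unfolding A_def A'_def by blast
  define C where "C = \<bar>C0\<bar>"
  have C: "norm (A t - A s - (t - s) *\<^sub>R A') \<le> C * (t - s)\<^sup>2" if "\<bar>t - s\<bar> \<le> 1" for t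
    by (rule order_trans[OF C0[OF that]]) (simp add: C_def mult_right_mono)
  have C_nn: "C \<ge> 0" by (simp add: C_def)
  define L where "L = C + norm A'"
  have AL: "norm (A t - A s) \<le> L * \<bar>t - s\<bar>" if t: "\<bar>t - s\<bar> \<le> 1" for t
  proof -
    have "norm (A t - A s) \<le> norm (A t - A s - (t - s) *\<^sub>R A') + norm ((t - s) *\<^sub>R A')"
      by (rule order_trans[OF _ norm_triangle_ineq]) simp
    also have "\<dots> \<le> C * (t - s)\<^sup>2 + \<bar>t - s\<bar> * norm A'" using C[OF t] by simp
    also have "\<dots> \<le> C * \<bar>t - s\<bar> + \<bar>t - s\<bar> * norm A'"
    proof -
      have "(t - s)\<^sup>2 = \<bar>t - s\<bar> * \<bar>t - s\<bar>" by (simp add: power2_eq_square)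
      also have "\<dots> \<le> 1 * \<bar>t - s\<bar>" using t by (intro mult_right_mono) auto
      finally show ?thesis using C_nn by (simp add: mult_left_mono)
    qed
    finally show ?thesis by (simp add: L_def algebra_simps)
  qed
  obtain B where B: "bdd_on D (shift b j s) B" using shift_Linf[OF b] Linf_iff by blast
  obtain c where "bdd_on D (\<psi> j) c" using \<psi> Linf_iff by blast
  then have c: "bdd_on D (\<psi> j) \<bar>c\<bar>" by (rule bdd_on_mono) simp
  \<comment> \<open>For |t - s| \<le> 1 the shifted exponent is bounded by B + |c|, so Q bounds the
    operators R t uniformly there.\<close>
  define Q where "Q = (poincare_const + 1) * exp (B + \<bar>c\<bar>)"
  have Q: "norm (R t) \<le> Q" if t: "\<bar>t - s\<bar> \<le> 1" for t
  proof -
    have "bdd_on D (\<lambda>x. shift b j s x + (t - s) * \<psi> j x) (B + \<bar>t - s\<bar> * \<bar>c\<bar>)"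
      by (intro bdd_on_add bdd_on_mult bdd_on_const B c)
    then have "bdd_on D (shift b j t) (B + \<bar>t - s\<bar> * \<bar>c\<bar>)" by (simp add: algebra_simps)
    then have "bdd_on D (shift b j t) (B + \<bar>c\<bar>)"
      by (rule bdd_on_mono) (use t mult_right_mono[OF t, of "\<bar>c\<bar>"] in simp)
    then show ?thesis unfolding R_def Q_def by (rule norm_Rop)
  qed
  have Q0: "Q \<ge> 0" using order_trans[OF norm_ge_zero Q[of s]] by simp
  have Rd: "R t - R s = - (R t o\<^sub>L ((A t - A s) o\<^sub>L R s))" for t
    unfolding R_def A_def by (rule Rop_diff[OF shift_Linf[OF b] shift_Linf[OF b]])
  have RL: "norm (R t - R s) \<le> Q * (L * \<bar>t - s\<bar> * Q)" if t: "\<bar>t - s\<bar> \<le> 1" for t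
  proof -
    have "norm (R t - R s) \<le> norm (R t) * (norm (A t - A s) * norm (R s))"
      unfolding Rd norm_minus_cancel
      by (rule order_trans[OF norm_blinfun_compose]) (intro mult_left_mono norm_blinfun_compose norm_ge_zero)
    also have "\<dots> \<le> Q * (L * \<bar>t - s\<bar> * Q)"
      using AL[OF t] Q[OF t] Q[of s] Q0 by (intro mult_mono) (auto intro: order_trans[OF norm_ge_zero])
    finally show ?thesis .
  qed
  have "(R has_vector_derivative - (R s o\<^sub>L A' o\<^sub>L R s)) (at s)"
  proof (rule has_vector_derivative_quadratic)
    fix t assume t: "\<bar>t - s\<bar> \<le> 1"
    have "R t - R s - (t - s) *\<^sub>R (- (R s o\<^sub>L A' o\<^sub>L R s))
      = - (R t o\<^sub>L ((A t - A s - (t - s) *\<^sub>R A') o\<^sub>L R s)) - ((R t - R s) o\<^sub>L (((t - s) *\<^sub>R A') o\<^sub>L R s))"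
    proof (rule blinfun_eqI)
      fix h
      have "R t h - R s h = - R t (A t (R s h) - A s (R s h))"
        using arg_cong[OF Rd[of t], of "\<lambda>T. T h"] by (simp add: blinfun.diff_left blinfun.minus_left)
      then show "(R t - R s - (t - s) *\<^sub>R (- (R s o\<^sub>L A' o\<^sub>L R s))) h
        = (- (R t o\<^sub>L ((A t - A s - (t - s) *\<^sub>R A') o\<^sub>L R s)) - ((R t - R s) o\<^sub>L (((t - s) *\<^sub>R A') o\<^sub>L R s))) h"
        by (simp add: blinfun.diff_left blinfun.diff_right blinfun.minus_left blinfun.scaleR_left blinfun.scaleR_right
            blinfun.add_left blinfun.add_right scaleR_diff_left) (simp add: algebra_simps)
    qed
    then have "norm (R t - R s - (t - s) *\<^sub>R (- (R s o\<^sub>L A' o\<^sub>L R s)))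
      \<le> norm (R t o\<^sub>L ((A t - A s - (t - s) *\<^sub>R A') o\<^sub>L R s)) + norm ((R t - R s) o\<^sub>L (((t - s) *\<^sub>R A') o\<^sub>L R s))"
      using norm_triangle_ineq4[of "- (R t o\<^sub>L ((A t - A s - (t - s) *\<^sub>R A') o\<^sub>L R s))" "(R t - R s) o\<^sub>L (((t - s) *\<^sub>R A') o\<^sub>L R s)"]
      by simp
    also have "\<dots> \<le> Q * (C * (t - s)\<^sup>2 * Q) + (Q * (L * \<bar>t - s\<bar> * Q)) * (\<bar>t - s\<bar> * norm A' * Q)"
    proof (rule add_mono)
      show "norm (R t o\<^sub>L ((A t - A s - (t - s) *\<^sub>R A') o\<^sub>L R s)) \<le> Q * (C * (t - s)\<^sup>2 * Q)"
        by (rule order_trans[OF norm_blinfun_compose], intro mult_mono order_trans[OF norm_blinfun_compose])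
          (use C[OF t] Q[OF t] Q[of s] Q0 C_nn in auto)
      show "norm ((R t - R s) o\<^sub>L (((t - s) *\<^sub>R A') o\<^sub>L R s)) \<le> (Q * (L * \<bar>t - s\<bar> * Q)) * (\<bar>t - s\<bar> * norm A' * Q)"
        by (rule order_trans[OF norm_blinfun_compose], intro mult_mono order_trans[OF norm_blinfun_compose])
          (use RL[OF t] Q[of s] Q0 in \<open>auto intro: order_trans[OF norm_ge_zero RL[OF t]]\<close>)
    qed
    also have "\<dots> = (Q * C * Q + Q * L * Q * norm A' * Q) * (t - s)\<^sup>2"
    proof -
      have "\<bar>t - s\<bar> * \<bar>t - s\<bar> = (t - s)\<^sup>2" by (simp add: power2_eq_square)
      then show ?thesis by (simp add: algebra_simps)
    qed
    finally show "norm (R t - R s - (t - s) *\<^sub>R (- (R s o\<^sub>L A' o\<^sub>L R s)))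
      \<le> (Q * C * Q + Q * L * Q * norm A' * Q) * (t - s)\<^sup>2" .
  qed
  then show ?thesis unfolding R_def A_def A'_def .
qed

lemma taylor_eq:
  "\<mu> \<in> multi_indices \<Longrightarrow> taylor b h \<mu> = Rop b ((if \<mu> = (\<lambda>_. 0) then h else 0)
       - (\<Sum>\<kappa>\<in>{\<kappa>. \<kappa> \<le> \<mu> \<and> \<kappa> \<noteq> (\<lambda>_. 0)}. Pop \<kappa> (Aop b (taylor b h (\<mu> - \<kappa>)))))"
  by (subst taylor.simps) simp

lemma taylor_0: "taylor b h (\<lambda>_. 0) = Rop b h"
proof -
  have e: "{\<kappa>. \<kappa> \<le> (\<lambda>_. 0) \<and> \<kappa> \<noteq> (\<lambda>_. 0 :: nat)} = {}" by (auto simp: le_fun_def)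
  show ?thesis unfolding taylor_eq[OF zero_multi_index] e by simp
qed

text \<open>Bookkeeping of the Leibniz rule: the term of index \<kappa> receives \<mu>_j + 1 -
  \<kappa>_j from differentiating the Taylor coefficient and \<kappa>_j from differentiating the
  diffusion coefficient, in total \<mu>_j + 1.\<close>

lemma sum_lower_Suc:
  fixes X :: "(nat \<Rightarrow> nat) \<Rightarrow> 'v::real_vector" and j :: nat
  assumes \<mu>: "\<mu> \<in> multi_indices"
  defines "\<mu>' \<equiv> \<mu>(j := Suc (\<mu> j))"
  shows "(\<Sum>\<kappa>\<in>{\<kappa>. \<kappa> \<le> \<mu> \<and> \<kappa> \<noteq> (\<lambda>_. 0)}. real (Suc (\<mu> j) - \<kappa> j) *\<^sub>R X \<kappa>)
      + (\<Sum>\<kappa>\<in>{\<kappa>. \<kappa> \<le> \<mu>}. real (Suc (\<kappa> j)) *\<^sub>R X (\<kappa>(j := Suc (\<kappa> j))))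
    = real (Suc (\<mu> j)) *\<^sub>R (\<Sum>\<kappa>\<in>{\<kappa>. \<kappa> \<le> \<mu>' \<and> \<kappa> \<noteq> (\<lambda>_. 0)}. X \<kappa>)"
proof -
  let ?S = "{\<kappa>. \<kappa> \<le> \<mu> \<and> \<kappa> \<noteq> (\<lambda>_. 0)}" and ?S' = "{\<kappa>. \<kappa> \<le> \<mu>' \<and> \<kappa> \<noteq> (\<lambda>_. 0)}"
  have "\<mu>' \<in> multi_indices" unfolding \<mu>'_def by (rule multi_indices_upd[OF \<mu>])
  then have fin': "finite {\<kappa>. \<kappa> \<le> \<mu>'}" by (intro finite_lower) (simp add: multi_indices_def)
  have fS': "finite ?S'" by (rule finite_subset[OF _ fin']) auto
  have le_iff: "\<kappa> \<le> \<mu> \<longleftrightarrow> \<kappa> \<le> \<mu>' \<and> \<kappa> j \<noteq> Suc (\<mu> j)" for \<kappa>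
  proof
    assume k: "\<kappa> \<le> \<mu>"
    have "\<kappa> i \<le> \<mu> i" for i using k by (rule le_funD)
    then show "\<kappa> \<le> \<mu>' \<and> \<kappa> j \<noteq> Suc (\<mu> j)"
      unfolding \<mu>'_def le_fun_def by (metis Suc_n_not_le_n fun_upd_apply le_SucI)
  next
    assume k: "\<kappa> \<le> \<mu>' \<and> \<kappa> j \<noteq> Suc (\<mu> j)"
    have "\<kappa> i \<le> \<mu> i" for i using le_funD[OF conjunct1[OF k], of i] k by (cases "i = j") (auto simp: \<mu>'_def)
    then show "\<kappa> \<le> \<mu>" by (simp add: le_fun_def)
  qed
  \<comment> \<open>The indices with \<kappa>_j = \<mu>_j + 1 may be added because their factor is
    0.\<close>
  have 1: "(\<Sum>\<kappa>\<in>?S. real (Suc (\<mu> j) - \<kappa> j) *\<^sub>R X \<kappa>) = (\<Sum>\<kappa>\<in>?S'. real (Suc (\<mu> j) - \<kappa> j) *\<^sub>R X \<kappa>)"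
    by (rule sum.mono_neutral_left[OF fS']) (auto simp: le_iff)
  have inj: "inj_on (\<lambda>\<kappa>. \<kappa>(j := Suc (\<kappa> j))) {\<kappa>. \<kappa> \<le> \<mu>}"
  proof (rule inj_onI)
    fix \<kappa> \<kappa>' :: "nat \<Rightarrow> nat" assume eq: "\<kappa>(j := Suc (\<kappa> j)) = \<kappa>'(j := Suc (\<kappa>' j))"
    show "\<kappa> = \<kappa>'"
    proof
      fix i show "\<kappa> i = \<kappa>' i" using fun_cong[OF eq, of i] by (cases "i = j") auto
    qed
  qed
  have img: "(\<lambda>\<kappa>. \<kappa>(j := Suc (\<kappa> j))) ` {\<kappa>. \<kappa> \<le> \<mu>} = {\<kappa>\<in>?S'. \<kappa> j \<noteq> 0}"
  proof (intro equalityI subsetI)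
    fix \<kappa> assume "\<kappa> \<in> (\<lambda>\<kappa>. \<kappa>(j := Suc (\<kappa> j))) ` {\<kappa>. \<kappa> \<le> \<mu>}"
    then obtain \<sigma> where s: "\<sigma> \<le> \<mu>" "\<kappa> = \<sigma>(j := Suc (\<sigma> j))" by auto
    have "\<kappa> i \<le> \<mu>' i" for i using le_funD[OF s(1), of i] by (cases "i = j") (auto simp: s(2) \<mu>'_def)
    moreover have "\<kappa> j \<noteq> 0" by (simp add: s)
    ultimately show "\<kappa> \<in> {\<kappa>\<in>?S'. \<kappa> j \<noteq> 0}" by (auto simp: le_fun_def)
  next
    fix \<kappa> assume k: "\<kappa> \<in> {\<kappa>\<in>?S'. \<kappa> j \<noteq> 0}"
    then have le: "\<kappa> \<le> \<mu>'" by simp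
    have "(\<kappa>(j := \<kappa> j - 1)) i \<le> \<mu> i" for i using le_funD[OF le, of i] k by (cases "i = j") (auto simp: \<mu>'_def)
    then have m: "\<kappa>(j := \<kappa> j - 1) \<in> {\<kappa>. \<kappa> \<le> \<mu>}" by (simp add: le_fun_def)
    show "\<kappa> \<in> (\<lambda>\<kappa>. \<kappa>(j := Suc (\<kappa> j))) ` {\<kappa>. \<kappa> \<le> \<mu>}"
      by (rule image_eqI[OF _ m]) (use k in auto)
  qed
  have "(\<Sum>\<kappa>\<in>{\<kappa>. \<kappa> \<le> \<mu>}. real (Suc (\<kappa> j)) *\<^sub>R X (\<kappa>(j := Suc (\<kappa> j)))) = (\<Sum>\<kappa>\<in>{\<kappa>\<in>?S'. \<kappa> j \<noteq> 0}. real (\<kappa> j) *\<^sub>R X \<kappa>)"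
    unfolding img[symmetric] by (subst sum.reindex[OF inj]) simp
  \<comment> \<open>The indices with \<kappa>_j = 0, which the shift misses, carry the factor
    0.\<close>
  also have "\<dots> = (\<Sum>\<kappa>\<in>?S'. real (\<kappa> j) *\<^sub>R X \<kappa>)"
    by (rule sum.mono_neutral_left[OF fS']) auto
  finally have 2: "(\<Sum>\<kappa>\<in>{\<kappa>. \<kappa> \<le> \<mu>}. real (Suc (\<kappa> j)) *\<^sub>R X (\<kappa>(j := Suc (\<kappa> j)))) = (\<Sum>\<kappa>\<in>?S'. real (\<kappa> j) *\<^sub>R X \<kappa>)" .
  have "(\<Sum>\<kappa>\<in>?S'. real (Suc (\<mu> j) - \<kappa> j) *\<^sub>R X \<kappa>) + (\<Sum>\<kappa>\<in>?S'. real (\<kappa> j) *\<^sub>R X \<kappa>)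
      = (\<Sum>\<kappa>\<in>?S'. real (Suc (\<mu> j)) *\<^sub>R X \<kappa>)"
    unfolding sum.distrib[symmetric]
  proof (rule sum.cong[OF refl])
    fix \<kappa> assume "\<kappa> \<in> ?S'"
    then have "\<kappa> j \<le> \<mu>' j" by (auto dest: le_funD)
    then have "\<kappa> j \<le> Suc (\<mu> j)" by (simp add: \<mu>'_def)
    then show "real (Suc (\<mu> j) - \<kappa> j) *\<^sub>R X \<kappa> + real (\<kappa> j) *\<^sub>R X \<kappa> = real (Suc (\<mu> j)) *\<^sub>R X \<kappa>"
      by (simp add: scaleR_add_left[symmetric] of_nat_diff del: of_nat_Suc)
  qed
  then show ?thesis unfolding 1 2 by (simp add: scaleR_sum_right)
qed

text \<open>The recursion T = R F is differentiated by the product rule. The derivative of F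
  supplies the Leibniz terms with \<kappa> \<noteq> 0; the derivative of R supplies -R \<psi>_j A T,
  which is the missing term \<kappa> = 0. \<open>sum_lower_Suc\<close> then recognises the recursion
  for \<mu> raised at j.\<close>

lemma taylor_derivative:
  assumes b: "b \<in> Linf D" and \<mu>: "\<mu> \<in> multi_indices"
  shows "((\<lambda>s. taylor (shift b j s) h \<mu>) has_vector_derivative
    real (Suc (\<mu> j)) *\<^sub>R taylor (shift b j s) h (\<mu>(j := Suc (\<mu> j)))) (at s)"
  using \<mu>
proof (induction "degree_of \<mu>" arbitrary: \<mu> rule: less_induct)
  case less
  note \<mu> = less.prems
  have fin: "finite {j. \<mu> j \<noteq> 0}" using \<mu> by (simp add: multi_indices_def)
  define \<mu>' where "\<mu>' = \<mu>(j := Suc (\<mu> j))"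
  have \<mu>': "\<mu>' \<in> multi_indices" unfolding \<mu>'_def by (rule multi_indices_upd[OF \<mu>])
  have \<mu>'0: "\<mu>' \<noteq> (\<lambda>_. 0)" by (auto simp: \<mu>'_def fun_eq_iff)
  let ?S = "{\<kappa>. \<kappa> \<le> \<mu> \<and> \<kappa> \<noteq> (\<lambda>_. 0)}"
  have finS: "finite ?S" by (rule finite_subset[OF _ finite_lower[OF fin]]) auto
  define T where "T t \<sigma> = taylor (shift b j t) h \<sigma>" for t \<sigma>
  define A where "A t = Aop (shift b j t)" for t
  define R where "R t = Rop (shift b j t)" for t
  define F where "F t = (if \<mu> = (\<lambda>_. 0) then h else 0) - (\<Sum>\<kappa>\<in>?S. Pop \<kappa> (A t (T t (\<mu> - \<kappa>))))" for t
  have TF: "T t \<mu> = R t (F t)" for t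
    unfolding T_def R_def F_def A_def by (rule taylor_eq[OF \<mu>])
  have dT: "((\<lambda>t. T t (\<mu> - \<kappa>)) has_vector_derivative real (Suc (\<mu> j) - \<kappa> j) *\<^sub>R T s (\<mu>' - \<kappa>)) (at s)"
    if \<kappa>: "\<kappa> \<in> ?S" for \<kappa>
  proof -
    have lj: "\<kappa> j \<le> \<mu> j" using \<kappa> by (auto dest: le_funD)
    have "degree_of (\<mu> - \<kappa>) < degree_of \<mu>" using \<kappa> by (intro degree_of_diff_less fin) auto
    from less.hyps[OF this multi_indices_diff[OF \<mu>]]
    have "((\<lambda>t. T t (\<mu> - \<kappa>)) has_vector_derivative real (Suc ((\<mu> - \<kappa>) j)) *\<^sub>R T s ((\<mu> - \<kappa>)(j := Suc ((\<mu> - \<kappa>) j)))) (at s)"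
      unfolding T_def .
    moreover have "(\<mu> - \<kappa>)(j := Suc ((\<mu> - \<kappa>) j)) = \<mu>' - \<kappa>" "Suc ((\<mu> - \<kappa>) j) = Suc (\<mu> j) - \<kappa> j"
      using lj by (auto simp: \<mu>'_def fun_eq_iff)
    ultimately show ?thesis by (simp only:)
  qed
  have dA: "(A has_vector_derivative (Mul D (\<psi> j) o\<^sub>L A s)) (at s)"
    unfolding A_def by (rule Aop_derivative(1)[OF b])
  have dR: "(R has_vector_derivative - (R s o\<^sub>L (Mul D (\<psi> j) o\<^sub>L A s) o\<^sub>L R s)) (at s)"
    unfolding A_def R_def by (rule Rop_derivative[OF b])
  define X where "X \<kappa> = Pop \<kappa> (A s (T s (\<mu>' - \<kappa>)))" for \<kappa>
  have psiX: "Pop \<kappa> (Mul D (\<psi> j) (A s (T s (\<mu> - \<kappa>)))) = real (Suc (\<kappa> j)) *\<^sub>R X (\<kappa>(j := Suc (\<kappa> j)))"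
    if "\<kappa> \<le> \<mu>" for \<kappa>
  proof -
    have "finite {i. \<kappa> i \<noteq> 0}" using finite_support_mono[OF fin that] .
    from arg_cong[OF Pop_psi[OF this, of j], of "\<lambda>L. L (A s (T s (\<mu> - \<kappa>)))"]
    have "Pop \<kappa> (Mul D (\<psi> j) (A s (T s (\<mu> - \<kappa>)))) = real (Suc (\<kappa> j)) *\<^sub>R Pop (\<kappa>(j := Suc (\<kappa> j))) (A s (T s (\<mu> - \<kappa>)))"
      by (simp add: blinfun.scaleR_left)
    moreover have "\<mu> - \<kappa> = \<mu>' - \<kappa>(j := Suc (\<kappa> j))" by (auto simp: \<mu>'_def fun_eq_iff)
    ultimately show ?thesis by (simp only: X_def)
  qed
  have psi0: "Mul D (\<psi> j) g = Pop (\<lambda>_. 0) (Mul D (\<psi> j) g)" for g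
  proof -
    have "Pop (\<lambda>_. 0) o\<^sub>L Mul D (\<psi> j) = (Mul D (\<psi> j) :: ('a, 'a) L2 \<Rightarrow>\<^sub>L ('a, 'a) L2)"
      using Pop_psi[of "\<lambda>_. 0" j] by (simp add: Pop_def monom_e[unfolded unit_index_def One_nat_def])
    from arg_cong[OF this, of "\<lambda>L. L g"] show ?thesis by simp
  qed
  have dPA: "((\<lambda>t. Pop \<kappa> (A t (T t (\<mu> - \<kappa>)))) has_vector_derivative
      (real (Suc (\<mu> j) - \<kappa> j) *\<^sub>R X \<kappa> + real (Suc (\<kappa> j)) *\<^sub>R X (\<kappa>(j := Suc (\<kappa> j))))) (at s)" if \<kappa>: "\<kappa> \<in> ?S" for \<kappa>
  proof -
    have "((\<lambda>t. A t (T t (\<mu> - \<kappa>))) has_vector_derivative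
       (A s (real (Suc (\<mu> j) - \<kappa> j) *\<^sub>R T s (\<mu>' - \<kappa>)) + (Mul D (\<psi> j) o\<^sub>L A s) (T s (\<mu> - \<kappa>)))) (at s)"
      by (rule bounded_bilinear.has_vector_derivative[OF bounded_bilinear_blinfun_apply dA dT[OF \<kappa>]])
    from bounded_linear.has_vector_derivative[OF blinfun.bounded_linear_right this, of "Pop \<kappa>"]
    show ?thesis using \<kappa> psiX[of \<kappa>] by (simp add: X_def blinfun.add_right blinfun.scaleR_right del: of_nat_Suc)
  qed
  have dF: "(F has_vector_derivative
      - (\<Sum>\<kappa>\<in>?S. real (Suc (\<mu> j) - \<kappa> j) *\<^sub>R X \<kappa> + real (Suc (\<kappa> j)) *\<^sub>R X (\<kappa>(j := Suc (\<kappa> j))))) (at s)"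
  proof -
    have "(F has_vector_derivative 0 - (\<Sum>\<kappa>\<in>?S. real (Suc (\<mu> j) - \<kappa> j) *\<^sub>R X \<kappa> + real (Suc (\<kappa> j)) *\<^sub>R X (\<kappa>(j := Suc (\<kappa> j))))) (at s)"
      unfolding F_def
      by (intro has_vector_derivative_diff has_vector_derivative_const has_vector_derivative_sum dPA)
    then show ?thesis by simp
  qed
  have "((\<lambda>t. R t (F t)) has_vector_derivative
     (R s (- (\<Sum>\<kappa>\<in>?S. real (Suc (\<mu> j) - \<kappa> j) *\<^sub>R X \<kappa> + real (Suc (\<kappa> j)) *\<^sub>R X (\<kappa>(j := Suc (\<kappa> j)))))
      + (- (R s o\<^sub>L (Mul D (\<psi> j) o\<^sub>L A s) o\<^sub>L R s)) (F s))) (at s)"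
    by (rule bounded_bilinear.has_vector_derivative[OF bounded_bilinear_blinfun_apply dR dF])
  moreover have "R s (- (\<Sum>\<kappa>\<in>?S. real (Suc (\<mu> j) - \<kappa> j) *\<^sub>R X \<kappa> + real (Suc (\<kappa> j)) *\<^sub>R X (\<kappa>(j := Suc (\<kappa> j)))))
      + (- (R s o\<^sub>L (Mul D (\<psi> j) o\<^sub>L A s) o\<^sub>L R s)) (F s) = real (Suc (\<mu> j)) *\<^sub>R T s \<mu>'"
  proof -
    have lowS: "{\<kappa>. \<kappa> \<le> \<mu>} = insert (\<lambda>_. 0) ?S" by (auto simp: le_fun_def)
    \<comment> \<open>The contribution of the derivative of R, rewritten as the term \<kappa> = 0 of
      the second sum.\<close>
    have z: "Mul D (\<psi> j) (A s (T s \<mu>)) = real (Suc 0) *\<^sub>R X ((\<lambda>_. 0)(j := Suc 0))"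
    proof -
      have "\<mu> - (\<lambda>_. 0) = \<mu>" by (auto simp: fun_eq_iff)
      then show ?thesis using psiX[of "\<lambda>_. 0"] psi0[of "A s (T s \<mu>)"] by (simp add: le_fun_def)
    qed
    have "(\<Sum>\<kappa>\<in>?S. real (Suc (\<mu> j) - \<kappa> j) *\<^sub>R X \<kappa> + real (Suc (\<kappa> j)) *\<^sub>R X (\<kappa>(j := Suc (\<kappa> j)))) + Mul D (\<psi> j) (A s (T s \<mu>))
      = (\<Sum>\<kappa>\<in>?S. real (Suc (\<mu> j) - \<kappa> j) *\<^sub>R X \<kappa>) + (\<Sum>\<kappa>\<in>{\<kappa>. \<kappa> \<le> \<mu>}. real (Suc (\<kappa> j)) *\<^sub>R X (\<kappa>(j := Suc (\<kappa> j))))"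
      unfolding z lowS using finS by (simp add: sum.distrib del: of_nat_Suc)
    also have "\<dots> = real (Suc (\<mu> j)) *\<^sub>R (\<Sum>\<kappa>\<in>{\<kappa>. \<kappa> \<le> \<mu>' \<and> \<kappa> \<noteq> (\<lambda>_. 0)}. X \<kappa>)"
      unfolding \<mu>'_def by (rule sum_lower_Suc[OF \<mu>])
    finally have e: "(\<Sum>\<kappa>\<in>?S. real (Suc (\<mu> j) - \<kappa> j) *\<^sub>R X \<kappa> + real (Suc (\<kappa> j)) *\<^sub>R X (\<kappa>(j := Suc (\<kappa> j)))) + Mul D (\<psi> j) (A s (T s \<mu>))
      = real (Suc (\<mu> j)) *\<^sub>R (\<Sum>\<kappa>\<in>{\<kappa>. \<kappa> \<le> \<mu>' \<and> \<kappa> \<noteq> (\<lambda>_. 0)}. X \<kappa>)" .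
    have "T s \<mu>' = R s (- (\<Sum>\<kappa>\<in>{\<kappa>. \<kappa> \<le> \<mu>' \<and> \<kappa> \<noteq> (\<lambda>_. 0)}. X \<kappa>))"
      unfolding T_def R_def using taylor_eq[OF \<mu>', of "shift b j s" h] \<mu>'0 by (simp add: X_def A_def T_def)
    then have "real (Suc (\<mu> j)) *\<^sub>R T s \<mu>' = - R s (real (Suc (\<mu> j)) *\<^sub>R (\<Sum>\<kappa>\<in>{\<kappa>. \<kappa> \<le> \<mu>' \<and> \<kappa> \<noteq> (\<lambda>_. 0)}. X \<kappa>))"
      by (simp add: blinfun.minus_right blinfun.scaleR_right del: of_nat_Suc)
    then show ?thesis unfolding e[symmetric] by (simp add: blinfun.minus_right blinfun.add_right blinfun.minus_left TF del: of_nat_Suc)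
  qed
  ultimately have "((\<lambda>t. R t (F t)) has_vector_derivative real (Suc (\<mu> j)) *\<^sub>R T s \<mu>') (at s)" by simp
  then show ?case unfolding TF[symmetric] unfolding T_def \<mu>'_def .
qed

section \<open>The energy estimate\<close>

lemma taylor_energy:
  assumes b: "b \<in> Linf D" and \<mu>: "\<mu> \<in> multi_indices"
  shows "Aop b (taylor b h \<mu>) \<bullet> taylor b h \<mu> = ((if \<mu> = (\<lambda>_. 0) then h else 0)
       - (\<Sum>\<kappa>\<in>{\<kappa>. \<kappa> \<le> \<mu> \<and> \<kappa> \<noteq> (\<lambda>_. 0)}. Pop \<kappa> (Aop b (taylor b h (\<mu> - \<kappa>))))) \<bullet> taylor b h \<mu>"
    and "\<exists>v\<in>H10 D. taylor b h \<mu> = snd v"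
proof -
  let ?F = "(if \<mu> = (\<lambda>_. 0) then h else 0)
       - (\<Sum>\<kappa>\<in>{\<kappa>. \<kappa> \<le> \<mu> \<and> \<kappa> \<noteq> (\<lambda>_. 0)}. Pop \<kappa> (Aop b (taylor b h (\<mu> - \<kappa>))))"
  obtain B where B: "bdd_on D b B" using b Linf_iff by blast
  note sol = Sol_apply(1)[OF elliptic_exp[OF B], of ?F]
  have t: "taylor b h \<mu> = snd (Sol (\<lambda>x. exp (b x)) ?F)"
    unfolding taylor_eq[OF \<mu>, of b h] by (simp add: Rop_def bounded_linear_Blinfun_apply[OF bounded_linear_snd])
  show "Aop b (taylor b h \<mu>) \<bullet> taylor b h \<mu> = ?F \<bullet> taylor b h \<mu>"
    using sol unfolding t Aop_def solves_def by blast
  show "\<exists>v\<in>H10 D. taylor b h \<mu> = snd v" using sol t unfolding solves_def by blast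
qed

text \<open>Put s_\<mu> = \<rho>^\<mu> t_\<mu> with energy E_\<mu>. Young's inequality bounds
  E_\<mu> by halves of quadratic forms in s_(\<mu>-\<kappa>) and in s_\<mu>. After exchanging the
  sums each s_\<sigma> is charged at most two halves of the form whose weight is the sum of all
  X_\<kappa>, that is at most \<eta> E_\<sigma>. So the energies with \<mu> \<noteq> 0 are together
  at most \<eta> times the total, and absorption leaves the energy of order 0.\<close>

lemma taylor_bound:
  assumes b: "b \<in> Linf D" and \<rho>: "\<And>j. 0 \<le> \<rho> j" and \<eta>: "0 \<le> \<eta>" "\<eta> < 1"
    and small: "AE x in lebesgue_on D. exp (\<Sum>j<N. \<rho> j * \<bar>\<psi> j x\<bar>) - 1 \<le> \<eta>"
  shows "(\<Sum>\<mu>\<in>index_box N r. (index_pow \<rho> \<mu>)\<^sup>2 * (Aop b (taylor b h \<mu>) \<bullet> taylor b h \<mu>))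
    \<le> Aop b (Rop b h) \<bullet> Rop b h / (1 - \<eta>)"
proof -
  define P where "P = index_box N r"
  define P0 where "P0 = P - {\<lambda>_. 0}"
  have finP: "finite P" "finite P0" by (auto simp: P_def P0_def finite_index_box)
  have z0: "(\<lambda>_. 0) \<in> P" by (simp add: P_def index_box_def)
  have mi: "\<mu> \<in> multi_indices" "finite {j. \<mu> j \<noteq> 0}" if "\<mu> \<in> P" for \<mu>
    using that index_box_multi_indices by (auto simp: P_def multi_indices_def)
  have low: "\<kappa> \<in> P" if "\<mu> \<in> P" "\<kappa> \<le> \<mu>" for \<mu> \<kappa> using index_box_lower that by (simp add: P_def)
  define t where "t \<mu> = taylor b h \<mu>" for \<mu>
  define s where "s \<mu> = index_pow \<rho> \<mu> *\<^sub>R t \<mu>" for \<mu>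
  \<comment> \<open>The scaled perturbation without its sign. The factor exp b stays inside, so that
    the sum over \<kappa> is compared with exp b itself and no ellipticity constant appears.\<close>
  define X where "X \<kappa> x = (index_pow \<rho> \<kappa> * \<bar>monom_fn \<kappa> x\<bar>) * exp (b x)" for \<kappa> x
  define q where "q \<phi> g = Mul D \<phi> g \<bullet> g" for \<phi> and g :: "('a, 'a) L2"
  have XL: "X \<kappa> \<in> Linf D" for \<kappa>
    unfolding X_def using b monom_fn_Linf by (intro Linf_mult Linf_exp Linf_abs) auto
  have Xnn: "0 \<le> X \<kappa> x" for \<kappa> x unfolding X_def using index_pow_nonneg[OF \<rho>] by auto
  have qnn: "0 \<le> q (X \<kappa>) g" for \<kappa> g unfolding q_def using Xnn by (intro Mul_nonneg XL) auto
  let ?a = "\<lambda>x. exp (b x)"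
  have aL: "?a \<in> Linf D" using b by auto
  define E where "E \<mu> = q ?a (s \<mu>)" for \<mu>
  have E_eq: "E \<mu> = (index_pow \<rho> \<mu>)\<^sup>2 * (Aop b (t \<mu>) \<bullet> t \<mu>)" for \<mu>
    by (simp add: E_def q_def s_def Aop_def blinfun.scaleR_right power2_eq_square)
  have step: "E \<mu> \<le> (\<Sum>\<kappa>\<in>{\<kappa>\<in>P0. \<kappa> \<le> \<mu>}. (q (X \<kappa>) (s (\<mu> - \<kappa>)) + q (X \<kappa>) (s \<mu>)) / 2)" if \<mu>: "\<mu> \<in> P0" for \<mu>
  proof -
    have \<mu>P: "\<mu> \<in> P" and \<mu>0: "\<mu> \<noteq> (\<lambda>_. 0)" using \<mu> by (auto simp: P0_def)
    \<comment> \<open>Everything below \<mu> lies in the box, so the recursion runs over part of P0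
      and the double sum can be exchanged.\<close>
    have set: "{\<kappa>. \<kappa> \<le> \<mu> \<and> \<kappa> \<noteq> (\<lambda>_. 0)} = {\<kappa>\<in>P0. \<kappa> \<le> \<mu>}" using low[OF \<mu>P] by (auto simp: P0_def)
    have "E \<mu> = (index_pow \<rho> \<mu>)\<^sup>2 * ((- (\<Sum>\<kappa>\<in>{\<kappa>\<in>P0. \<kappa> \<le> \<mu>}. Pop \<kappa> (Aop b (t (\<mu> - \<kappa>))))) \<bullet> t \<mu>)"
      unfolding E_eq t_def using taylor_energy(1)[OF b mi(1)[OF \<mu>P], of h] \<mu>0 by (simp add: set)
    also have "\<dots> = (\<Sum>\<kappa>\<in>{\<kappa>\<in>P0. \<kappa> \<le> \<mu>}. - ((index_pow \<rho> \<mu>)\<^sup>2 * (Pop \<kappa> (Aop b (t (\<mu> - \<kappa>))) \<bullet> t \<mu>)))"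
      by (simp add: inner_sum_left sum_distrib_left sum_negf)
    also have "\<dots> \<le> (\<Sum>\<kappa>\<in>{\<kappa>\<in>P0. \<kappa> \<le> \<mu>}. (q (X \<kappa>) (s (\<mu> - \<kappa>)) + q (X \<kappa>) (s \<mu>)) / 2)"
    proof (rule sum_mono)
      fix \<kappa> assume "\<kappa> \<in> {\<kappa>\<in>P0. \<kappa> \<le> \<mu>}"
      then have \<kappa>: "\<kappa> \<le> \<mu>" by simp
      let ?f = "\<lambda>x. index_pow \<rho> \<kappa> * (monom_fn \<kappa> x * exp (b x))"
      have L1: "(\<lambda>x. monom_fn \<kappa> x * exp (b x)) \<in> Linf D" using monom_fn_Linf aL by (rule Linf_mult)
      have fL: "?f \<in> Linf D" by (rule Linf_mult[OF Linf_const L1])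
      have "Mul D ?f = index_pow \<rho> \<kappa> *\<^sub>R (Pop \<kappa> o\<^sub>L Aop b)"
        unfolding Pop_def Aop_def Mul_mult[OF monom_fn_Linf aL, symmetric] by (rule Mul_scale[OF L1])
      then have "Mul D ?f (s (\<mu> - \<kappa>)) \<bullet> s \<mu> = index_pow \<rho> \<kappa> * index_pow \<rho> (\<mu> - \<kappa>) * index_pow \<rho> \<mu> * (Pop \<kappa> (Aop b (t (\<mu> - \<kappa>))) \<bullet> t \<mu>)"
        by (simp add: s_def blinfun.scaleR_left blinfun.scaleR_right)
      also have "index_pow \<rho> \<kappa> * index_pow \<rho> (\<mu> - \<kappa>) = index_pow \<rho> \<mu>"
        using index_pow_split[OF mi(2)[OF \<mu>P] \<kappa>] by simp
      finally have "(index_pow \<rho> \<mu>)\<^sup>2 * (Pop \<kappa> (Aop b (t (\<mu> - \<kappa>))) \<bullet> t \<mu>) = Mul D ?f (s (\<mu> - \<kappa>)) \<bullet> s \<mu>"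
        by (simp only: power2_eq_square)
      moreover have "\<bar>Mul D ?f (s (\<mu> - \<kappa>)) \<bullet> s \<mu>\<bar> \<le> (q (X \<kappa>) (s (\<mu> - \<kappa>)) + q (X \<kappa>) (s \<mu>)) / 2"
        unfolding q_def
        by (rule Mul_abs_le[OF fL XL]) (simp add: X_def abs_mult index_pow_nonneg[OF \<rho>])
      ultimately show "- ((index_pow \<rho> \<mu>)\<^sup>2 * (Pop \<kappa> (Aop b (t (\<mu> - \<kappa>))) \<bullet> t \<mu>)) \<le> (q (X \<kappa>) (s (\<mu> - \<kappa>)) + q (X \<kappa>) (s \<mu>)) / 2"
        by linarith
    qed
    finally show ?thesis .
  qed
  \<comment> \<open>The sum over \<kappa> is taken at fixed x, where it is at most exp of the sum of
    \<rho>_j |\<psi>_j(x)|, minus 1, times exp b.\<close>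
  have qX: "(\<Sum>\<kappa>\<in>P0. q (X \<kappa>) g) \<le> \<eta> * q ?a g" for g
  proof -
    have SL: "(\<lambda>x. \<Sum>\<kappa>\<in>P0. X \<kappa> x) \<in> Linf D" by (intro Linf_sum XL)
    have "(\<Sum>\<kappa>\<in>P0. q (X \<kappa>) g) = q (\<lambda>x. \<Sum>\<kappa>\<in>P0. X \<kappa> x) g"
      unfolding q_def by (simp add: Mul_sum finP XL blinfun.sum_left inner_sum_left)
    also have "\<dots> \<le> q (\<lambda>x. \<eta> * exp (b x)) g"
      unfolding q_def
    proof (rule Mul_mono[OF SL Linf_mult[OF Linf_const aL]])
      show "AE x in lebesgue_on D. (\<Sum>\<kappa>\<in>P0. X \<kappa> x) \<le> \<eta> * exp (b x)"
        using small
      proof eventually_elim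
        fix x assume sm: "exp (\<Sum>j<N. \<rho> j * \<bar>\<psi> j x\<bar>) - 1 \<le> \<eta>"
        define z where "z j = \<rho> j * \<bar>\<psi> j x\<bar>" for j
        have "index_pow \<rho> \<kappa> * \<bar>monom_fn \<kappa> x\<bar> = index_pow z \<kappa> / index_fact \<kappa>" for \<kappa>
          using index_fact_pos[of \<kappa>]
          by (simp add: monom_fn_def abs_mult index_pow_def z_def abs_prod power_abs power_mult_distrib prod.distrib)
        then have "(\<Sum>\<kappa>\<in>P0. X \<kappa> x) = (\<Sum>\<kappa>\<in>P0. index_pow z \<kappa> / index_fact \<kappa>) * exp (b x)"
          by (simp add: X_def sum_distrib_right)
        also have "\<dots> \<le> (exp (\<Sum>j<N. z j) - 1) * exp (b x)"
          unfolding P0_def P_def using \<rho> by (intro mult_right_mono sum_index_box_exp) (auto simp: z_def)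
        also have "\<dots> \<le> \<eta> * exp (b x)" using sm by (intro mult_right_mono) (auto simp: z_def)
        finally show "(\<Sum>\<kappa>\<in>P0. X \<kappa> x) \<le> \<eta> * exp (b x)" .
      qed
    qed
    also have "\<dots> = \<eta> * q ?a g"
      unfolding q_def by (simp add: Mul_scale[OF aL] blinfun.scaleR_left)
    finally show ?thesis .
  qed
  have "(\<Sum>\<mu>\<in>P0. E \<mu>) \<le> (\<Sum>\<mu>\<in>P0. \<Sum>\<kappa>\<in>{\<kappa>\<in>P0. \<kappa> \<le> \<mu>}. (q (X \<kappa>) (s (\<mu> - \<kappa>)) + q (X \<kappa>) (s \<mu>)) / 2)"
    by (intro sum_mono step)
  also have "\<dots> = (\<Sum>\<kappa>\<in>P0. \<Sum>\<mu>\<in>{\<mu>\<in>P0. \<kappa> \<le> \<mu>}. (q (X \<kappa>) (s (\<mu> - \<kappa>)) + q (X \<kappa>) (s \<mu>)) / 2)"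
    by (rule sum.swap_restrict[OF finP(2) finP(2)])
  also have "\<dots> \<le> (\<Sum>\<kappa>\<in>P0. \<Sum>\<sigma>\<in>P. q (X \<kappa>) (s \<sigma>))"
  proof (rule sum_mono)
    fix \<kappa> assume "\<kappa> \<in> P0"
    let ?M = "{\<mu>\<in>P0. \<kappa> \<le> \<mu>}"
    \<comment> \<open>Subtracting \<kappa> is injective on the indices above \<kappa> and stays in
      the box. It can reach the index 0, so the sum is compared with one over P, not P0.\<close>
    have "(\<Sum>\<mu>\<in>?M. q (X \<kappa>) (s (\<mu> - \<kappa>))) = (\<Sum>\<sigma>\<in>(\<lambda>\<mu>. \<mu> - \<kappa>) ` ?M. q (X \<kappa>) (s \<sigma>))"
    proof (subst sum.reindex)
      show "inj_on (\<lambda>\<mu>. \<mu> - \<kappa>) ?M"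
      proof (rule inj_onI)
        fix \<mu> \<mu>' assume m: "\<mu> \<in> ?M" "\<mu>' \<in> ?M" "\<mu> - \<kappa> = \<mu>' - \<kappa>"
        show "\<mu> = \<mu>'"
        proof
          fix j
          have "\<kappa> j \<le> \<mu> j" "\<kappa> j \<le> \<mu>' j" using m by (auto dest: le_funD)
          then show "\<mu> j = \<mu>' j" using fun_cong[OF m(3), of j] by simp
        qed
      qed
    qed simp
    also have "\<dots> \<le> (\<Sum>\<sigma>\<in>P. q (X \<kappa>) (s \<sigma>))"
    proof (rule sum_mono2[OF finP(1)])
      show "(\<lambda>\<mu>. \<mu> - \<kappa>) ` ?M \<subseteq> P"
      proof
        fix \<sigma> assume "\<sigma> \<in> (\<lambda>\<mu>. \<mu> - \<kappa>) ` ?M"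
        then obtain \<mu> where "\<mu> \<in> P" "\<sigma> = \<mu> - \<kappa>" by (auto simp: P0_def)
        then show "\<sigma> \<in> P" using low[of \<mu> \<sigma>] by (simp add: le_fun_def)
      qed
    qed (rule qnn)
    finally have 1: "(\<Sum>\<mu>\<in>?M. q (X \<kappa>) (s (\<mu> - \<kappa>))) \<le> (\<Sum>\<sigma>\<in>P. q (X \<kappa>) (s \<sigma>))" .
    have 2: "(\<Sum>\<mu>\<in>?M. q (X \<kappa>) (s \<mu>)) \<le> (\<Sum>\<sigma>\<in>P. q (X \<kappa>) (s \<sigma>))"
      by (rule sum_mono2[OF finP(1)]) (auto simp: P0_def qnn)
    show "(\<Sum>\<mu>\<in>?M. (q (X \<kappa>) (s (\<mu> - \<kappa>)) + q (X \<kappa>) (s \<mu>)) / 2) \<le> (\<Sum>\<sigma>\<in>P. q (X \<kappa>) (s \<sigma>))"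
      using 1 2 by (simp add: sum_divide_distrib[symmetric] sum.distrib)
  qed
  also have "\<dots> = (\<Sum>\<sigma>\<in>P. \<Sum>\<kappa>\<in>P0. q (X \<kappa>) (s \<sigma>))" by (rule sum.swap)
  also have "\<dots> \<le> (\<Sum>\<sigma>\<in>P. \<eta> * E \<sigma>)" unfolding E_def by (intro sum_mono qX)
  finally have "(\<Sum>\<mu>\<in>P0. E \<mu>) \<le> \<eta> * (\<Sum>\<mu>\<in>P. E \<mu>)" by (simp add: sum_distrib_left)
  moreover have "(\<Sum>\<mu>\<in>P. E \<mu>) = E (\<lambda>_. 0) + (\<Sum>\<mu>\<in>P0. E \<mu>)"
    unfolding P0_def by (rule sum.remove[OF finP(1) z0])
  ultimately have "(1 - \<eta>) * (\<Sum>\<mu>\<in>P. E \<mu>) \<le> E (\<lambda>_. 0)" by (simp add: algebra_simps)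
  moreover have "E (\<lambda>_. 0) = Aop b (Rop b h) \<bullet> Rop b h" by (simp add: E_eq t_def taylor_0)
  ultimately have "(\<Sum>\<mu>\<in>P. E \<mu>) \<le> Aop b (Rop b h) \<bullet> Rop b h / (1 - \<eta>)"
    using \<eta> by (simp add: field_simps)
  then show ?thesis unfolding E_eq t_def P_def .
qed

end

lemma has_vector_derivative_quotient:
  assumes "(f has_vector_derivative d) (at x)"
  shows "((\<lambda>h. (f (x + h) - f x) /\<^sub>R h) \<longlongrightarrow> d) (at 0)"
proof (rule LIM_zero_cancel, rule tendsto_norm_zero_cancel)
  have "((\<lambda>h. norm (f (x + h) - f x - h *\<^sub>R d) / norm h) \<longlongrightarrow> 0) (at 0)"
    using assms by (simp add: has_vector_derivative_def has_derivative_at)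
  then show "((\<lambda>h. norm ((f (x + h) - f x) /\<^sub>R h - d)) \<longlongrightarrow> 0) (at 0)"
  proof (rule Lim_transform_eventually)
    show "\<forall>\<^sub>F h in at 0. norm (f (x + h) - f x - h *\<^sub>R d) / norm h = norm ((f (x + h) - f x) /\<^sub>R h - d)"
      unfolding eventually_at
    proof (intro exI[of _ 1] conjI ballI impI)
      fix h :: real assume "h \<noteq> 0 \<and> dist h 0 < 1"
      then have "(f (x + h) - f x) /\<^sub>R h - d = (f (x + h) - f x - h *\<^sub>R d) /\<^sub>R h"
        by (simp add: scaleR_diff_right)
      then show "norm (f (x + h) - f x - h *\<^sub>R d) / norm h = norm ((f (x + h) - f x) /\<^sub>R h - d)"
        by (simp add: divide_inverse_commute)
    qed simp
  qed
qed

section \<open>Dependence of the solution operator on the coefficient\<close>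

context pde_domain
begin

text \<open>The coefficient enters \<open>solves\<close> only through its multiplication operator,
  so changes on null sets are invisible. This matters because the limit b is picked by
  \<open>SOME\<close> and is known only almost everywhere.\<close>

lemma Sol_cong: "Mul D a = (Mul D a' :: ('a, 'a) L2 \<Rightarrow>\<^sub>L ('a, 'a) L2) \<Longrightarrow> Sol a = Sol a'"
  unfolding Sol_def solves_def by simp

lemma Mul_exp_cong:
  assumes "b \<in> Linf D" "b' \<in> Linf D" "AE x in lebesgue_on D. b x = b' x"
  shows "Mul D (\<lambda>x. exp (b x)) = Mul D (\<lambda>x. exp (b' x))"
  by (rule Mul_cong) (use assms in auto)

lemma bdd_on_limit:
  assumes m: "b \<in> borel_measurable (lebesgue_on D)" and c: "\<And>\<epsilon>. \<epsilon> > 0 \<Longrightarrow> bdd_on D b (c + \<epsilon>)"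
  shows "bdd_on D b c"
proof -
  have "AE x in lebesgue_on D. \<forall>k. \<bar>b x\<bar> \<le> c + 1 / real (Suc k)"
    unfolding AE_all_countable using c by (auto simp: bdd_on_def)
  then have "AE x in lebesgue_on D. \<bar>b x\<bar> \<le> c"
  proof eventually_elim
    fix x assume "\<forall>k. \<bar>b x\<bar> \<le> c + 1 / real (Suc k)"
    then have "\<bar>b x\<bar> \<le> c + \<epsilon>" if "\<epsilon> > 0" for \<epsilon>
      using nat_approx_posE[OF that] by (meson add_left_mono less_imp_le order_trans)
    then show "\<bar>b x\<bar> \<le> c" by (rule field_le_epsilon)
  qed
  then show ?thesis using m by (simp add: bdd_on_def)
qed

lemma Linf_norm_nonneg:
  assumes "D \<noteq> {}" "b \<in> Linf D"
  shows "0 \<le> Linf_norm D b"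
proof (rule ccontr)
  assume neg: "\<not> 0 \<le> Linf_norm D b"
  have "AE x in lebesgue. x \<notin> D"
    using AE_bdd_on[OF Linf_bdd_on[OF assms(2)]]
  proof (rule eventually_mono)
    fix x assume "x \<in> D \<longrightarrow> \<bar>b x\<bar> \<le> Linf_norm D b"
    then show "x \<notin> D" using neg abs_ge_zero[of "b x"] by linarith
  qed
  then have "negligible D" unfolding negligible_iff_null_sets
    by (simp add: AE_iff_null_sets)
  then show False using open_not_negligible[OF open_D assms(1)] by blast
qed

text \<open>Local Lipschitz continuity from the resolvent identity. The restriction \<delta> \<le> 1
  keeps b' bounded by B + 1, so that one constant serves all these perturbations.\<close>

lemma Sol_close:
  assumes b: "bdd_on D b B" and b': "b' \<in> Linf D" and d: "bdd_on D (\<lambda>x. b' x - b x) \<delta>" "0 \<le> \<delta>" "\<delta> \<le> 1"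
  shows "norm (Sol (\<lambda>x. exp (b' x)) - Sol (\<lambda>x. exp (b x)))
    \<le> ((poincare_const + 1) / exp (- (B + 1))) * ((exp B * exp 1) * ((poincare_const + 1) / exp (- B))) * \<delta>"
proof -
  have "bdd_on D (\<lambda>x. b x + (b' x - b x)) (B + \<delta>)" by (rule bdd_on_add[OF b d(1)])
  then have b'B: "bdd_on D b' (B + 1)" using d(3) bdd_on_mono[of D b' "B + \<delta>" "B + 1"] by simp
  have ell: "elliptic (\<lambda>x. exp (\<phi> x)) (exp (- K))" if "bdd_on D \<phi> K" for \<phi> K
  proof -
    have "AE x in lebesgue_on D. exp (- K) \<le> exp (\<phi> x)"
      using that unfolding bdd_on_def by (auto elim!: eventually_mono)
    then show ?thesis using that Linf_iff by (auto simp: elliptic_def)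
  qed
  have bL: "b \<in> Linf D" using b Linf_iff by blast
  have MM: "norm (Mul D (\<lambda>x. exp (b' x)) - (Mul D (\<lambda>x. exp (b x)) :: ('a, 'a) L2 \<Rightarrow>\<^sub>L ('a, 'a) L2)) \<le> exp B * exp 1 * \<delta>"
  proof (rule Mul_dist)
    show "bdd_on D (\<lambda>x. exp (b' x) - exp (b x)) (exp B * exp 1 * \<delta>)"
      unfolding bdd_on_def
    proof (intro conjI)
      have "(\<lambda>x. exp (b' x) - exp (b x)) \<in> Linf D" using bL b' by auto
      then show "(\<lambda>x. exp (b' x) - exp (b x)) \<in> borel_measurable (lebesgue_on D)" by (simp add: Linf_def)
      have "AE x in lebesgue_on D. \<bar>b x\<bar> \<le> B" "AE x in lebesgue_on D. \<bar>b' x - b x\<bar> \<le> \<delta>" using b d by (auto simp: bdd_on_def)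
      then show "AE x in lebesgue_on D. \<bar>exp (b' x) - exp (b x)\<bar> \<le> exp B * exp 1 * \<delta>"
      proof eventually_elim
        fix x assume x: "\<bar>b x\<bar> \<le> B" "\<bar>b' x - b x\<bar> \<le> \<delta>"
        define z where "z = b' x - b x"
        have "\<bar>exp z - 1\<bar> \<le> \<bar>z\<bar> * exp \<bar>z\<bar>"
        proof -
          obtain t where t: "\<bar>t\<bar> \<le> \<bar>z\<bar>" "exp z = (\<Sum>m<1. z ^ m / fact m) + exp t / fact 1 * z ^ 1"
            using Maclaurin_exp_le[of z 1] by blast
          then have "\<bar>exp z - 1\<bar> = \<bar>z\<bar> * exp t" by (simp add: abs_mult)
          also have "\<dots> \<le> \<bar>z\<bar> * exp \<bar>z\<bar>" using t(1) by (intro mult_left_mono) auto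
          finally show ?thesis .
        qed
        also have "\<dots> \<le> \<delta> * exp 1" using x(2) d by (intro mult_mono) (auto simp: z_def)
        finally have "exp (b x) * \<bar>exp z - 1\<bar> \<le> exp B * (\<delta> * exp 1)" using x(1) by (intro mult_mono) auto
        moreover have "exp (b' x) - exp (b x) = exp (b x) * (exp z - 1)"
          by (simp add: z_def exp_diff field_simps)
        ultimately show "\<bar>exp (b' x) - exp (b x)\<bar> \<le> exp B * exp 1 * \<delta>" by (simp add: abs_mult mult_ac)
      qed
    qed
  qed (use bL b' d in auto)
  define S where "S = (\<lambda>\<phi>. Sol (\<lambda>x. exp (\<phi> x)))"
  have sn: "norm (Blinfun snd :: 'a H1 \<Rightarrow>\<^sub>L ('a, 'a) L2) \<le> 1"
    by (rule norm_blinfun_bound) (auto simp: bounded_linear_Blinfun_apply[OF bounded_linear_snd] norm_snd_le split: prod.split)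
  have n1: "norm (S b') \<le> (poincare_const + 1) / exp (- (B + 1))" unfolding S_def by (rule Sol_apply(2)[OF ell[OF b'B]])
  have n2: "norm (S b) \<le> (poincare_const + 1) / exp (- B)" unfolding S_def by (rule Sol_apply(2)[OF ell[OF b]])
  have "norm (S b' - S b) \<le> norm (S b') * (norm (Mul D (\<lambda>x. exp (b' x)) - (Mul D (\<lambda>x. exp (b x)) :: ('a, 'a) L2 \<Rightarrow>\<^sub>L ('a, 'a) L2)) * (norm (Blinfun snd :: 'a H1 \<Rightarrow>\<^sub>L ('a, 'a) L2) * norm (S b)))"
    unfolding S_def Sol_diff[OF ell[OF b'B] ell[OF b]] norm_minus_cancel
    by (intro order_trans[OF norm_blinfun_compose] mult_left_mono norm_ge_zero order_refl)
  also have "\<dots> \<le> ((poincare_const + 1) / exp (- (B + 1))) * ((exp B * exp 1 * \<delta>) * (1 * ((poincare_const + 1) / exp (- B))))"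
    by (intro mult_mono n1 n2 MM sn mult_nonneg_nonneg norm_ge_zero) (use poincare_const(1) d in auto)
  also have "\<dots> = ((poincare_const + 1) / exp (- (B + 1))) * ((exp B * exp 1) * ((poincare_const + 1) / exp (- B))) * \<delta>"
    by (simp only: mult_ac mult_1_left)
  finally show ?thesis unfolding S_def .
qed

text \<open>The filter is arbitrary because two limits are taken: in the parameter y in
  \<open>Sol_psum_continuous\<close>, and in the number of terms in
  \<open>usol_measurable\<close>.\<close>

lemma Sol_tendsto:
  assumes b: "b \<in> Linf D" and bn: "\<And>n. bn n \<in> Linf D"
    and d: "\<And>n. bdd_on D (\<lambda>x. bn n x - b x) (\<delta> n)" "\<And>n. 0 \<le> \<delta> n" "(\<delta> \<longlongrightarrow> 0) F"
  shows "((\<lambda>n. Sol (\<lambda>x. exp (bn n x))) \<longlongrightarrow> Sol (\<lambda>x. exp (b x))) F"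
proof -
  obtain B where B: "bdd_on D b B" using b Linf_iff by blast
  define L where "L = ((poincare_const + 1) / exp (- (B + 1))) * ((exp B * exp 1) * ((poincare_const + 1) / exp (- B)))"
  have "\<forall>\<^sub>F n in F. \<delta> n < 1" using d(3) by (rule order_tendstoD) simp
  then have ev: "\<forall>\<^sub>F n in F. norm (Sol (\<lambda>x. exp (bn n x)) - Sol (\<lambda>x. exp (b x))) \<le> L * \<delta> n"
    by eventually_elim (unfold L_def, rule Sol_close[OF B bn d(1,2)], simp)
  have "((\<lambda>n. L * \<delta> n) \<longlongrightarrow> L * 0) F" by (intro tendsto_intros d)
  then have "((\<lambda>n. L * \<delta> n) \<longlongrightarrow> 0) F" by simp
  with ev show ?thesis by (rule LIM_zero_cancel[OF Lim_null_comparison])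
qed

end

context pde_family
begin

lemma taylor_cong:
  assumes "Rop b = Rop b'" "Aop b = Aop b'" "\<mu> \<in> multi_indices"
  shows "taylor b h \<mu> = taylor b' h \<mu>"
  using assms(3)
proof (induction "degree_of \<mu>" arbitrary: \<mu> rule: less_induct)
  case less
  have IH: "taylor b h (\<mu> - \<kappa>) = taylor b' h (\<mu> - \<kappa>)" if "\<kappa> \<in> {\<kappa>. \<kappa> \<le> \<mu> \<and> \<kappa> \<noteq> (\<lambda>_. 0)}" for \<kappa>
    using that less.prems by (intro less.hyps degree_of_diff_less multi_indices_diff) (auto simp: multi_indices_def)
  have "(\<Sum>\<kappa>\<in>{\<kappa>. \<kappa> \<le> \<mu> \<and> \<kappa> \<noteq> (\<lambda>_. 0)}. Pop \<kappa> (Aop b' (taylor b h (\<mu> - \<kappa>))))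
    = (\<Sum>\<kappa>\<in>{\<kappa>. \<kappa> \<le> \<mu> \<and> \<kappa> \<noteq> (\<lambda>_. 0)}. Pop \<kappa> (Aop b' (taylor b' h (\<mu> - \<kappa>))))"
    by (rule sum.cong[OF refl]) (simp only: IH)
  then show ?case unfolding taylor_eq[OF less.prems] assms(1,2) by (simp only:)
qed

lemma taylor_cong_AE:
  assumes "b \<in> Linf D" "b' \<in> Linf D" "AE x in lebesgue_on D. b x = b' x" "\<mu> \<in> multi_indices"
  shows "taylor b h \<mu> = taylor b' h \<mu>"
proof (rule taylor_cong[OF _ _ assms(4)])
  have M: "Mul D (\<lambda>x. exp (b x)) = (Mul D (\<lambda>x. exp (b' x)) :: ('a, 'a) L2 \<Rightarrow>\<^sub>L ('a, 'a) L2)" by (rule Mul_exp_cong[OF assms(1-3)])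
  show "Aop b = Aop b'" by (simp add: Aop_def M)
  show "Rop b = Rop b'" by (simp add: Rop_def Sol_cong[OF M])
qed

section \<open>Random series\<close>

definition psum :: "nat \<Rightarrow> (nat \<Rightarrow> real) \<Rightarrow> 'a \<Rightarrow> real" where
  "psum n y x = (\<Sum>j<n. y j * \<psi> j x)"

abbreviation conv :: "(nat \<Rightarrow> real) set" where "conv \<equiv> convergence_set D \<psi>"

text \<open>The same choice as inside \<open>diffusion\<close>, so that the two agree literally and
  not merely almost everywhere.\<close>

definition blim :: "(nat \<Rightarrow> real) \<Rightarrow> 'a \<Rightarrow> real" where
  "blim y = (SOME b. Linf_sums D (\<lambda>j x. y j * \<psi> j x) b)"

lemma psum_Linf: "psum n y \<in> Linf D"
  unfolding psum_def using \<psi> by (intro Linf_sum Linf_mult) auto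

lemma diffusion_eq: "diffusion D \<psi> y = (\<lambda>x. exp (blim y x))"
  by (simp add: diffusion_def blim_def)

lemma blim:
  assumes "y \<in> conv"
  shows "blim y \<in> Linf D" "(\<lambda>n. Linf_norm D (\<lambda>x. blim y x - psum n y x)) \<longlonglongrightarrow> 0"
proof -
  have "\<exists>b. Linf_sums D (\<lambda>j x. y j * \<psi> j x) b" using assms by (simp add: convergence_set_def)
  then have "Linf_sums D (\<lambda>j x. y j * \<psi> j x) (blim y)" unfolding blim_def by (rule someI_ex)
  then show "blim y \<in> Linf D" "(\<lambda>n. Linf_norm D (\<lambda>x. blim y x - psum n y x)) \<longlonglongrightarrow> 0"
    by (simp_all add: Linf_sums_def psum_def)
qed

lemma bdd_on_blim_psum: "y \<in> conv \<Longrightarrow> bdd_on D (\<lambda>x. blim y x - psum n y x) (Linf_norm D (\<lambda>x. blim y x - psum n y x))"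
  by (rule Linf_bdd_on) (intro Linf_diff blim(1) psum_Linf)

lemma Linf_sums_unique:
  assumes "D \<noteq> {}" "Linf_sums D h b" "Linf_sums D h b'" "\<And>j. h j \<in> Linf D"
  shows "AE x in lebesgue_on D. b x = b' x"
proof -
  define p where "p n x = (\<Sum>j<n. h j x)" for n x
  have pL: "p n \<in> Linf D" for n unfolding p_def using assms(4) by (intro Linf_sum)
  have b: "b \<in> Linf D" "b' \<in> Linf D" and l: "(\<lambda>n. Linf_norm D (\<lambda>x. b x - p n x)) \<longlonglongrightarrow> 0" "(\<lambda>n. Linf_norm D (\<lambda>x. b' x - p n x)) \<longlonglongrightarrow> 0"
    using assms by (auto simp: Linf_sums_def p_def)
  have dL: "(\<lambda>x. b x - b' x) \<in> Linf D" using b by auto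
  have "bdd_on D (\<lambda>x. b x - b' x) 0"
  proof (rule bdd_on_limit)
    show "(\<lambda>x. b x - b' x) \<in> borel_measurable (lebesgue_on D)" using dL by (simp add: Linf_def)
    fix \<epsilon> :: real assume e: "\<epsilon> > 0"
    have "\<forall>\<^sub>F n in sequentially. Linf_norm D (\<lambda>x. b x - p n x) < \<epsilon> / 2" "\<forall>\<^sub>F n in sequentially. Linf_norm D (\<lambda>x. b' x - p n x) < \<epsilon> / 2"
      using order_tendstoD(2)[OF l(1), of "\<epsilon> / 2"] order_tendstoD(2)[OF l(2), of "\<epsilon> / 2"] e by simp_all
    then have "\<forall>\<^sub>F n in sequentially. Linf_norm D (\<lambda>x. b x - p n x) < \<epsilon> / 2 \<and> Linf_norm D (\<lambda>x. b' x - p n x) < \<epsilon> / 2"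
      by (rule eventually_conj)
    then obtain n where n: "Linf_norm D (\<lambda>x. b x - p n x) < \<epsilon> / 2" "Linf_norm D (\<lambda>x. b' x - p n x) < \<epsilon> / 2"
      using eventually_happens'[OF sequentially_bot] by blast
    have 1: "bdd_on D (\<lambda>x. b x - p n x) (\<epsilon> / 2)"
      by (rule bdd_on_mono[OF Linf_bdd_on]) (use b pL n in auto)
    have "bdd_on D (\<lambda>x. b' x - p n x) (\<epsilon> / 2)"
      by (rule bdd_on_mono[OF Linf_bdd_on]) (use b pL n in auto)
    then have 2: "bdd_on D (\<lambda>x. (-1) * (b' x - p n x)) (\<bar>-1\<bar> * (\<epsilon> / 2))" by (intro bdd_on_mult bdd_on_const)
    from bdd_on_add[OF 1 2] show "bdd_on D (\<lambda>x. b x - b' x) (0 + \<epsilon>)" by (simp add: algebra_simps)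
  qed
  then have "AE x in lebesgue_on D. \<bar>b x - b' x\<bar> \<le> 0" by (simp add: bdd_on_def)
  then show ?thesis by eventually_elim simp
qed

text \<open>Completeness of L-infinity, phrased by countably many conditions on pairs of partial
  sums. Each condition is closed in y, from which \<open>conv_measurable\<close> obtains
  measurability.\<close>

lemma conv_iff_Cauchy:
  assumes D0: "D \<noteq> {}"
  shows "y \<in> conv \<longleftrightarrow> (\<forall>k. \<exists>N. \<forall>n\<ge>N. \<forall>m\<ge>N. bdd_on D (\<lambda>x. psum n y x - psum m y x) (1 / real (Suc k)))"
proof
  assume y: "y \<in> conv"
  show "\<forall>k. \<exists>N. \<forall>n\<ge>N. \<forall>m\<ge>N. bdd_on D (\<lambda>x. psum n y x - psum m y x) (1 / real (Suc k))"
  proof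
    fix k
    define e where "e = 1 / real (Suc k)"
    have e: "e / 2 > 0" by (simp add: e_def)
    have "\<forall>\<^sub>F n in sequentially. Linf_norm D (\<lambda>x. blim y x - psum n y x) < e / 2"
      using blim(2)[OF y] e by (rule order_tendstoD)
    then obtain N where N: "\<And>n. n \<ge> N \<Longrightarrow> Linf_norm D (\<lambda>x. blim y x - psum n y x) < e / 2"
      by (auto simp: eventually_sequentially)
    have "bdd_on D (\<lambda>x. psum n y x - psum m y x) e" if "n \<ge> N" "m \<ge> N" for n m
    proof -
      have b: "bdd_on D (\<lambda>x. blim y x - psum i y x) (e / 2)" if "i \<ge> N" for i
        by (rule bdd_on_mono[OF bdd_on_blim_psum[OF y]]) (use N[OF that] in simp)
      have "bdd_on D (\<lambda>x. (-1) * (blim y x - psum n y x)) (\<bar>-1\<bar> * (e / 2))" by (intro bdd_on_mult bdd_on_const b that)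
      from bdd_on_add[OF b[OF \<open>m \<ge> N\<close>] this] show ?thesis by (simp add: algebra_simps)
    qed
    then show "\<exists>N. \<forall>n\<ge>N. \<forall>m\<ge>N. bdd_on D (\<lambda>x. psum n y x - psum m y x) (1 / real (Suc k))"
      unfolding e_def by blast
  qed
next
  assume "\<forall>k. \<exists>N. \<forall>n\<ge>N. \<forall>m\<ge>N. bdd_on D (\<lambda>x. psum n y x - psum m y x) (1 / real (Suc k))"
  then obtain N where N: "\<And>k n m. n \<ge> N k \<Longrightarrow> m \<ge> N k \<Longrightarrow> bdd_on D (\<lambda>x. psum n y x - psum m y x) (1 / real (Suc k))" by metis
  \<comment> \<open>The exceptional sets of these countably many bounds are united before any limit
    is taken pointwise.\<close>
  have ae: "AE x in lebesgue_on D. \<forall>k n m. n \<ge> N k \<longrightarrow> m \<ge> N k \<longrightarrow> \<bar>psum n y x - psum m y x\<bar> \<le> 1 / real (Suc k)"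
    unfolding AE_all_countable
  proof (intro allI)
    fix k n m
    show "AE x in lebesgue_on D. n \<ge> N k \<longrightarrow> m \<ge> N k \<longrightarrow> \<bar>psum n y x - psum m y x\<bar> \<le> 1 / real (Suc k)"
      using N[of k n m] by (cases "n \<ge> N k \<and> m \<ge> N k") (auto simp: bdd_on_def)
  qed
  have [measurable]: "psum n y \<in> borel_measurable (lebesgue_on D)" for n using psum_Linf[of n y] by (simp add: Linf_def)
  define b where "b x = lim (\<lambda>n. psum n y x)" for x
  have [measurable]: "b \<in> borel_measurable (lebesgue_on D)" unfolding b_def by measurable
  have bd: "bdd_on D (\<lambda>x. b x - psum n y x) (1 / real (Suc k))" if n: "n \<ge> N k" for n k
    unfolding bdd_on_def
  proof (intro conjI)
    show "(\<lambda>x. b x - psum n y x) \<in> borel_measurable (lebesgue_on D)" by measurable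
    show "AE x in lebesgue_on D. \<bar>b x - psum n y x\<bar> \<le> 1 / real (Suc k)"
      using ae
    proof eventually_elim
      fix x assume x: "\<forall>k n m. n \<ge> N k \<longrightarrow> m \<ge> N k \<longrightarrow> \<bar>psum n y x - psum m y x\<bar> \<le> 1 / real (Suc k)"
      have "Cauchy (\<lambda>n. psum n y x)"
      proof (rule CauchyI)
        fix e :: real assume "e > 0"
        then obtain k where "1 / real (Suc k) < e" using nat_approx_posE by blast
        then show "\<exists>M. \<forall>m\<ge>M. \<forall>n\<ge>M. norm (psum m y x - psum n y x) < e"
          using x by (intro exI[of _ "N k"]) (auto intro: le_less_trans)
      qed
      then have "(\<lambda>m. psum m y x) \<longlonglongrightarrow> b x" unfolding b_def by (simp add: Cauchy_convergent_iff convergent_LIMSEQ_iff)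
      then have "(\<lambda>m. \<bar>psum m y x - psum n y x\<bar>) \<longlonglongrightarrow> \<bar>b x - psum n y x\<bar>" by (intro tendsto_intros)
      then show "\<bar>b x - psum n y x\<bar> \<le> 1 / real (Suc k)"
        by (rule LIMSEQ_le_const2) (use x n in blast)
    qed
  qed
  have bL: "b \<in> Linf D"
  proof -
    have "(\<lambda>x. (b x - psum (N 0) y x) + psum (N 0) y x) \<in> Linf D"
      using bd[of 0 "N 0"] psum_Linf Linf_iff by (intro Linf_add) blast+
    then show ?thesis by simp
  qed
  have "(\<lambda>n. Linf_norm D (\<lambda>x. b x - psum n y x)) \<longlonglongrightarrow> 0"
  proof (rule LIMSEQ_I)
    fix e :: real assume "e > 0"
    then obtain k where k: "1 / real (Suc k) < e" using nat_approx_posE by blast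
    show "\<exists>no. \<forall>n\<ge>no. norm (Linf_norm D (\<lambda>x. b x - psum n y x) - 0) < e"
    proof (intro exI allI impI)
      fix n assume n: "n \<ge> N k"
      have "Linf_norm D (\<lambda>x. b x - psum n y x) \<le> 1 / real (Suc k)" by (rule bdd_on_Linf(2)[OF bd[OF n]]) simp
      moreover have "0 \<le> Linf_norm D (\<lambda>x. b x - psum n y x)" by (intro Linf_norm_nonneg D0 Linf_diff bL psum_Linf)
      ultimately show "norm (Linf_norm D (\<lambda>x. b x - psum n y x) - 0) < e" using k by simp
    qed
  qed
  then have "Linf_sums D (\<lambda>j x. y j * \<psi> j x) b" using bL by (simp add: Linf_sums_def psum_def)
  then show "y \<in> conv" by (auto simp: convergence_set_def)
qed

lemma psum_tendsto: "X \<longlonglongrightarrow> y \<Longrightarrow> (\<lambda>i. psum n (X i) x) \<longlonglongrightarrow> psum n y x" for X :: "nat \<Rightarrow> nat \<Rightarrow> real"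
proof -
  assume "X \<longlonglongrightarrow> y"
  then have "(\<lambda>i. X i j) \<longlonglongrightarrow> y j" for j
    using continuous_on_tendsto_compose[OF continuous_on_product_coordinates, of X y sequentially j] by auto
  then show ?thesis unfolding psum_def by (intro tendsto_intros)
qed

lemma conv_measurable:
  assumes D0: "D \<noteq> {}"
  shows "conv \<in> sets gaussian"
proof -
  \<comment> \<open>At each x the partial sums are continuous in y, and an almost everywhere bound
    along a sequence survives its limit.\<close>
  have cl: "closed {y. bdd_on D (\<lambda>x. psum n y x - psum m y x) c}" for n m c
    unfolding closed_sequential_limits
  proof (intro allI impI, elim conjE)
    fix X y assume X: "\<forall>i. X i \<in> {y. bdd_on D (\<lambda>x. psum n y x - psum m y x) c}" and lim: "X \<longlonglongrightarrow> y"
    have "AE x in lebesgue_on D. \<forall>i. \<bar>psum n (X i) x - psum m (X i) x\<bar> \<le> c"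
      unfolding AE_all_countable using X by (auto simp: bdd_on_def)
    then have "AE x in lebesgue_on D. \<bar>psum n y x - psum m y x\<bar> \<le> c"
    proof eventually_elim
      fix x assume x: "\<forall>i. \<bar>psum n (X i) x - psum m (X i) x\<bar> \<le> c"
      have "(\<lambda>i. \<bar>psum n (X i) x - psum m (X i) x\<bar>) \<longlonglongrightarrow> \<bar>psum n y x - psum m y x\<bar>"
        by (intro tendsto_intros psum_tendsto lim)
      then show "\<bar>psum n y x - psum m y x\<bar> \<le> c" by (rule LIMSEQ_le_const2) (use x in blast)
    qed
    moreover have "(\<lambda>x. psum n y x - psum m y x) \<in> Linf D" by (intro Linf_diff psum_Linf)
    ultimately show "y \<in> {y. bdd_on D (\<lambda>x. psum n y x - psum m y x) c}" by (simp add: bdd_on_def Linf_def)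
  qed
  have "conv = (\<Inter>k. \<Union>N. \<Inter>n\<in>{N..}. \<Inter>m\<in>{N..}. {y. bdd_on D (\<lambda>x. psum n y x - psum m y x) (1 / real (Suc k))})"
    by (rule set_eqI) (simp only: conv_iff_Cauchy[OF D0] INT_iff UN_iff mem_Collect_eq Ball_def Bex_def UNIV_I atLeast_iff simp_thms)
  also have "\<dots> \<in> sets borel"
  proof -
    have "(\<Inter>n\<in>{N..}. \<Inter>m\<in>{N..}. {y. bdd_on D (\<lambda>x. psum n y x - psum m y x) (1 / real (Suc k))}) \<in> sets borel" for N k
      by (intro borel_closed closed_INT ballI cl)
    then have S: "(\<Union>N. \<Inter>n\<in>{N..}. \<Inter>m\<in>{N..}. {y. bdd_on D (\<lambda>x. psum n y x - psum m y x) (1 / real (Suc k))}) \<in> sets borel" for k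
      by (intro sets.countable_UN) blast
    show ?thesis by (rule sets.countable_INT'') (simp, simp, rule S)
  qed
  finally show ?thesis by (simp add: sets_gaussian_borel)
qed

text \<open>Changing coordinate j alters all partial sums beyond j by the same multiple of \<psi>_j.
  Hence the convergence set is a union of whole coordinate lines, and the derivative along such a
  line has no exceptional points.\<close>

lemma
  assumes D0: "D \<noteq> {}" and y: "y \<in> conv"
  shows conv_upd: "y(j := s) \<in> conv"
    and blim_upd: "AE x in lebesgue_on D. blim (y(j := s)) x = blim y x + (s - y j) * \<psi> j x"
proof -
  have ps: "psum n (y(j := s)) x = psum n y x + (s - y j) * \<psi> j x" if "n > j" for n x
  proof -
    have "psum n (y(j := s)) x = s * \<psi> j x + (\<Sum>i\<in>{..<n} - {j}. y i * \<psi> i x)"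
      unfolding psum_def using that by (subst sum.remove[of _ j]) auto
    moreover have "psum n y x = y j * \<psi> j x + (\<Sum>i\<in>{..<n} - {j}. y i * \<psi> i x)"
      unfolding psum_def using that by (subst sum.remove[of _ j]) auto
    ultimately show ?thesis by (simp add: algebra_simps)
  qed
  let ?b = "\<lambda>x. blim y x + (s - y j) * \<psi> j x"
  have bL: "?b \<in> Linf D" by (intro Linf_add Linf_mult blim(1)[OF y] \<psi> Linf_const)
  have "(\<lambda>n. Linf_norm D (\<lambda>x. ?b x - psum n (y(j := s)) x)) \<longlonglongrightarrow> 0"
  proof (rule Lim_transform_eventually[OF blim(2)[OF y]])
    show "\<forall>\<^sub>F n in sequentially. Linf_norm D (\<lambda>x. blim y x - psum n y x) = Linf_norm D (\<lambda>x. ?b x - psum n (y(j := s)) x)"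
      using eventually_gt_at_top[of j] by eventually_elim (simp add: ps)
  qed
  then have L: "Linf_sums D (\<lambda>i x. (y(j := s)) i * \<psi> i x) ?b" using bL by (simp add: Linf_sums_def psum_def)
  then show c: "y(j := s) \<in> conv" unfolding convergence_set_def by blast
  have "Linf_sums D (\<lambda>i x. (y(j := s)) i * \<psi> i x) (blim (y(j := s)))"
    using blim[OF c] by (simp add: Linf_sums_def psum_def)
  then show "AE x in lebesgue_on D. blim (y(j := s)) x = ?b x"
    by (rule Linf_sums_unique[OF D0 _ L]) (intro Linf_mult \<psi> Linf_const)
qed

lemma conv_upd_iff: "D \<noteq> {} \<Longrightarrow> y(j := s) \<in> conv \<longleftrightarrow> y \<in> conv"
  using conv_upd[of "y(j := s)" j "y j"] conv_upd[of y j s] by auto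

section \<open>The solution and its Taylor coefficients as random variables\<close>

definition usol :: "('a, 'a) L2 \<Rightarrow> (nat \<Rightarrow> real) \<Rightarrow> 'a H1" where
  "usol h y = (if y \<in> conv then Sol (\<lambda>x. exp (blim y x)) h else 0)"

definition tay :: "('a, 'a) L2 \<Rightarrow> (nat \<Rightarrow> nat) \<Rightarrow> (nat \<Rightarrow> real) \<Rightarrow> ('a, 'a) L2" where
  "tay h \<mu> y = (if y \<in> conv then taylor (blim y) h \<mu> else 0)"

lemma tay_0: "tay h (\<lambda>_. 0) y = snd (usol h y)"
  by (simp add: tay_def usol_def taylor_0 Rop_def bounded_linear_Blinfun_apply[OF bounded_linear_snd])

lemma Sol_psum_continuous: "continuous_on UNIV (\<lambda>y. Sol (\<lambda>x. exp (psum n y x)) h)"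
proof (rule continuous_at_imp_continuous_on, rule ballI)
  fix y :: "nat \<Rightarrow> real"
  define c where "c j = Linf_norm D (\<psi> j)" for j
  have c: "bdd_on D (\<psi> j) (c j)" for j unfolding c_def by (rule Linf_bdd_on[OF \<psi>])
  define \<delta> where "\<delta> y' = (\<Sum>j<n. \<bar>y' j - y j\<bar> * \<bar>c j\<bar>)" for y' :: "nat \<Rightarrow> real"
  have b: "bdd_on D (\<lambda>x. psum n y' x - psum n y x) (\<delta> y')" for y'
  proof -
    have "bdd_on D (\<lambda>x. \<Sum>j<m. (y' j - y j) * \<psi> j x) (\<Sum>j<m. \<bar>y' j - y j\<bar> * \<bar>c j\<bar>)" for m
    proof (induction m)
      case (Suc m)
      have "bdd_on D (\<lambda>x. (y' m - y m) * \<psi> m x) (\<bar>y' m - y m\<bar> * \<bar>c m\<bar>)"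
        by (intro bdd_on_mult bdd_on_const bdd_on_mono[OF c]) simp
      from bdd_on_add[OF Suc this] show ?case by simp
    qed (use bdd_on_const[of D 0] in simp)
    then show ?thesis by (simp add: psum_def \<delta>_def left_diff_distrib sum_subtractf)
  qed
  have "((\<lambda>y'. \<delta> y') \<longlongrightarrow> \<delta> y) (at y)"
  proof -
    have "((\<lambda>y'. y' j) \<longlongrightarrow> y j) (at y)" for j
    proof -
      have "continuous_on UNIV (\<lambda>y' :: nat \<Rightarrow> real. y' j)" by (rule continuous_on_product_coordinates)
      then show ?thesis by (simp add: continuous_on_def)
    qed
    then show ?thesis unfolding \<delta>_def by (intro tendsto_intros)
  qed
  then have "((\<lambda>y'. \<delta> y') \<longlongrightarrow> 0) (at y)" by (simp add: \<delta>_def)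
  then have "((\<lambda>y'. Sol (\<lambda>x. exp (psum n y' x))) \<longlongrightarrow> Sol (\<lambda>x. exp (psum n y x))) (at y)"
    by (intro Sol_tendsto[OF psum_Linf psum_Linf b]) (auto simp: \<delta>_def intro: sum_nonneg)
  then have "((\<lambda>y'. Sol (\<lambda>x. exp (psum n y' x)) h) \<longlongrightarrow> Sol (\<lambda>x. exp (psum n y x)) h) (at y)"
    by (intro blinfun.tendsto tendsto_const)
  then show "isCont (\<lambda>y. Sol (\<lambda>x. exp (psum n y x)) h) y" by (simp add: isCont_def)
qed

text \<open>A pointwise limit: on the convergence set the solutions for the partial sums, which are
  continuous in y, converge; off it everything is 0.\<close>

lemma usol_measurable:
  assumes D0: "D \<noteq> {}"
  shows "usol h \<in> borel_measurable gaussian"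
proof (rule borel_measurable_LIMSEQ_metric)
  define U where "U n y = (if y \<in> conv then Sol (\<lambda>x. exp (psum n y x)) h else 0)" for n y
  have "(\<lambda>y. Sol (\<lambda>x. exp (psum n y x)) h) \<in> borel_measurable gaussian" for n
    using borel_measurable_continuous_onI[OF Sol_psum_continuous]
    by (simp add: measurable_cong_sets[OF sets_gaussian_borel refl])
  then show "U n \<in> borel_measurable gaussian" for n
    unfolding U_def using conv_measurable[OF D0] by (intro measurable_If_set) auto
  show "(\<lambda>n. U n y) \<longlonglongrightarrow> usol h y" for y
  proof (cases "y \<in> conv")
    case True
    have "bdd_on D (\<lambda>x. psum n y x - blim y x) (Linf_norm D (\<lambda>x. blim y x - psum n y x))" for n
      using bdd_on_mult[OF bdd_on_const[of D "-1"] bdd_on_blim_psum[OF True, of n]] by simp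
    then have "(\<lambda>n. Sol (\<lambda>x. exp (psum n y x))) \<longlonglongrightarrow> Sol (\<lambda>x. exp (blim y x))"
      by (rule Sol_tendsto[OF blim(1)[OF True] psum_Linf])
        (intro Linf_norm_nonneg D0 Linf_diff blim(1)[OF True] psum_Linf, rule blim(2)[OF True])
    then have "(\<lambda>n. Sol (\<lambda>x. exp (psum n y x)) h) \<longlonglongrightarrow> Sol (\<lambda>x. exp (blim y x)) h"
      by (intro blinfun.tendsto tendsto_const)
    then show ?thesis using True by (simp add: U_def usol_def)
  qed (simp add: U_def usol_def)
qed

lemma tay_derivative:
  assumes D0: "D \<noteq> {}" and \<mu>: "\<mu> \<in> multi_indices"
  shows "((\<lambda>s. tay h \<mu> (y(j := s))) has_vector_derivative
    real (Suc (\<mu> j)) *\<^sub>R tay h (\<mu>(j := Suc (\<mu> j))) (y(j := s))) (at s)"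
proof (cases "y \<in> conv")
  case True
  \<comment> \<open>The field with coordinate j set to 0, so that b + s \<psi>_j is the field at y(j
    := s) up to a null set.\<close>
  define b where "b x = blim y x + (- y j) * \<psi> j x" for x
  have bL: "b \<in> Linf D" unfolding b_def by (intro Linf_add Linf_mult blim(1)[OF True] \<psi> Linf_const)
  have eq: "tay h \<nu> (y(j := s)) = taylor (shift b j s) h \<nu>" if "\<nu> \<in> multi_indices" for \<nu> s
  proof -
    have "taylor (blim (y(j := s))) h \<nu> = taylor (shift b j s) h \<nu>"
    proof (rule taylor_cong_AE[OF blim(1)[OF conv_upd[OF D0 True]] shift_Linf[OF bL] _ that])
      show "AE x in lebesgue_on D. blim (y(j := s)) x = b x + s * \<psi> j x"
        using blim_upd[OF D0 True, of j s] by eventually_elim (simp add: b_def algebra_simps)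
    qed
    then show ?thesis using conv_upd[OF D0 True] by (simp add: tay_def)
  qed
  show ?thesis unfolding eq[OF \<mu>] eq[OF multi_indices_upd[OF \<mu>]]
    by (rule taylor_derivative[OF bL \<mu>])
next
  case False
  then show ?thesis using conv_upd_iff[OF D0] by (simp add: tay_def)
qed

text \<open>A coefficient of higher order is a limit of difference quotients of one of lower order,
  so measurability descends from the solution by induction on the degree; the operator recursion is
  not revisited.\<close>

lemma tay_measurable:
  assumes D0: "D \<noteq> {}" and \<mu>: "\<mu> \<in> multi_indices"
  shows "tay h \<mu> \<in> borel_measurable gaussian"
  using \<mu>
proof (induction "degree_of \<mu>" arbitrary: \<mu> rule: less_induct)
  case less
  note \<mu> = less.prems
  show ?case
  proof (cases "\<mu> = (\<lambda>_. 0)")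
    case True
    have "(\<lambda>y. snd (usol h y)) \<in> borel_measurable gaussian"
      by (rule measurable_compose[OF usol_measurable[OF D0]])
        (intro borel_measurable_continuous_onI continuous_intros)
    then show ?thesis unfolding True tay_0[abs_def] .
  next
    case False
    then obtain j where j: "\<mu> j \<noteq> 0" by blast
    define \<mu>' where "\<mu>' = \<mu>(j := \<mu> j - 1)"
    have \<mu>_eq: "\<mu> = \<mu>'(j := Suc (\<mu>' j))" using j by (auto simp: \<mu>'_def)
    have \<mu>': "\<mu>' \<in> multi_indices" unfolding \<mu>'_def by (rule multi_indices_upd[OF \<mu>])
    have "\<mu>' = \<mu> - (\<lambda>_. 0)(j := 1)" by (auto simp: \<mu>'_def fun_eq_iff)
    moreover have "degree_of (\<mu> - (\<lambda>_. 0)(j := 1)) < degree_of \<mu>"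
      using \<mu> j by (intro degree_of_diff_less) (auto simp: multi_indices_def le_fun_def fun_eq_iff)
    ultimately have "degree_of \<mu>' < degree_of \<mu>" by simp
    from less.hyps[OF this \<mu>'] have m[measurable]: "tay h \<mu>' \<in> borel_measurable gaussian" .
    define e where "e n = 1 / real (Suc n)" for n
    have elim0: "filterlim e (at 0) sequentially"
      unfolding filterlim_at e_def using LIMSEQ_inverse_real_of_nat by (auto simp: inverse_eq_divide)
    define Q where "Q n y = (1 / real (Suc (\<mu>' j))) *\<^sub>R ((tay h \<mu>' (y(j := y j + e n)) - tay h \<mu>' y) /\<^sub>R e n)" for n y
    show ?thesis
    proof (rule borel_measurable_LIMSEQ_metric)
      have "(\<lambda>y. y(j := y j + e n)) \<in> measurable (PiM UNIV (\<lambda>_. borel)) (PiM UNIV (\<lambda>_. borel :: real measure))" for n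
        by (rule measurable_PiM_single') (auto simp: space_PiM)
      then have um: "(\<lambda>y. y(j := y j + e n)) \<in> measurable gaussian gaussian" for n
        using measurable_cong_sets[OF sets_gaussian sets_gaussian] by blast
      show "Q n \<in> borel_measurable gaussian" for n
        unfolding Q_def using measurable_compose[OF um m] by measurable
      show "(\<lambda>n. Q n y) \<longlonglongrightarrow> tay h \<mu> y" for y
      proof -
        have "((\<lambda>s. tay h \<mu>' (y(j := s))) has_vector_derivative real (Suc (\<mu>' j)) *\<^sub>R tay h \<mu> (y(j := y j))) (at (y j))"
          using tay_derivative[OF D0 \<mu>', of h y j "y j"] unfolding \<mu>_eq[symmetric] .
        then have "((\<lambda>t. (tay h \<mu>' (y(j := y j + t)) - tay h \<mu>' (y(j := y j))) /\<^sub>R t) \<longlongrightarrow> real (Suc (\<mu>' j)) *\<^sub>R tay h \<mu> (y(j := y j))) (at 0)"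
          by (rule has_vector_derivative_quotient)
        from filterlim_compose[OF this elim0] have "(\<lambda>n. (tay h \<mu>' (y(j := y j + e n)) - tay h \<mu>' y) /\<^sub>R e n) \<longlonglongrightarrow> real (Suc (\<mu>' j)) *\<^sub>R tay h \<mu> y" by simp
        then have "(\<lambda>n. Q n y) \<longlonglongrightarrow> (1 / real (Suc (\<mu>' j))) *\<^sub>R (real (Suc (\<mu>' j)) *\<^sub>R tay h \<mu> y)"
          unfolding Q_def by (rule tendsto_scaleR[OF tendsto_const])
        then show ?thesis by (simp del: of_nat_Suc)
      qed
    qed
  qed
qed

end

text \<open>What is kept of the wavelets: w is the sequence of sup-norms divided by C, and
  \<open>overlap\<close> bounds, uniformly in x, the sum of any positive power of w over the
  functions not vanishing at x. Three exponents are used: 1/2 to bound b, 1/4 for convergence, and 1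
  - \<theta> for the weights.\<close>

locale wavelet_family = pde_family +
  fixes w :: "nat \<Rightarrow> real" and C q :: real
  assumes D0: "D \<noteq> {}"
    and w: "\<And>j. 0 < w j" "\<And>j. w j \<le> 1" and C: "0 < C" and q: "0 < q"
    and \<psi>_bound: "\<And>j. bdd_on D (\<psi> j) (C * w j)"
    and summable_w: "summable (\<lambda>j. w j powr q)"
    and overlap: "\<And>\<epsilon>. 0 < \<epsilon> \<Longrightarrow> \<exists>K\<ge>0. \<forall>x\<in>D. \<forall>F. finite F \<longrightarrow> (\<Sum>j\<in>F. if \<psi> j x \<noteq> 0 then w j powr \<epsilon> else 0) \<le> K"
begin

text \<open>Almost surely all but finitely many \<open>\<bar>y j\<bar>\<close> are below \<open>level_cut j\<close>; \<open>excess\<close> measures by how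
  much the others exceed it.\<close>

definition level_cut :: "nat \<Rightarrow> real" where "level_cut j = - q * ln (w j)"

definition excess :: "nat \<Rightarrow> real \<Rightarrow> real" where "excess j t = max 0 (\<bar>t\<bar> - level_cut j)"

definition W :: "(nat \<Rightarrow> real) \<Rightarrow> real" where "W y = (\<Sum>j. w j * excess j (y j))"

definition tame :: "(nat \<Rightarrow> real) \<Rightarrow> bool" where "tame y \<longleftrightarrow> summable (\<lambda>j. w j * excess j (y j))"

lemma level_cut_nonneg: "0 \<le> level_cut j"
  using w[of j] q by (simp add: level_cut_def mult_nonneg_nonpos)

lemma excess_nonneg: "0 \<le> excess j t" by (simp add: excess_def)

lemma wexcess_nonneg: "0 \<le> w j * excess j t" using w(1)[of j] excess_nonneg by (simp add: less_imp_le)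

text \<open>The logarithm costs half of the exponent: ln(1/w) = 2 ln(w^(-1/2)) \<le> 2
  w^(-1/2).\<close>

lemma w_level_cut: "w j * level_cut j \<le> 2 * q * w j powr (1/2)"
proof -
  define z where "z = w j powr (- 1/2)"
  have z: "z > 0" using w(1)[of j] by (simp add: z_def)
  have "- ln (w j) = 2 * ln z" using w(1)[of j] by (simp add: z_def ln_powr)
  also have "\<dots> \<le> 2 * z" using ln_less_self[OF z] by simp
  finally have "level_cut j \<le> q * (2 * z)" using q mult_left_mono[of "- ln (w j)" "2 * z" q] by (simp add: level_cut_def)
  then have "w j * level_cut j \<le> w j * (q * (2 * z))" using w(1)[of j] by (intro mult_left_mono) auto
  also have "\<dots> = 2 * q * (w j powr 1 * z)" using w(1)[of j] by simp
  also have "w j powr 1 * z = w j powr (1/2)" unfolding z_def powr_add[symmetric] by simp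
  finally show ?thesis .
qed

section \<open>Bounds and convergence of the random series\<close>

definition regular :: "'a \<Rightarrow> bool" where "regular x \<longleftrightarrow> x \<in> D \<and> (\<forall>j. \<bar>\<psi> j x\<bar> \<le> C * w j)"

lemma AE_regular: "AE x in lebesgue_on D. regular x"
proof -
  have "AE x in lebesgue_on D. \<forall>j. \<bar>\<psi> j x\<bar> \<le> C * w j"
    unfolding AE_all_countable using \<psi>_bound by (auto simp: bdd_on_def)
  moreover have "AE x in lebesgue_on D. x \<in> D" using AE_space[of "lebesgue_on D"] by (rule eventually_mono) (simp add: space_restrict_space)
  ultimately show ?thesis by eventually_elim (simp add: regular_def)
qed

text \<open>Splits |y_j| at the cut: the part below it is deterministic and left to
  \<open>overlap\<close>; the excess stays random, with weight w_j and without dependence on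
  x.\<close>

lemma series_term_bound:
  assumes x: "regular x"
  shows "\<bar>y j * \<psi> j x\<bar> \<le> 2 * q * C * (if \<psi> j x \<noteq> 0 then w j powr (1/2) else 0) + C * (w j * excess j (y j))"
proof (cases "\<psi> j x = 0")
  case True
  then show ?thesis using C wexcess_nonneg[of j] by simp
next
  case False
  have "\<bar>y j\<bar> \<le> level_cut j + excess j (y j)" by (simp add: excess_def)
  moreover have "\<bar>\<psi> j x\<bar> \<le> C * w j" using x by (simp add: regular_def)
  ultimately have "\<bar>y j * \<psi> j x\<bar> \<le> (level_cut j + excess j (y j)) * (C * w j)"
    unfolding abs_mult by (intro mult_mono) (auto intro: add_nonneg_nonneg level_cut_nonneg excess_nonneg)
  also have "\<dots> = C * (w j * level_cut j) + C * (w j * excess j (y j))" by (simp add: algebra_simps)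
  also have "\<dots> \<le> C * (2 * q * w j powr (1/2)) + C * (w j * excess j (y j))"
    using C w_level_cut by (intro add_right_mono mult_left_mono) auto
  finally show ?thesis using False by (simp add: mult_ac)
qed

lemma series_bound:
  assumes x: "regular x"
  shows "(\<Sum>j\<in>F. \<bar>y j * \<psi> j x\<bar>) \<le> 2 * q * C * (\<Sum>j\<in>F. if \<psi> j x \<noteq> 0 then w j powr (1/2) else 0)
    + C * (\<Sum>j\<in>F. w j * excess j (y j))"
  unfolding sum_distrib_left sum.distrib[symmetric] by (intro sum_mono series_term_bound[OF x])

definition K_half :: real where
  "K_half = (SOME K. K \<ge> 0 \<and> (\<forall>x\<in>D. \<forall>F. finite F \<longrightarrow> (\<Sum>j\<in>F. if \<psi> j x \<noteq> 0 then w j powr (1/2) else 0) \<le> K))"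

lemma K_half: "K_half \<ge> 0" "x \<in> D \<Longrightarrow> finite F \<Longrightarrow> (\<Sum>j\<in>F. if \<psi> j x \<noteq> 0 then w j powr (1/2) else 0) \<le> K_half"
  using someI_ex[OF overlap[of "1/2"]] unfolding K_half_def by auto

definition B0 :: real where "B0 = 2 * q * C * K_half"

lemma psum_bound:
  assumes y: "tame y"
  shows "bdd_on D (psum n y) (B0 + C * W y)"
proof -
  have "AE x in lebesgue_on D. \<bar>psum n y x\<bar> \<le> B0 + C * W y"
    using AE_regular
  proof eventually_elim
    fix x assume x: "regular x"
    have "\<bar>psum n y x\<bar> \<le> (\<Sum>j<n. \<bar>y j * \<psi> j x\<bar>)" unfolding psum_def by (rule sum_abs)
    also have "\<dots> \<le> 2 * q * C * (\<Sum>j<n. if \<psi> j x \<noteq> 0 then w j powr (1/2) else 0) + C * (\<Sum>j<n. w j * excess j (y j))"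
      by (rule series_bound[OF x])
    also have "\<dots> \<le> 2 * q * C * K_half + C * W y"
      unfolding W_def using x q C y wexcess_nonneg
      by (intro add_mono mult_left_mono K_half sum_le_suminf) (auto simp: regular_def tame_def)
    finally show "\<bar>psum n y x\<bar> \<le> B0 + C * W y" by (simp add: B0_def)
  qed
  then show ?thesis using psum_Linf[of n y] by (simp add: bdd_on_def Linf_def)
qed

lemma w_tendsto_0: "w \<longlonglongrightarrow> 0"
proof -
  have "(\<lambda>j. (w j powr q) powr (1 / q)) \<longlonglongrightarrow> 0 powr (1 / q)"
    using q by (intro tendsto_powr' summable_LIMSEQ_zero[OF summable_w] tendsto_const) auto
  then show ?thesis using w(1) q by (simp add: powr_powr less_imp_le)
qed

text \<open>In a block of late terms the exponent 1/2 is split as 1/4 + 1/4: one factor is small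
  because w tends to 0, the other is summed by \<open>overlap\<close>. The excess part is a block of
  a convergent series.\<close>

lemma tame_conv:
  assumes y: "tame y"
  shows "y \<in> conv"
  unfolding conv_iff_Cauchy[OF D0]
proof
  fix k
  define e where "e = 1 / real (Suc k)"
  have e: "e > 0" by (simp add: e_def)
  obtain K where K: "K \<ge> 0" "\<And>x F. x \<in> D \<Longrightarrow> finite F \<Longrightarrow> (\<Sum>j\<in>F. if \<psi> j x \<noteq> 0 then w j powr (1/4) else 0) \<le> K"
    using overlap[of "1/4"] by auto
  \<comment> \<open>Makes 2 q C d (K + 1) = e/2; the excess contributes the other half of e.\<close>
  define d where "d = e / (4 * q * C * (K + 1))"
  have d: "d > 0" using e q C K(1) by (simp add: d_def)
  have "(\<lambda>j. w j powr (1/4)) \<longlonglongrightarrow> 0 powr (1/4)"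
    by (intro tendsto_powr' w_tendsto_0 tendsto_const) (auto intro: always_eventually less_imp_le w)
  then have "\<forall>\<^sub>F j in sequentially. w j powr (1/4) < d" using d by (intro order_tendstoD) auto
  then obtain N1 where N1: "\<And>j. j \<ge> N1 \<Longrightarrow> w j powr (1/4) < d" by (auto simp: eventually_sequentially)
  have "e / (2 * C) > 0" using e C by simp
  then obtain N2 where N2: "\<And>m n. m \<ge> N2 \<Longrightarrow> norm (\<Sum>j\<in>{m..<n}. w j * excess j (y j)) < e / (2 * C)"
    using y unfolding tame_def summable_Cauchy by meson
  have half: "bdd_on D (\<lambda>x. psum n y x - psum m y x) e" if nm: "max N1 N2 \<le> m" "m \<le> n" for n m
  proof -
    have "AE x in lebesgue_on D. \<bar>psum n y x - psum m y x\<bar> \<le> e"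
      using AE_regular
    proof eventually_elim
      fix x assume x: "regular x"
      have "psum n y x - psum m y x = (\<Sum>j\<in>{m..<n}. y j * \<psi> j x)"
        unfolding psum_def using nm(2) by (simp add: sum_diff_nat_ivl[of 0 m n, unfolded atLeast0LessThan])
      then have "\<bar>psum n y x - psum m y x\<bar> \<le> (\<Sum>j\<in>{m..<n}. \<bar>y j * \<psi> j x\<bar>)" by (simp add: sum_abs)
      also have "\<dots> \<le> 2 * q * C * (\<Sum>j\<in>{m..<n}. if \<psi> j x \<noteq> 0 then w j powr (1/2) else 0) + C * (\<Sum>j\<in>{m..<n}. w j * excess j (y j))"
        by (rule series_bound[OF x])
      also have "\<dots> \<le> 2 * q * C * (d * K) + C * (e / (2 * C))"
      proof (intro add_mono mult_left_mono)
        have "(\<Sum>j\<in>{m..<n}. if \<psi> j x \<noteq> 0 then w j powr (1/2) else 0)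
          \<le> (\<Sum>j\<in>{m..<n}. d * (if \<psi> j x \<noteq> 0 then w j powr (1/4) else 0))"
        proof (rule sum_mono)
          fix j assume j: "j \<in> {m..<n}"
          have "w j powr (1/2) = w j powr (1/4) * w j powr (1/4)" by (simp flip: powr_add)
          also have "\<dots> \<le> d * w j powr (1/4)" using N1[of j] j nm by (intro mult_right_mono) auto
          finally show "(if \<psi> j x \<noteq> 0 then w j powr (1/2) else 0) \<le> d * (if \<psi> j x \<noteq> 0 then w j powr (1/4) else 0)" by simp
        qed
        also have "\<dots> = d * (\<Sum>j\<in>{m..<n}. if \<psi> j x \<noteq> 0 then w j powr (1/4) else 0)" by (rule sum_distrib_left[symmetric])
        also have "\<dots> \<le> d * K" using d x by (intro mult_left_mono K) (auto simp: regular_def)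
        finally show "(\<Sum>j\<in>{m..<n}. if \<psi> j x \<noteq> 0 then w j powr (1/2) else 0) \<le> d * K" .
        show "(\<Sum>j\<in>{m..<n}. w j * excess j (y j)) \<le> e / (2 * C)" using N2[of m n] nm by simp
      qed (use q C in auto)
      also have "\<dots> \<le> e"
      proof -
        have "2 * q * C * (d * K) \<le> 2 * q * C * (d * (K + 1))" using q C d by (intro mult_left_mono) auto
        also have "\<dots> = e / 2"
        proof -
          have "K + 1 \<noteq> 0" using K(1) by simp
          then show ?thesis using q C by (simp add: d_def)
        qed
        finally show ?thesis using C by simp
      qed
      finally show "\<bar>psum n y x - psum m y x\<bar> \<le> e" .
    qed
    moreover have "(\<lambda>x. psum n y x - psum m y x) \<in> Linf D" by (intro Linf_diff psum_Linf)
    ultimately show ?thesis by (simp add: bdd_on_def Linf_def)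
  qed
  have "bdd_on D (\<lambda>x. psum n y x - psum m y x) e" if "n \<ge> max N1 N2" "m \<ge> max N1 N2" for n m
  proof (cases "m \<le> n")
    case True
    then show ?thesis using half that by blast
  next
    case False
    then have "bdd_on D (\<lambda>x. psum m y x - psum n y x) e" using half that by simp
    then show ?thesis using bdd_on_mult[OF bdd_on_const[of D "-1"], of "\<lambda>x. psum m y x - psum n y x" e] by simp
  qed
  then show "\<exists>N. \<forall>n\<ge>N. \<forall>m\<ge>N. bdd_on D (\<lambda>x. psum n y x - psum m y x) (1 / real (Suc k))"
    unfolding e_def by blast
qed

lemma blim_bound:
  assumes y: "tame y"
  shows "bdd_on D (blim y) (B0 + C * W y)"
proof (rule bdd_on_limit)
  note c = tame_conv[OF y]
  show "blim y \<in> borel_measurable (lebesgue_on D)" using blim(1)[OF c] by (simp add: Linf_def)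
  fix \<epsilon> :: real assume "\<epsilon> > 0"
  then have "\<forall>\<^sub>F n in sequentially. Linf_norm D (\<lambda>x. blim y x - psum n y x) < \<epsilon>"
    using blim(2)[OF c] by (intro order_tendstoD)
  then obtain n where n: "Linf_norm D (\<lambda>x. blim y x - psum n y x) < \<epsilon>"
    using eventually_happens'[OF sequentially_bot] by blast
  have "bdd_on D (\<lambda>x. blim y x - psum n y x) \<epsilon>" by (rule bdd_on_mono[OF bdd_on_blim_psum[OF c]]) (use n in simp)
  from bdd_on_add[OF psum_bound[OF y, of n] this] show "bdd_on D (blim y) (B0 + C * W y + \<epsilon>)" by simp
qed

section \<open>Exponential moments\<close>

lemma excess_measurable[measurable]: "excess j \<in> borel_measurable borel"
  unfolding excess_def[abs_def] by measurable

lemma partial_W_measurable: "(\<lambda>y. \<Sum>j<n. w j * excess j (y j)) \<in> borel_measurable gaussian"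
  by (intro borel_measurable_sum borel_measurable_times borel_measurable_const
      measurable_compose[OF measurable_gaussian_component excess_measurable])

text \<open>Where the excess is positive, the factor exp(|t| - level_cut) \<ge> 1 may be inserted,
  and exp(-level_cut) = w^q. This explains the cut -q ln w: the correction to 1 is summable in
  j.\<close>

lemma exp_excess_le:
  assumes c: "0 \<le> c"
  shows "exp (c * (w j * excess j t)) \<le> 1 + w j powr q * exp ((c + 1) * \<bar>t\<bar>)"
proof (cases "\<bar>t\<bar> \<le> level_cut j")
  case True
  then show ?thesis by (simp add: excess_def)
next
  case False
  then have e: "excess j t = \<bar>t\<bar> - level_cut j" by (simp add: excess_def)
  have "w j * excess j t \<le> 1 * excess j t" using w(2) excess_nonneg by (intro mult_right_mono) auto
  also have "\<dots> \<le> \<bar>t\<bar>" using e level_cut_nonneg[of j] by simp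
  finally have "c * (w j * excess j t) \<le> c * \<bar>t\<bar>" using c by (rule mult_left_mono)
  then have "exp (c * (w j * excess j t)) \<le> exp (c * \<bar>t\<bar>) * 1" by simp
  also have "\<dots> \<le> exp (c * \<bar>t\<bar>) * exp (\<bar>t\<bar> - level_cut j)" using False by (intro mult_left_mono) auto
  also have "\<dots> = w j powr q * exp ((c + 1) * \<bar>t\<bar>)"
    using w(1)[of j] by (simp add: powr_def level_cut_def algebra_simps flip: exp_add)
  finally show ?thesis by simp
qed

text \<open>Independence turns the moment into a product of factors at most 1 + G w_j^q \<le> exp(G
  w_j^q), bounded uniformly in n because w^q is summable.\<close>

lemma exp_moment_partial:
  assumes c: "0 \<le> c"
  shows "\<exists>B. \<forall>n. (\<integral>\<^sup>+y. ennreal (exp (c * (\<Sum>j<n. w j * excess j (y j)))) \<partial>gaussian) \<le> ennreal B"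
proof -
  interpret N: prob_space std_normal_distribution by (rule prob_space_std_normal)
  define G where "G = (\<integral>t. exp ((c + 1) * \<bar>t\<bar>) \<partial>std_normal_distribution)"
  have G0: "G \<ge> 0" unfolding G_def by simp
  have one: "(\<integral>\<^sup>+t. ennreal (exp (c * (w j * excess j t))) \<partial>std_normal_distribution) \<le> ennreal (exp (G * w j powr q))" for j
  proof -
    have "(\<integral>\<^sup>+t. ennreal (exp (c * (w j * excess j t))) \<partial>std_normal_distribution)
      \<le> (\<integral>\<^sup>+t. ennreal (1 + w j powr q * exp ((c + 1) * \<bar>t\<bar>)) \<partial>std_normal_distribution)"
      by (intro nn_integral_mono ennreal_leI exp_excess_le c)
    also have "\<dots> = ennreal (\<integral>t. 1 + w j powr q * exp ((c + 1) * \<bar>t\<bar>) \<partial>std_normal_distribution)"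
      by (rule nn_integral_eq_integral)
        (auto intro!: Bochner_Integration.integrable_add integrable_mult_right integrable_exp_abs_std_normal add_nonneg_nonneg)
    also have "(\<integral>t. 1 + w j powr q * exp ((c + 1) * \<bar>t\<bar>) \<partial>std_normal_distribution) = 1 + w j powr q * G"
      using integrable_exp_abs_std_normal[of "c + 1"] N.prob_space by (simp add: G_def)
    also have "ennreal (1 + w j powr q * G) \<le> ennreal (exp (G * w j powr q))"
      by (intro ennreal_leI) (simp add: mult.commute)
    finally show ?thesis .
  qed
  have "(\<integral>\<^sup>+y. ennreal (exp (c * (\<Sum>j<n. w j * excess j (y j)))) \<partial>gaussian) \<le> ennreal (exp (G * (\<Sum>j. w j powr q)))" for n
  proof -
    have "(\<integral>\<^sup>+y. ennreal (exp (c * (\<Sum>j<n. w j * excess j (y j)))) \<partial>gaussian)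
      = (\<integral>\<^sup>+y. (\<Prod>j<n. ennreal (exp (c * (w j * excess j (y j))))) \<partial>gaussian)"
      by (simp add: sum_distrib_left exp_sum prod_ennreal)
    also have "\<dots> = (\<Prod>j<n. \<integral>\<^sup>+t. ennreal (exp (c * (w j * excess j t))) \<partial>std_normal_distribution)"
      by (rule nn_integral_gaussian_prod) auto
    also have "\<dots> \<le> (\<Prod>j<n. ennreal (exp (G * w j powr q)))"
      by (induction n) (auto intro!: mult_mono one)
    also have "\<dots> = ennreal (exp (G * (\<Sum>j<n. w j powr q)))" by (simp add: prod_ennreal exp_sum sum_distrib_left)
    also have "\<dots> \<le> ennreal (exp (G * (\<Sum>j. w j powr q)))"
      using G0 summable_w by (intro ennreal_leI) (auto intro!: mult_left_mono sum_le_suminf)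
    finally show ?thesis .
  qed
  then show ?thesis by blast
qed

text \<open>By monotone convergence the supremum over n of exp of the partial sums is integrable,
  hence almost surely finite, and 1 + x \<le> exp x then bounds the partial sums.\<close>

lemma AE_tame: "AE y in gaussian. tame y"
proof -
  define f where "f n y = ennreal (exp (1 * (\<Sum>j<n. w j * excess j (y j))))" for n y
  have fm: "f n \<in> borel_measurable gaussian" for n
    unfolding f_def using partial_W_measurable[of n] by measurable
  obtain B where B: "\<And>n. (\<integral>\<^sup>+y. f n y \<partial>gaussian) \<le> ennreal B"
    using exp_moment_partial[of 1] unfolding f_def by auto
  have "(\<integral>\<^sup>+y. (SUP n. f n y) \<partial>gaussian) = (SUP n. \<integral>\<^sup>+y. f n y \<partial>gaussian)"
  proof (rule nn_integral_monotone_convergence_SUP[OF _ fm])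
    show "incseq f"
      unfolding incseq_def f_def le_fun_def
      by (auto intro!: ennreal_leI sum_mono2 wexcess_nonneg)
  qed
  also have "\<dots> \<le> ennreal B" by (intro SUP_least B)
  also have "\<dots> < \<infinity>" by simp
  finally have "(\<integral>\<^sup>+y. (SUP n. f n y) \<partial>gaussian) \<noteq> \<infinity>" by simp
  then have "AE y in gaussian. (SUP n. f n y) \<noteq> \<infinity>"
    by (intro nn_integral_PInf_AE borel_measurable_SUP fm) auto
  then show ?thesis
  proof eventually_elim
    fix y assume "(SUP n. f n y) \<noteq> \<infinity>"
    then obtain r where r: "0 \<le> r" "(SUP n. f n y) = ennreal r" by (cases "SUP n. f n y") auto
    have "(\<Sum>j<n. w j * excess j (y j)) \<le> r" for n
    proof -
      have "f n y \<le> ennreal r" unfolding r(2)[symmetric] by (rule SUP_upper) simp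
      then have "exp (\<Sum>j<n. w j * excess j (y j)) \<le> r" using r(1) by (simp add: f_def)
      then show ?thesis using exp_ge_add_one_self[of "\<Sum>j<n. w j * excess j (y j)"] by linarith
    qed
    then show "tame y" unfolding tame_def
      by (intro bounded_imp_summable[where B = r] wexcess_nonneg) (simp only: lessThan_Suc_atMost[symmetric])
  qed
qed

lemma W_measurable: "W \<in> borel_measurable gaussian"
  unfolding W_def[abs_def]
  by (intro borel_measurable_suminf borel_measurable_times borel_measurable_const
      measurable_compose[OF measurable_gaussian_component excess_measurable])

text \<open>Fatou's lemma along the partial sums, whose exponential moments are bounded
  uniformly.\<close>

lemma integrable_exp_W:
  assumes c: "0 \<le> c"
  shows "integrable gaussian (\<lambda>y. exp (c * W y))"
proof -
  note [measurable] = W_measurable partial_W_measurable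
  obtain B where B: "\<And>n. (\<integral>\<^sup>+y. ennreal (exp (c * (\<Sum>j<n. w j * excess j (y j)))) \<partial>gaussian) \<le> ennreal B"
    using exp_moment_partial[OF c] by blast
  have "(\<integral>\<^sup>+y. ennreal (exp (c * W y)) \<partial>gaussian)
    = (\<integral>\<^sup>+y. liminf (\<lambda>n. ennreal (exp (c * (\<Sum>j<n. w j * excess j (y j))))) \<partial>gaussian)"
  proof (rule nn_integral_cong_AE)
    show "AE y in gaussian. ennreal (exp (c * W y)) = liminf (\<lambda>n. ennreal (exp (c * (\<Sum>j<n. w j * excess j (y j)))))"
      using AE_tame
    proof eventually_elim
      fix y assume "tame y"
      then have "(\<lambda>n. \<Sum>j<n. w j * excess j (y j)) \<longlonglongrightarrow> W y" unfolding W_def tame_def by (rule summable_LIMSEQ)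
      then have "(\<lambda>n. ennreal (exp (c * (\<Sum>j<n. w j * excess j (y j))))) \<longlonglongrightarrow> ennreal (exp (c * W y))"
        by (intro tendsto_ennrealI tendsto_intros)
      then show "ennreal (exp (c * W y)) = liminf (\<lambda>n. ennreal (exp (c * (\<Sum>j<n. w j * excess j (y j)))))"
        using lim_imp_Liminf[OF sequentially_bot] by metis
    qed
  qed
  also have "\<dots> \<le> liminf (\<lambda>n. \<integral>\<^sup>+y. ennreal (exp (c * (\<Sum>j<n. w j * excess j (y j)))) \<partial>gaussian)"
    by (rule nn_integral_liminf) measurable
  also have "\<dots> \<le> liminf (\<lambda>n::nat. ennreal B)" by (intro Liminf_mono always_eventually allI B)
  also have "\<dots> = ennreal B" by (simp add: Liminf_const)
  also have "\<dots> < \<infinity>" by simp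
  finally show ?thesis by (simp add: integrable_iff_bounded)
qed

section \<open>Summability of the Hermite coefficients\<close>

text \<open>Multiplying w^(-\<theta>) by |\<psi>_j| \<le> C w_j leaves the exponent 1 - \<theta>,
  positive since \<theta> < 1, and \<open>overlap\<close> sums that power.\<close>

lemma rho_exists:
  assumes \<theta>: "0 < \<theta>" "\<theta> < 1"
  shows "\<exists>\<kappa>>0. AE x in lebesgue_on D. \<forall>N. exp (\<Sum>j<N. \<kappa> * w j powr (- \<theta>) * \<bar>\<psi> j x\<bar>) - 1 \<le> 1 / 2"
proof -
  obtain K where K: "K \<ge> 0" "\<And>x F. x \<in> D \<Longrightarrow> finite F \<Longrightarrow> (\<Sum>j\<in>F. if \<psi> j x \<noteq> 0 then w j powr (1 - \<theta>) else 0) \<le> K"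
    using overlap[of "1 - \<theta>"] \<theta> by auto
  \<comment> \<open>Makes the exponent at most ln(3/2), so that exp minus 1 is at most 1/2; K + 1
    avoids division by 0.\<close>
  define \<kappa> where "\<kappa> = ln (3 / 2) / (C * (K + 1))"
  have \<kappa>: "\<kappa> > 0" using C K(1) by (simp add: \<kappa>_def)
  have "AE x in lebesgue_on D. \<forall>N. exp (\<Sum>j<N. \<kappa> * w j powr (- \<theta>) * \<bar>\<psi> j x\<bar>) - 1 \<le> 1 / 2"
    using AE_regular
  proof eventually_elim
    fix x assume x: "regular x"
    show "\<forall>N. exp (\<Sum>j<N. \<kappa> * w j powr (- \<theta>) * \<bar>\<psi> j x\<bar>) - 1 \<le> 1 / 2"
    proof
      fix N
      have "(\<Sum>j<N. \<kappa> * w j powr (- \<theta>) * \<bar>\<psi> j x\<bar>) \<le> (\<Sum>j<N. (\<kappa> * C) * (if \<psi> j x \<noteq> 0 then w j powr (1 - \<theta>) else 0))"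
      proof (rule sum_mono)
        fix j
        have "\<kappa> * w j powr (- \<theta>) * \<bar>\<psi> j x\<bar> \<le> \<kappa> * w j powr (- \<theta>) * (C * w j powr 1)"
          using x \<kappa> w(1)[of j] by (intro mult_left_mono) (auto simp: regular_def)
        also have "\<dots> = (\<kappa> * C) * (w j powr (- \<theta>) * w j powr 1)" by (simp only: mult_ac)
        also have "w j powr (- \<theta>) * w j powr 1 = w j powr (1 - \<theta>)" unfolding powr_add[symmetric] by simp
        finally show "\<kappa> * w j powr (- \<theta>) * \<bar>\<psi> j x\<bar> \<le> (\<kappa> * C) * (if \<psi> j x \<noteq> 0 then w j powr (1 - \<theta>) else 0)" by simp
      qed
      also have "\<dots> = (\<kappa> * C) * (\<Sum>j<N. if \<psi> j x \<noteq> 0 then w j powr (1 - \<theta>) else 0)" by (rule sum_distrib_left[symmetric])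
      also have "\<dots> \<le> (\<kappa> * C) * (K + 1)"
      proof (rule mult_left_mono)
        show "(\<Sum>j<N. if \<psi> j x \<noteq> 0 then w j powr (1 - \<theta>) else 0) \<le> K + 1"
          using K(2)[of x "{..<N}"] x by (simp add: regular_def)
      qed (use \<kappa> C in simp)
      also have "\<dots> = ln (3 / 2)"
      proof -
        have "K + 1 \<noteq> 0" using K(1) by simp
        then show ?thesis using C by (simp add: \<kappa>_def)
      qed
      finally have "exp (\<Sum>j<N. \<kappa> * w j powr (- \<theta>) * \<bar>\<psi> j x\<bar>) \<le> exp (ln (3 / 2))" by (subst exp_le_cancel_iff)
      then show "exp (\<Sum>j<N. \<kappa> * w j powr (- \<theta>) * \<bar>\<psi> j x\<bar>) - 1 \<le> 1 / 2" by simp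
    qed
  qed
  then show ?thesis using \<kappa> by blast
qed

text \<open>Let B be the random bound of b. Four factors exp B arise: one in passing from energy to
  norm, one from the norm of \<open>Aop b\<close>, two from the square of the bound for
  \<open>Rop b\<close>. The factor 2 is 1/(1 - \<eta>) with \<eta> = 1/2.\<close>

lemma tay_bound:
  assumes y: "tame y" and \<rho>: "\<And>j. 0 \<le> \<rho> j"
    and small: "AE x in lebesgue_on D. \<forall>N. exp (\<Sum>j<N. \<rho> j * \<bar>\<psi> j x\<bar>) - 1 \<le> 1 / 2"
  shows "(\<Sum>\<mu>\<in>index_box N R. (index_pow \<rho> \<mu>)\<^sup>2 * (norm (tay h \<mu> y))\<^sup>2)
    \<le> 2 * (poincare_const + 1)\<^sup>2 * (norm h)\<^sup>2 * exp (4 * B0) * exp (4 * C * W y)"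
proof -
  define B where "B = B0 + C * W y"
  have c: "y \<in> conv" by (rule tame_conv[OF y])
  define b where "b = blim y"
  have b: "bdd_on D b B" unfolding B_def b_def by (rule blim_bound[OF y])
  have bL: "b \<in> Linf D" unfolding b_def by (rule blim(1)[OF c])
  have tay_eq: "tay h \<mu> y = taylor b h \<mu>" for \<mu> using c by (simp add: tay_def b_def)
  have ell: "AE x in lebesgue_on D. exp (- B) \<le> exp (b x)"
    using b unfolding bdd_on_def by (auto elim!: eventually_mono)
  have coer: "(norm (taylor b h \<mu>))\<^sup>2 \<le> exp B * (Aop b (taylor b h \<mu>) \<bullet> taylor b h \<mu>)" if "\<mu> \<in> index_box N R" for \<mu>
  proof -
    have "\<mu> \<in> multi_indices" using that index_box_multi_indices by auto
    then obtain v where v: "v \<in> H10 D" "taylor b h \<mu> = snd v" using taylor_energy(2)[OF bL] by blast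
    have "exp (- B) * (V_norm v)\<^sup>2 \<le> Mul D (\<lambda>x. exp (b x)) (snd v) \<bullet> snd v"
      using bL by (intro Mul_coercive v(1) ell) auto
    then have "exp B * (exp (- B) * (norm (taylor b h \<mu>))\<^sup>2) \<le> exp B * (Aop b (taylor b h \<mu>) \<bullet> taylor b h \<mu>)"
      by (intro mult_left_mono) (auto simp: v(2) V_norm_def Aop_def)
    then show ?thesis by (simp add: mult.assoc[symmetric] mult_exp_exp)
  qed
  have "(\<Sum>\<mu>\<in>index_box N R. (index_pow \<rho> \<mu>)\<^sup>2 * (norm (tay h \<mu> y))\<^sup>2)
    \<le> (\<Sum>\<mu>\<in>index_box N R. (index_pow \<rho> \<mu>)\<^sup>2 * (exp B * (Aop b (taylor b h \<mu>) \<bullet> taylor b h \<mu>)))"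
    unfolding tay_eq by (intro sum_mono mult_left_mono coer) auto
  also have "\<dots> = exp B * (\<Sum>\<mu>\<in>index_box N R. (index_pow \<rho> \<mu>)\<^sup>2 * (Aop b (taylor b h \<mu>) \<bullet> taylor b h \<mu>))"
    by (simp add: sum_distrib_left mult_ac)
  also have "\<dots> \<le> exp B * (Aop b (Rop b h) \<bullet> Rop b h / (1 - 1 / 2))"
  proof (rule mult_left_mono)
    have "AE x in lebesgue_on D. exp (\<Sum>j<N. \<rho> j * \<bar>\<psi> j x\<bar>) - 1 \<le> 1 / 2" using small by eventually_elim simp
    then show "(\<Sum>\<mu>\<in>index_box N R. (index_pow \<rho> \<mu>)\<^sup>2 * (Aop b (taylor b h \<mu>) \<bullet> taylor b h \<mu>)) \<le> Aop b (Rop b h) \<bullet> Rop b h / (1 - 1 / 2)"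
      by (intro taylor_bound[OF bL \<rho>]) auto
  qed simp
  also have "\<dots> \<le> exp B * (exp B * ((poincare_const + 1) * exp B * norm h)\<^sup>2 / (1 - 1 / 2))"
  proof (intro mult_left_mono divide_right_mono)
    have "Aop b (Rop b h) \<bullet> Rop b h \<le> norm (Aop b (Rop b h)) * norm (Rop b h)" by (rule norm_cauchy_schwarz)
    also have "\<dots> \<le> (norm (Aop b) * norm (Rop b h)) * norm (Rop b h)" by (intro mult_right_mono norm_blinfun) auto
    also have "\<dots> \<le> (exp B * norm (Rop b h)) * norm (Rop b h)" by (intro mult_right_mono norm_Aop[OF b]) auto
    also have "\<dots> = exp B * (norm (Rop b h))\<^sup>2" by (simp add: power2_eq_square)
    also have "\<dots> \<le> exp B * ((poincare_const + 1) * exp B * norm h)\<^sup>2"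
    proof (intro mult_left_mono power_mono)
      have "norm (Rop b h) \<le> norm (Rop b) * norm h" by (rule norm_blinfun)
      also have "\<dots> \<le> ((poincare_const + 1) * exp B) * norm h" by (intro mult_right_mono norm_Rop[OF b]) auto
      finally show "norm (Rop b h) \<le> (poincare_const + 1) * exp B * norm h" .
    qed auto
    finally show "Aop b (Rop b h) \<bullet> Rop b h \<le> exp B * ((poincare_const + 1) * exp B * norm h)\<^sup>2" .
  qed auto
  also have "\<dots> = 2 * (poincare_const + 1)\<^sup>2 * (norm h)\<^sup>2 * (exp B * exp B * (exp B)\<^sup>2)"
    by (simp add: power_mult_distrib mult_ac)
  also have "exp B * exp B * (exp B)\<^sup>2 = exp (4 * B0) * exp (4 * C * W y)"
    by (simp add: power2_eq_square B_def algebra_simps flip: exp_add)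
  finally show ?thesis by (simp only: mult.assoc)
qed

text \<open>Supplies the hypotheses of \<open>weighted_hermite_bound\<close>: \<Phi> is the
  pointwise bound of \<open>tay_bound\<close>, integrable by the exponential moments of W.\<close>

lemma
  assumes \<theta>: "0 < \<theta>" "\<theta> < 1"
  shows sq_integrable_tay: "sq_integrable (tay h (\<lambda>_. 0))"
    and weighted_tay_bound: "1 \<le> r \<Longrightarrow> \<exists>\<kappa>>0. \<exists>A. \<forall>\<Lambda>. finite \<Lambda> \<longrightarrow> \<Lambda> \<subseteq> multi_indices \<longrightarrow>
      (\<Sum>\<nu>\<in>\<Lambda>. bweight (\<lambda>j. \<kappa> * w j powr (- \<theta>)) r \<nu> * (norm (hcoeff (tay h (\<lambda>_. 0)) \<nu>))\<^sup>2) \<le> A"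
proof -
  obtain \<kappa> where \<kappa>: "\<kappa> > 0" "AE x in lebesgue_on D. \<forall>N. exp (\<Sum>j<N. \<kappa> * w j powr (- \<theta>) * \<bar>\<psi> j x\<bar>) - 1 \<le> 1 / 2"
    using rho_exists[OF \<theta>] by blast
  define \<rho> where "\<rho> j = \<kappa> * w j powr (- \<theta>)" for j
  have \<rho>: "0 < \<rho> j" for j using \<kappa>(1) w(1)[of j] by (simp add: \<rho>_def)
  define \<Phi> where "\<Phi> y = 2 * (poincare_const + 1)\<^sup>2 * (norm h)\<^sup>2 * exp (4 * B0) * exp (4 * C * W y)" for y
  have i: "integrable gaussian \<Phi>" unfolding \<Phi>_def using C by (intro integrable_mult_right integrable_exp_W) auto
  have Td: "AE y in gaussian. \<forall>\<mu>\<in>multi_indices. \<forall>j s. ((\<lambda>s. tay h \<mu> (y(j := s))) has_vector_derivative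
        real (Suc (\<mu> j)) *\<^sub>R tay h (\<mu>(j := Suc (\<mu> j))) (y(j := s))) (at s)"
    using tay_derivative[OF D0] by (intro AE_I2) blast
  have Tb: "AE y in gaussian. \<forall>N R. (\<Sum>\<mu>\<in>index_box N R. (index_pow \<rho> \<mu>)\<^sup>2 * (norm (tay h \<mu> y))\<^sup>2) \<le> \<Phi> y"
    using AE_tame
  proof eventually_elim
    fix y assume y: "tame y"
    show "\<forall>N R. (\<Sum>\<mu>\<in>index_box N R. (index_pow \<rho> \<mu>)\<^sup>2 * (norm (tay h \<mu> y))\<^sup>2) \<le> \<Phi> y"
      unfolding \<Phi>_def using tay_bound[OF y less_imp_le[OF \<rho>], of "\<lambda>j. j"] \<kappa>(2)[folded \<rho>_def] by blast
  qed
  note * = weighted_hermite_bound[of "tay h", OF tay_measurable[OF D0] Td \<rho> i Tb]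
  show "sq_integrable (tay h (\<lambda>_. 0))" by (rule *(1)) (auto simp: multi_indices_def)
  show "1 \<le> r \<Longrightarrow> \<exists>\<kappa>>0. \<exists>A. \<forall>\<Lambda>. finite \<Lambda> \<longrightarrow> \<Lambda> \<subseteq> multi_indices \<longrightarrow>
      (\<Sum>\<nu>\<in>\<Lambda>. bweight (\<lambda>j. \<kappa> * w j powr (- \<theta>)) r \<nu> * (norm (hcoeff (tay h (\<lambda>_. 0)) \<nu>))\<^sup>2) \<le> A"
    using *(2)[of r] \<kappa>(1) unfolding \<rho>_def by blast
qed

lemma hcoeff_summable:
  assumes p: "0 < p" "p < 2" and pq: "2 * p / (2 - p) > q"
  shows "(\<lambda>\<nu>. norm (hcoeff (tay h (\<lambda>_. 0)) \<nu>) powr p) summable_on multi_indices"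
proof -
  define t where "t = p / (2 - p)"
  have t: "t > 0" "2 * t > q" using p pq by (auto simp: t_def)
  \<comment> \<open>Makes \<rho>_j^(-2t) a multiple of w_j^q; the hypothesis 2p/(2-p) > q is exactly
    \<theta> < 1.\<close>
  define \<theta> where "\<theta> = q / (2 * t)"
  have \<theta>: "0 < \<theta>" "\<theta> < 1" and t\<theta>: "2 * t * \<theta> = q" using t q by (auto simp: \<theta>_def)
  \<comment> \<open>Order of differentiation large enough for r t \<ge> 2, as
    \<open>sum_bweight_bounded\<close> requires.\<close>
  define r where "r = Suc (nat \<lceil>2 / t\<rceil>)"
  have r: "1 \<le> r" "2 \<le> real r * t"
  proof -
    have "2 / t \<le> real r" unfolding r_def by linarith
    then show "2 \<le> real r * t" using t(1) by (simp add: field_simps)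
  qed (simp add: r_def)
  obtain \<kappa> A where \<kappa>: "\<kappa> > 0" and A: "\<And>\<Lambda>. finite \<Lambda> \<Longrightarrow> \<Lambda> \<subseteq> multi_indices \<Longrightarrow>
      (\<Sum>\<nu>\<in>\<Lambda>. bweight (\<lambda>j. \<kappa> * w j powr (- \<theta>)) r \<nu> * (norm (hcoeff (tay h (\<lambda>_. 0)) \<nu>))\<^sup>2) \<le> A"
    using weighted_tay_bound[OF \<theta> r(1), of h] by blast
  define \<rho> where "\<rho> j = \<kappa> * w j powr (- \<theta>)" for j
  have \<rho>: "0 < \<rho> j" for j using \<kappa> w(1)[of j] by (simp add: \<rho>_def)
  have "summable (\<lambda>j. \<rho> j powr (- 2 * t) + \<rho> j powr (- 2 * t * r))"
  proof (rule summable_comparison_test')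
    show "summable (\<lambda>j. (\<kappa> powr (- 2 * t) + \<kappa> powr (- 2 * t * r)) * w j powr q)"
      by (intro summable_mult summable_w)
    fix j :: nat assume "0 \<le> j"
    have e1: "\<rho> j powr (- 2 * t) = \<kappa> powr (- 2 * t) * w j powr q"
    proof -
      have "- \<theta> * (- 2 * t) = q" using t\<theta> by (simp add: mult_ac)
      then show ?thesis unfolding \<rho>_def using \<kappa> by (simp only: powr_mult powr_powr)
    qed
    \<comment> \<open>Here the power of w_j is q r \<ge> q, and w_j \<le> 1.\<close>
    have e2: "\<rho> j powr (- 2 * t * r) \<le> \<kappa> powr (- 2 * t * r) * w j powr q"
    proof -
      have "- \<theta> * (- 2 * t * r) = q * r" using t\<theta> by (simp add: mult_ac)
      then have "\<rho> j powr (- 2 * t * r) = \<kappa> powr (- 2 * t * r) * w j powr (q * r)"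
        unfolding \<rho>_def using \<kappa> by (simp only: powr_mult powr_powr)
      also have "\<dots> \<le> \<kappa> powr (- 2 * t * r) * w j powr q"
        using w[of j] q r(1) by (intro mult_left_mono powr_mono') auto
      finally show ?thesis .
    qed
    show "norm (\<rho> j powr (- 2 * t) + \<rho> j powr (- 2 * t * r)) \<le> (\<kappa> powr (- 2 * t) + \<kappa> powr (- 2 * t * r)) * w j powr q"
      using e1 e2 by (simp add: distrib_right)
  qed
  from sum_bweight_bounded[OF \<rho> t(1) r this] obtain Bd where Bd: "\<And>\<Lambda>. finite \<Lambda> \<Longrightarrow> \<Lambda> \<subseteq> multi_indices \<Longrightarrow>
      (\<Sum>\<nu>\<in>\<Lambda>. bweight \<rho> r \<nu> powr (- t)) \<le> Bd" by blast
  show ?thesis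
  proof (rule summable_powr_from_weights[OF p])
    show "0 < bweight \<rho> r \<nu>" for \<nu> by (rule bweight_pos[OF \<rho>])
    show "(\<Sum>\<nu>\<in>\<Lambda>. bweight \<rho> r \<nu> * (norm (hcoeff (tay h (\<lambda>_. 0)) \<nu>))\<^sup>2) \<le> A" if "finite \<Lambda>" "\<Lambda> \<subseteq> multi_indices" for \<Lambda>
      using A[OF that] by (simp add: \<rho>_def[abs_def])
    show "(\<Sum>\<nu>\<in>\<Lambda>. bweight \<rho> r \<nu> powr (- (p / (2 - p)))) \<le> Bd" if "finite \<Lambda>" "\<Lambda> \<subseteq> multi_indices" for \<Lambda>
      using Bd[OF that] by (simp add: t_def)
  qed simp
qed

section \<open>The solution in L2(U,V) and its best approximations\<close>

lemma usol_H10: "usol h y \<in> H10 D"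
proof (cases "y \<in> conv")
  case True
  obtain B where "bdd_on D (blim y) B" using blim(1)[OF True] Linf_iff by blast
  then show ?thesis using True Sol_H10[OF elliptic_exp] by (simp add: usol_def)
qed (use subspace_0[OF H10_subspace] in \<open>simp add: usol_def\<close>)

text \<open>The estimates so far concern the gradient component; Poincare's inequality adds the
  function component, so that the Bochner integral over pairs exists.\<close>

lemma sq_integrable_usol: "sq_integrable (usol h)"
proof -
  note [measurable] = usol_measurable[OF D0, of h]
  have "integrable gaussian (\<lambda>y. (norm (usol h y))\<^sup>2)"
  proof (rule Bochner_Integration.integrable_bound)
    show "integrable gaussian (\<lambda>y. (poincare_const + 1)\<^sup>2 * (norm (tay h (\<lambda>_. 0) y))\<^sup>2)"
      using sq_integrable_tay[of "1/2" h] by (intro integrable_mult_right) (simp add: sq_integrable_def)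
    show "AE y in gaussian. norm ((norm (usol h y))\<^sup>2) \<le> norm ((poincare_const + 1)\<^sup>2 * (norm (tay h (\<lambda>_. 0) y))\<^sup>2)"
    proof (rule AE_I2)
      fix y
      have "(norm (usol h y))\<^sup>2 \<le> ((poincare_const + 1) * norm (snd (usol h y)))\<^sup>2"
        using norm_H10_le[OF usol_H10] by (intro power_mono) (auto simp: V_norm_def)
      then show "norm ((norm (usol h y))\<^sup>2) \<le> norm ((poincare_const + 1)\<^sup>2 * (norm (tay h (\<lambda>_. 0) y))\<^sup>2)"
        by (simp add: tay_0 power_mult_distrib)
    qed
  qed measurable
  then show ?thesis using usol_measurable[OF D0] by (simp add: sq_integrable_def)
qed

lemma snd_hermite_coeff:
  shows "snd (hermite_coeff (usol h) \<nu>) = hcoeff (tay h (\<lambda>_. 0)) \<nu>"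
proof -
  have H: "sq_integrable (hermite_multi \<nu>)"
  proof (cases "\<nu> \<in> multi_indices")
    \<comment> \<open>A product over an infinite support is 1 by convention, so such an index acts
      like 0.\<close>
    case False
    then have "hermite_multi \<nu> = (\<lambda>y. 1)" by (simp add: hermite_multi_def fun_eq_iff multi_indices_def)
    then show ?thesis using sq_integrable_hermite[of "\<lambda>_. 0"] by (simp add: hermite_multi_def[abs_def])
  qed (rule sq_integrable_hermite)
  have "snd (\<integral>y. hermite_multi \<nu> y *\<^sub>R usol h y \<partial>gaussian) = (\<integral>y. snd (hermite_multi \<nu> y *\<^sub>R usol h y) \<partial>gaussian)"
    by (rule integral_bounded_linear[OF bounded_linear_snd, symmetric]) (rule sq_integrable_mult[OF H sq_integrable_usol])
  then show ?thesis by (simp add: hermite_coeff_def hcoeff_def tay_0)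
qed

lemma V_norm_hermite_coeff: "V_norm (hermite_coeff (usol h) \<nu>) = norm (hcoeff (tay h (\<lambda>_. 0)) \<nu>)"
  by (simp add: V_norm_def snd_hermite_coeff)

lemma sq_integrable_snd_usol: "sq_integrable (tay h (\<lambda>_. 0))"
  using sq_integrable_tay[of "1/2"] by simp

lemma usol_L2_UV: "usol h \<in> L2_UV D"
  using usol_measurable[OF D0] usol_H10 sq_integrable_snd_usol[of h]
  by (simp add: L2_UV_def sq_integrable_def tay_0 V_norm_def)

text \<open>The rate s corresponds to s = 1/p - 1/2 in Stechkin's estimate, that is p = 2/(2s+1).
  Then 2p/(2-p) = 1/s, and s < 1/q becomes the condition for summability.\<close>

lemma hermite_rate_pos:
  assumes s: "0 < s" "s < 1 / q"
  shows "\<exists>Cs. \<forall>n\<ge>1. \<forall>\<Lambda>. n_largest (\<lambda>\<nu>. V_norm (hermite_coeff (usol h) \<nu>)) n \<Lambda> \<longrightarrow>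
    L2_UV_norm (\<lambda>y. usol h y - hermite_partial (usol h) \<Lambda> y) \<le> Cs * real n powr (- s)"
proof -
  define F where "F = tay h (\<lambda>_. 0)"
  define p where "p = 2 / (2 * s + 1)"
  have p: "0 < p" "p < 2" using s by (auto simp: p_def field_simps)
  have ps: "(2 - p) / p = 2 * s" using s by (simp add: p_def field_simps)
  have "2 * p / (2 - p) = 2 / ((2 - p) / p)" using p by (simp add: field_simps)
  also have "\<dots> = 1 / s" using ps by simp
  finally have "2 * p / (2 - p) = 1 / s" .
  moreover have "q < 1 / s" using s q by (simp add: field_simps)
  ultimately have pq: "2 * p / (2 - p) > q" by simp
  note sm = hcoeff_summable[OF p pq, of h, folded F_def]
  define S where "S = infsum (\<lambda>\<nu>. norm (hcoeff F \<nu>) powr p) multi_indices"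
  have S: "0 \<le> S" unfolding S_def by (intro infsum_nonneg) simp
  have "L2_UV_norm (\<lambda>y. usol h y - hermite_partial (usol h) \<Lambda> y) \<le> sqrt (S powr (2 * s) * S) * real n powr (- s)"
    if n: "1 \<le> n" and L: "n_largest (\<lambda>\<nu>. V_norm (hermite_coeff (usol h) \<nu>)) n \<Lambda>" for n \<Lambda>
  proof -
    have L': "n_largest (\<lambda>\<nu>. norm (hcoeff F \<nu>)) n \<Lambda>" using L by (simp add: V_norm_hermite_coeff F_def)
    have "snd (usol h y - hermite_partial (usol h) \<Lambda> y) = F y - (\<Sum>\<nu>\<in>\<Lambda>. hermite_multi \<nu> y *\<^sub>R hcoeff F \<nu>)" for y
      by (simp add: F_def tay_0 hermite_partial_def snd_hermite_coeff snd_sum)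
    then have "L2_UV_norm (\<lambda>y. usol h y - hermite_partial (usol h) \<Lambda> y)
      = sqrt (\<integral>y. (norm (F y - (\<Sum>\<nu>\<in>\<Lambda>. hermite_multi \<nu> y *\<^sub>R hcoeff F \<nu>)))\<^sup>2 \<partial>gaussian)"
      by (simp add: L2_UV_norm_def V_norm_def)
    also have "\<dots> \<le> sqrt ((S / real n) powr (2 * s) * S)"
      using best_n_term_error[OF sq_integrable_snd_usol p sm[unfolded F_def] n L'[unfolded F_def]]
      unfolding ps S_def F_def by simp
    also have "(S / real n) powr (2 * s) * S = (S powr (2 * s) * S) * (real n powr (- s))\<^sup>2"
      using n S by (simp add: powr_divide powr_minus power2_eq_square divide_simps flip: powr_add)
    also have "sqrt \<dots> = sqrt (S powr (2 * s) * S) * real n powr (- s)"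
      by (simp add: real_sqrt_mult)
    finally show ?thesis .
  qed
  then show ?thesis by blast
qed

lemma hermite_rate:
  assumes s: "s < 1 / q"
  shows "\<exists>Cs. \<forall>n\<ge>1. \<forall>\<Lambda>. n_largest (\<lambda>\<nu>. V_norm (hermite_coeff (usol h) \<nu>)) n \<Lambda> \<longrightarrow>
    L2_UV_norm (\<lambda>y. usol h y - hermite_partial (usol h) \<Lambda> y) \<le> Cs * real n powr (- s)"
proof -
  \<comment> \<open>A positive rate that is at least s and still below 1/q; it settles s \<le> 0 as
    well. The sign of Ct is unknown, hence its absolute value below.\<close>
  define t where "t = max s (1 / (2 * q))"
  have t: "0 < t" "t < 1 / q" "s \<le> t" using s q by (auto simp: t_def less_max_iff_disj field_simps)
  obtain Ct where Ct: "\<And>n \<Lambda>. n \<ge> 1 \<Longrightarrow> n_largest (\<lambda>\<nu>. V_norm (hermite_coeff (usol h) \<nu>)) n \<Lambda> \<Longrightarrow>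
    L2_UV_norm (\<lambda>y. usol h y - hermite_partial (usol h) \<Lambda> y) \<le> Ct * real n powr (- t)"
    using hermite_rate_pos[OF t(1,2)] by blast
  have "L2_UV_norm (\<lambda>y. usol h y - hermite_partial (usol h) \<Lambda> y) \<le> \<bar>Ct\<bar> * real n powr (- s)"
    if n: "1 \<le> n" and L: "n_largest (\<lambda>\<nu>. V_norm (hermite_coeff (usol h) \<nu>)) n \<Lambda>" for n \<Lambda>
  proof -
    have "Ct * real n powr (- t) \<le> \<bar>Ct\<bar> * real n powr (- s)"
      using n t(3) by (intro mult_mono powr_mono) auto
    then show ?thesis using Ct[OF n L] by simp
  qed
  then show ?thesis by blast
qed

lemma n_largest_hermite_exists: "\<exists>\<Lambda>. n_largest (\<lambda>\<nu>. V_norm (hermite_coeff (usol h) \<nu>)) n \<Lambda>"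
proof -
  \<comment> \<open>An admissible exponent: here 2p/(2-p) = 2 q > q.\<close>
  define p where "p = 2 * q / (q + 1)"
  have p: "0 < p" "p < 2" using q by (auto simp: p_def field_simps)
  have "2 * p / (2 - p) = 2 * q" using q by (simp add: p_def field_simps)
  then have "(\<lambda>\<nu>. norm (hcoeff (tay h (\<lambda>_. 0)) \<nu>) powr p) summable_on multi_indices"
    using q by (intro hcoeff_summable p) simp
  then show ?thesis unfolding V_norm_hermite_coeff by (rule n_largest_exists) (use p in auto)
qed

text \<open>Existence and uniqueness in one equivalence, from which the definite description in
  \<open>solution\<close> evaluates to \<open>usol\<close>.\<close>

lemma usol_weak_solution:
  assumes y: "y \<in> conv" and f: "\<And>v. v \<in> H10 D \<Longrightarrow> f v = h \<bullet> snd v"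
  shows "weak_solution D (diffusion D \<psi> y) f v \<longleftrightarrow> v = usol h y"
proof -
  obtain B where B: "bdd_on D (blim y) B" using blim(1)[OF y] Linf_iff by blast
  note ell = elliptic_exp[OF B]
  have "(\<lambda>x. exp (blim y x)) \<in> Linf D" using ell by (simp add: elliptic_def)
  then have "weak_solution D (diffusion D \<psi> y) f v \<longleftrightarrow> solves (\<lambda>x. exp (blim y x)) h v"
    using f by (simp add: weak_solution_def solves_def diffusion_eq wgrad_def inner_Mul)
  also have "\<dots> \<longleftrightarrow> v = Sol (\<lambda>x. exp (blim y x)) h"
    using Sol_apply(1)[OF ell] solves_unique[OF ell] by blast
  finally show ?thesis using y by (simp add: usol_def)
qed

lemma solution_eq_usol:
  assumes f: "\<And>v. v \<in> H10 D \<Longrightarrow> f v = h \<bullet> snd v"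
  shows "solution D f \<psi> = usol h"
proof
  fix y show "solution D f \<psi> y = usol h y"
  proof (cases "y \<in> conv")
    case True
    then have "weak_solution D (diffusion D \<psi> y) f = (\<lambda>v. v = usol h y)"
      by (intro ext usol_weak_solution f)
    then show ?thesis using True by (simp add: solution_def)
  qed (simp add: solution_def usol_def)
qed

end

section \<open>From the hypotheses of the theorem to the abstract setting\<close>

lemma (in pde_domain) riesz_H_minus1:
  assumes "f \<in> H_minus1 D"
  obtains h where "\<And>v. v \<in> H10 D \<Longrightarrow> f v = h \<bullet> snd v"
proof -
  \<comment> \<open>Solve with coefficient 1; the gradient of the solution is the representing field
    h.\<close>
  have "elliptic (\<lambda>x. 1) 1" by (simp add: elliptic_def)
  moreover obtain K where "\<And>v. v \<in> H10 D \<Longrightarrow> \<bar>f v\<bar> \<le> K * V_norm v" using assms unfolding H_minus1_def by blast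
  ultimately have "\<exists>w\<in>H10 D. \<forall>v\<in>H10 D. Mul D (\<lambda>x. 1) (snd w) \<bullet> snd v = f v"
    using assms by (intro elliptic_form_exists) (auto simp: H_minus1_def)
  then show ?thesis using that gradient_eq_0_outside by metis
qed

text \<open>At most M functions of each level are nonzero at x, so grouping by level leaves M times
  a geometric series.\<close>

lemma wavelet_overlap:
  fixes D :: "'a::euclidean_space set"
  assumes W: "wavelet_system D I level \<psi>" and enum: "bij_betw enum UNIV I" and \<beta>: "0 \<le> \<beta>" "\<beta> < 1"
  shows "\<exists>K\<ge>0. \<forall>x\<in>D. \<forall>F. finite F \<longrightarrow>
    (\<Sum>j\<in>F. if \<psi> (enum j) x \<noteq> 0 then \<beta> ^ level (enum j) else 0) \<le> (K :: real)"
proof -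
  obtain M where M: "\<And>l x. x \<in> D \<Longrightarrow> card {\<kappa>\<in>I. level \<kappa> = l \<and> \<psi> \<kappa> x \<noteq> 0} \<le> M"
    using W unfolding wavelet_system_def by blast
  have fin: "finite {\<kappa>\<in>I. level \<kappa> = l}" for l using W by (auto simp: wavelet_system_def)
  have "(\<Sum>j\<in>F. if \<psi> (enum j) x \<noteq> 0 then \<beta> ^ level (enum j) else 0) \<le> real M / (1 - \<beta>)"
    if x: "x \<in> D" and F: "finite F" for x F
  proof -
    define G where "G = {j\<in>F. \<psi> (enum j) x \<noteq> 0}"
    define L where "L = (\<lambda>j. level (enum j)) ` G"
    have G: "finite G" using F by (simp add: G_def)
    have "(\<Sum>j\<in>F. if \<psi> (enum j) x \<noteq> 0 then \<beta> ^ level (enum j) else 0) = (\<Sum>j\<in>G. \<beta> ^ level (enum j))"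
      unfolding G_def by (rule sum.inter_filter[OF F, symmetric])
    also have "\<dots> = (\<Sum>l\<in>L. \<Sum>j\<in>{j\<in>G. level (enum j) = l}. \<beta> ^ level (enum j))"
      unfolding L_def by (rule sum.image_gen[OF G])
    also have "\<dots> = (\<Sum>l\<in>L. real (card {j\<in>G. level (enum j) = l}) * \<beta> ^ l)" by (intro sum.cong) auto
    also have "\<dots> \<le> (\<Sum>l\<in>L. real M * \<beta> ^ l)"
    proof (intro sum_mono mult_right_mono)
      fix l
      have "card {j\<in>G. level (enum j) = l} = card (enum ` {j\<in>G. level (enum j) = l})"
        using enum by (intro card_image[symmetric]) (auto simp: bij_betw_def intro: inj_on_subset)
      also have "\<dots> \<le> card {\<kappa>\<in>I. level \<kappa> = l \<and> \<psi> \<kappa> x \<noteq> 0}"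
        using enum by (intro card_mono finite_subset[OF _ fin[of l]]) (auto simp: G_def bij_betw_def)
      also have "\<dots> \<le> M" by (rule M[OF x])
      finally show "real (card {j\<in>G. level (enum j) = l}) \<le> real M" by simp
    qed (use \<beta> in simp)
    also have "\<dots> = real M * (\<Sum>l\<in>L. \<beta> ^ l)" by (rule sum_distrib_left[symmetric])
    also have "\<dots> \<le> real M * (\<Sum>l. \<beta> ^ l)"
      using \<beta> G by (intro mult_left_mono sum_le_suminf summable_geometric) (auto simp: L_def)
    also have "\<dots> = real M / (1 - \<beta>)" using \<beta> by (simp add: suminf_geometric)
    finally show ?thesis .
  qed
  then show ?thesis using \<beta> by (intro exI[of _ "real M / (1 - \<beta>)"]) auto
qed

theorem corollary6p2:
  fixes D :: "(real ^ 'd) set"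
    and f :: "(real ^ 'd) H1 \<Rightarrow> real"
    and I :: "'i set"
    and level :: "'i \<Rightarrow> nat"
    and \<psi> :: "'i \<Rightarrow> real ^ 'd \<Rightarrow> real"
    and enum :: "nat \<Rightarrow> 'i"
    and C \<alpha> q :: real
    and u :: "(nat \<Rightarrow> real) \<Rightarrow> (real ^ 'd) H1"
  assumes "bounded_lipschitz_domain D"
    and "f \<in> H_minus1 D"
    and "wavelet_system D I level \<psi>"
    and "bij_betw enum UNIV I"
    and "mono (\<lambda>j. level (enum j))"
    and "0 < C"
    and "0 < \<alpha>"
    and "\<And>\<kappa>. \<kappa> \<in> I \<Longrightarrow> Linf_norm D (\<psi> \<kappa>) = C * 2 powr (- \<alpha> * real (level \<kappa>))"
    and "0 < q"
    and "summable (\<lambda>j. Linf_norm D (\<psi> (enum j)) powr q)"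
    and "u = solution D f (\<lambda>j. \<psi> (enum j))"
  shows
    "(AE y in gaussian. y \<in> convergence_set D (\<lambda>j. \<psi> (enum j)) \<and>
        weak_solution D (diffusion D (\<lambda>j. \<psi> (enum j)) y) f (u y)) \<and>
     u \<in> L2_UV D \<and>
     (\<forall>p. 0 < p \<and> p < 2 \<and> 2 * p / (2 - p) > q \<longrightarrow>
        (\<lambda>\<nu>. V_norm (hermite_coeff u \<nu>) powr p) summable_on multi_indices) \<and>
     (\<forall>n\<ge>1. \<exists>\<Lambda>. n_largest (\<lambda>\<nu>. V_norm (hermite_coeff u \<nu>)) n \<Lambda>) \<and>
     (\<forall>s < 1 / q. \<exists>Cs. \<forall>n\<ge>1. \<forall>\<Lambda>. n_largest (\<lambda>\<nu>. V_norm (hermite_coeff u \<nu>)) n \<Lambda> \<longrightarrow>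
        L2_UV_norm (\<lambda>y. u y - hermite_partial u \<Lambda> y) \<le> Cs * real n powr (- s))"
proof -
  \<comment> \<open>The norm without the factor C, so that w \<le> 1: nonnegativity of the cut and
    the comparison of powers of w rely on it.\<close>
  define w where "w j = 2 powr (- \<alpha> * real (level (enum j)))" for j
  have enum: "enum j \<in> I" for j using assms(4) by (auto simp: bij_betw_def)
  have norm: "Linf_norm D (\<psi> (enum j)) = C * w j" for j using assms(8)[OF enum] by (simp add: w_def)
  have Linf: "\<psi> (enum j) \<in> Linf D" for j using assms(3) enum by (auto simp: wavelet_system_def)
  interpret wavelet_family D "\<lambda>j. \<psi> (enum j)" w C q
  proof
    show "open D" "bounded D" "D \<noteq> {}" using assms(1) by (auto simp: bounded_lipschitz_domain_def)
    show "0 < w j" for j by (simp add: w_def)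
    show "w j \<le> 1" for j
      using powr_mono[of "- \<alpha> * real (level (enum j))" 0 2] assms(7) by (simp add: w_def)
    show "bdd_on D (\<psi> (enum j)) (C * w j)" for j using Linf_bdd_on[OF Linf] norm by simp
    have "summable (\<lambda>j. (1 / C powr q) * (C * w j) powr q)"
      using assms(10) unfolding norm by (rule summable_mult)
    moreover have "(1 / C powr q) * (C * w j) powr q = w j powr q" for j
      using assms(6) by (simp add: powr_mult w_def)
    ultimately show "summable (\<lambda>j. w j powr q)" by (simp only:)
    fix \<epsilon> :: real assume \<epsilon>: "0 < \<epsilon>"
    \<comment> \<open>A power of w is geometric in the level, with ratio below 1 because \<alpha>
      and \<epsilon> are positive.\<close>
    define \<beta> where "\<beta> = 2 powr (- \<alpha> * \<epsilon>)"
    have \<beta>: "0 \<le> \<beta>" "\<beta> < 1"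
      using \<epsilon> assms(7) powr_less_mono[of "- \<alpha> * \<epsilon>" 0 2] by (auto simp: \<beta>_def)
    have "w j powr \<epsilon> = \<beta> ^ level (enum j)" for j
      by (simp add: w_def \<beta>_def powr_powr mult_ac flip: powr_realpow)
    then show "\<exists>K\<ge>0. \<forall>x\<in>D. \<forall>F. finite F \<longrightarrow> (\<Sum>j\<in>F. if \<psi> (enum j) x \<noteq> 0 then w j powr \<epsilon> else 0) \<le> K"
      using wavelet_overlap[OF assms(3,4) \<beta>] by (simp only:)
  qed (use assms Linf in auto)
  obtain h where h: "\<And>v. v \<in> H10 D \<Longrightarrow> f v = h \<bullet> snd v" using riesz_H_minus1[OF assms(2)] by blast
  have u: "u = usol h" using solution_eq_usol[OF h] assms(11) by simp
  have "AE y in gaussian. y \<in> conv \<and> weak_solution D (diffusion D (\<lambda>j. \<psi> (enum j)) y) f (u y)"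
    using AE_tame by eventually_elim (simp add: tame_conv usol_weak_solution[OF tame_conv h] u)
  moreover have "(\<lambda>\<nu>. V_norm (hermite_coeff u \<nu>) powr p) summable_on multi_indices"
    if "0 < p" "p < 2" "2 * p / (2 - p) > q" for p
    unfolding u V_norm_hermite_coeff by (rule hcoeff_summable[OF that])
  ultimately show ?thesis
    using usol_L2_UV[of h] n_largest_hermite_exists[of h] hermite_rate[of _ h] unfolding u by blast
qed

end
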